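(* In the setting and notation of the context, with other primitives fixed, the ratio $\lambda^{\mathrm{eff}}/(1-g)$ is: (a) weakly increasing in the safety speed $g\in(0,1)$; (b) weakly increasing under pointwise increases of the hazard profile $\lambda$ (within the admissible class of hazard functions); (c) weakly decreasing in the discount rate $r$ (on $r>\alpha-\beta$), and strictly decreasing if $\phi$ is nonconstant. Thus an increase in $g$, a pointwise increase in $\lambda$, or a decrease in $r$ weakly expands the region of primitives where the pacing profile $\sigma^P$ is (defined and) a Markov-perfect equilibrium (MPE) and weakly shrinks the region where the racing profile $\sigma^R$ is an MPE; that is, under any such change, if $\sigma^P$ is an MPE before the change then (the pacing profile for the new primitives) is an MPE after it, and if $\sigma^R$ is an MPE after the change then it is an MPE before it.
   Context: **Primitives.** Real numbers $\alpha>\beta>0$, $r>\alpha-\beta$, $g\in(0,1)$, and a hazard function $\lambda:\mathbb R\to[0,\infty)$ with $\lambda(D)=0$ for $D\le0$ and $\lambda(D)=\lambda_0+\phi(D)$ for $D>0$, where $\lambda_0\ge0$ and $\phi:[0,\infty)\to\mathbb R$ is continuous, nondecreasing, concave, twice continuously differentiable on $(0,\infty)$, with $\phi(0)=0$. **Game.** Two firms $i\in\{1,2\}$ ($j$ denotes the other firm). A state is $S=(A_1,A_2,X)\in\mathbb R^3$; $D=\max\{A_1,A_2\}-X$. A feasible (pre-disaster) history $h_t=(S_s)_{0\le s\le t}$ is an absolutely continuous state path, from an arbitrary initial state, with $\dot A_{1s},\dot A_{2s}\in[0,1]$ and $\dot X_s=g$ for a.e. $s$. A pure strategy $\sigma_i$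 prescribes a speed $\sigma_i(h_t)\in[0,1]$ after every feasible history; formally it is a map $[0,\infty)\times\Omega\to[0,1]$, $\Omega$ being the set of pairs (infinite feasible state path, disaster time $\tau_D\in[0,\infty]$), progressively measurable with respect to $\mathcal F_t=\sigma(S_{s},\mathbf 1\{\tau_D\le s\}:s\le t)$. A Markov strategy is a Borel map $\sigma_i:\mathbb R^3\to[0,1]$ of the current state. For histories put $d(h_t,\tilde h_{t'})=|t-t'|+\sup_{s\ge0}\|h_t(s\wedge t)-\tilde h_{t'}(s\wedge t')\|$ (Euclidean norm), where $h_t(s)$ is the state of $h_t$ at date $s$. For a profile $\sigma=(\sigma_1,\sigma_2)$, $$K[\sigma](h_t)=\bigcap_{\varepsilon>0}\overline{\mathrm{co}}\{\sigma(\tilde h_{t'}):\tilde h_{t'}\text{ feasible},\ d(h_t,\tilde h_{t'})<\varepsilon\}\subseteq[0,1]^2.$$ $\mathcal P(\sigma;h_t)$ is the set of absolutely continuous extensions of $h_t$ to $[0,\infty)$ with $(\dot A_{1s},\dot A_{2s})\in K[\sigma](h_s)$ and $\dot X_s=g$ for a.e. $s>t$ ($h_s$ = full history along the path). The payoff of firm $i$ is $$V_i(\sigma,h_t)=\sup_{\mathcal P(\sigma;h_t)}\int_t^\infty e^{-r(s-t)-\int_t^s\lambda(D_u)du}\,e^{\alpha A_{is}-\beta A_{js}}\,ds\in(0,\infty].$$ A Markov profile $\sigma$ is an MPE if for every feasible history $h_t$, each $i$ and every (possibly history-dependent) strategy $\sigma_i'$, $V_i((\sigma_i',\sigma_j),h_t)\le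 V_i(\sigma,h_t)$. **Benchmark values.** Put $\delta=r-\alpha+\beta$. $P(0)=\frac1{r-g(\alpha-\beta)}$; for $D>0$, $P(D)=\int_0^{D/g}e^{-rt-\int_0^t\lambda(D-gs)ds}dt+e^{-rD/g-\frac1g\int_0^D\lambda(s)ds}P(0)$; for $D<0$, $P(D)=\frac{1-e^{\delta D/(1-g)}}{\delta}+e^{\delta D/(1-g)}P(0)$. For $D\in\mathbb R$, $R(D)=\int_0^\infty e^{-\delta t-\int_0^t\lambda(D+(1-g)s)ds}dt$. The effective hazard is $\lambda^{\mathrm{eff}}=\frac1{R(0)}-\delta$; $\lambda^{\mathrm{eff}}\ge(1-g)(\alpha-\beta)$ is equivalent to $R(0)\le P(0)$. **Racing profile.** $\sigma_i^R(S)=1$ for each $i$ and every $S$. **Pacing profile** (defined when $R(0)\le P(0)$). If $P(0)=R(0)$ set $\bar D=0$; if $P(0)>R(0)$ let $\bar D>0$ be the unique positive solution of $P(\bar D)=R(\bar D)$. Set $a^*(D)=1$ for $D<0$, $a^*(0)=g$, $a^*(D)=0$ for $0<D\le\bar D$, $a^*(D)=1$ for $D>\bar D$. Let $G=|A_1-A_2|$, $B=r+\beta-g\alpha>0$, $E_D(t)=\exp\{-(r+\beta)t-\int_0^t\lambda(D-gs)ds\}$. For $0\le D\le\bar D$, $G>0$: $C(0,G)=\frac1B+(P(0)-\frac1B)e^{-BG/(1-g)}$; for $D>0$, $C(D,G)=\int_0^GE_D(t)dt+E_D(G)P(D-gG)$ if $G\le D/g$, and $C(D,G)=\int_0^{D/g}E_D(t)dt+E_D(D/g)\,C(0,G-D/g)$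 if $G\ge D/g$ (with $C(0,0)=P(0)$). For $0\le D\le\bar D$ let $$e^{-\beta G}V_L(D,G)=R(D)+\max\Big\{0,\max_{D\le d\le\bar D}e^{-\frac1{1-g}\int_D^d(\delta+\lambda(s))ds}[C(d,G)-R(d)]\Big\}.$$ Define $b(D,G)$: $b=1$ if $P(0)=R(0)$; if $P(0)>R(0)$ then $b=g$ when $D=0$ and $V_L(0,G)=e^{\beta G}C(0,G)$; $b=0$ when $0<D\le\bar D$ and $V_L(D,G)=e^{\beta G}C(D,G)$; $b=1$ otherwise. Then $\sigma_i^P(S)=a^*(D)$ if $A_i=A_j$, $\sigma_i^P(S)=1$ if $A_i<A_j$, $\sigma_i^P(S)=b(D,G)$ if $A_i>A_j$. *)

theory Defs
  imports "HOL-Analysis.Analysis"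
begin

section \<open>Primitives\<close>

text \<open>
  The hazard function is carried by its two components: \<open>lambda0\<close> and \<open>phi\<close>
  (only the restriction of \<open>phi\<close> to the half-line \<open>[0, \<infinity>)\<close> matters).
\<close>

record primitives =
  alpha :: real
  beta :: real
  disc :: real
  safety :: real
  lambda0 :: real
  phi :: "real \<Rightarrow> real"

definition admissible_hazard :: "real \<Rightarrow> (real \<Rightarrow> real) \<Rightarrow> bool" where
  "admissible_hazard l f \<longleftrightarrow>
     0 \<le> l \<and> continuous_on {0..} f \<and> mono_on {0..} f \<and> concave_on {0..} f \<and> f 0 = 0 \<and>
     (\<exists>f' f''. (\<forall>x>0. (f has_real_derivative f' x) (at x) \<and>
                      (f' has_real_derivative f'' x) (at x)) \<and>
               continuous_on {0<..} f'')"

definition admissible :: "primitives \<Rightarrow> bool" where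
  "admissible p \<longleftrightarrow>
     alpha p > beta p \<and> beta p > 0 \<and> disc p > alpha p - beta p \<and>
     0 < safety p \<and> safety p < 1 \<and> admissible_hazard (lambda0 p) (phi p)"

definition hazard :: "primitives \<Rightarrow> real \<Rightarrow> real" where
  "hazard p D = (if D \<le> 0 then 0 else lambda0 p + phi p D)"


section \<open>The game\<close>

datatype firm = Firm1 | Firm2

fun other :: "firm \<Rightarrow> firm" where
  "other Firm1 = Firm2"
| "other Firm2 = Firm1"

text \<open>A state is \<open>(A\<^sub>1, A\<^sub>2, X)\<close>; the norm of the product type is the Euclidean one.\<close>

type_synonym state = "real \<times> real \<times> real"
type_synonym path = "real \<Rightarrow> state"

fun cap :: "firm \<Rightarrow> state \<Rightarrow> real" where
  "cap Firm1 (a1, a2, x) = a1"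
| "cap Firm2 (a1, a2, x) = a2"

definition lead :: "state \<Rightarrow> real" where
  "lead S = max (cap Firm1 S) (cap Firm2 S) - snd (snd S)"

definition abs_continuous :: "real \<Rightarrow> real \<Rightarrow> (real \<Rightarrow> 'a::metric_space) \<Rightarrow> bool" where
  "abs_continuous a b f \<longleftrightarrow>
     (\<forall>\<epsilon>>0. \<exists>\<delta>>0. \<forall>n (x::nat \<Rightarrow> real) y.
        (\<forall>k<n. a \<le> x k \<and> x k \<le> y k \<and> y k \<le> b) \<and>
        (\<forall>k. Suc k < n \<longrightarrow> y k \<le> x (Suc k)) \<and>
        (\<Sum>k<n. y k - x k) < \<delta>
        \<longrightarrow> (\<Sum>k<n. dist (f (x k)) (f (y k))) < \<epsilon>)"

text \<open>On the unbounded half-line, absolute continuity is required on every compact interval.\<close>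

definition abs_continuous_path :: "path \<Rightarrow> bool" where
  "abs_continuous_path S \<longleftrightarrow> (\<forall>T\<ge>0. abs_continuous 0 T S)"

text \<open>
  Infinite feasible state paths. The values of a path at negative times are irrelevant:
  nothing below inspects them.
\<close>

definition feasible_path :: "primitives \<Rightarrow> path \<Rightarrow> bool" where
  "feasible_path p S \<longleftrightarrow>
     abs_continuous_path S \<and>
     (AE s in lborel. s > 0 \<longrightarrow>
        (\<exists>a1\<in>{0..1}. \<exists>a2\<in>{0..1}. (S has_vector_derivative (a1, a2, safety p)) (at s)))"

text \<open>
  A feasible history \<open>h\<^sub>t\<close> is represented by a pair \<open>(t, S)\<close> of the current date and an infinite
  feasible path whose restriction to \<open>[0, t]\<close> is \<open>h\<^sub>t\<close>. Such a path always exists (continue with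
  constant speeds), and everything defined on histories depends on \<open>S\<close> only through its
  restriction to \<open>[0, t]\<close>; for strategies this is a consequence of their adaptedness.
\<close>

type_synonym history = "real \<times> path"

definition feasible_history :: "primitives \<Rightarrow> history \<Rightarrow> bool" where
  "feasible_history p h \<longleftrightarrow> fst h \<ge> 0 \<and> feasible_path p (snd h)"

definition hist_dist :: "history \<Rightarrow> history \<Rightarrow> real" where
  "hist_dist h h' = \<bar>fst h - fst h'\<bar> +
     (SUP s\<in>{0..}. norm (snd h (min s (fst h)) - snd h' (min s (fst h'))))"

text \<open>Outcomes: a state path together with a disaster time in \<open>[0, \<infinity>]\<close>.\<close>

type_synonym outcome = "path \<times> ennreal"

definition outcomes :: "primitives \<Rightarrow> outcome set" where
  "outcomes p = {S. feasible_path p S} \<times> UNIV"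

definition info :: "primitives \<Rightarrow> real \<Rightarrow> outcome measure" where
  "info p t = sigma (outcomes p)
     ({{\<omega> \<in> outcomes p. fst \<omega> s \<in> U} | s U. s \<in> {0..t} \<and> U \<in> sets borel} \<union>
      {{\<omega> \<in> outcomes p. snd \<omega> \<le> ennreal s} | s. s \<in> {0..t}})"

type_synonym strategy = "real \<Rightarrow> outcome \<Rightarrow> real"

definition is_strategy :: "primitives \<Rightarrow> strategy \<Rightarrow> bool" where
  "is_strategy p \<sigma> \<longleftrightarrow>
     (\<forall>t\<ge>0. \<forall>\<omega>\<in>outcomes p. \<sigma> t \<omega> \<in> {0..1}) \<and>
     (\<forall>t\<ge>0. (\<lambda>(s, \<omega>). \<sigma> s \<omega>) \<in> borel_measurable (restrict_space borel {0..t} \<Otimes>\<^sub>M info p t))"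

text \<open>
  Pre-disaster value of a strategy after a history: the disaster time may be any element
  of \<open>(t, \<infinity>]\<close>, since date-\<open>t\<close> information does not distinguish between them.
\<close>

definition speed_after :: "strategy \<Rightarrow> history \<Rightarrow> real" where
  "speed_after \<sigma> h = \<sigma> (fst h) (snd h, \<infinity>)"

type_synonym profile = "firm \<Rightarrow> strategy"

definition krasovskii :: "primitives \<Rightarrow> profile \<Rightarrow> history \<Rightarrow> (real \<times> real) set" where
  "krasovskii p \<sigma> h =
     (\<Inter>\<epsilon>\<in>{0<..}. closure (convex hull
        {(speed_after (\<sigma> Firm1) h', speed_after (\<sigma> Firm2) h') | h'.
           feasible_history p h' \<and> hist_dist h h' < \<epsilon>}))"

definition continuations :: "primitives \<Rightarrow> profile \<Rightarrow> history \<Rightarrow> path set" where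
  "continuations p \<sigma> h =
     {S. abs_continuous_path S \<and> (\<forall>s\<in>{0..fst h}. S s = snd h s) \<and>
         (AE s in lborel. s > fst h \<longrightarrow>
            (\<exists>a1 a2. (S has_vector_derivative (a1, a2, safety p)) (at s) \<and>
                     (a1, a2) \<in> krasovskii p \<sigma> (s, S)))}"

definition payoff :: "primitives \<Rightarrow> firm \<Rightarrow> profile \<Rightarrow> history \<Rightarrow> ennreal" where
  "payoff p i \<sigma> h =
     (SUP S\<in>continuations p \<sigma> h.
        \<integral>\<^sup>+ s. ennreal (exp (- disc p * (s - fst h)
                            - integral {fst h..s} (\<lambda>u. hazard p (lead (S u))))
                       * exp (alpha p * cap i (S s) - beta p * cap (other i) (S s)))
              * indicator {fst h..} s \<partial>lborel)"

type_synonym markov_profile = "firm \<Rightarrow> state \<Rightarrow> real"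

definition is_markov_strategy :: "(state \<Rightarrow> real) \<Rightarrow> bool" where
  "is_markov_strategy m \<longleftrightarrow> m \<in> borel_measurable borel \<and> (\<forall>S. m S \<in> {0..1})"

definition of_markov :: "markov_profile \<Rightarrow> profile" where
  "of_markov m = (\<lambda>i t \<omega>. m i (fst \<omega> t))"

definition is_MPE :: "primitives \<Rightarrow> markov_profile \<Rightarrow> bool" where
  "is_MPE p m \<longleftrightarrow>
     (\<forall>i. is_markov_strategy (m i)) \<and>
     (\<forall>h i \<sigma>'. feasible_history p h \<and> is_strategy p \<sigma>' \<longrightarrow>
        payoff p i ((of_markov m)(i := \<sigma>')) h \<le> payoff p i (of_markov m) h)"


section \<open>Benchmark values\<close>

definition eff_disc :: "primitives \<Rightarrow> real" where
  "eff_disc p = disc p - alpha p + beta p"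

definition pace0 :: "primitives \<Rightarrow> real" where
  "pace0 p = 1 / (disc p - safety p * (alpha p - beta p))"

definition pace_value :: "primitives \<Rightarrow> real \<Rightarrow> real" where
  "pace_value p D =
     (if D = 0 then pace0 p
      else if D > 0 then
        integral {0..D / safety p}
          (\<lambda>t. exp (- disc p * t - integral {0..t} (\<lambda>s. hazard p (D - safety p * s))))
        + exp (- disc p * D / safety p - 1 / safety p * integral {0..D} (hazard p)) * pace0 p
      else (1 - exp (eff_disc p * D / (1 - safety p))) / eff_disc p
        + exp (eff_disc p * D / (1 - safety p)) * pace0 p)"

definition race_value :: "primitives \<Rightarrow> real \<Rightarrow> real" where
  "race_value p D =
     integral {0..} (\<lambda>t. exp (- eff_disc p * t
                             - integral {0..t} (\<lambda>s. hazard p (D + (1 - safety p) * s))))"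

definition eff_hazard :: "primitives \<Rightarrow> real" where
  "eff_hazard p = 1 / race_value p 0 - eff_disc p"

definition hazard_ratio :: "primitives \<Rightarrow> real" where
  "hazard_ratio p = eff_hazard p / (1 - safety p)"


section \<open>Racing and pacing profiles\<close>

definition racing :: markov_profile where
  "racing = (\<lambda>i S. 1)"

definition pacing_defined :: "primitives \<Rightarrow> bool" where
  "pacing_defined p \<longleftrightarrow> race_value p 0 \<le> pace_value p 0"

definition threshold :: "primitives \<Rightarrow> real" where
  "threshold p =
     (if pace_value p 0 = race_value p 0 then 0
      else (THE d. d > 0 \<and> pace_value p d = race_value p d))"

definition pace_speed :: "primitives \<Rightarrow> real \<Rightarrow> real" where
  "pace_speed p D =
     (if D < 0 then 1 else if D = 0 then safety p else if D \<le> threshold p then 0 else 1)"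

definition coast_rate :: "primitives \<Rightarrow> real" where
  "coast_rate p = disc p + beta p - safety p * alpha p"

definition coast_disc :: "primitives \<Rightarrow> real \<Rightarrow> real \<Rightarrow> real" where
  "coast_disc p D t =
     exp (- (disc p + beta p) * t - integral {0..t} (\<lambda>s. hazard p (D - safety p * s)))"

definition coast0 :: "primitives \<Rightarrow> real \<Rightarrow> real" where
  "coast0 p G = 1 / coast_rate p
     + (pace_value p 0 - 1 / coast_rate p) * exp (- coast_rate p * G / (1 - safety p))"

text \<open>The function \<open>C(D, G)\<close>, for \<open>D \<ge> 0\<close>.\<close>

definition coast_value :: "primitives \<Rightarrow> real \<Rightarrow> real \<Rightarrow> real" where
  "coast_value p D G =
     (if D = 0 then coast0 p G
      else if G \<le> D / safety p then
        integral {0..G} (coast_disc p D) + coast_disc p D G * pace_value p (D - safety p * G)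
      else
        integral {0..D / safety p} (coast_disc p D)
        + coast_disc p D (D / safety p) * coast0 p (G - D / safety p))"

text \<open>
  \<open>V\<^sub>L(D, G)\<close>, for \<open>0 \<le> D \<le> threshold p\<close>. The supremum is a maximum of a continuous function
  over a nonempty compact interval.
\<close>

definition leader_value :: "primitives \<Rightarrow> real \<Rightarrow> real \<Rightarrow> real" where
  "leader_value p D G =
     exp (beta p * G) *
     (race_value p D +
      max 0 (SUP d\<in>{D..threshold p}.
        exp (- 1 / (1 - safety p) * integral {D..d} (\<lambda>s. eff_disc p + hazard p s))
        * (coast_value p d G - race_value p d)))"

definition leader_speed :: "primitives \<Rightarrow> real \<Rightarrow> real \<Rightarrow> real" where
  "leader_speed p D G =
     (if pace_value p 0 = race_value p 0 then 1
      else if D = 0 \<and> leader_value p 0 G = exp (beta p * G) * coast_value p 0 G then safety p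
      else if 0 < D \<and> D \<le> threshold p \<and>
              leader_value p D G = exp (beta p * G) * coast_value p D G then 0
      else 1)"

definition pacing :: "primitives \<Rightarrow> markov_profile" where
  "pacing p i S =
     (if cap i S = cap (other i) S then pace_speed p (lead S)
      else if cap i S < cap (other i) S then 1
      else leader_speed p (lead S) \<bar>cap Firm1 S - cap Firm2 S\<bar>)"

end

theory Submission
  imports Defs "HOL-Real_Asymp.Real_Asymp"
begin

text \<open>
  Everything reduces to the monotonicity of the hazard ratio, because both equilibrium regions are
  half-lines of it: racing is an equilibrium iff the ratio is at most \<open>alpha\<close>, and pacing is defined
  iff the ratio is at least \<open>alpha - beta\<close>, in which case it is an equilibrium. The ratio \<open>\<eta>\<close> is
  characterised by the vanishing of the integral of \<open>hazard - (1 - g) * \<eta>\<close> along the racing path,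
  weighted by the racing discount factor. The integrand changes sign at most once, so replacing the
  weight by one with a monotone likelihood ratio signs the integral; a change of \<open>g\<close> is absorbed by a
  time change, using that a concave hazard is star-shaped.

  For the equilibria, a laggard that races forces a leading or tied firm into the one-dimensional
  problem of choosing the path of the larger capability. There racing first and coasting afterwards is
  optimal: any path is a limit of concatenations of short coasting and racing pieces, and coasting for
  a while and then following the best such plan never beats that plan started at once. The latter rests
  on the persistence of profitable delays (a single-crossing argument) and on the equality of the
  value at a tie with the pacing value up to the threshold. A lagging firm cannot slow down a pacing leader, whose
  stopping region only shrinks when the gap grows, so it gains nothing before the equilibrium tie date;
  from there on the tied value, decreasing in the common capability, bounds its continuation payoff.
  Racing fails to be an equilibrium when the ratio exceeds \<open>alpha\<close>: a firm with zero lead and a huge gap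
  then prefers to hold its lead at zero.
\<close>

section \<open>Integrals of hazards along paths\<close>

text \<open>Krasovskii solutions leave the speed of a pacing firm undetermined where its
  prescription is discontinuous, and a deviation may steer play there. Deviations are therefore
  bounded through facts that survive every selection: a firm strictly behind races, a pacing firm
  races off its closed stopping region, and it does not drop below the safety frontier once it has
  reached it. On the equilibrium side a payoff is a supremum over continuations, so one explicit
  continuation bounds it from below. The critical ratios come from holding the lead at 0 forever.
  This is worth \<open>1 / rho\<close> at a tie and \<open>1 / B\<close> against a laggard that
  never catches up; comparing both with \<open>R 0\<close> and using \<open>rho_de\<close> and
  \<open>B_de\<close> gives \<open>al - be\<close> and \<open>al\<close>. In the gap and delay
  arguments the hazard jumps at lead 0 and the paths have kinks at ties and at the ends of races.
  Finite differences with a vanishing error take the place of derivatives there.\<close>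

lemma bounded_borel_integrable_on:
  fixes f :: "real \<Rightarrow> real"
  assumes f: "f \<in> borel_measurable borel" and K: "\<And>x. x \<in> {a..b} \<Longrightarrow> \<bar>f x\<bar> \<le> K"
  shows "f integrable_on {a..b}"
proof -
  have "set_integrable lborel {a..b} f"
    unfolding set_integrable_def
  proof (rule Bochner_Integration.integrable_bound[where f = "\<lambda>x. indicat_real {a..b} x * K"])
    show "integrable lborel (\<lambda>x. indicat_real {a..b} x * K)"
      by (intro integrable_mult_left integrable_real_indicator) (simp_all add: emeasure_lborel_Icc_eq)
    show "AE x in lborel. norm (indicat_real {a..b} x *\<^sub>R f x) \<le> norm (indicat_real {a..b} x * K)"
    proof (rule AE_I2)
      fix x show "norm (indicat_real {a..b} x *\<^sub>R f x) \<le> norm (indicat_real {a..b} x * K)"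
        using K[of x] by (cases "x \<in> {a..b}") simp_all
    qed
  qed (use f in measurable)
  then show ?thesis
    by (rule set_borel_integral_eq_integral)
qed

text \<open>The whole hazard, with its jump \<open>lambda0\<close> at lead 0, plays the role of the
  concave function: its value 0 at 0 lies below the limit from the right, so concavity of increments
  and star-shapedness hold from 0 on. The analysis sees the hazard only through the properties
  listed here.\<close>

locale race_env =
  fixes al be r g :: real and lam lam' :: "real \<Rightarrow> real"
  assumes be_less: "be < al" and be_pos: "0 < be" and r_gt: "al - be < r"
    and g_pos: "0 < g" and g_less: "g < 1"
    and lam_nonpos: "\<And>x. x \<le> 0 \<Longrightarrow> lam x = 0"
    and lam_mono: "\<And>x y. x \<le> y \<Longrightarrow> lam x \<le> lam y"
    and lam_conc: "\<And>x y h. \<lbrakk>0 \<le> x; x \<le> y; 0 \<le> h\<rbrakk> \<Longrightarrow> lam (y + h) - lam y \<le> lam (x + h) - lam x"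
    and lam_star: "\<And>c x. \<lbrakk>0 \<le> c; c \<le> 1; 0 \<le> x\<rbrakk> \<Longrightarrow> c * lam x \<le> lam (c * x)"
    and lam_deriv: "\<And>x. 0 < x \<Longrightarrow> (lam has_real_derivative lam' x) (at x)"
    and lam'_anti: "\<And>x y. \<lbrakk>0 < x; x \<le> y\<rbrakk> \<Longrightarrow> lam' y \<le> lam' x"
begin

text \<open>Rates at which the leading firm's flow decays without hazard: \<open>de\<close> when
  both firms race, \<open>rho\<close> when tied firms move at speed \<open>g\<close>,
  \<open>B\<close> when the leader moves at speed \<open>g\<close> and the laggard races.\<close>

definition "de = r - al + be"
definition "rho = r - g * (al - be)"
definition "B = r + be - g * al"

lemma de_pos: "0 < de"
  using r_gt by (simp add: de_def)

lemma B_split: "B - rho = be * (1 - g)" and B_de: "B - de = al * (1 - g)"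
  and rho_de: "rho - de = (1 - g) * (al - be)"
  by (auto simp: B_def rho_def de_def algebra_simps)

lemma rho_gt: "de < rho" and B_gt: "rho < B"
proof -
  have "0 < (1 - g) * (al - be)" "0 < be * (1 - g)"
    using g_less be_less be_pos by simp_all
  then show "de < rho" "rho < B" using rho_de B_split by linarith+
qed

lemma rho_pos: "0 < rho" and B_pos: "0 < B" and al_pos: "0 < al" and r_pos: "0 < r"
  using de_pos rho_gt B_gt be_less be_pos r_gt by linarith+

lemma lam_nonneg: "0 \<le> lam x"
  by (metis lam_mono lam_nonpos linear)

lemma lam_borel [measurable]: "lam \<in> borel_measurable borel"
  by (rule borel_measurable_mono) (simp add: lam_mono monoI)

lemma lam_cont: "0 < x \<Longrightarrow> isCont lam x"
  using lam_deriv DERIV_isCont by blast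

lemma lam_integrable:
  assumes D: "continuous_on UNIV D"
  shows "(\<lambda>u::real. lam (D u)) integrable_on {a..b}"
proof -
  have [measurable]: "D \<in> borel_measurable borel"
    using D by (rule borel_measurable_continuous_onI)
  have "compact (D ` {a..b})"
    using D by (intro compact_continuous_image) (auto intro: continuous_on_subset)
  then obtain K where K: "\<And>x. x \<in> {a..b} \<Longrightarrow> D x \<le> K"
    by (metis bounded_imp_bdd_above bdd_above.E compact_imp_bounded imageI)
  show ?thesis
  proof (rule bounded_borel_integrable_on)
    show "(\<lambda>u. lam (D u)) \<in> borel_measurable borel" by measurable
    fix x assume "x \<in> {a..b}"
    then show "\<bar>lam (D x)\<bar> \<le> lam K"
      using lam_mono[OF K] lam_nonneg by auto
  qed
qed

definition "Lam x = integral {0..x} lam"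

lemma Lam_nonpos: "x \<le> 0 \<Longrightarrow> Lam x = 0"
  by (cases "x = 0") (auto simp: Lam_def)

lemma Lam_diff: "x \<le> y \<Longrightarrow> Lam y - Lam x = integral {x..y} lam"
proof -
  assume xy: "x \<le> y"
  have int: "lam integrable_on {a..b}" for a b
    using lam_integrable[of "\<lambda>x. x"] by simp
  have z: "integral {a..b} lam = 0" if "b \<le> 0" for a b
  proof -
    have "integral {a..b} lam = integral {a..b} (\<lambda>_. 0)"
      using that lam_nonpos by (intro Henstock_Kurzweil_Integration.integral_cong) auto
    then show ?thesis by simp
  qed
  consider "0 \<le> x" | "x \<le> 0" "0 \<le> y" | "x \<le> 0" "y \<le> 0" by linarith
  then show ?thesis
  proof cases
    case 1
    then show ?thesis using Henstock_Kurzweil_Integration.integral_combine[OF 1 xy int]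
      by (simp add: Lam_def)
  next
    case 2
    then show ?thesis using Henstock_Kurzweil_Integration.integral_combine[OF 2 int] z[of 0 x]
      by (simp add: Lam_nonpos) (simp add: Lam_def)
  next
    case 3
    then show ?thesis by (simp add: z Lam_nonpos)
  qed
qed

lemma Lam_mono: "x \<le> y \<Longrightarrow> Lam x \<le> Lam y"
proof -
  assume "x \<le> y"
  moreover have "0 \<le> integral {x..y} lam"
    using lam_integrable[of "\<lambda>x. x"] lam_nonneg by (intro integral_nonneg) auto
  ultimately show ?thesis using Lam_diff[of x y] by linarith
qed

lemma Lam_nonneg: "0 \<le> Lam x"
  using Lam_mono[of 0 x] Lam_nonpos[of 0] Lam_nonpos[of x] by (cases "x \<le> 0") auto

lemma Lam_diff_bounds:
  assumes "x \<le> y" shows "lam x * (y - x) \<le> Lam y - Lam x" "Lam y - Lam x \<le> lam y * (y - x)"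
proof -
  have int: "lam integrable_on {x..y}"
    using lam_integrable[of "\<lambda>x. x"] by simp
  have "integral {x..y} (\<lambda>_. lam x) \<le> integral {x..y} lam"
    using int lam_mono by (intro integral_le) auto
  moreover have "integral {x..y} lam \<le> integral {x..y} (\<lambda>_. lam y)"
    using int lam_mono by (intro integral_le) auto
  ultimately show "lam x * (y - x) \<le> Lam y - Lam x" "Lam y - Lam x \<le> lam y * (y - x)"
    using assms Lam_diff[OF assms] by (simp_all add: mult.commute)
qed

lemma Lam_deriv: "x \<noteq> 0 \<Longrightarrow> (Lam has_real_derivative lam x) (at x)"
proof (cases "0 < x")
  case True
  have "((\<lambda>u. integral {0..u} lam) has_real_derivative lam x) (at x within {0..x + 1})"
    using integral_has_vector_derivative_continuous_at[of lam 0 "x + 1" x "{}"]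
      lam_integrable[of "\<lambda>x. x" 0 "x + 1"] True continuous_at_imp_continuous_at_within[OF lam_cont[OF True]]
    unfolding has_real_derivative_iff_has_vector_derivative by simp
  then have "((\<lambda>u. integral {0..u} lam) has_real_derivative lam x) (at x within {0<..<x + 1})"
    by (rule DERIV_subset) auto
  moreover have "at x within {0<..<x + 1} = at x" using True by (intro at_within_open) auto
  moreover have "Lam = (\<lambda>u. integral {0..u} lam)" by (simp add: fun_eq_iff Lam_def)
  ultimately show ?thesis by simp
next
  case False
  assume "x \<noteq> 0"
  with False have "x < 0" by simp
  have "((\<lambda>x. 0::real) has_real_derivative 0) (at x)" by simp
  then have "(Lam has_real_derivative 0) (at x)"
    by (rule has_field_derivative_transform_within_open[of _ _ _ "{..<0}"])
      (use \<open>x < 0\<close> Lam_nonpos in auto)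
  then show ?thesis using \<open>x < 0\<close> by (simp add: lam_nonpos)
qed

lemma Lam_cont: "isCont Lam x"
proof (cases "x = 0")
  case False
  then show ?thesis using Lam_deriv DERIV_isCont by blast
next
  case True
  have "(Lam \<longlongrightarrow> 0) (at 0)"
  proof (rule tendsto_sandwich[of "\<lambda>_. 0" _ _ "\<lambda>x. lam 1 * \<bar>x\<bar>"])
    show "\<forall>\<^sub>F x in at 0. Lam x \<le> lam 1 * \<bar>x\<bar>"
    proof -
      have "\<forall>\<^sub>F x::real in at 0. x < 1"
        using order_tendstoD(2)[OF tendsto_ident_at[of "0::real" UNIV], of 1] by simp
      then show ?thesis
      proof eventually_elim
        case (elim x)
        show ?case
        proof (cases "x \<le> 0")
          case True
          then show ?thesis using lam_nonneg[of 1] by (simp add: Lam_nonpos mult_nonneg_nonpos)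
        next
          case False
          then have "Lam x \<le> lam x * x" using Lam_diff_bounds(2)[of 0 x] by (simp add: Lam_nonpos)
          also have "\<dots> \<le> lam 1 * x" using False elim by (intro mult_right_mono lam_mono) auto
          finally show ?thesis using False by simp
        qed
      qed
    qed
    show "((\<lambda>x. lam 1 * \<bar>x\<bar>) \<longlongrightarrow> 0) (at 0)" by (auto intro!: tendsto_eq_intros)
  qed (auto simp: Lam_nonneg)
  then show ?thesis using True by (simp add: isCont_def Lam_nonpos)
qed

lemma continuous_on_Lam [continuous_intros]: "continuous_on A f \<Longrightarrow> continuous_on A (\<lambda>x. Lam (f x))"
  using continuous_on_compose2[of UNIV Lam A f] Lam_cont by (simp add: continuous_at_imp_continuous_on)

lemma lam_affine_integral:
  assumes "s \<le> t" "c \<noteq> 0"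
  shows "((\<lambda>u. lam (y + c * u)) has_integral (Lam (y + c * t) - Lam (y + c * s)) / c) {s..t}"
proof -
  have "((\<lambda>u. lam (y + c * u)) has_integral (Lam (y + c * t) / c - Lam (y + c * s) / c)) {s..t}"
  \<comment> \<open>The only date at which \<open>Lam (y + c * u)\<close> may fail to be
    differentiable: its argument is 0 there, where the hazard jumps.\<close>
  proof (rule fundamental_theorem_of_calculus_interior_strong[of "{- y / c}"])
    fix x assume "x \<in> {s<..<t} - {- y / c}"
    then have "y + c * x \<noteq> 0" using assms by (auto simp: field_simps)
    then have "((\<lambda>u. Lam (y + c * u)) has_real_derivative lam (y + c * x) * c) (at x)"
      by (intro DERIV_chain2[OF Lam_deriv]) (auto intro!: derivative_eq_intros)
    then have "((\<lambda>u. Lam (y + c * u) / c) has_real_derivative lam (y + c * x)) (at x)"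
      using assms DERIV_cdivide[of "\<lambda>u. Lam (y + c * u)" "lam (y + c * x) * c" x UNIV c] by simp
    then show "((\<lambda>u. Lam (y + c * u) / c) has_vector_derivative lam (y + c * x)) (at x)"
      by (simp add: has_real_derivative_iff_has_vector_derivative)
  qed (use assms in \<open>auto intro!: continuous_intros\<close>)
  then show ?thesis by (simp add: diff_divide_distrib)
qed

section \<open>Discounted flows along paths\<close>

text \<open>
  A path \<open>m\<close> records the increase of the larger capability from a state with lead \<open>y\<close> and gap \<open>G\<close>;
  \<open>fl y G m\<close> is the discounted flow of the leading firm, normalised to start at 1, when the laggard
  races until it has caught up and then moves along.
\<close>

definition admpath :: "(real \<Rightarrow> real) \<Rightarrow> bool" where
  "admpath m \<longleftrightarrow> m 0 = 0 \<and> (\<forall>s t. s \<le> t \<longrightarrow> m s \<le> m t \<and> m t - m s \<le> t - s)"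

definition "H y m t = integral {0..t} (\<lambda>u. lam (y + m u - g * u))"

definition "fl y G m t = exp (- r * t - H y m t + al * m t - be * min t (G + m t))"

lemma admpathD:
  assumes "admpath m"
  shows "m 0 = 0" "s \<le> t \<Longrightarrow> m s \<le> m t" "s \<le> t \<Longrightarrow> m t \<le> m s + (t - s)" 
    "0 \<le> t \<Longrightarrow> 0 \<le> m t" "0 \<le> t \<Longrightarrow> m t \<le> t"
proof -
  show 1: "m 0 = 0" "s \<le> t \<Longrightarrow> m s \<le> m t" "s \<le> t \<Longrightarrow> m t \<le> m s + (t - s)" for s t
    using assms by (auto simp: admpath_def) (smt (verit))+
  show "0 \<le> t \<Longrightarrow> 0 \<le> m t" "0 \<le> t \<Longrightarrow> m t \<le> t" using 1(1) 1(2)[of 0 t] 1(3)[of 0 t] by auto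
qed

lemma admpath_cont: "admpath m \<Longrightarrow> continuous_on A m"
proof -
  assume "admpath m"
  then have "1-lipschitz_on UNIV m"
    by (intro lipschitz_onI) (auto simp: dist_real_def admpath_def abs_if not_less, (smt (verit))+)
  then show ?thesis using lipschitz_on_continuous_on continuous_on_subset by blast
qed

lemma admpath_shift: "admpath m \<Longrightarrow> admpath (\<lambda>t. m (s + t) - m s)"
  by (auto simp: admpath_def) (smt (verit))

lemma admpath_max: "admpath m \<Longrightarrow> admpath n \<Longrightarrow> admpath (\<lambda>t. max (m t) (n t))"
  unfolding admpath_def by (auto simp: max_def) (smt (verit))+

lemma admpath_id: "admpath (\<lambda>t. t)" and admpath_lin: "0 \<le> c \<Longrightarrow> c \<le> 1 \<Longrightarrow> admpath (\<lambda>t. c * t)"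
proof -
  show "admpath (\<lambda>t. t)" by (simp add: admpath_def)
  assume "0 \<le> c" "c \<le> 1"
  then have "c * t - c * s \<le> t - s" if "s \<le> t" for s t :: real
    using mult_right_mono[of c 1 "t - s"] that by (simp add: algebra_simps)
  then show "admpath (\<lambda>t. c * t)" using \<open>0 \<le> c\<close> by (simp add: admpath_def mult_left_mono)
qed

lemma H_integrable: "admpath m \<Longrightarrow> (\<lambda>u. lam (y + m u - g * u)) integrable_on {a..b}"
  by (intro lam_integrable continuous_intros admpath_cont)

lemma H_0 [simp]: "H y m 0 = 0" by (simp add: H_def)

lemma H_add:
  assumes "admpath m" "0 \<le> s" "0 \<le> t"
  shows "H y m (s + t) = H y m s + H (y + m s - g * s) (\<lambda>t. m (s + t) - m s) t"
proof -
  have "H y m (s + t) = H y m s + integral {s..s + t} (\<lambda>u. lam (y + m u - g * u))"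
    unfolding H_def using assms H_integrable by (subst Henstock_Kurzweil_Integration.integral_combine) auto
  also have "integral {s..s + t} (\<lambda>u. lam (y + m u - g * u))
      = integral {0..t} (\<lambda>u. lam (y + m (u + s) - g * (u + s)))"
    using integral_shift_real_ivl[of s s "s + t" "\<lambda>u. lam (y + m u - g * u)"] by simp
  finally show ?thesis by (simp add: H_def algebra_simps)
qed

lemma H_nonneg: "admpath m \<Longrightarrow> 0 \<le> H y m t"
  unfolding H_def by (intro integral_nonneg H_integrable) (auto simp: lam_nonneg)

lemma H_mono_path:
  assumes "admpath m" "admpath n" "\<And>u. 0 \<le> u \<Longrightarrow> u \<le> t \<Longrightarrow> lam (y + m u - g * u) \<le> lam (z + n u - g * u)"
  shows "H y m t \<le> H z n t"
  unfolding H_def using assms by (intro integral_le H_integrable) auto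

lemma H_cong:
  assumes "\<And>u. 0 \<le> u \<Longrightarrow> u \<le> t \<Longrightarrow> m u = n u" shows "H y m t = H y n t"
  unfolding H_def by (intro integral_cong) (use assms in auto)

lemma H_cont: "admpath m \<Longrightarrow> continuous_on {0..} (H y m)"
proof -
  assume m: "admpath m"
  have "continuous_on {0..b} (H y m)" for b
    unfolding H_def[abs_def] by (intro indefinite_integral_continuous_1 H_integrable m)
  then have "continuous (at x within {0..}) (H y m)" if "0 \<le> x" for x
  proof -
    have "continuous (at x within {0..x + 1}) (H y m)"
      using that \<open>\<And>b. continuous_on {0..b} (H y m)\<close>[of "x + 1"] by (auto simp: continuous_on_eq_continuous_within)
    moreover have "at x within {0..} = at x within {0..x + 1}"
      by (rule at_within_nhd[of x "{..<x + 1}" "{0..}" "{0..x+1}"]) auto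
    ultimately show ?thesis by simp
  qed
  then show ?thesis by (auto simp: continuous_on_eq_continuous_within)
qed

lemma fl_pos: "0 < fl y G m t" by (simp add: fl_def)

lemma fl_0: "admpath m \<Longrightarrow> 0 \<le> G \<Longrightarrow> fl y G m 0 = 1"
  by (simp add: fl_def admpathD)

lemma fl_cont: "admpath m \<Longrightarrow> continuous_on {0..} (fl y G m)"
  unfolding fl_def[abs_def] by (intro continuous_intros H_cont admpath_cont)

lemma fl_cont': "admpath m \<Longrightarrow> 0 \<le> a \<Longrightarrow> continuous_on {a..b} (fl y G m)"
  by (rule continuous_on_subset[OF fl_cont]) auto

lemma fl_integrable: "admpath m \<Longrightarrow> 0 \<le> a \<Longrightarrow> fl y G m integrable_on {a..b}"
  by (intro integrable_continuous_interval fl_cont')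

text \<open>Own progress is worth \<open>al\<close>, the laggard's costs \<open>be\<close>, and
  after the gap is closed the two move together. Hence hazard-free growth is at most
  \<open>al - be\<close>, and every flow is integrable because \<open>de\<close> is
  positive.\<close>

lemma fl_le: 
  assumes "admpath m" "0 \<le> G" "0 \<le> t" shows "fl y G m t \<le> exp (- de * t)"
proof -
  have m: "0 \<le> m t" "m t \<le> t" using assms admpathD by auto
  have "al * m t - be * min t (G + m t) \<le> (al - be) * t"
  proof (cases "t \<le> G + m t")
    case True then show ?thesis using mult_left_mono[OF m(2), of al] al_pos by (simp add: algebra_simps)
  next
    case False
    have "al * m t - be * (G + m t) \<le> (al - be) * m t" using be_pos assms by (simp add: algebra_simps)
    also have "\<dots> \<le> (al - be) * t" using m be_less by (intro mult_left_mono) auto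
    finally show ?thesis using False by simp
  qed
  then show ?thesis using H_nonneg[OF assms(1), of y t] by (simp add: fl_def de_def algebra_simps)
qed

text \<open>The normalisation to 1 at the start makes the flow multiplicative: what remains after
  \<open>s\<close> is the flow from the lead and gap reached by then. The clamp of the gap at 0 fits
  because a laggard that has caught up moves along with the path.\<close>

lemma fl_add:
  assumes "admpath m" "0 \<le> G" "0 \<le> s" "0 \<le> t"
  shows "fl y G m (s + t) = fl y G m s * fl (y + m s - g * s) (max 0 (G + m s - s)) (\<lambda>t. m (s + t) - m s) t"
proof -
  have "m (s + t) - m s \<le> t" using admpathD(3)[OF assms(1), of s "s + t"] assms by auto
  then have "min (s + t) (G + m (s + t)) = min s (G + m s) + min t (max 0 (G + m s - s) + (m (s + t) - m s))"
    by (auto simp: min_def max_def)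
  then show ?thesis unfolding fl_def H_add[OF assms(1,3,4)] exp_add[symmetric]
    by (simp add: algebra_simps)
qed

section \<open>Values of paths\<close>

definition "J y G m = enn2real (\<integral>\<^sup>+ t. ennreal (fl y G m t) * indicator {0..} t \<partial>lborel)"

lemma fl_borel [measurable]:
  assumes "admpath m"
  shows "(\<lambda>t. ennreal (fl y G m t) * indicator {0..} t) \<in> borel_measurable borel"
proof -
  have "(\<lambda>t. indicat_real {0..} t *\<^sub>R fl y G m t) \<in> borel_measurable borel"
    using fl_cont[OF assms] by (intro borel_measurable_continuous_on_indicator) auto
  then have "(\<lambda>t. ennreal (indicat_real {0..} t *\<^sub>R fl y G m t)) \<in> borel_measurable borel" by measurable
  also have "(\<lambda>t. ennreal (indicat_real {0..} t *\<^sub>R fl y G m t)) = (\<lambda>t. ennreal (fl y G m t) * indicator {0..} t)"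
    by (auto simp: indicator_def)
  finally show ?thesis .
qed

lemma nn_exp: "c > 0 \<Longrightarrow> (\<integral>\<^sup>+ t. ennreal (exp (- c * t)) * indicator {0..} t \<partial>lborel) = ennreal (1 / c)"
proof -
  assume c: "c > 0"
  have "(\<integral>\<^sup>+ t. ennreal (exp (- c * t)) * indicator {0..} t \<partial>lborel) = ennreal (0 - (- exp (- c * 0) / c))"
  proof (rule nn_integral_FTC_atLeast)
    show "((\<lambda>t. - exp (- c * t) / c) \<longlongrightarrow> 0) at_top"
    proof -
      have "((\<lambda>t. exp (- (c * t))) \<longlongrightarrow> 0) at_top"
        using c by real_asymp
      then have "((\<lambda>t. - exp (- (c * t)) / c) \<longlongrightarrow> - 0 / c) at_top"
        using c by (intro tendsto_intros) auto
      then show ?thesis by simp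
    qed
  qed (use c in \<open>auto intro!: derivative_eq_intros\<close>)
  then show ?thesis by simp
qed

lemma nn_J:
  assumes "admpath m" "0 \<le> G"
  shows "(\<integral>\<^sup>+ t. ennreal (fl y G m t) * indicator {0..} t \<partial>lborel) = ennreal (J y G m)"
    and "J y G m \<le> 1 / de" and "0 \<le> J y G m"
proof -
  have "(\<integral>\<^sup>+ t. ennreal (fl y G m t) * indicator {0..} t \<partial>lborel)
      \<le> (\<integral>\<^sup>+ t. ennreal (exp (- de * t)) * indicator {0..} t \<partial>lborel)"
    by (rule nn_integral_mono) (use fl_le[OF assms] in \<open>auto simp: indicator_def ennreal_leI\<close>)
  then have le: "(\<integral>\<^sup>+ t. ennreal (fl y G m t) * indicator {0..} t \<partial>lborel) \<le> ennreal (1 / de)"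
    using nn_exp[OF de_pos] by simp
  then have lt: "(\<integral>\<^sup>+ t. ennreal (fl y G m t) * indicator {0..} t \<partial>lborel) < top"
    using ennreal_less_top le_less_trans by blast
  then show "(\<integral>\<^sup>+ t. ennreal (fl y G m t) * indicator {0..} t \<partial>lborel) = ennreal (J y G m)"
    by (simp add: J_def)
  show "J y G m \<le> 1 / de" "0 \<le> J y G m"
    using le enn2real_mono[OF le] de_pos by (auto simp: J_def)
qed

lemma nn_fl_Icc:
  assumes "admpath m" "0 \<le> a"
  shows "(\<integral>\<^sup>+ t. ennreal (fl y G m t) * indicator {a..b} t \<partial>lborel) = ennreal (integral {a..b} (fl y G m))"
proof -
  have "set_integrable lborel {a..b} (fl y G m)"
    using fl_cont'[OF assms] by (rule borel_integrable_atLeastAtMost')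
  then have i: "integrable lborel (\<lambda>t. indicat_real {a..b} t * fl y G m t)" by (simp add: set_integrable_def)
  have "(\<integral>\<^sup>+ t. ennreal (fl y G m t) * indicator {a..b} t \<partial>lborel)
      = (\<integral>\<^sup>+ t. ennreal (indicat_real {a..b} t * fl y G m t) \<partial>lborel)"
    by (intro nn_integral_cong) (auto simp: indicator_def)
  also have "\<dots> = ennreal (LINT t|lborel. indicat_real {a..b} t * fl y G m t)"
    by (intro nn_integral_eq_integral i) (auto simp: indicator_def less_imp_le fl_pos)
  also have "(LINT t|lborel. indicat_real {a..b} t * fl y G m t) = integral {a..b} (fl y G m)"
    using set_borel_integral_eq_integral(2)[OF \<open>set_integrable lborel {a..b} (fl y G m)\<close>]
    by (simp add: set_lebesgue_integral_def)
  finally show ?thesis .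
qed

lemma integral_fl_nonneg: "admpath m \<Longrightarrow> 0 \<le> a \<Longrightarrow> 0 \<le> integral {a..b} (fl y G m)"
  by (intro integral_nonneg fl_integrable) (auto simp: less_imp_le fl_pos)

lemma J_split:
  assumes m: "admpath m" and G: "0 \<le> G" and s: "0 \<le> s"
  shows "J y G m = integral {0..s} (fl y G m)
      + fl y G m s * J (y + m s - g * s) (max 0 (G + m s - s)) (\<lambda>t. m (s + t) - m s)"
    (is "_ = ?I + ?f * ?J")
proof -
  note [measurable] = fl_borel[OF m] fl_borel[OF admpath_shift[OF m]]
  have "ennreal (J y G m) = (\<integral>\<^sup>+ t. ennreal (fl y G m t) * indicator {0..s} t
      + ennreal (fl y G m t) * indicator {0..} t * indicator {s<..} t \<partial>lborel)"
    unfolding nn_J(1)[OF m G, symmetric] by (intro nn_integral_cong) (use s in \<open>auto simp: indicator_def\<close>)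
  also have "\<dots> = (\<integral>\<^sup>+ t. ennreal (fl y G m t) * indicator {0..s} t \<partial>lborel)
      + (\<integral>\<^sup>+ t. ennreal (fl y G m t) * indicator {0..} t * indicator {s<..} t \<partial>lborel)"
  proof (rule nn_integral_add)
    have "(\<lambda>t. ennreal (fl y G m t) * indicator {0..} t * indicator {0..s} t) \<in> borel_measurable lborel" by measurable
    moreover have "(\<lambda>t. ennreal (fl y G m t) * indicator {0..} t * indicator {0..s} t)
        = (\<lambda>t. ennreal (fl y G m t) * indicator {0..s} t)" by (auto simp: indicator_def)
    ultimately show "(\<lambda>t. ennreal (fl y G m t) * indicator {0..s} t) \<in> borel_measurable lborel" by simp
  qed measurable
  also have "(\<integral>\<^sup>+ t. ennreal (fl y G m t) * indicator {0..} t * indicator {s<..} t \<partial>lborel)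
      = (\<integral>\<^sup>+ t. ennreal (fl y G m (s + t)) * indicator {0..} (s + t) * indicator {s<..} (s + t) \<partial>lborel)"
    using nn_integral_real_affine[of "\<lambda>t. ennreal (fl y G m t) * indicator {0..} t * indicator {s<..} t" 1 s] by simp
  also have "\<dots> = (\<integral>\<^sup>+ t. ennreal ?f * (ennreal (fl (y + m s - g * s) (max 0 (G + m s - s)) (\<lambda>t. m (s + t) - m s) t)
      * indicator {0..} t) \<partial>lborel)"
  proof (rule nn_integral_cong_AE)
    show "AE t in lborel. ennreal (fl y G m (s + t)) * indicator {0..} (s + t) * indicator {s<..} (s + t)
      = ennreal ?f * (ennreal (fl (y + m s - g * s) (max 0 (G + m s - s)) (\<lambda>t. m (s + t) - m s) t) * indicator {0..} t)"
      using AE_lborel_singleton[of 0]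
      by eventually_elim (use s fl_add[OF m G s] in \<open>auto simp: indicator_def ennreal_mult less_imp_le fl_pos\<close>)
  qed
  also have "\<dots> = ennreal ?f * ennreal ?J"
    using admpath_shift[OF m, of s] by (subst nn_integral_cmult) (auto simp: nn_J fl_borel)
  also have "(\<integral>\<^sup>+ t. ennreal (fl y G m t) * indicator {0..s} t \<partial>lborel) = ennreal ?I"
    by (rule nn_fl_Icc) (use m in auto)
  also have "ennreal ?I + ennreal ?f * ennreal ?J = ennreal (?I + ?f * ?J)"
    using fl_pos[of y G m s] nn_J(3)[OF admpath_shift[OF m], of "max 0 (G + m s - s)"] integral_fl_nonneg[OF m, of 0]
    by (simp add: ennreal_mult ennreal_plus less_imp_le)
  finally show ?thesis
    using fl_pos[of y G m s] nn_J(3)[OF admpath_shift[OF m], of "max 0 (G + m s - s)"] integral_fl_nonneg[OF m, of 0]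
      nn_J(3)[OF m G] by (subst (asm) ennreal_inj) (auto intro!: add_nonneg_nonneg mult_nonneg_nonneg simp: less_imp_le)
qed

lemma J_mono:
  assumes "admpath m" "admpath n" "0 \<le> G" "0 \<le> G'" "0 \<le> K"
    and "\<And>t. 0 \<le> t \<Longrightarrow> fl y G m t \<le> K * fl z G' n t"
  shows "J y G m \<le> K * J z G' n"
proof -
  have "ennreal (J y G m) \<le> (\<integral>\<^sup>+ t. ennreal K * (ennreal (fl z G' n t) * indicator {0..} t) \<partial>lborel)"
    unfolding nn_J(1)[OF assms(1,3), symmetric]
    by (intro nn_integral_mono) (use assms(5,6) in \<open>auto simp: indicator_def ennreal_mult[symmetric] less_imp_le fl_pos ennreal_leI\<close>)
  also have "\<dots> = ennreal (K * J z G' n)"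
    using assms by (subst nn_integral_cmult) (auto simp: nn_J fl_borel ennreal_mult)
  finally show ?thesis using assms nn_J(3)[OF assms(2,4)] by (subst (asm) ennreal_le_iff) auto
qed

lemma J_cong:
  assumes "\<And>t. 0 \<le> t \<Longrightarrow> m t = n t" shows "J y G m = J y G n"
proof -
  have "fl y G m t = fl y G n t" if "0 \<le> t" for t
    using H_cong[of t m n y] assms that by (simp add: fl_def)
  then show ?thesis unfolding J_def by (intro arg_cong[where f = enn2real] nn_integral_cong) (auto simp: indicator_def)
qed

text \<open>By \<open>fl_le\<close> the tail beyond \<open>T\<close> is worth at most
  \<open>exp (- de * T) / de\<close>, which vanishes.\<close>

lemma J_le_of_partial:
  assumes m: "admpath m" "0 \<le> G" and K: "\<And>T. 0 \<le> T \<Longrightarrow> integral {0..T} (fl y G m) \<le> K"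
  shows "J y G m \<le> K"
proof -
  have K0: "0 \<le> K" using K[of 0] by simp
  have sp: "J y G m \<le> K + exp (- de * T) * (1 / de)" if "0 \<le> T" for T
  proof -
    let ?J = "J (y + m T - g * T) (max 0 (G + m T - T)) (\<lambda>t. m (T + t) - m T)"
    have "fl y G m T * ?J \<le> exp (- de * T) * (1 / de)"
      using fl_le[OF m that] nn_J(2,3)[OF admpath_shift[OF m(1)]] fl_pos[of y G m T] by (intro mult_mono) auto
    then show ?thesis using J_split[OF m that, of y] K[OF that] by linarith
  qed
  have lim: "((\<lambda>T. K + exp (- de * T) * (1 / de)) \<longlongrightarrow> K + 0 * (1 / de)) at_top"
  proof (intro tendsto_intros)
    show "((\<lambda>T. exp (- de * T)) \<longlongrightarrow> 0) at_top"
      using de_pos by real_asymp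
  qed
  have "J y G m \<le> K + 0 * (1 / de)"
    by (rule tendsto_lowerbound[OF lim]) (use sp in \<open>auto intro!: eventually_at_top_linorderI[of 0]\<close>)
  then show ?thesis by simp
qed

end

text \<open>With \<open>n\<close> equal steps the quadratic errors add up to
  \<open>K * (b - a)^2 / n\<close>, which vanishes as \<open>n\<close> grows.\<close>

lemma antitone_of_quadratic_step:
  fixes f :: "real \<Rightarrow> real"
  assumes st: "\<And>x \<epsilon>. \<lbrakk>a \<le> x; 0 < \<epsilon>\<rbrakk> \<Longrightarrow> f (x + \<epsilon>) \<le> f x + K * \<epsilon>\<^sup>2" and ab: "a \<le> b"
  shows "f b \<le> f a"
proof (cases "a = b")
  case False
  have "f b \<le> f a + K * (b - a)\<^sup>2 / real (Suc n)" for n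
  proof -
    define h where "h = (b - a) / real (Suc n)"
    have h: "0 < h" using ab False by (simp add: h_def)
    have "f (a + real k * h) \<le> f a + real k * (K * h\<^sup>2)" for k
    proof (induction k)
      case (Suc k)
      have "f (a + real k * h + h) \<le> f (a + real k * h) + K * h\<^sup>2"
        using mult_nonneg_nonneg[of "real k" h] h by (intro st) auto
      with Suc show ?case by (simp add: algebra_simps)
    qed simp
    from this[of "Suc n"] have "f b \<le> f a + real (Suc n) * (K * h\<^sup>2)"
      by (simp add: h_def del: of_nat_Suc)
    also have "real (Suc n) * (K * h\<^sup>2) = K * (b - a)\<^sup>2 / real (Suc n)"
      by (simp add: h_def power2_eq_square del: of_nat_Suc)
    finally show ?thesis .
  qed
  moreover have "(\<lambda>n. f a + K * (b - a)\<^sup>2 / real (Suc n)) \<longlonglongrightarrow> f a + 0"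
    by (intro tendsto_add tendsto_const) (rule LIMSEQ_Suc[OF lim_const_over_n])
  ultimately show ?thesis by (intro LIMSEQ_le_const) auto
qed simp

context race_env
begin

lemma Lam_conv: 
  assumes "x \<le> x'" "0 \<le> h" shows "Lam (x + h) - Lam x \<le> Lam (x' + h) - Lam x'"
proof -
  have i: "((\<lambda>u. lam (y + 1 * u)) has_integral (Lam (y + 1 * h) - Lam (y + 1 * 0)) / 1) {0..h}" for y
    by (rule lam_affine_integral) (use assms in auto)
  show ?thesis using has_integral_le[OF i[of x] i[of x']] assms(1) lam_mono by auto
qed

text \<open>\<open>nb y\<close> coasts until the lead \<open>y\<close> is used up and then moves at
  speed \<open>g\<close>, which keeps the lead at 0; \<open>mt th y\<close> races up to date
  \<open>th\<close> first. \<open>C\<close> and \<open>V\<close> are the values of these two plans,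
  \<open>R\<close> is the value of racing forever and \<open>e\<close> the flow along a
  race.\<close>

definition "nb y t = max 0 (g * t - y)"
definition "C y G = J y G (nb y)"
definition "R y = J y 0 (\<lambda>t. t)"
definition "e y t = exp (- de * t - (Lam (y + (1 - g) * t) - Lam y) / (1 - g))"
definition "mt th y t = max (min t th) (g * t - y)"
definition "V th y G = J y G (mt th y)"

lemma admpath_g: "admpath (\<lambda>t. g * t)"
  using admpath_lin[of g] g_pos g_less by simp

lemma admpathI:
  assumes "m 0 = 0" "\<And>s t. s \<le> t \<Longrightarrow> m s \<le> m t" "\<And>s t. s \<le> t \<Longrightarrow> m t \<le> m s + (t - s)"
  shows "admpath m"
  unfolding admpath_def using assms by (auto simp: algebra_simps)

lemma g_speed: "s \<le> t \<Longrightarrow> g * s - y \<le> g * t - y" "s \<le> t \<Longrightarrow> g * t - y \<le> g * s - y + (t - s)"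
  using admpathD(2,3)[OF admpath_g, of s t] by auto

lemma admpath_mt: "0 \<le> th \<Longrightarrow> 0 \<le> y \<Longrightarrow> admpath (mt th y)"
proof (rule admpathI)
  fix s t :: real assume "s \<le> t"
  then show "mt th y s \<le> mt th y t" "mt th y t \<le> mt th y s + (t - s)"
    using g_speed[of s t y] unfolding mt_def by linarith+
qed (simp add: mt_def)

lemma admpath_nb: "0 \<le> y \<Longrightarrow> admpath (nb y)"
proof (rule admpathI)
  fix s t :: real assume "s \<le> t"
  then show "nb y s \<le> nb y t" "nb y t \<le> nb y s + (t - s)"
    using g_speed[of s t y] unfolding nb_def by linarith+
qed (simp add: nb_def)

lemma mt_0: "0 \<le> t \<Longrightarrow> mt 0 y t = nb y t"
  by (simp add: mt_def nb_def)

lemma V_0: "V 0 y G = C y G"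
  unfolding V_def C_def by (rule J_cong) (simp add: mt_0)

lemma mt_race: "0 \<le> y \<Longrightarrow> 0 \<le> t \<Longrightarrow> t \<le> th \<Longrightarrow> mt th y t = t"
  using mult_right_mono[of g 1 t] g_less by (auto simp: mt_def)

lemma H_race:
  assumes "\<And>u. 0 \<le> u \<Longrightarrow> u \<le> t \<Longrightarrow> m u = u" "0 \<le> t"
  shows "H y m t = (Lam (y + (1 - g) * t) - Lam y) / (1 - g)"
proof -
  have "H y m t = integral {0..t} (\<lambda>u. lam (y + (1 - g) * u))"
    unfolding H_def by (intro integral_cong) (use assms in \<open>auto simp: algebra_simps\<close>)
  also have "\<dots> = (Lam (y + (1 - g) * t) - Lam (y + (1 - g) * 0)) / (1 - g)"
    using lam_affine_integral[OF assms(2), of "1 - g" y] g_less by (intro integral_unique) auto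
  finally show ?thesis by simp
qed

lemma H_nb:
  assumes "0 \<le> t" shows "H y (nb y) t = (Lam y - Lam (y - g * t)) / g"
proof -
  have "lam (y + nb y u - g * u) = lam (y + (- g) * u)" for u
    using lam_nonpos[of "y - g * u"] lam_nonpos[of 0] by (auto simp: nb_def max_def)
  then have "H y (nb y) t = integral {0..t} (\<lambda>u. lam (y + (- g) * u))" by (simp add: H_def)
  also have "\<dots> = (Lam (y + (- g) * t) - Lam (y + (- g) * 0)) / (- g)"
    using lam_affine_integral[OF assms, of "- g" y] g_pos by (intro integral_unique) auto
  finally show ?thesis using g_pos by (simp add: field_simps)
qed

lemma fl_nb: "0 \<le> t \<Longrightarrow> fl y G (nb y) t
    = exp (- r * t - (Lam y - Lam (y - g * t)) / g + al * nb y t - be * min t (G + nb y t))"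
  by (simp add: fl_def H_nb)

lemma fl_race:
  assumes "\<And>u. 0 \<le> u \<Longrightarrow> u \<le> t \<Longrightarrow> m u = u" "0 \<le> t" "0 \<le> G"
  shows "fl y G m t = e y t"
proof -
  have "m t = t" "min t (G + t) = t" using assms by auto
  then show ?thesis using H_race[OF assms(1,2)] by (simp add: fl_def e_def de_def algebra_simps)
qed

lemma e_pos: "0 < e y t" and e_0: "e y 0 = 1" by (simp_all add: e_def)

lemma e_le: "0 \<le> t \<Longrightarrow> e y t \<le> exp (- de * t)"
  using Lam_mono[of y "y + (1 - g) * t"] g_less by (simp add: e_def)

lemma e_cont: "continuous_on A (e y)"
  unfolding e_def[abs_def] using g_less by (intro continuous_intros) auto

lemma e_integrable: "e y integrable_on {a..b}"
  by (intro integrable_continuous_interval e_cont)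

lemma R_G: "0 \<le> G \<Longrightarrow> J y G (\<lambda>t. t) = R y"
proof -
  assume G: "0 \<le> G"
  have "fl y G (\<lambda>t. t) t = fl y 0 (\<lambda>t. t) t" if "0 \<le> t" for t
    using that G by (simp add: fl_race)
  then show ?thesis unfolding R_def J_def
    by (intro arg_cong[where f = enn2real] nn_integral_cong) (auto simp: indicator_def)
qed

lemma race_integral:
  assumes "\<And>u. 0 \<le> u \<Longrightarrow> u \<le> s \<Longrightarrow> m u = u" "0 \<le> G"
  shows "integral {0..s} (fl y G m) = integral {0..s} (e y)"
  by (intro integral_cong) (use assms fl_race in auto)

lemma R_rec:
  assumes s: "0 \<le> s" shows "R y = integral {0..s} (e y) + e y s * R (y + (1 - g) * s)"
  using J_split[OF admpath_id order.refl s, of y] race_integral[of s "\<lambda>t. t" 0 y] s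
  by (simp add: R_def fl_race algebra_simps)

lemma V_rec:
  assumes y: "0 \<le> y" and G: "0 \<le> G" and s: "0 \<le> s" "s \<le> th"
  shows "V th y G = integral {0..s} (e y) + e y s * V (th - s) (y + (1 - g) * s) G"
proof -
  have ms: "mt th y u = u" if "0 \<le> u" "u \<le> s" for u using mt_race[OF y that(1)] that s by auto
  have "V th y G = integral {0..s} (fl y G (mt th y)) + fl y G (mt th y) s
      * J (y + s - g * s) (max 0 (G + s - s)) (\<lambda>t. mt th y (s + t) - s)"
    unfolding V_def using J_split[OF admpath_mt[of th y] G s(1)] ms s y by simp
  moreover have "J (y + s - g * s) (max 0 (G + s - s)) (\<lambda>t. mt th y (s + t) - s) = V (th - s) (y + (1 - g) * s) G"
    unfolding V_def using G by (auto simp: algebra_simps mt_def intro!: J_cong arg_cong2[where f = J])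
  ultimately show ?thesis using race_integral[OF ms G] fl_race[OF ms s(1) G] by simp
qed

lemma V_eq: "0 \<le> y \<Longrightarrow> 0 \<le> G \<Longrightarrow> 0 \<le> th \<Longrightarrow> V th y G = integral {0..th} (e y) + e y th * C (y + (1 - g) * th) G"
  using V_rec[of y G th th] by (simp add: V_0)

lemma V_R: "0 \<le> y \<Longrightarrow> 0 \<le> G \<Longrightarrow> 0 \<le> th \<Longrightarrow>
    V th y G = R y + e y th * (C (y + (1 - g) * th) G - R (y + (1 - g) * th))"
  using V_eq[of y G th] R_rec[of th y] by (simp add: algebra_simps)

lemma nb_state: "0 \<le> y \<Longrightarrow> y + nb y s - g * s = max 0 (y - g * s)"
  by (auto simp: nb_def max_def)

lemma nb_shift: "0 \<le> t \<Longrightarrow> nb y (s + t) - nb y s = nb (max 0 (y - g * s)) t"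
proof -
  assume "0 \<le> t"
  then have "0 \<le> g * t" using g_pos by simp
  then show ?thesis unfolding nb_def distrib_left by (simp add: max_def)
qed

lemma J_nb_shift:
  assumes "0 \<le> y" "0 \<le> G" "0 \<le> s"
  shows "C y G = integral {0..s} (fl y G (nb y))
      + fl y G (nb y) s * C (max 0 (y - g * s)) (max 0 (G + nb y s - s))"
proof -
  have "J (max 0 (y - g * s)) F (\<lambda>t. nb y (s + t) - nb y s) = C (max 0 (y - g * s)) F" for F
    unfolding C_def by (rule J_cong) (simp add: nb_shift)
  then show ?thesis using J_split[OF admpath_nb[OF assms(1)] assms(2,3), of y]
    by (simp add: nb_state assms C_def)
qed

lemmas C_rec = J_nb_shift

lemma C_nonneg: "0 \<le> y \<Longrightarrow> 0 \<le> G \<Longrightarrow> 0 \<le> C y G" and C_le: "0 \<le> y \<Longrightarrow> 0 \<le> G \<Longrightarrow> C y G \<le> 1 / de"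
  unfolding C_def using nn_J admpath_nb by auto

lemma R_nonneg: "0 \<le> R y" and R_le: "R y \<le> 1 / de"
  unfolding R_def using nn_J[OF admpath_id] by auto

lemma V_nonneg: "0 \<le> th \<Longrightarrow> 0 \<le> y \<Longrightarrow> 0 \<le> G \<Longrightarrow> 0 \<le> V th y G"
  and V_le: "0 \<le> th \<Longrightarrow> 0 \<le> y \<Longrightarrow> 0 \<le> G \<Longrightarrow> V th y G \<le> 1 / de"
  unfolding V_def using nn_J admpath_mt by auto

text \<open>A larger lead exposes the flow to more hazard and delays the pacing phase, and the
  capability forgone is worth at least \<open>al - be\<close> per unit even where the laggard would
  copy it. A larger gap leaves the laggard more room to advance.\<close>

lemma C_antimono:
  assumes "0 \<le> y" "y \<le> y'" "0 \<le> G" "G \<le> G'" shows "C y' G' \<le> C y G"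
proof -
  have "J y' G' (nb y') \<le> 1 * J y G (nb y)"
  proof (rule J_mono)
    fix t :: real assume t: "0 \<le> t"
    have "H y (nb y) t \<le> H y' (nb y') t"
      using assms by (intro H_mono_path admpath_nb lam_mono) (auto simp: nb_def max_def)
    moreover have "al * nb y' t - be * min t (G' + nb y' t) \<le> al * nb y t - be * min t (G + nb y t)"
    proof -
      have n: "nb y' t \<le> nb y t" using assms by (auto simp: nb_def)
      then have "min t (G + nb y t) \<le> min t (G' + nb y' t) + (nb y t - nb y' t)" using assms by auto
      then have "be * min t (G + nb y t) \<le> be * min t (G' + nb y' t) + be * (nb y t - nb y' t)"
        using be_pos mult_left_mono[of _ _ be] by (fastforce simp: algebra_simps)
      moreover have "be * (nb y t - nb y' t) \<le> al * (nb y t - nb y' t)"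
        using n be_less by (intro mult_right_mono) auto
      ultimately show ?thesis by (simp add: algebra_simps)
    qed
    ultimately show "fl y' G' (nb y') t \<le> 1 * fl y G (nb y) t" by (simp add: fl_def)
  qed (use assms admpath_nb in auto)
  then show ?thesis by (simp add: C_def)
qed

text \<open>The flows themselves are comparable at every date: their hazard exposures differ by at
  most the first term, the leader's progress by the distance of the leads and the laggard's by the
  distance of the gaps. Continuity of \<open>C\<close> is drawn from this bound.\<close>

lemma C_log_Lipschitz:
  assumes "0 \<le> y" "0 \<le> y'" "0 \<le> G" "0 \<le> G'"
  shows "exp (- (\<bar>Lam y' - Lam y\<bar> / g + al * \<bar>y' - y\<bar> + be * \<bar>G' - G\<bar>)) * C y G \<le> C y' G'" (is "?K * _ \<le> _")
proof -
  have *: "exp (- ((Lam z - Lam y) / g + al * (z - y) + be * (F - G))) * C y G \<le> C z F"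
    if z: "y \<le> z" "G \<le> F" for z F
  proof -
    let ?K = "exp ((Lam z - Lam y) / g + al * (z - y) + be * (F - G))"
    have "J y G (nb y) \<le> ?K * J z F (nb z)"
    proof (rule J_mono)
      fix t :: real assume t: "0 \<le> t"
      have "H z (nb z) t - H y (nb y) t \<le> (Lam z - Lam y) / g"
        using H_nb[OF t] Lam_mono[of "y - g * t" "z - g * t"] z g_pos
        by (simp add: diff_divide_distrib[symmetric] divide_right_mono)
      moreover have "nb y t - nb z t \<le> z - y" using z by (auto simp: nb_def max_def)
      then have "al * (nb y t - nb z t) \<le> al * (z - y)" using al_pos by (intro mult_left_mono) auto
      moreover have "min t (F + nb z t) \<le> min t (G + nb y t) + (F - G)" using z by (auto simp: nb_def)
      then have "be * min t (F + nb z t) \<le> be * (min t (G + nb y t) + (F - G))" using be_pos by (intro mult_left_mono) auto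
      ultimately show "fl y G (nb y) t \<le> ?K * fl z F (nb z) t"
        unfolding fl_def exp_add[symmetric] exp_le_cancel_iff by (simp add: algebra_simps)
    qed (use assms z admpath_nb in auto)
    then have "exp (- ((Lam z - Lam y) / g + al * (z - y) + be * (F - G))) * J y G (nb y)
        \<le> exp (- ((Lam z - Lam y) / g + al * (z - y) + be * (F - G))) * (?K * J z F (nb z))"
      by (intro mult_left_mono) auto
    then show ?thesis by (simp add: C_def mult.assoc[symmetric] exp_add[symmetric] flip: exp_minus)
  qed
  \<comment> \<open>The estimate is proved for moves that increase both arguments. A general move
    goes up to the componentwise maximum and then down, which can only raise
    \<open>C\<close>.\<close>
  let ?z = "max y y'" and ?F = "max G G'"
  have "(Lam ?z - Lam y) / g \<le> \<bar>Lam y' - Lam y\<bar> / g"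
    using g_pos by (intro divide_right_mono) (auto simp: max_def)
  moreover have "al * (?z - y) \<le> al * \<bar>y' - y\<bar>" "be * (?F - G) \<le> be * \<bar>G' - G\<bar>"
    using al_pos be_pos by (intro mult_left_mono; simp)+
  ultimately have "?K \<le> exp (- ((Lam ?z - Lam y) / g + al * (?z - y) + be * (?F - G)))" by simp
  then have "?K * C y G \<le> exp (- ((Lam ?z - Lam y) / g + al * (?z - y) + be * (?F - G))) * C y G"
    using C_nonneg assms by (intro mult_right_mono) auto
  also have "\<dots> \<le> C ?z ?F" by (rule *) auto
  also have "\<dots> \<le> C y' G'" using assms by (intro C_antimono) auto
  finally show ?thesis .
qed

lemma C_pos: "0 \<le> y \<Longrightarrow> 0 \<le> G \<Longrightarrow> 0 < C y G"
proof -
  assume y: "0 \<le> y" "0 \<le> G"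
  have "0 < integral {0..1} (fl y G (nb y))"
  proof -
    have "0 \<noteq> integral {0..1} (fl y G (nb y))"
    proof
      assume "0 = integral {0..1} (fl y G (nb y))"
      then have "fl y G (nb y) 0 = 0"
        using integral_eq_0_iff[of 0 1 "fl y G (nb y)"] fl_cont'[OF admpath_nb[OF y(1)]] less_imp_le[OF fl_pos] by simp
      then show False using fl_pos[of y G "nb y" 0] by simp
    qed
    then show ?thesis using integral_fl_nonneg[OF admpath_nb[OF y(1)], of 0 1 y G] by linarith
  qed
  moreover have "0 \<le> fl y G (nb y) 1 * C (max 0 (y - g * 1)) (max 0 (G + nb y 1 - 1))"
    using fl_pos[of y G "nb y" 1] C_nonneg by (intro mult_nonneg_nonneg) auto
  ultimately show ?thesis using C_rec[OF y, of 1] by linarith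
qed

lemma R_antimono: "y \<le> y' \<Longrightarrow> R y' \<le> R y"
proof -
  assume y: "y \<le> y'"
  have "J y' 0 (\<lambda>t. t) \<le> 1 * J y 0 (\<lambda>t. t)"
  proof (rule J_mono)
    fix t :: real assume "0 \<le> t"
    have "H y (\<lambda>t. t) t \<le> H y' (\<lambda>t. t) t" using y by (intro H_mono_path admpath_id lam_mono) auto
    then show "fl y' 0 (\<lambda>t. t) t \<le> 1 * fl y 0 (\<lambda>t. t) t" by (simp add: fl_def)
  qed (auto simp: admpath_id)
  then show ?thesis by (simp add: R_def)
qed

text \<open>A race of length \<open>th\<close> raises the path by at most \<open>th\<close>.
  Consequently a given relative gain over coasting requires a race of a certain minimal
  length.\<close>

lemma V_le_C: "0 \<le> th \<Longrightarrow> 0 \<le> y \<Longrightarrow> 0 \<le> G \<Longrightarrow> V th y G \<le> exp (al * th) * C y G"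
proof -
  assume a: "0 \<le> th" "0 \<le> y" "0 \<le> G"
  show ?thesis unfolding V_def C_def
  proof (rule J_mono)
    fix t :: real assume t: "0 \<le> t"
    have m: "nb y t \<le> mt th y t" "mt th y t \<le> nb y t + th" using t a by (auto simp: mt_def nb_def)
    have "H y (nb y) t \<le> H y (mt th y) t"
      using a by (intro H_mono_path admpath_nb admpath_mt lam_mono) (auto simp: mt_def nb_def)
    moreover have "al * mt th y t \<le> al * (nb y t + th)" using m al_pos by (intro mult_left_mono) auto
    moreover have "be * min t (G + nb y t) \<le> be * min t (G + mt th y t)" using m be_pos by (intro mult_left_mono) auto
    ultimately show "fl y G (mt th y) t \<le> exp (al * th) * fl y G (nb y) t"
      unfolding fl_def exp_add[symmetric] exp_le_cancel_iff by (simp add: algebra_simps)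
  qed (use a admpath_nb admpath_mt in auto)
qed

section \<open>Monotonicity of the gain from racing in the gap\<close>

text \<open>The date at which a racing laggard catches up with a leader that coasts from lead \<open>y\<close> and then paces.\<close>

definition "tau y G = max G ((G - y) / (1 - g))"

lemma tau_facts:
  assumes "0 \<le> y" "0 \<le> G"
  shows "0 \<le> tau y G" "G + nb y (tau y G) - tau y G = 0" 
    "\<And>t. 0 \<le> t \<Longrightarrow> t \<le> tau y G \<Longrightarrow> t \<le> G + nb y t"
    "max 0 (y - g * tau y G) = y - G + (1 - g) * tau y G"
    "y - max 0 (y - g * tau y G) \<le> g * G"
proof -
  show t0: "0 \<le> tau y G" using assms by (simp add: tau_def)
  show 1: "G + nb y (tau y G) - tau y G = 0"
    using g_less assms by (auto simp: tau_def nb_def max_def field_simps)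
  then show "max 0 (y - g * tau y G) = y - G + (1 - g) * tau y G"
    using nb_state[OF assms(1), of "tau y G"] by (simp add: algebra_simps)
  show "t \<le> G + nb y t" if "0 \<le> t" "t \<le> tau y G" for t
    using that g_less assms by (auto simp: tau_def nb_def max_def field_simps split: if_splits)
  show "y - max 0 (y - g * tau y G) \<le> g * G"
    using g_less g_pos assms by (auto simp: tau_def max_def field_simps split: if_splits)
qed

text \<open>An additional gap \<open>\<epsilon>\<close> is felt only after date
  \<open>tau y G\<close>, when the laggard would otherwise be level. Up to then the flows agree, and
  what remains is the effect of the gap \<open>\<epsilon>\<close> at a tie.\<close>

lemma C_gap_step:
  assumes y: "0 \<le> y" and G: "0 \<le> G" and ep: "0 \<le> \<epsilon>"
  defines "x \<equiv> max 0 (y - g * tau y G)"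
  shows "C y G - C y (G + \<epsilon>) = fl y G (nb y) (tau y G) * (C x 0 - C x \<epsilon>)"
proof -
  note t = tau_facts[OF y G]
  have eq: "fl y (G + \<epsilon>) (nb y) t = fl y G (nb y) t" if "0 \<le> t" "t \<le> tau y G" for t
    using t(3)[OF that] ep by (simp add: fl_def)
  then have "integral {0..tau y G} (fl y (G + \<epsilon>) (nb y)) = integral {0..tau y G} (fl y G (nb y))"
    by (intro integral_cong) auto
  moreover have E: "G + \<epsilon> + nb y (tau y G) - tau y G = \<epsilon>" using t(2) by linarith
  ultimately show ?thesis unfolding x_def
    using C_rec[OF y G t(1)] C_rec[of y "G + \<epsilon>", OF y _ t(1)] eq[OF t(1) order.refl] t(2) G ep
    unfolding E by (simp add: right_diff_distrib)
qed

text \<open>The gap \<open>\<epsilon>\<close> is closed by date \<open>\<epsilon> / (1 - g)\<close>,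
  and from then on the flow is smaller by exactly the factor \<open>exp (- be * \<epsilon>)\<close>.
  The short initial phase contributes only an error of second order.\<close>

lemma C_small_gap:
  assumes x: "0 \<le> x" and ep: "0 \<le> \<epsilon>"
  shows "C x 0 - C x \<epsilon> \<le> (1 - exp (- be * \<epsilon>)) * C x 0"
    and "(1 - exp (- be * \<epsilon>)) * (C x 0 - \<epsilon> / (1 - g)) \<le> C x 0 - C x \<epsilon>"
proof -
  show "C x 0 - C x \<epsilon> \<le> (1 - exp (- be * \<epsilon>)) * C x 0"
    using C_log_Lipschitz[of x x 0 \<epsilon>] assms by (simp add: algebra_simps)
  let ?s = "\<epsilon> / (1 - g)"
  have s: "0 \<le> ?s" "\<epsilon> \<le> ?s" using ep g_less g_pos by (auto simp: field_simps)
  have nbs: "\<epsilon> + nb x ?s \<le> ?s"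
  proof -
    have "\<epsilon> = (1 - g) * ?s" using g_less by simp
    moreover have "nb x ?s \<le> g * ?s" using x s g_pos mult_nonneg_nonneg[of g ?s] by (auto simp: nb_def)
    moreover have "(1 - g) * ?s + g * ?s = ?s" by (simp only: distrib_right[symmetric]) simp
    ultimately show ?thesis by linarith
  qed
  let ?a = "integral {0..?s} (fl x 0 (nb x))"
  have f: "fl x \<epsilon> (nb x) ?s = exp (- be * \<epsilon>) * fl x 0 (nb x) ?s"
  proof -
    have "min ?s (\<epsilon> + nb x ?s) = \<epsilon> + nb x ?s" "min ?s (0 + nb x ?s) = nb x ?s" using nbs ep by linarith+
    then show ?thesis unfolding fl_def exp_add[symmetric] by (simp add: algebra_simps)
  qed
  have a1: "integral {0..?s} (fl x \<epsilon> (nb x)) \<le> ?a"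
  proof (intro integral_le fl_integrable admpath_nb x order.refl)
    fix t show "fl x \<epsilon> (nb x) t \<le> fl x 0 (nb x) t" 
      using be_pos ep by (auto simp: fl_def intro!: mult_left_mono)
  qed
  have a2: "?a \<le> ?s"
  proof -
    have "?a \<le> integral {0..?s} (\<lambda>_. 1)"
    proof (intro integral_le fl_integrable admpath_nb x order.refl)
      fix t assume "t \<in> {0..?s}"
      then have "exp (- de * t) \<le> 1" "fl x 0 (nb x) t \<le> exp (- de * t)"
        using de_pos fl_le[OF admpath_nb[OF x]] by auto
      then show "fl x 0 (nb x) t \<le> 1" by linarith
    qed auto
    then show ?thesis using s by simp
  qed
  have "C x \<epsilon> = integral {0..?s} (fl x \<epsilon> (nb x)) + exp (- be * \<epsilon>) * (C x 0 - ?a)"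
  proof -
    have "max 0 (\<epsilon> + nb x ?s - ?s) = 0" "max 0 (0 + nb x ?s - ?s) = 0" using nbs ep by linarith+
    then show ?thesis using C_rec[OF x ep s(1)] C_rec[OF x order.refl s(1)] unfolding f by simp
  qed
  then have "C x \<epsilon> \<le> ?a + exp (- be * \<epsilon>) * (C x 0 - ?a)" using a1 by simp
  moreover have "(1 - exp (- be * \<epsilon>)) * ?a \<le> (1 - exp (- be * \<epsilon>)) * ?s"
    using a2 be_pos ep by (intro mult_left_mono) auto
  ultimately show "(1 - exp (- be * \<epsilon>)) * (C x 0 - ?s) \<le> C x 0 - C x \<epsilon>" by (simp add: algebra_simps)
qed

text \<open>This compares the marginal costs of the gap with and without a preliminary race. The
  race postpones the tie, leaves a larger lead at it and, as \<open>Lam\<close> is convex, leads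
  through more hazard while coasting, so less tied value is carried to the tie.\<close>

lemma tie_flow_antimono:
  assumes y: "0 \<le> y" and G: "0 \<le> G" and th: "0 \<le> th"
  defines "d \<equiv> y + (1 - g) * th"
  shows "e y th * (fl d G (nb d) (tau d G) * C (max 0 (d - g * tau d G)) 0)
      \<le> fl y G (nb y) (tau y G) * C (max 0 (y - g * tau y G)) 0"
proof -
  have d: "y \<le> d" "0 \<le> d" using y th g_less by (auto simp: d_def)
  note ty = tau_facts[OF y G] and td = tau_facts[OF d(2) G]
  have th_tau: "tau y G \<le> th + tau d G"
  proof -
    have "(G - d) / (1 - g) = (G - y) / (1 - g) - th" using g_less by (simp add: d_def field_simps)
    then show ?thesis using th by (auto simp: tau_def)
  qed
  let ?xy = "max 0 (y - g * tau y G)" and ?xd = "max 0 (d - g * tau d G)"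
  have x: "?xy \<le> ?xd"
    unfolding ty(4) td(4) using mult_left_mono[OF th_tau, of "1 - g"] g_less by (simp add: d_def algebra_simps)
  have len: "y - ?xy \<le> d - ?xd"
  proof (cases "?xd = 0")
    case False
    then have "tau d G = G" using td(4) g_less g_pos
      by (auto simp: tau_def max_def field_simps split: if_splits)
    then have "d - ?xd = g * G" using False by (simp add: max_def split: if_splits)
    then show ?thesis using ty(5) by simp
  qed (use d in auto)
  have "Lam (?xy + (y - ?xy)) - Lam ?xy \<le> Lam ((d - (y - ?xy)) + (y - ?xy)) - Lam (d - (y - ?xy))"
    using d y g_pos ty(1) by (intro Lam_conv) auto
  moreover have "Lam ?xd \<le> Lam (d - (y - ?xy))" using len by (intro Lam_mono) linarith
  ultimately have L: "Lam y - Lam ?xy \<le> Lam d - Lam ?xd" by simp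
  have Lx: "Lam (max 0 z) = Lam z" for z by (auto simp: max_def Lam_nonpos)
  \<comment> \<open>At the tie the leader has gained \<open>tau z G - G\<close>, so the flow depends
    on the plan only through the tie date and the hazard met while coasting.\<close>
  have fe: "fl z G (nb z) (tau z G) = exp (- de * tau z G - al * G - (Lam z - Lam (max 0 (z - g * tau z G))) / g)"
    if "0 \<le> z" for z
  proof -
    note tz = tau_facts[OF that G]
    have "min (tau z G) (G + nb z (tau z G)) = tau z G" "nb z (tau z G) = tau z G - G" using tz(2) by auto
    then show ?thesis unfolding fl_nb[OF tz(1)] Lx by (simp add: de_def right_diff_distrib left_diff_distrib distrib_right)
  qed
  have Lyd: "Lam y \<le> Lam d" using d by (intro Lam_mono)
  have "e y th * fl d G (nb d) (tau d G) \<le> fl y G (nb y) (tau y G)"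
  proof -
    have "(Lam y - Lam ?xy) / g \<le> (Lam d - Lam ?xd) / g" using L g_pos by (simp add: divide_right_mono)
    moreover have "de * tau y G \<le> de * th + de * tau d G" 
      using mult_left_mono[OF th_tau, of de] de_pos by (simp add: algebra_simps)
    moreover have "0 \<le> (Lam d - Lam y) / (1 - g)" using Lyd g_less by simp
    ultimately show ?thesis unfolding fe[OF y] fe[OF d(2)] e_def d_def[symmetric] exp_add[symmetric] exp_le_cancel_iff
      by linarith
  qed
  then show ?thesis unfolding mult.assoc[symmetric]
    using C_antimono[OF _ x, of 0 0] C_nonneg[of ?xd 0] fl_pos[of y G "nb y" "tau y G"]
    by (intro mult_mono) auto
qed

text \<open>Up to a quadratic error, a unit of gap costs \<open>be\<close> times the tied value
  discounted to the tie date. By \<open>tie_flow_antimono\<close> this cost is smaller when a race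
  comes first, and \<open>antitone_of_quadratic_step\<close> removes the error.\<close>

lemma gap_difference_antimono:
  assumes y: "0 \<le> y" and th: "0 \<le> th" and G: "0 \<le> G1" "G1 \<le> G2"
  defines "d \<equiv> y + (1 - g) * th"
  shows "C y G2 - e y th * C d G2 \<le> C y G1 - e y th * C d G1"
proof -
  have d: "0 \<le> d" using y th g_less by (simp add: d_def)
  have "C y (F + \<epsilon>) - e y th * C d (F + \<epsilon>) \<le> C y F - e y th * C d F + (be / (1 - g)) * \<epsilon>\<^sup>2"
    if F: "G1 \<le> F" "0 < \<epsilon>" for F \<epsilon>
  proof -
    have F0: "0 \<le> F" "0 \<le> \<epsilon>" using F G by auto
    let ?xy = "max 0 (y - g * tau y F)" and ?xd = "max 0 (d - g * tau d F)"
    let ?fy = "fl y F (nb y) (tau y F)" and ?fd = "fl d F (nb d) (tau d F)" and ?q = "1 - exp (- be * \<epsilon>)"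
    have q: "0 \<le> ?q" "?q \<le> be * \<epsilon>" using be_pos F0 exp_ge_add_one_self[of "- be * \<epsilon>"] by auto
    have fy1: "?fy \<le> 1"
    proof -
      have "exp (- de * tau y F) \<le> 1" using de_pos tau_facts(1)[OF y F0(1)] by simp
      then show ?thesis using fl_le[OF admpath_nb[OF y] F0(1) tau_facts(1)[OF y F0(1)], of y] by linarith
    qed
    have "e y th * (C d F - C d (F + \<epsilon>)) \<le> e y th * (?fd * (?q * C ?xd 0))"
      unfolding C_gap_step[OF d F0] using C_small_gap(1)[of ?xd, OF _ F0(2)] e_pos[of y th] fl_pos[of d F "nb d" "tau d F"]
      by (intro mult_left_mono) auto
    also have "\<dots> = ?q * (e y th * (?fd * C ?xd 0))" by simp
    also have "\<dots> \<le> ?q * (?fy * C ?xy 0)"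
      unfolding d_def using tie_flow_antimono[OF y F0(1) th] q by (intro mult_left_mono)
    also have "\<dots> = ?fy * (?q * (C ?xy 0 - \<epsilon> / (1 - g))) + ?fy * (?q * (\<epsilon> / (1 - g)))" by (simp add: algebra_simps)
    also have "\<dots> \<le> ?fy * (C ?xy 0 - C ?xy \<epsilon>) + 1 * (be * \<epsilon> * (\<epsilon> / (1 - g)))"
      using C_small_gap(2)[of ?xy, OF _ F0(2)] fl_pos[of y F "nb y" "tau y F"] fy1 q F0 g_less
      by (intro add_mono mult_mono mult_left_mono mult_right_mono) auto
    also have "\<dots> = C y F - C y (F + \<epsilon>) + be / (1 - g) * \<epsilon>\<^sup>2"
      unfolding C_gap_step[OF y F0] by (simp add: power2_eq_square)
    finally show ?thesis by (simp add: algebra_simps)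
  qed
  from antitone_of_quadratic_step[of G1 "\<lambda>F. C y F - e y th * C d F", OF this G(2)] show ?thesis .
qed

text \<open>The flow during the race does not depend on the gap, so only the two coasting values
  matter.\<close>

lemma race_gain_mono:
  assumes "0 \<le> y" "0 \<le> th" "0 \<le> G1" "G1 \<le> G2"
  shows "V th y G1 - C y G1 \<le> V th y G2 - C y G2"
  using gap_difference_antimono[OF assms] assms by (simp add: V_eq)


section \<open>Delaying a race\<close>

lemma fl_integral_add:
  assumes m: "admpath m" and "0 \<le> G" "0 \<le> s" "0 \<le> t"
  shows "integral {0..s + t} (fl y G m) = integral {0..s} (fl y G m)
    + fl y G m s * integral {0..t} (fl (y + m s - g * s) (max 0 (G + m s - s)) (\<lambda>t. m (s + t) - m s))"
proof -
  have "integral {0..s + t} (fl y G m) = integral {0..s} (fl y G m) + integral {s..s + t} (fl y G m)"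
    using assms by (intro Henstock_Kurzweil_Integration.integral_combine[symmetric] fl_integrable) auto
  also have "integral {s..s + t} (fl y G m) = integral {0..t} (\<lambda>u. fl y G m (u + s))"
    using integral_shift_real_ivl[of s s "s + t" "fl y G m"] by simp
  also have "\<dots> = integral {0..t} (\<lambda>u. fl y G m s * fl (y + m s - g * s) (max 0 (G + m s - s)) (\<lambda>t. m (s + t) - m s) u)"
    by (intro integral_cong) (use fl_add[OF assms(1-3)] in \<open>auto simp: add.commute\<close>)
  finally show ?thesis by simp
qed

text \<open>The delayed plan: coast for \<open>h\<close>, race for \<open>th\<close>, then coast
  again, with the floor \<open>g * t - y\<close> that keeps the lead from becoming negative.\<close>

definition "M1 th h y t = max (min th (max 0 (t - h))) (g * t - y)"
definition "W th h y G = J y G (M1 th h y)"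

lemma admpath_M1: "0 \<le> th \<Longrightarrow> 0 \<le> y \<Longrightarrow> 0 \<le> h \<Longrightarrow> admpath (M1 th h y)"
proof (rule admpathI)
  fix s t :: real assume "s \<le> t"
  then show "M1 th h y s \<le> M1 th h y t" "M1 th h y t \<le> M1 th h y s + (t - s)"
    using g_speed[of s t y] unfolding M1_def by linarith+
qed (simp add: M1_def)

lemma W_0: "0 \<le> th \<Longrightarrow> W th 0 y G = V th y G"
  unfolding W_def V_def by (rule J_cong) (auto simp: M1_def mt_def)

lemma fl_cong_path:
  assumes "\<And>u. 0 \<le> u \<Longrightarrow> u \<le> t \<Longrightarrow> m u = n u" "0 \<le> t" shows "fl y G m t = fl y G n t"
  using H_cong[of t m n y] assms by (simp add: fl_def)

lemma integral_fl_cong: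
  assumes "\<And>u. 0 \<le> u \<Longrightarrow> u \<le> t \<Longrightarrow> m u = n u" shows "integral {0..t} (fl y G m) = integral {0..t} (fl y G n)"
  by (intro integral_cong fl_cong_path) (use assms in auto)

lemma W_rec:
  assumes "0 \<le> th" "0 \<le> y" "0 \<le> G" "0 \<le> b" "0 \<le> h" "g * b \<le> y"
  shows "W th (b + h) y G = integral {0..b} (fl y G (nb y))
    + fl y G (nb y) b * W th h (y - g * b) (max 0 (G - b))"
proof -
  have eq: "M1 th (b + h) y u = nb y u" if "0 \<le> u" "u \<le> b" for u
    using that assms by (auto simp: M1_def nb_def)
  have nb: "nb y b = 0" using assms by (simp add: nb_def)
  have sh: "M1 th (b + h) y (b + t) - 0 = M1 th h (y - g * b) t" for t
    by (simp add: M1_def algebra_simps)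
  show ?thesis
    using J_split[OF admpath_M1[of th y "b + h"], of G b y] assms eq[of b]
      integral_fl_cong[of b, OF eq] fl_cong_path[of b, OF eq] nb sh
    by (simp add: W_def)
qed

text \<open>\<open>m0\<close> and \<open>m1\<close> are \<open>mt\<close> and \<open>M1\<close>
  without the floor \<open>g * t - y\<close>, which does not bind up to date \<open>th + h\<close>
  when \<open>g * h \<le> y\<close>.\<close>

definition m0 :: "real \<Rightarrow> real \<Rightarrow> real" where "m0 th t = min t th"
definition m1 :: "real \<Rightarrow> real \<Rightarrow> real \<Rightarrow> real" where "m1 th h t = min th (max 0 (t - h))"

lemma admpath_m0: "0 \<le> th \<Longrightarrow> admpath (m0 th)" and admpath_m1: "0 \<le> th \<Longrightarrow> 0 \<le> h \<Longrightarrow> admpath (m1 th h)"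
  by (rule admpathI; simp add: m0_def m1_def; linarith)+

text \<open>Both plans have progress \<open>th\<close> at date \<open>th + h\<close>, hence reach
  the same state and share the continuation value \<open>c\<close>. Only the flows up to that date
  have to be compared.\<close>

lemma pair_split:
  assumes "0 \<le> th" "0 \<le> y" "0 \<le> G" "0 \<le> h" "g * h \<le> y"
  defines "E \<equiv> th + h" and "c \<equiv> C (y + th - g * (th + h)) (max 0 (G - h))"
  shows "V th y G = integral {0..E} (fl y G (m0 th)) + fl y G (m0 th) E * c"
    and "W th h y G = integral {0..E} (fl y G (m1 th h)) + fl y G (m1 th h) E * c"
    and "0 \<le> u \<Longrightarrow> u \<le> E \<Longrightarrow> 0 \<le> y + m1 th h u - g * u"
    and "0 \<le> y + th - g * (th + h)"
proof -
  have E: "0 \<le> E" using assms by (simp add: E_def)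
  have gth: "g * th \<le> th" using assms g_less mult_right_mono[of g 1 th] by simp
  show ye: "0 \<le> y + th - g * (th + h)" using assms gth by (simp add: algebra_simps)
  have gu: "g * u \<le> m1 th h u + y" if "0 \<le> u" "u \<le> E" for u
  proof (cases "u \<le> h")
    case True
    then have "g * u \<le> g * h" using g_pos by simp
    then show ?thesis using True assms by (simp add: m1_def)
  next
    case False
    then have "g * (u - h) \<le> u - h" using g_less mult_right_mono[of g 1 "u - h"] by simp
    then show ?thesis using False that assms by (simp add: m1_def E_def algebra_simps)
  qed
  then show "0 \<le> u \<Longrightarrow> u \<le> E \<Longrightarrow> 0 \<le> y + m1 th h u - g * u" for u
    by (fastforce simp: algebra_simps)
  have e0: "mt th y u = m0 th u" if "0 \<le> u" "u \<le> E" for u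
  proof -
    have "m1 th h u \<le> m0 th u" using that assms by (auto simp: m0_def m1_def)
    then show ?thesis using gu[OF that] by (simp add: mt_def m0_def)
  qed
  have e1: "M1 th h y u = m1 th h u" if "0 \<le> u" "u \<le> E" for u
    using gu[OF that] by (simp add: M1_def m1_def)
  have E0: "m0 th E = th" "m1 th h E = th" using assms by (auto simp: m0_def m1_def E_def)
  have G': "max 0 (G + th - E) = max 0 (G - h)" by (simp add: E_def)
  have J0: "J (y + th - g * E) F (\<lambda>t. mt th y (E + t) - th) = C (y + th - g * E) F"
    "J (y + th - g * E) F (\<lambda>t. M1 th h y (E + t) - th) = C (y + th - g * E) F" for F
    unfolding C_def by (rule J_cong; use assms in \<open>auto simp: mt_def M1_def nb_def E_def max_def algebra_simps\<close>)+
  show "V th y G = integral {0..E} (fl y G (m0 th)) + fl y G (m0 th) E * c"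
    using J_split[OF admpath_mt[OF assms(1,2)] assms(3) E, of y] e0[OF E order.refl] E0 G' J0
      integral_fl_cong[of E, OF e0] fl_cong_path[of E, OF e0] E
    by (simp add: V_def c_def E_def)
  show "W th h y G = integral {0..E} (fl y G (m1 th h)) + fl y G (m1 th h) E * c"
    using J_split[OF admpath_M1[OF assms(1,2,4)] assms(3) E, of y] e1[OF E order.refl] E0 G' J0
      integral_fl_cong[of E, OF e1] fl_cong_path[of E, OF e1] E
    by (simp add: W_def c_def E_def)
qed

text \<open>The logarithm of the ratio of the delayed to the undelayed flow, see
  \<open>fl_lr\<close>.\<close>

definition "lr th h y G t = H y (m0 th) t - H y (m1 th h) t - al * (m0 th t - m1 th h t)
    + be * (min t (G + m0 th t) - min t (G + m1 th h t))"

lemma fl_lr: "fl y G (m1 th h) t = fl y G (m0 th) t * exp (lr th h y G t)"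
  unfolding fl_def lr_def exp_add[symmetric] by (simp add: algebra_simps)

lemma m1_le_m0: "0 \<le> t \<Longrightarrow> 0 \<le> th \<Longrightarrow> 0 \<le> h \<Longrightarrow> m1 th h t \<le> m0 th t"
  by (auto simp: m0_def m1_def min_def max_def)

lemma H_diff:
  assumes "admpath m" "admpath n"
  shows "H y m t - H z n t = integral {0..t} (\<lambda>u. lam (y + m u - g * u) - lam (z + n u - g * u))"
  unfolding H_def by (intro integral_diff[symmetric] H_integrable assms)

lemma H_diff_integrable:
  assumes "admpath m" "admpath n"
  shows "(\<lambda>u. lam (y + m u - g * u) - lam (z + n u - g * u)) integrable_on {a..b}"
  by (intro integrable_diff H_integrable assms)

text \<open>Lagging behind the undelayed path saves hazard, and by concavity it saves more at a
  smaller lead. At a smaller gap the rival is held up more by the leader's position, so lagging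
  behind also restrains the rival more.\<close>

lemma lr_shift:
  assumes "0 \<le> th" "0 \<le> h" "y' \<le> y" "0 \<le> G'" "G' \<le> G" "g * h \<le> y'" "0 \<le> t" "t \<le> th + h"
  shows "lr th h y G t \<le> lr th h y' G' t"
proof -
  have y': "0 \<le> y'" using assms g_pos mult_nonneg_nonneg[of g h] by linarith
  note m = admpath_m0[OF assms(1)] admpath_m1[OF assms(1,2)]
  have "H y (m0 th) t - H y (m1 th h) t \<le> H y' (m0 th) t - H y' (m1 th h) t"
    unfolding H_diff[OF m]
  proof (intro integral_le H_diff_integrable m)
    fix u assume u: "u \<in> {0..t}"
    have "lam ((y + m1 th h u - g * u) + (m0 th u - m1 th h u)) - lam (y + m1 th h u - g * u)
      \<le> lam ((y' + m1 th h u - g * u) + (m0 th u - m1 th h u)) - lam (y' + m1 th h u - g * u)"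
      using pair_split(3)[OF assms(1) y' assms(4,2,6), of u] u assms m1_le_m0[of u th h] by (intro lam_conc) auto
    then show "lam (y + m0 th u - g * u) - lam (y + m1 th h u - g * u)
      \<le> lam (y' + m0 th u - g * u) - lam (y' + m1 th h u - g * u)" by (simp add: algebra_simps)
  qed
  moreover have "min t (G + m0 th t) - min t (G + m1 th h t) \<le> min t (G' + m0 th t) - min t (G' + m1 th h t)"
    using m1_le_m0[OF assms(7,1,2)] assms(5) by linarith
  then have "be * (min t (G + m0 th t) - min t (G + m1 th h t)) \<le> be * (min t (G' + m0 th t) - min t (G' + m1 th h t))"
    using be_pos by (intro mult_left_mono) auto
  ultimately show ?thesis unfolding lr_def by linarith
qed

text \<open>Both the additional hazard at the larger lead and the additional progress of the rival
  at the larger gap accumulate over time.\<close>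

lemma likelihood_mono:
  assumes "0 \<le> th" "y' \<le> y" "0 \<le> G'" "G' \<le> G" "0 \<le> s" "s \<le> t"
  shows "fl y' G' (m0 th) s / fl y G (m0 th) s \<le> fl y' G' (m0 th) t / fl y G (m0 th) t"
proof -
  note m = admpath_m0[OF assms(1)]
  have "H y (m0 th) s - H y' (m0 th) s \<le> H y (m0 th) t - H y' (m0 th) t"
    unfolding H_diff[OF m m] using assms
    by (intro integral_subset_le H_diff_integrable m) (auto simp: lam_mono)
  moreover have "min s (G + m0 th s) - min s (G' + m0 th s) \<le> min t (G + m0 th t) - min t (G' + m0 th t)"
    using assms unfolding m0_def by linarith
  then have "be * (min s (G + m0 th s) - min s (G' + m0 th s)) \<le> be * (min t (G + m0 th t) - min t (G' + m0 th t))"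
    using be_pos by (intro mult_left_mono) auto
  ultimately show ?thesis unfolding fl_def exp_diff[symmetric] exp_le_cancel_iff by (simp add: algebra_simps)
qed

text \<open>While the undelayed path pulls away, up to date \<open>min h th\<close>,
  \<open>lr\<close> is star-shaped in time and cannot return below 0. Afterwards the distance of the
  two paths no longer grows, the capability forgone is recovered and \<open>lr\<close>
  increases.\<close>

lemma lr_single_crossing:
  assumes "0 \<le> th" "0 \<le> h" "0 \<le> y" "0 \<le> G" "g * h \<le> y" "0 < s" "s \<le> t" "t \<le> th + h" "0 \<le> lr th h y G s"
  shows "0 \<le> lr th h y G t"
proof -
  note m = admpath_m0[OF assms(1)] admpath_m1[OF assms(1,2)]
  define k where "k u = lam (y + m0 th u - g * u) - lam (y + m1 th h u - g * u)" for u
  define I where "I t = integral {0..t} k" for t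
  have kint: "k integrable_on {a..b}" for a b unfolding k_def by (intro H_diff_integrable m)
  have lrI: "lr th h y G t = I t - al * (m0 th t - m1 th h t)
    + be * (min t (G + m0 th t) - min t (G + m1 th h t))" for t
    by (simp add: lr_def H_diff[OF m] I_def k_def[abs_def])
  have k0: "0 \<le> k u" if "0 \<le> u" for u
    using m1_le_m0[OF that assms(1,2)] by (simp add: k_def lam_mono)
  have Iadd: "I t = I s + integral {s..t} k" if "0 \<le> s" "s \<le> t" for s t
    unfolding I_def using that kint by (intro Henstock_Kurzweil_Integration.integral_combine[symmetric]) auto
  have Imono: "I s \<le> I t" if "0 \<le> s" "s \<le> t" for s t
    using Iadd[OF that] integral_nonneg[OF kint, of s t] k0 that by auto
  define a where "a = min h th"
  have kmono: "k u \<le> k v" if "0 \<le> u" "u \<le> v" "v \<le> a" for u v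
  proof -
    have "m0 th u = u" "m0 th v = v" "m1 th h u = 0" "m1 th h v = 0"
      using that assms by (auto simp: a_def m0_def m1_def)
    moreover have "lam (y + u - g * u) \<le> lam (y + v - g * v)"
      using mult_left_mono[of u v "1 - g"] that g_less by (intro lam_mono) (auto simp: algebra_simps)
    moreover have "lam (y + 0 - g * v) \<le> lam (y + 0 - g * u)"
      using that g_pos by (intro lam_mono) auto
    ultimately show ?thesis by (simp add: k_def)
  qed
  have early: "0 \<le> lr th h y G t" if st: "0 < s" "s \<le> t" "t \<le> a" and pos: "0 \<le> lr th h y G s" for s t
  proof -
    have "integral {0..s} k \<le> integral {0..s} (\<lambda>_. k s)"
      using st by (intro integral_le kint kmono) auto
    then have 1: "I s \<le> s * k s" using st by (simp add: I_def)
    have "integral {s..t} (\<lambda>_. k s) \<le> integral {s..t} k"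
      using st by (intro integral_le kint kmono) auto
    then have 2: "I s + (t - s) * k s \<le> I t" using Iadd[of s t] st by simp
    have "t * I s = s * I s + (t - s) * I s" by (simp add: algebra_simps)
    also have "\<dots> \<le> s * I s + (t - s) * (s * k s)" using 1 st by (intro add_mono mult_left_mono) auto
    also have "\<dots> = s * (I s + (t - s) * k s)" by (simp add: algebra_simps)
    also have "\<dots> \<le> s * I t" using 2 st by (intro mult_left_mono) auto
    finally have tI: "t * I s \<le> s * I t" .
    have mm: "m0 th s = s" "m0 th t = t" "m1 th h s = 0" "m1 th h t = 0"
      using st assms by (auto simp: a_def m0_def m1_def)
    have "s * min t G \<le> t * min s G"
    proof (cases "s \<le> G")
      case True
      then show ?thesis using st mult_left_mono[of "min t G" t s] by (simp add: min_def mult.commute)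
    next
      case False
      then show ?thesis using st assms mult_right_mono[of s t G] by (simp add: min_def)
    qed
    then have "t * (s - min s G) \<le> s * (t - min t G)" by (simp add: algebra_simps)
    then have "be * (t * (s - min s G)) \<le> be * (s * (t - min t G))" using be_pos by (intro mult_left_mono) auto
    moreover have "min t (G + t) = t" "min s (G + s) = s" using assms by auto
    \<comment> \<open>In this phase the hazard saved and the rival's restrained progress are convex
      in time, the capability forgone is linear, and all vanish at date 0; so \<open>lr\<close>
      divided by the date increases.\<close>
    ultimately have "t * lr th h y G s \<le> s * lr th h y G t"
      unfolding lrI mm using tI by (simp add: algebra_simps)
    moreover have "0 \<le> t * lr th h y G s" using st pos by simp
    ultimately show ?thesis using st zero_le_mult_iff[of s "lr th h y G t"] by linarith
  qed
  have late: "lr th h y G s \<le> lr th h y G t" if st: "a \<le> s" "s \<le> t" "t \<le> th + h" for s t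
  proof -
    have s0: "0 \<le> s" using st assms by (auto simp: a_def)
    define p where "p = (m0 th s - m1 th h s) - (m0 th t - m1 th h t)"
    have p: "0 \<le> p" using st assms unfolding p_def a_def m0_def m1_def by linarith
    have "- p \<le> (min t (G + m0 th t) - min t (G + m1 th h t)) - (min s (G + m0 th s) - min s (G + m1 th h s))"
      (is "_ \<le> ?z") using st assms unfolding p_def a_def m0_def m1_def by linarith
    then have "be * (- p) \<le> be * ?z" using be_pos by (intro mult_left_mono) auto
    moreover have "be * p \<le> al * p" using p be_less by (intro mult_right_mono) auto
    ultimately have "0 \<le> al * p + be * ?z" by linarith
    then show ?thesis using Imono[OF s0 st(2)] unfolding lrI p_def by (simp add: algebra_simps)
  qed
  show ?thesis
  proof (cases "t \<le> a")
    case True then show ?thesis using early assms by blast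
  next
    case False
    have "0 \<le> lr th h y G (max s a)"
    proof (cases "s \<le> a")
      case True then show ?thesis using early[of s a] assms by (simp add: max_def)
    next
      case False then show ?thesis using assms by (simp add: max_def)
    qed
    then show ?thesis using late[of "max s a" t] False assms by auto
  qed
qed

lemma lr_end:
  assumes "0 \<le> th" "0 \<le> h" shows "0 \<le> lr th h y G (th + h)" "lr th h y G 0 = 0"
proof -
  have "H y (m1 th h) (th + h) \<le> H y (m0 th) (th + h)"
    using assms by (intro H_mono_path admpath_m0 admpath_m1 lam_mono) (auto simp: m1_le_m0)
  moreover have "m0 th (th + h) = th" "m1 th h (th + h) = th" using assms by (auto simp: m0_def m1_def)
  ultimately show "0 \<le> lr th h y G (th + h)" by (simp add: lr_def)
  show "lr th h y G 0 = 0" using assms by (simp add: lr_def m0_def m1_def)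
qed

text \<open>
  Write \<open>W - V\<close> as the integral of the flow of the undelayed path against the relative gain
  \<open>exp lr - 1\<close>. That gain changes sign once, from negative to positive. Moving to a smaller lead
  and a smaller gap raises it pointwise (by concavity of the hazard) and shifts the weight
  towards late dates, so a profitable delay stays profitable.
\<close>

lemma delay_persists:
  assumes th: "0 \<le> th" and h: "0 \<le> h" and y: "y' \<le> y" and G: "0 \<le> G'" "G' \<le> G" and gh: "g * h \<le> y'"
    and VW: "V th y G \<le> W th h y G"
  shows "V th y' G' \<le> W th h y' G'"
proof -
  have y0: "0 \<le> y'" "0 \<le> y" "g * h \<le> y" "0 \<le> G" using g_pos h gh y G mult_nonneg_nonneg[of g h] by linarith+
  define E where "E = th + h"
  have E: "0 \<le> E" using th h by (simp add: E_def)
  note m = admpath_m0[OF th] admpath_m1[OF th h]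
  define f where "f = fl y G (m0 th)"
  define f' where "f' = fl y' G' (m0 th)"
  define q where "q t = exp (lr th h y G t) - 1" for t
  define q' where "q' t = exp (lr th h y' G' t) - 1" for t
  define c where "c = C (y + th - g * (th + h)) (max 0 (G - h))"
  define c' where "c' = C (y' + th - g * (th + h)) (max 0 (G' - h))"
  have pos: "0 < f t" "0 < f' t" for t by (simp_all add: f_def f'_def fl_pos)
  note ps = pair_split[OF th y0(2,4) h y0(3), folded E_def c_def]
  note ps' = pair_split[OF th y0(1) G(1) h gh, folded E_def c'_def]
  have cc: "0 \<le> c" "c \<le> c'"
    using ps(4) ps'(4) G y unfolding c_def c'_def by (auto intro!: C_nonneg C_antimono simp: E_def)
  have i1: "(\<lambda>t. f t * q t) integrable_on {0..E}" and i2: "(\<lambda>t. f' t * q' t) integrable_on {0..E}"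
    and f1: "fl y G (m1 th h) = (\<lambda>t. f t + f t * q t)" and f2: "fl y' G' (m1 th h) = (\<lambda>t. f' t + f' t * q' t)"
  proof -
    show f1: "fl y G (m1 th h) = (\<lambda>t. f t + f t * q t)" and f2: "fl y' G' (m1 th h) = (\<lambda>t. f' t + f' t * q' t)"
      by (auto simp: f_def q_def f'_def q'_def fl_lr algebra_simps)
    have "(\<lambda>t. fl y G (m1 th h) t - f t) integrable_on {0..E}" "(\<lambda>t. fl y' G' (m1 th h) t - f' t) integrable_on {0..E}"
      unfolding f_def f'_def by (intro integrable_diff fl_integrable m order.refl)+
    then show "(\<lambda>t. f t * q t) integrable_on {0..E}" "(\<lambda>t. f' t * q' t) integrable_on {0..E}"
      by (simp_all add: f1 f2)
  qed
  have fi: "f integrable_on {0..E}" "f' integrable_on {0..E}" unfolding f_def f'_def by (intro fl_integrable m order.refl)+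
  have d1: "W th h y G - V th y G = integral {0..E} (\<lambda>t. f t * q t) + f E * q E * c"
    unfolding ps f1 integral_add[OF fi(1) i1] by (simp add: f_def algebra_simps)
  have d2: "W th h y' G' - V th y' G' = integral {0..E} (\<lambda>t. f' t * q' t) + f' E * q' E * c'"
    unfolding ps' f2 integral_add[OF fi(2) i2] by (simp add: f'_def algebra_simps)
  define S where "S = {t. 0 < t \<and> t \<le> E \<and> lr th h y G t < 0}"
  define tc where "tc = (if S = {} then 0 else Sup S)"
  have bdd: "bdd_above S" by (auto simp: S_def bdd_above_def)
  have tc_bounds: "0 \<le> tc" "tc \<le> E"
  proof -
    have "0 \<le> Sup S \<and> Sup S \<le> E" if "S \<noteq> {}"
      using that bdd by (auto simp: S_def intro!: cSup_least intro: cSup_upper2)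
    then show "0 \<le> tc" "tc \<le> E" using E by (auto simp: tc_def)
  qed
  have after: "0 \<le> q t" if "tc < t" "t \<le> E" for t
  proof -
    have "t \<notin> S" using that cSup_upper[OF _ bdd, of t] by (auto simp: tc_def split: if_splits)
    then show ?thesis using that tc_bounds by (auto simp: S_def q_def not_less)
  qed
  have before: "q t \<le> 0" if "0 < t" "t < tc" for t
  proof (rule ccontr)
    assume "\<not> q t \<le> 0"
    then have t: "0 \<le> lr th h y G t" by (simp add: q_def)
    have "S \<noteq> {}" "t < Sup S" using that by (auto simp: tc_def split: if_splits)
    then obtain s where "s \<in> S" "t < s" using less_cSup_iff[OF _ bdd] by blast
    then show False using lr_single_crossing[OF th h y0(2,4,3) that(1), of s] t by (auto simp: S_def E_def)
  qed
  \<comment> \<open>The ratio of the weights at the crossing date \<open>tc\<close>. By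
    \<open>likelihood_mono\<close>, \<open>f' / f\<close> is at most \<rho> where \<open>q\<close>
    is negative and at least \<rho> where \<open>q\<close> is positive, so passing from
    \<open>\<rho> * f\<close> to \<open>f'\<close> raises the integrand everywhere.\<close>
  define \<rho> where "\<rho> = f' tc / f tc"
  have rho: "0 < \<rho>" using pos by (simp add: \<rho>_def)
  have key: "\<rho> * (f t * q t) \<le> f' t * q t" if t: "0 \<le> t" "t \<le> E" for t
  proof -
    consider "t = 0" | "t = tc" | "0 < t" "t < tc" | "tc < t" using t by linarith
    then show ?thesis
    proof cases
      case 1 then show ?thesis using lr_end[OF th h] by (simp add: q_def)
    next
      case 2 then show ?thesis using pos[of tc] by (simp add: \<rho>_def)
    next
      case 3
      then have "f' t / f t \<le> \<rho>" unfolding \<rho>_def f_def f'_def by (intro likelihood_mono th y G) auto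
      then have "f' t \<le> \<rho> * f t" using pos[of t] by (simp add: field_simps)
      then show ?thesis using mult_right_mono_neg[OF _ before[OF 3], of "f' t" "\<rho> * f t"] by (simp add: mult.assoc)
    next
      case 4
      then have "\<rho> \<le> f' t / f t" unfolding \<rho>_def f_def f'_def using tc_bounds by (intro likelihood_mono th y G) auto
      then have "\<rho> * f t \<le> f' t" using pos[of t] by (simp add: field_simps)
      then show ?thesis using mult_right_mono[OF _ after[OF 4 t(2)], of "\<rho> * f t" "f' t"] by (simp add: mult.assoc)
    qed
  qed
  have qq: "q t \<le> q' t" if "0 \<le> t" "t \<le> E" for t
    unfolding q_def q'_def using lr_shift[OF th h y G gh that[unfolded E_def]] by simp
  have key': "\<rho> * (f t * q t) \<le> f' t * q' t" if "0 \<le> t" "t \<le> E" for t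
    using key[OF that] mult_left_mono[OF qq[OF that], of "f' t"] pos[of t] by linarith
  have "\<rho> * (W th h y G - V th y G) = integral {0..E} (\<lambda>t. \<rho> * (f t * q t)) + \<rho> * (f E * q E) * c"
    unfolding d1 by (simp add: algebra_simps)
  also have "\<dots> \<le> integral {0..E} (\<lambda>t. f' t * q' t) + f' E * q' E * c'"
  proof (rule add_mono)
    show "integral {0..E} (\<lambda>t. \<rho> * (f t * q t)) \<le> integral {0..E} (\<lambda>t. f' t * q' t)"
      using integrable_cmul[OF i1, of \<rho>] by (intro integral_le i2 key') auto
    have "0 \<le> q E" using lr_end(1)[OF th h, of y G] by (simp add: q_def E_def)
    then have "0 \<le> f' E * q' E" using pos[of E] qq[OF E] by simp
    then show "\<rho> * (f E * q E) * c \<le> f' E * q' E * c'"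
      by (rule mult_mono[OF key'[OF E order.refl] cc(2)]) (use cc in auto)
  qed
  also have "\<dots> = W th h y' G' - V th y' G'" by (simp add: d2)
  finally show ?thesis using rho VW zero_le_mult_iff[of \<rho> "W th h y G - V th y G"] by linarith
qed


section \<open>The best value over race-then-coast plans\<close>

definition "v y G = (SUP th\<in>{0..}. V th y G)"

lemma V_le_v: "0 \<le> th \<Longrightarrow> 0 \<le> y \<Longrightarrow> 0 \<le> G \<Longrightarrow> V th y G \<le> v y G"
  unfolding v_def by (rule cSUP_upper) (auto simp: bdd_above_def intro!: exI[of _ "1 / de"] V_le)

lemma v_le: "(\<And>th. 0 \<le> th \<Longrightarrow> V th y G \<le> K) \<Longrightarrow> v y G \<le> K"
  unfolding v_def by (rule cSUP_least) auto

lemma v_nonneg: "0 \<le> y \<Longrightarrow> 0 \<le> G \<Longrightarrow> 0 \<le> v y G"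
  using V_le_v[of 0 y G] V_nonneg[of 0 y G] by linarith

lemma C_le_v: "0 \<le> y \<Longrightarrow> 0 \<le> G \<Longrightarrow> C y G \<le> v y G"
  using V_le_v[of 0 y G] by (simp add: V_0)

text \<open>Coasting for \<open>b\<close> is a common prefix of both plans and cancels, so the
  effect of a further delay is decided at the state reached by then.\<close>

lemma W_decr_iff:
  assumes "0 \<le> th" "0 \<le> y" "0 \<le> G" "0 \<le> b" "0 \<le> h" "g * b \<le> y"
  shows "W th (b + h) y G < W th b y G \<longleftrightarrow> W th h (y - g * b) (max 0 (G - b)) < V th (y - g * b) (max 0 (G - b))"
  using W_rec[OF assms] W_rec[OF assms(1-4) order.refl assms(6)] fl_pos[of y G "nb y" b]
  by (simp add: W_0 assms)

lemma fl_le_1: "admpath m \<Longrightarrow> 0 \<le> G \<Longrightarrow> 0 \<le> t \<Longrightarrow> fl y G m t \<le> 1"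
  using fl_le[of m G t y] de_pos mult_nonneg_nonneg[of de t] by (smt (verit) exp_le_one_iff mult_minus_left)

lemma integral_fl_le: "admpath m \<Longrightarrow> 0 \<le> G \<Longrightarrow> 0 \<le> t \<Longrightarrow> integral {0..t} (fl y G m) \<le> t"
proof -
  assume a: "admpath m" "0 \<le> G" "0 \<le> t"
  have "integral {0..t} (fl y G m) \<le> integral {0..t} (\<lambda>_. 1)"
    using a by (intro integral_le fl_integrable fl_le_1) auto
  then show ?thesis using a by simp
qed

text \<open>Coasting for a short time \<open>q\<close> changes exposure, capability and gap by
  amounts proportional to \<open>q\<close>, with a constant depending on \<open>y\<close> and
  \<open>th\<close> only. This supplies the continuity at delay 0 for
  \<open>delay_quasiconvex\<close>.\<close>

lemma V_small_shift:
  assumes th: "0 \<le> th" and y: "0 \<le> y" and G: "0 \<le> G" and q: "0 \<le> q" "g * q \<le> y"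
  defines "K \<equiv> lam (y + (1 - g) * th) * (g / (1 - g) + 1) + al * g + be"
  shows "V th (y - g * q) (max 0 (G - q)) \<le> exp (K * q) * V th y G"
proof -
  let ?y = "y - g * q" and ?G = "max 0 (G - q)"
  define d where "d = y + (1 - g) * th"
  have d: "?y + (1 - g) * th = d - g * q" "0 \<le> d - g * q" "0 \<le> d" "y \<le> d"
  proof -
    have "0 \<le> (1 - g) * th" using th g_less by simp
    then show "?y + (1 - g) * th = d - g * q" "0 \<le> d - g * q" "0 \<le> d" "y \<le> d"
      using q y by (simp_all add: d_def)
  qed
  have gr: "0 \<le> g * q" using g_pos q by simp
  have L: "Lam x - Lam (x - g * q) \<le> lam d * (g * q)" if "x \<le> d" for x
  proof -
    have "Lam x - Lam (x - g * q) \<le> lam x * (g * q)" using Lam_diff_bounds(2)[of "x - g * q" x] gr by simp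
    also have "\<dots> \<le> lam d * (g * q)" using that gr by (intro mult_right_mono lam_mono)
    finally show ?thesis .
  qed
  define A where "A = lam d * (g * q) / (1 - g)"
  have e_le: "e ?y t \<le> exp A * e y t" if "0 \<le> t" "t \<le> th" for t
  proof -
    have "y + (1 - g) * t \<le> d" using that g_less by (auto simp: d_def)
    note L[OF this]
    moreover have "Lam ?y \<le> Lam y" using gr by (intro Lam_mono) simp
    ultimately have "(Lam (y + (1 - g) * t) - Lam y) - (Lam (?y + (1 - g) * t) - Lam ?y) \<le> lam d * (g * q)"
      by (simp add: algebra_simps)
    then have "((Lam (y + (1 - g) * t) - Lam y) - (Lam (?y + (1 - g) * t) - Lam ?y)) / (1 - g) \<le> A"
      unfolding A_def using g_less by (intro divide_right_mono) auto
    then show ?thesis unfolding e_def exp_add[symmetric] exp_le_cancel_iff by (simp add: diff_divide_distrib)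
  qed
  define D where "D = lam d * q + al * (g * q) + be * q"
  have Cl: "C (d - g * q) ?G \<le> exp D * C d G"
  proof -
    have "exp (- (\<bar>Lam d - Lam (d - g * q)\<bar> / g + al * \<bar>d - (d - g * q)\<bar> + be * \<bar>G - ?G\<bar>)) * C (d - g * q) ?G \<le> C d G"
      by (rule C_log_Lipschitz) (use d G in auto)
    moreover have "\<bar>Lam d - Lam (d - g * q)\<bar> / g \<le> lam d * q"
      using L[of d] Lam_mono[of "d - g * q" d] gr g_pos by (auto simp: field_simps)
    moreover have "be * \<bar>G - ?G\<bar> \<le> be * q" using be_pos q G by (intro mult_left_mono) auto
    ultimately have "exp (- D) * C (d - g * q) ?G \<le> C d G"
      using gr C_nonneg[OF d(2), of ?G]
      by (smt (verit) D_def exp_le_cancel_iff mult_right_mono)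
    then have "exp D * (exp (- D) * C (d - g * q) ?G) \<le> exp D * C d G" by (intro mult_left_mono) auto
    then show ?thesis by (simp add: mult.assoc[symmetric] exp_add[symmetric])
  qed
  have pos: "0 \<le> lam d" "0 \<le> D" "0 \<le> A" using lam_nonneg al_pos be_pos gr q g_less by (auto simp: D_def A_def)
  have AD: "A + D = K * q" unfolding A_def D_def K_def d_def[symmetric] by (simp add: distrib_left distrib_right)
  have "V th ?y ?G = integral {0..th} (e ?y) + e ?y th * C (d - g * q) ?G"
    using V_eq[of ?y ?G th] q th d by simp
  also have "\<dots> \<le> exp A * integral {0..th} (e y) + (exp A * e y th) * (exp D * C d G)"
  proof (intro add_mono mult_mono e_le Cl)
    have "integral {0..th} (e ?y) \<le> integral {0..th} (\<lambda>t. exp A * e y t)"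
      by (intro integral_le e_integrable integrable_on_mult_right e_le) auto
    then show "integral {0..th} (e ?y) \<le> exp A * integral {0..th} (e y)" by simp
  qed (use th e_pos[of y th] C_nonneg[OF d(2), of ?G] in auto)
  also have "\<dots> \<le> exp (A + D) * integral {0..th} (e y) + exp (A + D) * (e y th * C d G)"
  proof (rule add_mono)
    show "exp A * integral {0..th} (e y) \<le> exp (A + D) * integral {0..th} (e y)"
      using pos by (intro mult_right_mono integral_nonneg e_integrable) (auto simp: less_imp_le e_pos)
  qed (simp add: exp_add)
  also have "\<dots> = exp (K * q) * V th y G"
    using V_eq[OF y G th] unfolding AD by (simp add: d_def algebra_simps)
  finally show ?thesis .
qed

text \<open>Suppose an interior delay \<open>s\<close> beats both ends. Somewhere after
  \<open>s\<close> a further delay \<open>h\<close> hurts, and by \<open>delay_persists\<close>,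
  read backwards, it hurts at all earlier delays too. Going back from \<open>s\<close> in steps of
  \<open>h\<close> then raises the value down to a delay below \<open>h\<close>, so \<open>W\<close>
  at \<open>s\<close> is at most \<open>V\<close> up to an error vanishing with
  \<open>h\<close>.\<close>

lemma delay_quasiconvex:
  assumes th: "0 \<le> th" and y: "0 \<le> y" and G: "0 \<le> G" and s: "0 \<le> s" "s \<le> T" "g * T \<le> y"
  shows "W th s y G \<le> max (V th y G) (W th T y G)"
proof (rule ccontr)
  assume "\<not> ?thesis"
  then have WV: "V th y G < W th s y G" and WT: "W th T y G < W th s y G" by auto
  have sT: "0 < s" "s < T"
  proof -
    show "0 < s" using WV s W_0[OF th, of y G] by (cases "s = 0") auto
    show "s < T" using WT s by (cases "s = T") auto
  qed
  have gle: "g * b \<le> y" if "b \<le> T" for b using that s(3) g_pos by (meson less_imp_le mult_left_mono order_trans)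
  define K where "K = lam (y + (1 - g) * th) * (g / (1 - g) + 1) + al * g + be"
  have K0: "0 \<le> K" using lam_nonneg g_pos g_less al_pos be_pos by (simp add: K_def)
  have bound: "W th s y G \<le> (T - s) / real n + exp (K * ((T - s) / real n)) * V th y G"
    if n: "0 < n" "(T - s) / real n \<le> s" for n :: nat
  proof -
    define h where "h = (T - s) / real n"
    have h: "0 < h" "h \<le> s" using n sT by (auto simp: h_def)
    have nh: "s + real n * h = T" using n by (simp add: h_def)
    \<comment> \<open>The value is lower at \<open>T\<close> than at \<open>s\<close>, so it falls
      over at least one of the \<open>n\<close> steps between them.\<close>
    have "\<exists>k<n. W th (s + real k * h + h) y G < W th (s + real k * h) y G"
    proof (rule ccontr)
      assume neg: "\<not> ?thesis"
      have st: "W th (s + real k * h) y G \<le> W th (s + real k * h + h) y G" if "k < n" for k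
        using neg that not_less by blast
      have "k \<le> n \<Longrightarrow> W th s y G \<le> W th (s + real k * h) y G" for k
      proof (induction k)
        case (Suc k)
        then have "W th s y G \<le> W th (s + real k * h + h) y G" using st[of k] by auto
        then show ?case by (simp add: algebra_simps)
      qed simp
      from this[of n] show False using WT nh by simp
    qed
    then obtain k where k: "k < n" "W th (s + real k * h + h) y G < W th (s + real k * h) y G" by blast
    define b' where "b' = s + real k * h"
    have "real (Suc k) * h \<le> real n * h" using k h by (intro mult_right_mono) auto
    then have b'T: "b' + h \<le> T" using nh by (simp add: b'_def algebra_simps)
    have b'0: "0 \<le> b'" "s \<le> b'" using s h by (auto simp: b'_def)
    \<comment> \<open>Otherwise the delay \<open>h\<close> would be harmless at the larger lead and
      gap after coasting for \<open>b\<close>, and \<open>delay_persists\<close> would make it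
      harmless after coasting for \<open>b'\<close>.\<close>
    have dec: "W th (b + h) y G < W th b y G" if b: "0 \<le> b" "b \<le> s" for b
    proof -
      have "W th h (y - g * b') (max 0 (G - b')) < V th (y - g * b') (max 0 (G - b'))"
        using W_decr_iff[OF th y G b'0(1), of h] k(2) h gle[of b'] b'T by (simp add: b'_def)
      moreover have "V th (y - g * b') (max 0 (G - b')) \<le> W th h (y - g * b') (max 0 (G - b'))"
        if "V th (y - g * b) (max 0 (G - b)) \<le> W th h (y - g * b) (max 0 (G - b))"
      proof (rule delay_persists[OF th _ _ _ _ _ that])
        show "y - g * b' \<le> y - g * b" using b b'0 g_pos by simp
        show "g * h \<le> y - g * b'" using gle[OF b'T] by (simp add: algebra_simps)
      qed (use h b b'0 in auto)
      ultimately have "W th h (y - g * b) (max 0 (G - b)) < V th (y - g * b) (max 0 (G - b))" by linarith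
      then show ?thesis using W_decr_iff[OF th y G b(1), of h] h b sT gle[of b] by simp
    qed
    \<comment> \<open>The number of full steps that fit between 0 and \<open>s\<close>; the
      remainder \<open>r\<close> is a delay of at most \<open>h\<close>.\<close>
    define j where "j = nat \<lfloor>s / h\<rfloor>"
    define r where "r = s - real j * h"
    have j: "real j = of_int \<lfloor>s / h\<rfloor>" using s h by (simp add: j_def)
    have r: "0 \<le> r" "r \<le> h"
    proof -
      have "real j \<le> s / h" "s / h \<le> real j + 1" unfolding j by linarith+
      then show "0 \<le> r" "r \<le> h" using h by (auto simp: r_def field_simps)
    qed
    have "i \<le> j \<Longrightarrow> W th (r + real i * h) y G \<le> W th r y G" for i
    proof (induction i)
      case (Suc i)
      have "real i * h \<le> real j * h" using Suc h by (intro mult_right_mono) auto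
      then have "r + real i * h \<le> s" by (simp add: r_def)
      then have "W th (r + real i * h + h) y G < W th (r + real i * h) y G"
        using r h by (intro dec) auto
      moreover have "W th (r + real i * h) y G \<le> W th r y G" using Suc by simp
      ultimately show ?case by (simp add: algebra_simps)
    qed simp
    from this[of j] have "W th s y G \<le> W th r y G" by (simp add: r_def)
    also have "W th r y G = integral {0..r} (fl y G (nb y)) + fl y G (nb y) r * V th (y - g * r) (max 0 (G - r))"
      using W_rec[OF th y G r(1) order.refl gle[of r]] r h sT by (simp add: W_0 th)
    also have "\<dots> \<le> r + 1 * (exp (K * r) * V th y G)"
    proof (intro add_mono mult_mono)
      show "V th (y - g * r) (max 0 (G - r)) \<le> exp (K * r) * V th y G"
      proof -
        have "g * r \<le> y" using r h sT by (intro gle) auto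
        then show ?thesis unfolding K_def by (rule V_small_shift[OF th y G r(1)])
      qed
      show "0 \<le> V th (y - g * r) (max 0 (G - r))" using th gle[of r] r h sT by (intro V_nonneg) auto
    qed (use y G r in \<open>auto intro!: integral_fl_le fl_le_1 admpath_nb\<close>)
    also have "\<dots> \<le> h + exp (K * h) * V th y G"
      using r K0 V_nonneg[OF th y G] by (auto intro!: add_mono mult_right_mono mult_left_mono)
    finally show ?thesis by (simp add: h_def)
  qed
  have lim: "(\<lambda>n. (T - s) / real n + exp (K * ((T - s) / real n)) * V th y G) \<longlonglongrightarrow> 0 + exp (K * 0) * V th y G"
    by (intro tendsto_intros lim_const_over_n)
  obtain N :: nat where N: "(T - s) / s < real N" using reals_Archimedean2 by blast
  have "W th s y G \<le> 0 + exp (K * 0) * V th y G"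
  proof (rule LIMSEQ_le_const[OF lim], intro exI allI impI)
    fix n assume n: "Suc N \<le> n"
    then have "(T - s) / s < real n" using N by simp
    then have "(T - s) / real n \<le> s" "0 < n" using sT n by (auto simp: field_simps)
    then show "W th s y G \<le> (T - s) / real n + exp (K * ((T - s) / real n)) * V th y G" by (intro bound)
  qed
  then show False using WV by simp
qed

text \<open>
  At zero lead, racing up to lead \<open>g * h\<close> and coasting back costs only \<open>O(h\<^sup>2)\<close> compared with
  pacing, whereas starting the optimal race a bit earlier saves a discount of order \<open>h\<close>.
\<close>

lemma loop_vs_pace:
  assumes F: "0 \<le> F" and h: "0 \<le> h" "h \<le> 1"
  defines "t1 \<equiv> g * h / (1 - g)"
  defines "K \<equiv> al * g / (1 - g) * exp (al * g / (1 - g)) / (1 - g)"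
  shows "V t1 0 (F + h) \<le> C 0 (F + h) + K * h\<^sup>2"
proof -
  let ?G = "F + h"
  have t1: "0 \<le> t1" "t1 \<le> g / (1 - g)" using h g_pos g_less by (auto simp: t1_def divide_right_mono mult_left_le)
  \<comment> \<open>This is \<open>t1 + h\<close>: racing to lead \<open>g * h\<close> takes
    \<open>t1\<close> and coasting back takes \<open>h\<close>. From then on the loop coincides with
    pacing.\<close>
  define t2 where "t2 = h / (1 - g)"
  have t2: "0 \<le> t2" "g * t2 = t1" using h g_less by (auto simp: t2_def t1_def)
  have t12: "t1 \<le> t2" using t2 g_less mult_right_mono[of g 1 t2] by simp
  have G: "0 \<le> ?G" using F h by simp
  note m = admpath_mt[OF t1(1) order.refl] admpath_nb[OF order.refl]
  have mt2: "mt t1 0 t2 = t1" "nb 0 t2 = t1" using t2 t12 t1 by (auto simp: mt_def nb_def)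
  have nm: "nb 0 t \<le> mt t1 0 t" "mt t1 0 t \<le> nb 0 t + t1" if "0 \<le> t" for t
    using that t1 mult_nonneg_nonneg[of g t] g_pos unfolding mt_def nb_def by linarith+
  have Hle: "H 0 (nb 0) t \<le> H 0 (mt t1 0) t" if "0 \<le> t" for t
    using m nm by (intro H_mono_path lam_mono) auto
  have flle: "fl 0 ?G (mt t1 0) t \<le> exp (al * t1) * fl 0 ?G (nb 0) t" if "0 \<le> t" for t
  proof -
    have "al * mt t1 0 t \<le> al * (nb 0 t + t1)" using nm[OF that] al_pos by (intro mult_left_mono) auto
    moreover have "be * min t (?G + nb 0 t) \<le> be * min t (?G + mt t1 0 t)" using nm[OF that] be_pos by (intro mult_left_mono) auto
    ultimately show ?thesis using Hle[OF that] unfolding fl_def exp_add[symmetric] exp_le_cancel_iff by (simp add: algebra_simps)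
  qed
  have end_le: "fl 0 ?G (mt t1 0) t2 \<le> fl 0 ?G (nb 0) t2"
    using Hle[OF t2(1)] by (simp add: fl_def mt2)
  let ?c = "C (0 + t1 - g * t2) (max 0 (?G + t1 - t2))"
  have c0: "0 \<le> ?c" using t2 by (intro C_nonneg) auto
  have "J (0 + t1 - g * t2) (max 0 (?G + t1 - t2)) (\<lambda>t. mt t1 0 (t2 + t) - t1) = ?c"
    unfolding C_def using t2 t12 g_pos by (intro J_cong) (auto simp: mt_def nb_def max_def algebra_simps mult_nonneg_nonneg)
  then have Vs: "V t1 0 ?G = integral {0..t2} (fl 0 ?G (mt t1 0)) + fl 0 ?G (mt t1 0) t2 * ?c"
    using J_split[OF m(1) G t2(1), of 0] mt2 by (simp add: V_def)
  have Cs: "C 0 ?G = integral {0..t2} (fl 0 ?G (nb 0)) + fl 0 ?G (nb 0) t2 * ?c"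
    using C_rec[OF order.refl G t2(1)] mt2 t2 t1 by simp
  have "integral {0..t2} (fl 0 ?G (mt t1 0)) \<le> integral {0..t2} (\<lambda>t. exp (al * t1) * fl 0 ?G (nb 0) t)"
    by (intro integral_le fl_integrable integrable_on_mult_right flle m) auto
  then have "V t1 0 ?G \<le> exp (al * t1) * integral {0..t2} (fl 0 ?G (nb 0)) + fl 0 ?G (nb 0) t2 * ?c"
    unfolding Vs using mult_right_mono[OF end_le c0] by simp
  also have "\<dots> = C 0 ?G + (exp (al * t1) - 1) * integral {0..t2} (fl 0 ?G (nb 0))"
    unfolding Cs by (simp add: algebra_simps)
  also have "\<dots> \<le> C 0 ?G + (al * t1 * exp (al * g / (1 - g))) * t2"
  proof (intro add_mono mult_mono order.refl)
    have "1 - al * t1 \<le> exp (- (al * t1))" using exp_ge_add_one_self[of "- (al * t1)"] by simp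
    then have "(1 - al * t1) * exp (al * t1) \<le> exp (- (al * t1)) * exp (al * t1)" by (intro mult_right_mono) auto
    then have "exp (al * t1) - 1 \<le> al * t1 * exp (al * t1)" by (simp add: algebra_simps exp_add[symmetric])
    also have "\<dots> \<le> al * t1 * exp (al * g / (1 - g))"
      using t1 al_pos mult_left_mono[OF t1(2), of al] by (intro mult_left_mono) auto
    finally show "exp (al * t1) - 1 \<le> al * t1 * exp (al * g / (1 - g))" .
    show "integral {0..t2} (fl 0 ?G (nb 0)) \<le> t2" using m G t2 by (intro integral_fl_le)
  qed (use t1 al_pos m integral_fl_nonneg in auto)
  also have "al * t1 * exp (al * g / (1 - g)) * t2 = K * h\<^sup>2"
    by (simp add: K_def t1_def t2_def power2_eq_square)
  finally show ?thesis by simp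
qed

text \<open>A race worth starting at lead 0 and gap \<open>F\<close> gains at least as much at gap
  \<open>F + h\<close> by \<open>race_gain_mono\<close>, and it passes through lead
  \<open>g * h\<close>. Entering it at that lead, instead of first coasting down, avoids discounting
  the gain by \<open>exp (- de * h)\<close>.\<close>

lemma early_race_gain:
  assumes F: "0 < F" and pos: "C 0 F < v 0 F"
  obtains h0 where "0 < h0" 
    "\<And>h. 0 < h \<Longrightarrow> h < h0 \<Longrightarrow> integral {0..h} (fl (g * h) (F + h) (nb (g * h)))
      + fl (g * h) (F + h) (nb (g * h)) h * v 0 F < v (g * h) (F + h)"
proof -
  define D where "D = v 0 F - C 0 F"
  have D: "0 < D" using pos by (simp add: D_def)
  define K where "K = al * g / (1 - g) * exp (al * g / (1 - g)) / (1 - g)"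
  have K: "0 \<le> K" using al_pos g_pos g_less by (simp add: K_def)
  have C0: "0 < C 0 F" using F by (intro C_pos) auto
  \<comment> \<open>By \<open>V_le_C\<close> a race no longer than \<open>th0\<close> gains at most
    \<open>D / 2\<close> over pacing.\<close>
  define th0 where "th0 = ln (1 + D / (2 * C 0 F)) / al"
  have th0: "0 < th0" using D C0 al_pos unfolding th0_def by (intro divide_pos_pos ln_gt_zero) auto
  \<comment> \<open>The three bounds give \<open>h \<le> 1\<close> for \<open>loop_vs_pace\<close>,
    a race to lead \<open>g * h\<close> shorter than \<open>th0\<close>, and \<open>K * h^2\<close>
    below the discount loss \<open>D * (1 - 1 / (1 + de * h))\<close>.\<close>
  define h0 where "h0 = min 1 (min (th0 * (1 - g) / g) (D * de / ((K + 1) * (1 + de))))"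
  have den: "0 < (K + 1) * (1 + de)" using K de_pos by (simp add: add_nonneg_pos)
  have "0 < h0" using th0 g_pos g_less D de_pos den by (simp add: h0_def)
  moreover have "integral {0..h} (fl (g * h) (F + h) (nb (g * h)))
      + fl (g * h) (F + h) (nb (g * h)) h * v 0 F < v (g * h) (F + h)" if h: "0 < h" "h < h0" for h
  proof -
    let ?t1 = "g * h / (1 - g)" and ?y = "g * h" and ?G = "F + h"
    have t1: "0 \<le> ?t1" "?t1 \<le> th0"
      using h g_pos g_less by (auto simp: h0_def field_simps)
    have h1: "h \<le> 1" using h by (simp add: h0_def)
    define e1 where "e1 = e 0 ?t1"
    define U where "U = integral {0..?t1} (e 0) + e1 * v ?y ?G"
    have y0: "0 + (1 - g) * ?t1 = ?y" using g_less by simp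
    have e1: "0 < e1" "e1 \<le> 1"
    proof -
      have "0 \<le> de * ?t1" using de_pos t1(1) by (intro mult_nonneg_nonneg) auto
      then have "exp (- de * ?t1) \<le> 1" by simp
      then show "0 < e1" "e1 \<le> 1" using e_pos[of 0 ?t1] e_le[OF t1(1), of 0] unfolding e1_def by linarith+
    qed
    have "v 0 F \<le> max (C 0 F + D / 2) (C 0 F + (U - C 0 ?G))"
    proof (rule v_le)
      fix th :: real assume th: "0 \<le> th"
      show "V th 0 F \<le> max (C 0 F + D / 2) (C 0 F + (U - C 0 ?G))"
      proof (cases "V th 0 F \<le> C 0 F + D / 2")
        case False
        then have "C 0 F + D / 2 < exp (al * th) * C 0 F" using V_le_C[OF th order.refl, of F] F by simp
        then have "1 + D / (2 * C 0 F) < exp (al * th)" using C0 by (simp add: field_simps)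
        then have "ln (1 + D / (2 * C 0 F)) < al * th" using D C0
          by (metis add_pos_pos divide_pos_pos exp_gt_zero ln_exp ln_less_cancel_iff mult_pos_pos zero_less_numeral zero_less_one)
        then have "th0 < th" using al_pos by (simp add: th0_def field_simps)
        then have t1th: "?t1 \<le> th" using t1 by simp
        have "V th 0 ?G = integral {0..?t1} (e 0) + e1 * V (th - ?t1) ?y ?G"
          using V_rec[of 0 ?G ?t1 th] F h t1 t1th y0 by (simp add: e1_def)
        also have "\<dots> \<le> U" unfolding U_def using e1 t1th F h g_pos by (intro add_mono mult_left_mono V_le_v) auto
        finally show ?thesis using race_gain_mono[of 0 th F ?G] th F h by simp
      qed simp
    qed
    moreover have "v 0 F = C 0 F + D" by (simp add: D_def)
    ultimately have "D \<le> U - C 0 ?G" using D by (cases "D / 2 \<le> U - C 0 ?G") (auto simp: max_def)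
    note DU = this
    have "V ?t1 0 ?G = integral {0..?t1} (e 0) + e1 * C ?y ?G"
      using V_eq[of 0 ?G ?t1] F h t1 y0 by (simp add: e1_def)
    moreover have "V ?t1 0 ?G \<le> C 0 ?G + K * h\<^sup>2"
      unfolding K_def using F h h1 by (intro loop_vs_pace) auto
    ultimately have vD: "D - K * h\<^sup>2 \<le> e1 * (v ?y ?G - C ?y ?G)" using DU by (simp add: U_def algebra_simps)
    let ?E = "fl ?y ?G (nb ?y) h"
    have nbh: "nb ?y h = 0" by (simp add: nb_def)
    have Crec: "C ?y ?G = integral {0..h} (fl ?y ?G (nb ?y)) + ?E * C 0 F"
      using C_rec[of ?y ?G h] F h g_pos nbh by simp
    have E: "?E \<le> exp (- de * h)" "0 < ?E" using F h g_pos by (intro fl_le fl_pos admpath_nb; simp)+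
    have "e1 * (?E * D) < D - K * h\<^sup>2"
    proof -
      have "e1 * (?E * D) \<le> 1 * (exp (- de * h) * D)"
        using e1 E D by (intro mult_mono) auto
      also have "exp (- de * h) \<le> 1 / (1 + de * h)"
        using exp_ge_add_one_self[of "de * h"] de_pos h by (simp add: exp_minus inverse_eq_divide frac_le add_pos_pos)
      also have "1 * (1 / (1 + de * h) * D) < D - K * h\<^sup>2"
      proof -
        have hh: "h * ((K + 1) * (1 + de)) < D * de" using h den by (simp add: h0_def pos_less_divide_eq)
        have dh: "0 < de * h" "de * h \<le> de" using de_pos h h1 by auto
        have "(K * h) * (1 + de * h) \<le> ((K + 1) * h) * (1 + de)"
          using K h dh de_pos by (intro mult_mono mult_right_mono) auto
        then have "(K * h) * (1 + de * h) < D * de" using hh by (simp add: mult_ac)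
        then have "(K * h) * (1 + de * h) * h < D * de * h" using h by (intro mult_strict_right_mono)
        then show ?thesis using dh by (simp add: field_simps power2_eq_square)
      qed
      finally show ?thesis using D by simp
    qed
    then have "?E * D < v ?y ?G - C ?y ?G" using vD e1 by (smt (verit) mult_less_cancel_left_pos)
    then show ?thesis using Crec by (simp add: D_def algebra_simps)
  qed
  ultimately show ?thesis using that by blast
qed

section \<open>Optimality of racing first and coasting afterwards\<close>

text \<open>Pacing at lead 0 only shrinks the gap, and the gain of a race over pacing is smaller at
  the smaller gap. So a race is not worth more after a pacing phase.\<close>

lemma pace_step:
  assumes G: "0 \<le> G" and s: "0 \<le> s" and tie: "v 0 0 \<le> C 0 0"
  shows "integral {0..s} (fl 0 G (nb 0)) + fl 0 G (nb 0) s * v 0 (max 0 (G + nb 0 s - s)) \<le> v 0 G"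
proof -
  let ?F = "max 0 (G + nb 0 s - s)"
  have F: "0 \<le> ?F" "?F \<le> G" using G s g_less mult_right_mono[of g 1 s] by (auto simp: nb_def)
  have Cr: "C 0 G = integral {0..s} (fl 0 G (nb 0)) + fl 0 G (nb 0) s * C 0 ?F"
  proof -
    have "max 0 (0 - g * s) = 0" using s g_pos by simp
    then show ?thesis using C_rec[OF order.refl G s] by simp
  qed
  have "v 0 ?F \<le> v 0 G - C 0 G + C 0 ?F"
  proof (rule v_le)
    fix th :: real assume "0 \<le> th"
    then show "V th 0 ?F \<le> v 0 G - C 0 G + C 0 ?F"
      using race_gain_mono[of 0 th ?F G] V_le_v[of th 0 G] F G by linarith
  qed
  moreover have "0 \<le> v 0 G - C 0 G" using C_le_v[of 0 G] G by simp
  moreover have "fl 0 G (nb 0) s \<le> 1" "0 < fl 0 G (nb 0) s" using G s by (auto intro!: fl_le_1 admpath_nb fl_pos)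
  ultimately have "fl 0 G (nb 0) s * (v 0 ?F - C 0 ?F) \<le> 1 * (v 0 G - C 0 G)"
    using C_le_v[of 0 ?F] F by (intro mult_mono) auto
  then show ?thesis using Cr by (simp add: algebra_simps)
qed

text \<open>If a delayed race beats every immediate plan, then by \<open>delay_quasiconvex\<close>
  so does the longest delay, which uses up the lead. A race then beats pacing at lead 0, and
  \<open>early_race_gain\<close> provides a race that does better when started slightly earlier.
  That delay beats both of its ends, against \<open>delay_quasiconvex\<close>.\<close>

lemma coast_V_step:
  assumes y: "0 \<le> y" and G: "0 \<le> G" and s: "0 \<le> s" "g * s \<le> y" and th: "0 \<le> th" and tie: "v 0 0 \<le> C 0 0"
  shows "W th s y G \<le> v y G"
proof (rule ccontr)
  assume "\<not> ?thesis"
  then have gt: "v y G < W th s y G" by simp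
  define T where "T = y / g"
  have T: "0 \<le> T" "g * T = y" "s \<le> T" using y s g_pos by (auto simp: T_def field_simps)
  have gT: "g * T \<le> y" using T by simp
  have q: "W th' u y G \<le> max (V th' y G) (W th' T y G)" if "0 \<le> th'" "0 \<le> u" "u \<le> T" for th' u
    using that T by (intro delay_quasiconvex y G) auto
  have WT: "v y G < W th T y G" using q[OF th s(1) T(3)] gt V_le_v[OF th y G] by (auto simp: max_def split: if_splits)
  have Tpos: "0 < T"
  proof (rule ccontr)
    assume "\<not> 0 < T"
    then have "T = 0" using T by simp
    then show False using WT V_le_v[OF th y G] W_0[OF th] by simp
  qed
  let ?F = "max 0 (G - T)" and ?E = "fl y G (nb y) T"
  have nb0: "nb y u = 0" if "u \<le> T" for u
  proof -
    have "g * u \<le> g * T" using that g_pos by simp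
    then show ?thesis using T by (simp add: nb_def)
  qed
  have Wr: "W th' T y G = integral {0..T} (fl y G (nb y)) + ?E * V th' 0 ?F" if "0 \<le> th'" for th'
    using W_rec[OF that y G T(1) order.refl gT] T(2) by (simp add: W_0 that)
  have Cr: "C y G = integral {0..T} (fl y G (nb y)) + ?E * C 0 ?F"
    using C_rec[OF y G T(1)] T(2) nb0[of T] by simp
  have "?E * C 0 ?F < ?E * V th 0 ?F" using WT Wr[OF th] Cr C_le_v[OF y G] by simp
  then have "C 0 ?F < V th 0 ?F" using fl_pos[of y G "nb y" T] by simp
  then have vF: "C 0 ?F < v 0 ?F" using V_le_v[OF th order.refl, of ?F] by simp
  \<comment> \<open>By \<open>tie\<close> no race beats pacing at lead 0 with the gap closed, so the
    lead runs out while the laggard is still behind.\<close>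
  then have GT: "T < G" using tie by (cases "T < G") (auto simp: max_def split: if_splits)
  then have F: "?F = G - T" "0 < G - T" by auto
  obtain h0 where h0: "0 < h0" "\<And>h. 0 < h \<Longrightarrow> h < h0 \<Longrightarrow> integral {0..h} (fl (g * h) (G - T + h) (nb (g * h)))
      + fl (g * h) (G - T + h) (nb (g * h)) h * v 0 (G - T) < v (g * h) (G - T + h)"
    using early_race_gain[OF F(2)] vF F(1) by metis
  define h where "h = min (h0 / 2) (T / 2)"
  have h: "0 < h" "h < h0" "h < T" using h0 Tpos by (auto simp: h_def)
  let ?S = "integral {0..h} (fl (g * h) (G - T + h) (nb (g * h))) + fl (g * h) (G - T + h) (nb (g * h)) h * v 0 (G - T)"
  have "\<exists>th'\<ge>0. ?S < V th' (g * h) (G - T + h)"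
  proof (rule ccontr)
    assume "\<not> ?thesis"
    then have "v (g * h) (G - T + h) \<le> ?S" by (intro v_le) (auto simp: not_less)
    then show False using h0(2)[OF h(1,2)] by simp
  qed
  then obtain th' where th': "0 \<le> th'" "?S < V th' (g * h) (G - T + h)" by blast
  let ?b = "T - h"
  have b: "0 \<le> ?b" "g * ?b \<le> y" "y - g * ?b = g * h" "max 0 (G - ?b) = G - T + h" "?b \<le> T"
    using h T F g_pos by (auto simp: algebra_simps)
  have Wb: "W th' ?b y G = integral {0..?b} (fl y G (nb y)) + fl y G (nb y) ?b * V th' (g * h) (G - T + h)"
    using W_rec[OF th'(1) y G b(1) order.refl b(2)] b by (simp add: W_0 th')
  have shift: "fl z F' (\<lambda>t. nb y (?b + t) - nb y ?b) t = fl z F' (nb (g * h)) t" if "0 \<le> t" for z F' t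
    using that b nb_shift[of _ y ?b] h g_pos by (intro fl_cong_path) (auto simp: max_def mult_nonneg_nonneg)
  have ish: "integral {0..h} (fl z F' (\<lambda>t. nb y (?b + t) - nb y ?b)) = integral {0..h} (fl z F' (nb (g * h)))" for z F'
    by (intro integral_cong shift) auto
  have comp: "integral {0..T} (fl y G (nb y)) + ?E * X = integral {0..?b} (fl y G (nb y))
      + fl y G (nb y) ?b * (integral {0..h} (fl (g * h) (G - T + h) (nb (g * h))) + fl (g * h) (G - T + h) (nb (g * h)) h * X)" for X
    using fl_integral_add[OF admpath_nb[OF y] G b(1), of h y] fl_add[OF admpath_nb[OF y] G b(1), of h y] h nb0[of ?b]
      b shift[of h] ish by (simp add: algebra_simps)
  have big: "integral {0..T} (fl y G (nb y)) + ?E * v 0 (G - T) < W th' ?b y G"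
    unfolding comp Wb using th'(2) fl_pos[of y G "nb y" ?b] by simp
  have "W th' T y G \<le> integral {0..T} (fl y G (nb y)) + ?E * v 0 (G - T)"
    unfolding Wr[OF th'(1)] F(1) using V_le_v[OF th'(1) order.refl, of "G - T"] F(2) fl_pos[of y G "nb y" T]
    by (intro add_mono mult_left_mono) auto
  moreover have "W th T y G \<le> integral {0..T} (fl y G (nb y)) + ?E * v 0 (G - T)"
    unfolding Wr[OF th] F(1) using V_le_v[OF th order.refl, of "G - T"] F(2) fl_pos[of y G "nb y" T]
    by (intro add_mono mult_left_mono) auto
  ultimately show False using big q[OF th'(1) b(1,5)] WT V_le_v[OF th'(1) y G] by (auto simp: max_def split: if_splits)
qed

lemma coast_step:
  assumes y: "0 \<le> y" and G: "0 \<le> G" and s: "0 \<le> s" "g * s \<le> y" and tie: "v 0 0 \<le> C 0 0"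
  shows "integral {0..s} (fl y G (nb y)) + fl y G (nb y) s * v (y - g * s) (max 0 (G - s)) \<le> v y G"
proof -
  let ?E = "fl y G (nb y) s" and ?I = "integral {0..s} (fl y G (nb y))"
  have E: "0 < ?E" by (rule fl_pos)
  have "v (y - g * s) (max 0 (G - s)) \<le> (v y G - ?I) / ?E"
  proof (rule v_le)
    fix th :: real assume th: "0 \<le> th"
    have "?I + ?E * V th (y - g * s) (max 0 (G - s)) \<le> v y G"
      using coast_V_step[OF y G s th tie] W_rec[OF th y G s(1) order.refl s(2)] by (simp add: W_0 th)
    then show "V th (y - g * s) (max 0 (G - s)) \<le> (v y G - ?I) / ?E" using E by (simp add: field_simps)
  qed
  then show ?thesis using E by (simp add: field_simps)
qed

lemma base_step:
  assumes y: "0 \<le> y" and G: "0 \<le> G" and s: "0 \<le> s" and tie: "v 0 0 \<le> C 0 0"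
  shows "integral {0..s} (fl y G (nb y)) + fl y G (nb y) s * v (max 0 (y - g * s)) (max 0 (G + nb y s - s)) \<le> v y G"
proof (cases "g * s \<le> y")
  case True
  then show ?thesis using coast_step[OF y G s True tie] by (simp add: nb_def)
next
  case False
  define T where "T = y / g"
  have T: "0 \<le> T" "g * T = y" "T \<le> s" using y s g_pos False by (auto simp: T_def field_simps)
  let ?F = "max 0 (G - T)"
  have nbT: "nb y T = 0" using T by (simp add: nb_def)
  have sh: "nb y (T + t) - nb y T = nb 0 t" if "0 \<le> t" for t
    using nb_shift[OF that, of y T] T by simp
  have nbs: "nb y s = nb 0 (s - T)" using sh[of "s - T"] nbT T by simp
  have fs: "fl 0 ?F (\<lambda>t. nb y (T + t) - nb y T) t = fl 0 ?F (nb 0) t" if "0 \<le> t" for t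
    using sh that by (intro fl_cong_path) auto
  have isx: "integral {0..s - T} (fl 0 ?F (\<lambda>t. nb y (T + t) - nb y T)) = integral {0..s - T} (fl 0 ?F (nb 0))"
    by (intro integral_cong fs) auto
  have g2: "max 0 (G + nb y s - s) = max 0 (?F + nb 0 (s - T) - (s - T))"
    using nbs g_pos T g_less mult_right_mono[of g 1 "s - T"] by (auto simp: nb_def max_def)
  have y2: "max 0 (y - g * s) = 0" using False by simp
  have "integral {0..s} (fl y G (nb y)) + fl y G (nb y) s * v (max 0 (y - g * s)) (max 0 (G + nb y s - s))
    = integral {0..T} (fl y G (nb y)) + fl y G (nb y) T *
      (integral {0..s - T} (fl 0 ?F (nb 0)) + fl 0 ?F (nb 0) (s - T) * v 0 (max 0 (?F + nb 0 (s - T) - (s - T))))"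
    using fl_integral_add[OF admpath_nb[OF y] G T(1), of "s - T" y] fl_add[OF admpath_nb[OF y] G T(1), of "s - T" y]
      T nbT fs[of "s - T"] isx unfolding g2 y2 by (simp add: algebra_simps)
  also have "\<dots> \<le> integral {0..T} (fl y G (nb y)) + fl y G (nb y) T * v 0 ?F"
    using pace_step[of ?F "s - T", OF _ _ tie] T fl_pos[of y G "nb y" T] by (intro add_left_mono mult_left_mono) auto
  also have "\<dots> \<le> v y G" using coast_step[OF y G T(1) _ tie] T by simp
  finally show ?thesis .
qed

lemma race_step:
  assumes y: "0 \<le> y" and G: "0 \<le> G" and s: "0 \<le> s"
  shows "integral {0..s} (e y) + e y s * v (y + (1 - g) * s) G \<le> v y G"
proof -
  have "v (y + (1 - g) * s) G \<le> (v y G - integral {0..s} (e y)) / e y s"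
  proof (rule v_le)
    fix th :: real assume th: "0 \<le> th"
    have "integral {0..s} (e y) + e y s * V th (y + (1 - g) * s) G \<le> v y G"
      using V_rec[OF y G s, of "th + s"] V_le_v[of "th + s" y G] th s y G by simp
    then show "V th (y + (1 - g) * s) G \<le> (v y G - integral {0..s} (e y)) / e y s" using e_pos[of y s] by (simp add: field_simps)
  qed
  then show ?thesis using e_pos[of y s] by (simp add: field_simps)
qed

text \<open>
  A path that is never below the coasting path is compared, on each interval of length
  \<open>\<epsilon>\<close>, with the path that coasts first and then races to the same end point; this changes
  the capability by at most \<open>\<epsilon>\<close>.
\<close>

lemma partial_payoff_step:
  fixes \<epsilon> :: real
  assumes ep: "0 < \<epsilon>"
    and w0: "\<And>y G. 0 \<le> y \<Longrightarrow> 0 \<le> G \<Longrightarrow> 0 \<le> w y G"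
    and base: "\<And>y G s. \<lbrakk>0 \<le> y; 0 \<le> G; 0 \<le> s; c \<or> s \<le> G\<rbrakk> \<Longrightarrow>
      integral {0..s} (fl y G (nb y)) + fl y G (nb y) s * w (max 0 (y - g * s)) (max 0 (G + nb y s - s)) \<le> w y G"
    and race: "\<And>y G s. \<lbrakk>0 \<le> y; 0 \<le> G; 0 \<le> s\<rbrakk> \<Longrightarrow>
      integral {0..s} (e y) + e y s * w (y + (1 - g) * s) G \<le> w y G"
  shows "\<lbrakk>0 \<le> y; 0 \<le> G; admpath m; \<And>t. 0 \<le> t \<Longrightarrow> g * t - y \<le> m t; c \<or> real k * \<epsilon> \<le> G\<rbrakk>
    \<Longrightarrow> integral {0..real k * \<epsilon>} (fl y G m) \<le> exp (al * \<epsilon>) * w y G"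
proof (induction k arbitrary: y G m)
  case 0
  then show ?case using w0 by simp
next
  case (Suc k)
  note y = Suc.prems(1) and G = Suc.prems(2) and m = Suc.prems(3) and lo = Suc.prems(4) and cG = Suc.prems(5)
  have ep0: "0 \<le> \<epsilon>" using ep by simp
  have keps: "0 \<le> real k * \<epsilon>" using ep by simp
  note mD = admpathD[OF m]
  have nbm: "nb y t \<le> m t" if "0 \<le> t" for t using lo[OF that] mD(4)[OF that] by (simp add: nb_def)
  have "continuous_on {0..\<epsilon>} (\<lambda>s. nb y s - s)"
    by (intro continuous_on_diff admpath_cont admpath_nb y continuous_on_id)
  \<comment> \<open>The date at which to switch from the base path to racing so as to end at
    \<open>m \<epsilon>\<close>: \<open>nb y t - t\<close> starts at 0 and is at most
    \<open>m \<epsilon> - \<epsilon>\<close> at the end.\<close>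
  then have "\<exists>s\<ge>0. s \<le> \<epsilon> \<and> nb y s - s = m \<epsilon> - \<epsilon>"
    by (intro IVT2'[of "\<lambda>s. nb y s - s" \<epsilon> "m \<epsilon> - \<epsilon>" 0])
      (use nbm[OF ep0] mD(5)[OF ep0] ep0 y admpath_nb[OF y] in \<open>auto simp: admpathD(1)\<close>)
  then obtain s where s: "0 \<le> s" "s \<le> \<epsilon>" "nb y s - s = m \<epsilon> - \<epsilon>" by blast
  define n where "n t = (if t \<le> s then nb y t else nb y s + (t - s))" for t
  have n: "admpath n"
  proof (rule admpathI)
    fix a b :: real assume ab: "a \<le> b"
    show "n a \<le> n b" using admpathD(2)[OF admpath_nb[OF y]] ab by (auto simp: n_def intro: add_increasing2)
    show "n b \<le> n a + (b - a)" using admpathD(3)[OF admpath_nb[OF y]] ab by (auto simp: n_def) (smt (verit))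
  qed (use s y in \<open>simp add: n_def nb_def\<close>)
  have nm: "n t \<le> m t" "m t \<le> n t + \<epsilon>" if t: "0 \<le> t" "t \<le> \<epsilon>" for t
  proof -
    show "n t \<le> m t"
      using nbm[OF t(1)] mD(3)[OF t(2)] s by (auto simp: n_def)
    have "0 \<le> n t" using admpathD(4)[OF n t(1)] .
    then show "m t \<le> n t + \<epsilon>" using mD(5)[OF t(1)] t by linarith
  qed
  have ne: "n \<epsilon> = m \<epsilon>" using s by (cases "s = \<epsilon>") (auto simp: n_def)
  have Hnm: "H y n t \<le> H y m t" if "0 \<le> t" "t \<le> \<epsilon>" for t
    using n m nm that by (intro H_mono_path lam_mono) auto
  have flnm: "fl y G m t \<le> exp (al * \<epsilon>) * fl y G n t" if t: "0 \<le> t" "t \<le> \<epsilon>" for t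
  proof -
    have "al * m t \<le> al * (n t + \<epsilon>)" using nm[OF t] al_pos by (intro mult_left_mono) auto
    moreover have "be * min t (G + n t) \<le> be * min t (G + m t)" using nm[OF t] be_pos by (intro mult_left_mono) auto
    ultimately show ?thesis using Hnm[OF t] unfolding fl_def exp_add[symmetric] exp_le_cancel_iff by (simp add: algebra_simps)
  qed
  have fle: "fl y G m \<epsilon> \<le> fl y G n \<epsilon>" using Hnm[OF ep0 order.refl] by (simp add: fl_def ne)
  define y1 where "y1 = y + m \<epsilon> - g * \<epsilon>"
  define G1 where "G1 = max 0 (G + m \<epsilon> - \<epsilon>)"
  have y1: "0 \<le> y1" "0 \<le> G1" using lo[OF ep0] by (auto simp: y1_def G1_def)
  have rest: "integral {0..real k * \<epsilon>} (fl y1 G1 (\<lambda>t. m (\<epsilon> + t) - m \<epsilon>)) \<le> exp (al * \<epsilon>) * w y1 G1"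
  proof (rule Suc.IH[OF y1 admpath_shift[OF m]])
    show "g * t - y1 \<le> m (\<epsilon> + t) - m \<epsilon>" if "0 \<le> t" for t
      using lo[of "\<epsilon> + t"] that ep0 by (simp add: y1_def algebra_simps)
    show "c \<or> real k * \<epsilon> \<le> G1" using cG mD(4)[OF ep0] by (auto simp: G1_def algebra_simps)
  qed
  define ys where "ys = max 0 (y - g * s)"
  define Gs where "Gs = max 0 (G + nb y s - s)"
  have ys: "ys = y + nb y s - g * s" using nb_state[OF y, of s] by (simp add: ys_def)
  have nsh: "n (s + t) - n s = t" if "0 \<le> t" for t using that by (cases "t = 0") (auto simp: n_def)
  have nss: "n u = nb y u" if "u \<le> s" for u using that by (simp add: n_def)
  have i1: "integral {0..s} (fl y G n) = integral {0..s} (fl y G (nb y))" and f1: "fl y G n s = fl y G (nb y) s"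
    using nss s by (auto intro!: integral_fl_cong fl_cong_path)
  have i2: "integral {0..\<epsilon> - s} (fl ys Gs (\<lambda>t. n (s + t) - n s)) = integral {0..\<epsilon> - s} (e ys)"
    using nsh s by (intro race_integral) (auto simp: Gs_def)
  have f2: "fl ys Gs (\<lambda>t. n (s + t) - n s) (\<epsilon> - s) = e ys (\<epsilon> - s)"
    using nsh s by (intro fl_race) (auto simp: Gs_def)
  have st1: "ys + (1 - g) * (\<epsilon> - s) = y1" using s(3) by (simp add: ys y1_def algebra_simps)
  have st2: "w y1 G1 = w (ys + (1 - g) * (\<epsilon> - s)) Gs"
  proof -
    have "G1 = Gs" using s(3) by (simp add: G1_def Gs_def algebra_simps)
    then show ?thesis using st1 by simp
  qed
  have key: "integral {0..\<epsilon>} (fl y G n) + fl y G n \<epsilon> * w y1 G1 \<le> w y G"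
  proof -
    have "integral {0..\<epsilon>} (fl y G n) + fl y G n \<epsilon> * w y1 G1
      = integral {0..s} (fl y G (nb y)) + fl y G (nb y) s * (integral {0..\<epsilon> - s} (e ys) + e ys (\<epsilon> - s) * w y1 G1)"
      using fl_integral_add[OF n G s(1), of "\<epsilon> - s" y] fl_add[OF n G s(1), of "\<epsilon> - s" y] s i1 f1 i2 f2 nss[of s]
      by (simp add: ys[symmetric] Gs_def[symmetric] algebra_simps)
    also have "\<dots> \<le> integral {0..s} (fl y G (nb y)) + fl y G (nb y) s * w ys Gs"
      unfolding st2 using s fl_pos[of y G "nb y" s] by (intro add_left_mono mult_left_mono race) (auto simp: ys_def Gs_def)
    also have "\<dots> \<le> w y G"
    proof -
      have "real (Suc k) * \<epsilon> = \<epsilon> + real k * \<epsilon>" by (simp add: distrib_right)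
      then have "c \<or> s \<le> G" using s(2) cG keps by linarith
      then show ?thesis unfolding ys_def Gs_def by (intro base y G s)
    qed
    finally show ?thesis .
  qed
  have "integral {0..real (Suc k) * \<epsilon>} (fl y G m) = integral {0..\<epsilon>} (fl y G m)
      + fl y G m \<epsilon> * integral {0..real k * \<epsilon>} (fl y1 G1 (\<lambda>t. m (\<epsilon> + t) - m \<epsilon>))"
    using fl_integral_add[OF m G ep0 keps, of y] by (simp add: y1_def G1_def algebra_simps)
  also have "\<dots> \<le> integral {0..\<epsilon>} (\<lambda>t. exp (al * \<epsilon>) * fl y G n t) + fl y G n \<epsilon> * (exp (al * \<epsilon>) * w y1 G1)"
  proof (intro add_mono mult_mono fle rest)
    show "integral {0..\<epsilon>} (fl y G m) \<le> integral {0..\<epsilon>} (\<lambda>t. exp (al * \<epsilon>) * fl y G n t)"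
      by (intro integral_le fl_integrable integrable_on_mult_right m n flnm) auto
  qed (use fl_pos[of y G n \<epsilon>] in \<open>auto intro!: integral_fl_nonneg admpath_shift m\<close>)
  also have "\<dots> = exp (al * \<epsilon>) * (integral {0..\<epsilon>} (fl y G n) + fl y G n \<epsilon> * w y1 G1)" by (simp add: algebra_simps)
  also have "\<dots> \<le> exp (al * \<epsilon>) * w y G" using key by (intro mult_left_mono) auto
  finally show ?case .
qed

text \<open>\<open>w\<close> is a supersolution: neither the base path nor a race can raise it, and
  short pieces of the two approximate any path. With \<open>c = False\<close> the claim concerns
  horizons within the gap only, before the laggard can be level; this form is used against an
  opponent that races forever.\<close>

lemma partial_payoff_le:
  assumes w0: "\<And>y G. 0 \<le> y \<Longrightarrow> 0 \<le> G \<Longrightarrow> 0 \<le> w y G"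
    and base: "\<And>y G s. \<lbrakk>0 \<le> y; 0 \<le> G; 0 \<le> s; c \<or> s \<le> G\<rbrakk> \<Longrightarrow>
      integral {0..s} (fl y G (nb y)) + fl y G (nb y) s * w (max 0 (y - g * s)) (max 0 (G + nb y s - s)) \<le> w y G"
    and race: "\<And>y G s. \<lbrakk>0 \<le> y; 0 \<le> G; 0 \<le> s\<rbrakk> \<Longrightarrow>
      integral {0..s} (e y) + e y s * w (y + (1 - g) * s) G \<le> w y G"
    and y: "0 \<le> y" and G: "0 \<le> G" and m: "admpath m" and T: "0 \<le> T" "c \<or> T \<le> G"
  shows "integral {0..T} (fl y G m) \<le> w y G"
proof (cases "T = 0")
  case True
  then show ?thesis using w0 y G by simp
next
  case False
  \<comment> \<open>Lifting the path to \<open>nb y\<close> removes negative leads, adds no hazard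
    because the lifted lead is 0, and adds capability worth at least \<open>al - be\<close> per
    unit.\<close>
  define n where "n t = max (m t) (nb y t)" for t
  have n: "admpath n" unfolding n_def by (intro admpath_max m admpath_nb y)
  have lo: "g * t - y \<le> n t" for t by (simp add: n_def nb_def)
  have flmn: "fl y G m t \<le> fl y G n t" if t: "0 \<le> t" for t
  proof -
    have mn: "m t \<le> n t" by (simp add: n_def)
    have "H y n t \<le> H y m t"
    proof (intro H_mono_path n m)
      fix u :: real assume "0 \<le> u"
      then have "0 \<le> m u" using admpathD(4)[OF m] by simp
      then show "lam (y + n u - g * u) \<le> lam (y + m u - g * u)"
        using lam_nonpos[of "y + n u - g * u"] lam_nonneg[of "y + m u - g * u"]
        by (cases "m u \<le> g * u - y") (auto simp: n_def nb_def max_def)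
    qed
    moreover have "al * m t - be * min t (G + m t) \<le> al * n t - be * min t (G + n t)"
    proof -
      have "min t (G + n t) \<le> min t (G + m t) + (n t - m t)" using mn by linarith
      then have "be * min t (G + n t) \<le> be * (min t (G + m t) + (n t - m t))" using be_pos by (intro mult_left_mono) auto
      moreover have "be * (n t - m t) \<le> al * (n t - m t)" using mn be_less by (intro mult_right_mono) auto
      ultimately show ?thesis by (simp add: algebra_simps)
    qed
    ultimately show ?thesis by (simp add: fl_def)
  qed
  have "integral {0..T} (fl y G n) \<le> exp (al * (T / real (Suc k))) * w y G" for k
  proof -
    have "real (Suc k) * (T / real (Suc k)) = T" by (simp del: of_nat_Suc)
    then show ?thesis
      using partial_payoff_step[where c = c and k = "Suc k" and \<epsilon> = "T / real (Suc k)", OF _ w0 base race y G n lo] T False by simp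
  qed
  moreover have "(\<lambda>k. exp (al * (T / real (Suc k))) * w y G) \<longlonglongrightarrow> exp (al * 0) * w y G"
    by (intro tendsto_intros) (rule LIMSEQ_Suc[OF lim_const_over_n])
  ultimately have "integral {0..T} (fl y G n) \<le> exp (al * 0) * w y G" by (intro LIMSEQ_le_const) auto
  moreover have "integral {0..T} (fl y G m) \<le> integral {0..T} (fl y G n)"
    using flmn by (intro integral_le fl_integrable m n) auto
  ultimately show ?thesis by simp
qed

theorem race_then_coast_optimal:
  assumes tie: "v 0 0 \<le> C 0 0" and y: "0 \<le> y" and G: "0 \<le> G" and m: "admpath m"
  shows "J y G m \<le> v y G"
proof (rule J_le_of_partial[OF m G])
  fix T :: real assume "0 \<le> T"
  then show "integral {0..T} (fl y G m) \<le> v y G"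
    by (intro partial_payoff_le[where c = True] v_nonneg base_step race_step tie y G m) auto
qed


section \<open>The tied race\<close>

lemma C_00: "C 0 0 = 1 / rho"
proof -
  have "fl 0 0 (nb 0) t = exp (- rho * t)" if "0 \<le> t" for t
  proof -
    have t: "0 \<le> g * t" "g * t \<le> t" using that g_pos g_less mult_right_mono[of g 1 t] by auto
    have "fl 0 0 (nb 0) t = exp (- r * t - (Lam 0 - Lam (0 - g * t)) / g + al * (g * t) - be * (g * t))"
      unfolding fl_nb[OF that] using t by (simp add: nb_def)
    also have "\<dots> = exp (- rho * t)" using t by (simp add: Lam_nonpos rho_def algebra_simps)
    finally show ?thesis .
  qed
  then have "(\<integral>\<^sup>+ t. ennreal (fl 0 0 (nb 0) t) * indicator {0..} t \<partial>lborel)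
      = (\<integral>\<^sup>+ t. ennreal (exp (- rho * t)) * indicator {0..} t \<partial>lborel)"
    by (intro nn_integral_cong) (auto simp: indicator_def)
  then show ?thesis unfolding C_def J_def using nn_exp[OF rho_pos] rho_pos by simp
qed

lemma integral_exp: "(c::real) \<noteq> 0 \<Longrightarrow> 0 \<le> s \<Longrightarrow> integral {0..s} (\<lambda>t. exp (- c * t)) = (1 - exp (- c * s)) / c"
proof -
  assume c: "c \<noteq> 0" "0 \<le> s"
  have "((\<lambda>t. exp (- c * t)) has_integral (- exp (- c * s) / c - (- exp (- c * 0) / c))) {0..s}"
    by (rule fundamental_theorem_of_calculus[where f = "\<lambda>t. - exp (- c * t) / c"])
      (use c in \<open>auto intro!: derivative_eq_intros simp flip: has_real_derivative_iff_has_vector_derivative\<close>)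
  then show ?thesis using c by (simp add: integral_unique field_simps)
qed

lemma fl_pace: 
  assumes "0 \<le> t" "t \<le> G + g * t" shows "fl 0 G (nb 0) t = exp (- B * t)"
proof -
  have "0 \<le> g * t" using assms g_pos by simp
  then show ?thesis unfolding fl_nb[OF assms(1)] using assms by (simp add: nb_def Lam_nonpos B_def min_def algebra_simps)
qed

lemma C_0: 
  assumes G: "0 \<le> G" shows "C 0 G = 1 / B + (1 / rho - 1 / B) * exp (- B * G / (1 - g))"
proof -
  define s where "s = G / (1 - g)"
  have s: "0 \<le> s" "G = (1 - g) * s" using G g_less by (auto simp: s_def)
  have gs: "0 \<le> g * s" using s g_pos by simp
  have fl: "fl 0 G (nb 0) t = exp (- B * t)" if "0 \<le> t" "t \<le> s" for t
    using that s mult_left_mono[of t s "1 - g"] g_less by (intro fl_pace) (auto simp: algebra_simps)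
  have "max 0 (G + nb 0 s - s) = 0" "max 0 (0 - g * s) = 0" using s gs by (auto simp: nb_def algebra_simps)
  then have "C 0 G = integral {0..s} (fl 0 G (nb 0)) + fl 0 G (nb 0) s * C 0 0"
    using C_rec[OF order.refl G s(1)] by simp
  also have "integral {0..s} (fl 0 G (nb 0)) = integral {0..s} (\<lambda>t. exp (- B * t))"
    by (intro integral_cong fl) auto
  also have "\<dots> = (1 - exp (- B * s)) / B" using B_pos s by (intro integral_exp) auto
  finally show ?thesis using fl[OF s(1) order.refl] by (simp add: C_00 s_def diff_divide_distrib right_diff_distrib left_diff_distrib mult.commute)
qed

section \<open>Integrating factors for racing and for tied coasting\<close>

definition "A y = exp ((de * y + Lam y) / (1 - g))"

lemma A_pos: "0 < A y" by (simp add: A_def)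

text \<open>\<open>A\<close> is the integrating factor of the racing value as a function of the
  lead: discounting along a race depends on its two end points only.\<close>

lemma e_A: "e y t = A y / A (y + (1 - g) * t)"
proof -
  have "- de * t - (Lam (y + (1 - g) * t) - Lam y) / (1 - g)
      = (de * y + Lam y) / (1 - g) - (de * (y + (1 - g) * t) + Lam (y + (1 - g) * t)) / (1 - g)"
  proof -
    have "- de * t - (L - M) / k = (de * y + M) / k - (de * (y + k * t) + L) / k" if "k \<noteq> 0" for k L M
      using that by (simp add: field_simps)
    from this[of "1 - g"] show ?thesis using g_less by simp
  qed
  then show ?thesis by (simp add: e_def A_def exp_diff[symmetric])
qed

lemma A_cont: "continuous_on S A"
  unfolding A_def[abs_def] using g_less by (intro continuous_intros) auto

lemma A_deriv: "y \<noteq> 0 \<Longrightarrow> (A has_real_derivative (de + lam y) / (1 - g) * A y) (at y)"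
  unfolding A_def[abs_def] using g_less
  by (auto intro!: derivative_eq_intros Lam_deriv)

lemma A_ge: "0 \<le> y \<Longrightarrow> de * y / (1 - g) \<le> A y"
proof -
  assume "0 \<le> y"
  have "de * y / (1 - g) \<le> (de * y + Lam y) / (1 - g)"
    using Lam_nonneg[of y] g_less by (intro divide_right_mono) auto
  then have "de * y / (1 - g) \<le> 1 + (de * y + Lam y) / (1 - g)" by simp
  also have "\<dots> \<le> A y" unfolding A_def by (rule exp_ge_add_one_self)
  finally show ?thesis .
qed

lemma inv_A_tendsto: "((\<lambda>y. K / A y) \<longlongrightarrow> 0) at_top"
proof -
  have "filterlim (\<lambda>y. de * y / (1 - g)) at_top at_top" using de_pos g_less by real_asymp
  then have "filterlim A at_top at_top"
    by (rule filterlim_at_top_mono) (auto intro!: eventually_at_top_linorderI[of 0] A_ge)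
  then show ?thesis by (intro real_tendsto_divide_at_top[OF tendsto_const])
qed

lemma R_over_A: "y \<le> z \<Longrightarrow> R y / A y = integral {y..z} (\<lambda>x. 1 / A x) / (1 - g) + R z / A z"
proof -
  assume yz: "y \<le> z"
  define s where "s = (z - y) / (1 - g)"
  have s: "0 \<le> s" "y + (1 - g) * s = z" using yz g_less by (auto simp: s_def)
  have cont: "continuous_on S (\<lambda>x. 1 / A x)" for S
    using A_pos by (intro continuous_intros A_cont) (auto simp: less_imp_neq[symmetric])
  have "((\<lambda>x. 1 / A x) has_integral integral {y..z} (\<lambda>x. 1 / A x)) (cbox y z)"
    using integrable_integral[OF integrable_continuous_interval[OF cont]] by simp
  from has_integral_affinity'[OF this, of "1 - g" y]
  have "((\<lambda>t. 1 / A ((1 - g) * t + y)) has_integral integral {y..z} (\<lambda>x. 1 / A x) / (1 - g)) {0..s}"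
    using g_less by (simp add: s_def divide_inverse mult.commute)
  then have "((\<lambda>t. A y * (1 / A ((1 - g) * t + y))) has_integral A y * (integral {y..z} (\<lambda>x. 1 / A x) / (1 - g))) {0..s}"
    by (rule has_integral_mult_right)
  moreover have "(\<lambda>t. A y * (1 / A ((1 - g) * t + y))) = e y" by (auto simp: e_A add.commute)
  ultimately have "integral {0..s} (e y) = A y * (integral {y..z} (\<lambda>x. 1 / A x) / (1 - g))"
    by (simp add: integral_unique)
  then show ?thesis using R_rec[OF s(1), of y] A_pos[of y] unfolding e_A s(2) by (simp add: field_simps)
qed

lemma R_over_A_deriv: "((\<lambda>y. R y / A y) has_real_derivative - 1 / ((1 - g) * A y)) (at y)"
proof -
  have cont: "continuous_on S (\<lambda>x. 1 / A x)" for S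
    using A_pos by (intro continuous_intros A_cont) (auto simp: less_imp_neq[symmetric])
  have "((\<lambda>u. integral {u..y + 1} (\<lambda>x. 1 / A x)) has_real_derivative - (1 / A y)) (at y within {y - 1..y + 1})"
    by (rule integral_has_real_derivative'[OF cont]) auto
  then have "((\<lambda>u. integral {u..y + 1} (\<lambda>x. 1 / A x)) has_real_derivative - (1 / A y)) (at y within {y - 1<..<y + 1})"
    by (rule DERIV_subset) auto
  then have "((\<lambda>u. integral {u..y + 1} (\<lambda>x. 1 / A x)) has_real_derivative - (1 / A y)) (at y)"
    using at_within_open[of y "{y - 1<..<y + 1}"] by simp
  then have "((\<lambda>u. integral {u..y + 1} (\<lambda>x. 1 / A x) / (1 - g) + R (y + 1) / A (y + 1)) has_real_derivative - (1 / A y) / (1 - g) + 0) (at y)"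
    by (intro DERIV_add DERIV_cdivide DERIV_const)
  then have "((\<lambda>y. R y / A y) has_real_derivative - (1 / A y) / (1 - g) + 0) (at y)"
  proof (rule has_field_derivative_transform_within_open[of _ _ _ "{y - 1<..<y + 1}"])
    fix u assume "u \<in> {y - 1<..<y + 1}"
    then show "integral {u..y + 1} (\<lambda>x. 1 / A x) / (1 - g) + R (y + 1) / A (y + 1) = R u / A u"
      using R_over_A[of u "y + 1"] by simp
  qed auto
  then show ?thesis by (simp add: mult.commute)
qed

lemma R_eq: "A y * (R y / A y) = R y" using A_pos[of y] by simp

lemma R_cont: "continuous_on S R"
proof -
  have "continuous_on S (\<lambda>y. A y * (R y / A y))"
    by (intro continuous_on_mult A_cont continuous_at_imp_continuous_on ballI DERIV_isCont[OF R_over_A_deriv])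
  then show ?thesis by (simp only: R_eq)
qed

lemma R_deriv: "y \<noteq> 0 \<Longrightarrow> (R has_real_derivative ((de + lam y) * R y - 1) / (1 - g)) (at y)"
proof -
  assume y: "y \<noteq> 0"
  have "((\<lambda>y. A y * (R y / A y)) has_real_derivative
      (de + lam y) / (1 - g) * A y * (R y / A y) + - 1 / ((1 - g) * A y) * A y) (at y)"
    by (rule DERIV_mult[OF A_deriv[OF y] R_over_A_deriv])
  moreover have "(\<lambda>y. A y * (R y / A y)) = R" by (simp only: R_eq)
  moreover have "(de + lam y) / (1 - g) * A y * (R y / A y) + - 1 / ((1 - g) * A y) * A y = ((de + lam y) * R y - 1) / (1 - g)"
  proof -
    have "(de + lam y) / k * A y * (R y / A y) + - 1 / (k * A y) * A y = ((de + lam y) * R y - 1) / k" if "k \<noteq> 0" for k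
      using that A_pos[of y] by (simp add: field_simps)
    from this[of "1 - g"] show ?thesis using g_less by simp
  qed
  ultimately show ?thesis by simp
qed

definition "Ep y = exp ((r * y + Lam y) / g)"
definition "P y = C y 0"

lemma Ep_pos: "0 < Ep y" by (simp add: Ep_def)

lemma Ep_cont: "continuous_on S Ep"
  unfolding Ep_def[abs_def] using g_pos by (intro continuous_intros) auto

lemma Ep_deriv: "y \<noteq> 0 \<Longrightarrow> (Ep has_real_derivative (r + lam y) / g * Ep y) (at y)"
  unfolding Ep_def[abs_def] using g_pos
  by (auto intro!: derivative_eq_intros Lam_deriv simp: field_simps)

text \<open>\<open>Ep\<close> is the integrating factor of tied coasting. Substituting the remaining
  lead for the date turns the flow into an integral of \<open>Ep\<close>, with terminal value
  \<open>1 / rho\<close> at lead 0.\<close>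

lemma Ep_P: 
  assumes y: "0 \<le> y" shows "Ep y * P y = 1 / rho + integral {0..y} Ep / g"
proof -
  define s where "s = y / g"
  have s: "0 \<le> s" "g * s = y" using y g_pos by (auto simp: s_def)
  have gs: "g * t \<le> y" if "t \<le> s" for t using that s g_pos mult_left_mono[of t s g] by simp
  have fl: "fl y 0 (nb y) t = Ep ((- g) * t + y) / Ep y" if "0 \<le> t" "t \<le> s" for t
  proof -
    have "fl y 0 (nb y) t = exp (- r * t - (Lam y - Lam (y - g * t)) / g)"
      unfolding fl_nb[OF that(1)] using gs[OF that(2)] that by (simp add: nb_def)
    also have "- r * t - (Lam y - Lam (y - g * t)) / g = (r * (y - g * t) + Lam (y - g * t)) / g - (r * y + Lam y) / g"
      using g_pos by (simp add: field_simps)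
    finally show ?thesis by (simp add: Ep_def exp_diff[symmetric])
  qed
  have "(Ep has_integral integral {0..y} Ep) (cbox 0 y)"
    using integrable_integral[OF integrable_continuous_interval[OF Ep_cont]] by simp
  from has_integral_affinity'[OF this g_pos, of 0]
  have "((\<lambda>t. Ep (g * t)) has_integral integral {0..y} Ep / g) {0..s}"
    by (simp add: s_def divide_inverse mult.commute)
  then have "((\<lambda>t. Ep (g * (- t))) has_integral integral {0..y} Ep / g) {- s..- 0}"
    by (rule has_integral_reflect_lemma_real)
  from has_integral_shift_real_ivl[OF this, of "- s"]
  have "((\<lambda>t. Ep ((- g) * t + y)) has_integral integral {0..y} Ep / g) {0..s}"
    using s by (simp add: algebra_simps)
  then have "((\<lambda>t. Ep ((- g) * t + y) / Ep y) has_integral (integral {0..y} Ep / g) / Ep y) {0..s}"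
    by (rule has_integral_divide)
  then have "integral {0..s} (\<lambda>t. Ep ((- g) * t + y) / Ep y) = (integral {0..y} Ep / g) / Ep y" by (rule integral_unique)
  moreover have "integral {0..s} (fl y 0 (nb y)) = integral {0..s} (\<lambda>t. Ep ((- g) * t + y) / Ep y)"
    by (intro integral_cong fl) auto
  moreover have "P y = integral {0..s} (fl y 0 (nb y)) + fl y 0 (nb y) s * C 0 0"
    using C_rec[OF y order.refl s(1)] s by (simp add: P_def nb_def)
  moreover have "fl y 0 (nb y) s = 1 / Ep y" using fl[OF s(1) order.refl] s by (simp add: Ep_def Lam_nonpos)
  ultimately show ?thesis using Ep_pos[of y] by (simp add: C_00 field_simps)
qed

lemma Ep_P_deriv: 
  assumes "0 < y" shows "((\<lambda>y. Ep y * P y) has_real_derivative Ep y / g) (at y)"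
proof -
  have "((\<lambda>u. integral {0..u} Ep) has_real_derivative Ep y) (at y within {0..y + 1})"
    by (rule integral_has_real_derivative[OF Ep_cont]) (use assms in auto)
  then have "((\<lambda>u. integral {0..u} Ep) has_real_derivative Ep y) (at y within {0<..<y + 1})"
    by (rule DERIV_subset) auto
  then have "((\<lambda>u. integral {0..u} Ep) has_real_derivative Ep y) (at y)"
    using at_within_open[of y "{0<..<y + 1}"] assms by simp
  then have "((\<lambda>u. 1 / rho + integral {0..u} Ep / g) has_real_derivative 0 + Ep y / g) (at y)"
    by (intro DERIV_add DERIV_cdivide DERIV_const)
  then have "((\<lambda>y. Ep y * P y) has_real_derivative 0 + Ep y / g) (at y)"
    by (rule has_field_derivative_transform_within_open[of _ _ _ "{0<..}"]) (use assms in \<open>auto simp: Ep_P\<close>)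
  then show ?thesis by simp
qed

lemma P_deriv: 
  assumes y: "0 < y" shows "(P has_real_derivative (1 - (r + lam y) * P y) / g) (at y)"
proof -
  have "((\<lambda>y. (Ep y * P y) / Ep y) has_real_derivative
      (Ep y / g * Ep y - Ep y * P y * ((r + lam y) / g * Ep y)) / (Ep y * Ep y)) (at y)"
    using Ep_pos[of y] y by (intro DERIV_divide[OF Ep_P_deriv Ep_deriv]) auto
  moreover have "(\<lambda>y. (Ep y * P y) / Ep y) = P" using Ep_pos by (auto simp: less_imp_neq[symmetric])
  moreover have "(Ep y / g * Ep y - Ep y * P y * ((r + lam y) / g * Ep y)) / (Ep y * Ep y) = (1 - (r + lam y) * P y) / g"
    using Ep_pos[of y] g_pos by (simp add: field_simps)
  ultimately show ?thesis by simp
qed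

lemma P_antimono: "0 \<le> x \<Longrightarrow> x \<le> y \<Longrightarrow> P y \<le> P x"
  unfolding P_def by (rule C_antimono) auto

lemma P_pos: "0 \<le> y \<Longrightarrow> 0 < P y" unfolding P_def by (rule C_pos) auto

lemma P_cont: "continuous_on {0..} P"
proof -
  have "continuous_on {0..b} (\<lambda>y. (1 / rho + integral {0..y} Ep / g) / Ep y)" for b
    using Ep_pos g_pos by (intro continuous_intros Ep_cont indefinite_integral_continuous_1 integrable_continuous_interval)
      (auto simp: less_imp_neq[symmetric])
  then have c: "continuous_on {0..b} P" for b
    by (rule continuous_on_eq) (use Ep_P Ep_pos in \<open>auto simp: field_simps less_imp_neq[symmetric]\<close>)
  have "continuous (at x within {0..}) P" if "0 \<le> x" for x
  proof -
    have "continuous (at x within {0..x + 1}) P" using that c[of "x + 1"] by (auto simp: continuous_on_eq_continuous_within)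
    moreover have "at x within {0..} = at x within {0..x + 1}"
      by (rule at_within_nhd[of x "{..<x + 1}" "{0..}" "{0..x+1}"]) auto
    ultimately show ?thesis by simp
  qed
  then show ?thesis by (auto simp: continuous_on_eq_continuous_within)
qed

lemma lam'_nonneg: "0 < x \<Longrightarrow> 0 \<le> lam' x"
proof (rule ccontr)
  assume x: "0 < x" "\<not> 0 \<le> lam' x"
  then obtain d where d: "d > 0" "\<And>h. 0 < h \<Longrightarrow> h < d \<Longrightarrow> lam (x + h) < lam x"
    using DERIV_neg_dec_right[OF lam_deriv[OF x(1)]] by force
  show False using d(2)[of "d/2"] d(1) lam_mono[of x "x + d/2"] by auto
qed

text \<open>\<open>u0\<close> is the advantage of tied coasting over racing, put on a common scale
  by \<open>A\<close>; \<open>q\<close> is minus its derivative up to a positive factor, see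
  \<open>u0_deriv\<close>.\<close>

definition "q y = (rho + lam y) * P y - 1"
definition "u0 y = (P y - R y) / A y"

lemma Ep_q_deriv:
  assumes y: "0 < y" shows "((\<lambda>y. Ep y * q y) has_real_derivative Ep y * (lam' y * P y - (al - be))) (at y)"
proof -
  have "((\<lambda>y. (rho + lam y) * (Ep y * P y) - Ep y) has_real_derivative
     (lam' y * (Ep y * P y) + Ep y / g * (rho + lam y)) - (r + lam y) / g * Ep y) (at y)"
  proof (intro DERIV_diff Ep_deriv DERIV_mult Ep_P_deriv y)
    show "((\<lambda>y. rho + lam y) has_real_derivative lam' y) (at y)"
      using y by (auto intro!: derivative_eq_intros lam_deriv)
  qed (use y in simp)
  moreover have "(\<lambda>y. (rho + lam y) * (Ep y * P y) - Ep y) = (\<lambda>y. Ep y * q y)"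
    by (auto simp: q_def algebra_simps)
  moreover have "(lam' y * (Ep y * P y) + Ep y / g * (rho + lam y)) - (r + lam y) / g * Ep y = Ep y * (lam' y * P y - (al - be))"
    using g_pos by (simp add: rho_def field_simps)
  ultimately show ?thesis by simp
qed

lemma u0_deriv:
  assumes y: "0 < y" shows "(u0 has_real_derivative - q y / (g * (1 - g) * A y)) (at y)"
proof -
  have "((\<lambda>y. P y / A y - R y / A y) has_real_derivative
    ((1 - (r + lam y) * P y) / g * A y - P y * ((de + lam y) / (1 - g) * A y)) / (A y * A y) - - 1 / ((1 - g) * A y)) (at y)"
    using y A_pos[of y] by (intro DERIV_diff R_over_A_deriv DERIV_divide P_deriv A_deriv) auto
  moreover have "(\<lambda>y. P y / A y - R y / A y) = u0" by (auto simp: u0_def diff_divide_distrib)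
  moreover have "((1 - (r + lam y) * P y) / g * A y - P y * ((de + lam y) / (1 - g) * A y)) / (A y * A y) - - 1 / ((1 - g) * A y)
    = - q y / (g * (1 - g) * A y)"
  proof -
    have "(1 - g) * (1 - (r + lam y) * P y) - g * (P y * (de + lam y)) + g = - q y"
      by (simp add: q_def rho_def de_def algebra_simps)
    moreover have "((1 - (r + lam y) * P y) / g * A y - P y * ((de + lam y) / (1 - g) * A y)) / (A y * A y) - - 1 / ((1 - g) * A y)
      = ((1 - g) * (1 - (r + lam y) * P y) - g * (P y * (de + lam y)) + g) / (g * (1 - g) * A y)"
    proof -
      have "(x / g * a - p * (w / (1 - g) * a)) / (a * a) - - 1 / ((1 - g) * a)
        = ((1 - g) * x - g * (p * w) + g) / (g * (1 - g) * a)" if "0 < a" for x a p w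
      proof -
        have "(x / g * a - p * (w / k * a)) / (a * a) - - 1 / (k * a) = (k * x - g * (p * w) + g) / (g * k * a)"
          if "k \<noteq> 0" for k
          using that \<open>0 < a\<close> g_pos by (simp add: field_simps)
        from this[of "1 - g"] show ?thesis using g_less by simp
      qed
      then show ?thesis using A_pos by blast
    qed
    ultimately show ?thesis by simp
  qed
  ultimately show ?thesis by simp
qed

lemma u0_cont: "continuous_on {0..} u0"
  unfolding u0_def[abs_def] using A_pos
  by (intro continuous_intros P_cont R_cont A_cont) (auto simp: less_imp_neq[symmetric])

lemma lam'_P_antimono: "0 < x \<Longrightarrow> x \<le> y \<Longrightarrow> lam' y * P y \<le> lam' x * P x"
  using lam'_anti[of x y] P_antimono[of x y] lam'_nonneg[of x] P_pos[of y] by (intro mult_mono) auto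

text \<open>\<open>lam' y * P y\<close> is antitone, so by \<open>Ep_q_deriv\<close> the function
  \<open>Ep * q\<close> first rises and then falls. It starts from a nonnegative limit at 0, hence
  can become negative only while falling and then stays negative.\<close>

lemma q_single_crossing:
  assumes x: "0 < x" "x \<le> y" and qx: "q x < 0" shows "q y < 0"
proof -
  have "lam' x * P x < al - be"
  proof (rule ccontr)
    assume k: "\<not> ?thesis"
    \<comment> \<open>\<open>q\<close> inherits the jump of the hazard at 0, so the limit is taken
      in the continuous lower bound with \<open>lam\<close> dropped.\<close>
    have "Ep z * (rho * P z - 1) \<le> Ep x * q x" if z: "0 < z" "z \<le> x" for z
    proof -
      have "Ep z * q z \<le> Ep x * q x"
      proof (rule DERIV_nonneg_imp_nondecreasing[OF z(2)])
        fix t assume t: "z \<le> t" "t \<le> x"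
        have "0 \<le> Ep t * (lam' t * P t - (al - be))"
          using k lam'_P_antimono[of t x] t z Ep_pos[of t] by simp
        then show "\<exists>D. ((\<lambda>y. Ep y * q y) has_real_derivative D) (at t) \<and> 0 \<le> D"
          using Ep_q_deriv[of t] t z by auto
      qed
      moreover have "Ep z * (rho * P z - 1) \<le> Ep z * q z"
        using Ep_pos[of z] lam_nonneg[of z] P_pos[of z] z by (auto simp: q_def algebra_simps)
      ultimately show ?thesis by linarith
    qed
    moreover have "((\<lambda>z. Ep z * (rho * P z - 1)) \<longlongrightarrow> Ep 0 * (rho * P 0 - 1)) (at 0 within {0..})"
    proof -
      have "continuous_on {0..} (\<lambda>z. Ep z * (rho * P z - 1))" by (intro continuous_intros Ep_cont P_cont)
      then show ?thesis by (auto simp: continuous_on_def)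
    qed
    then have "((\<lambda>z. Ep z * (rho * P z - 1)) \<longlongrightarrow> Ep 0 * (rho * P 0 - 1)) (at_right 0)"
      by (rule tendsto_within_subset) auto
    moreover have "\<forall>\<^sub>F z in at_right 0. 0 < z \<and> z \<le> x"
      using x eventually_at_right_less[of 0] eventually_at_right[of 0 x] by (auto intro!: eventually_conj eventually_at_rightI[of 0 x])
    ultimately have "Ep 0 * (rho * P 0 - 1) \<le> Ep x * q x"
      by (intro tendsto_upperbound[where F = "at_right 0"]) (auto elim!: eventually_mono)
    moreover have "rho * P 0 - 1 = 0" using C_00 rho_pos by (simp add: P_def)
    ultimately show False using qx Ep_pos[of x] mult_pos_neg[of "Ep x" "q x"] by simp
  qed
  have "Ep y * q y \<le> Ep x * q x"
  proof (rule DERIV_nonpos_imp_nonincreasing[OF x(2)])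
    fix t assume t: "x \<le> t" "t \<le> y"
    have "Ep t * (lam' t * P t - (al - be)) \<le> 0"
      using \<open>lam' x * P x < al - be\<close> lam'_P_antimono[of x t] t x Ep_pos[of t] by (intro mult_nonneg_nonpos) auto
    then show "\<exists>D. ((\<lambda>y. Ep y * q y) has_real_derivative D) (at t) \<and> D \<le> 0"
      using Ep_q_deriv[of t] t x by auto
  qed
  then have "Ep y * q y < 0" using qx Ep_pos[of x] mult_pos_neg[of "Ep x" "q x"] by linarith
  then show ?thesis using Ep_pos[of y] by (simp add: mult_less_0_iff)
qed

text \<open>Otherwise \<open>lam'\<close> is bounded below and the hazard grows linearly, while
  \<open>P\<close> is bounded below as well. The derivative of \<open>P\<close> is then eventually
  at most -1, and \<open>P\<close> would become negative.\<close>

lemma lam'P_eventually_small: "\<exists>x>0. lam' x * P x < al - be"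
proof (rule ccontr)
  assume "\<not> ?thesis"
  then have k: "al - be \<le> lam' x * P x" if "0 < x" for x using that by auto
  have l1: "0 < lam' 1" using k[of 1] lam'_nonneg[of 1] be_less by (cases "lam' 1 = 0") auto
  define c where "c = (al - be) / P 1"
  have c: "0 < c" using be_less P_pos[of 1] by (simp add: c_def)
  define l where "l = (al - be) / lam' 1"
  have l: "0 < l" using be_less l1 by (simp add: l_def)
  have Pl: "l \<le> P y" if "1 \<le> y" for y
  proof -
    have "al - be \<le> lam' y * P y" using k that by simp
    also have "\<dots> \<le> lam' 1 * P y" using lam'_anti[of 1 y] that P_pos[of y] by (intro mult_right_mono) auto
    finally show ?thesis using l1 by (simp add: l_def field_simps)
  qed
  have lc: "c \<le> lam' y" if "1 \<le> y" for y
  proof -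
    have "al - be \<le> lam' y * P y" using k that by simp
    also have "\<dots> \<le> lam' y * P 1" using P_antimono[of 1 y] that lam'_nonneg[of y] by (intro mult_left_mono) auto
    finally show ?thesis using P_pos[of 1] by (simp add: c_def field_simps)
  qed
  have lamc: "c * (y - 1) \<le> lam y" if "1 \<le> y" for y
  proof -
    have "lam 1 - c * 1 \<le> lam y - c * y"
    proof (rule DERIV_nonneg_imp_nondecreasing[OF that])
      fix t assume t: "1 \<le> t" "t \<le> y"
      have "((\<lambda>y. lam y - c * y) has_real_derivative lam' t - c) (at t)"
        using t by (auto intro!: derivative_eq_intros lam_deriv)
      then show "\<exists>D. ((\<lambda>y. lam y - c * y) has_real_derivative D) (at t) \<and> 0 \<le> D" using lc[OF t(1)] by auto
    qed
    then show ?thesis using lam_nonneg[of 1] by (simp add: algebra_simps)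
  qed
  \<comment> \<open>Beyond \<open>y0\<close> the linear lower bound on the hazard gives
    \<open>1 + g \<le> (r + lam y) * l\<close>, which makes the derivative of \<open>P\<close> at
    most -1.\<close>
  define y0 where "y0 = 1 + (1 + g) / (l * c)"
  have y0: "1 \<le> y0" using g_pos l c by (simp add: y0_def)
  have dP: "(1 - (r + lam y) * P y) / g \<le> - 1" if "y0 \<le> y" for y
  proof -
    have "(1 + g) / l \<le> c * (y - 1)" using that c l by (simp add: y0_def field_simps)
    also have "\<dots> \<le> r + lam y" using lamc[of y] that y0 r_pos by linarith
    finally have "1 + g \<le> (r + lam y) * l" using l by (simp add: field_simps)
    also have "\<dots> \<le> (r + lam y) * P y" using Pl[of y] that y0 r_pos lam_nonneg[of y] by (intro mult_left_mono) auto
    finally show ?thesis using g_pos by (simp add: field_simps)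
  qed
  have "P (y0 + P y0 + 1) + (y0 + P y0 + 1) \<le> P y0 + y0"
  proof (rule DERIV_nonpos_imp_nonincreasing[where f = "\<lambda>y. P y + y"])
    show "y0 \<le> y0 + P y0 + 1" using P_pos[of y0] y0 by simp
    fix t assume t: "y0 \<le> t"
    then have "((\<lambda>y. P y + y) has_real_derivative (1 - (r + lam t) * P t) / g + 1) (at t)"
      using y0 by (auto intro!: derivative_eq_intros P_deriv)
    then show "\<exists>D. ((\<lambda>y. P y + y) has_real_derivative D) (at t) \<and> D \<le> 0" using dP[OF t] by force
  qed
  then show False using P_pos[of "y0 + P y0 + 1"] P_pos[of y0] y0 by simp
qed

lemma q_eventually_neg: "\<exists>x>0. q x < 0"
proof -
  obtain x where x: "0 < x" "lam' x * P x < al - be" using lam'P_eventually_small by blast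
  define c where "c = Ep x * (al - be - lam' x * P x)"
  have c: "0 < c" using x Ep_pos by (simp add: c_def)
  have dec: "Ep y * q y + c * y \<le> Ep x * q x + c * x" if y: "x \<le> y" for y
  proof (rule DERIV_nonpos_imp_nonincreasing[OF y])
    fix t assume t: "x \<le> t" "t \<le> y"
    have "Ep x \<le> Ep t" unfolding Ep_def using t x r_pos g_pos Lam_mono[of x t] by (auto intro!: divide_right_mono add_mono)
    then have "Ep t * (lam' t * P t - (al - be)) \<le> - c"
    proof -
      have "c \<le> Ep t * (al - be - lam' x * P x)" unfolding c_def using \<open>Ep x \<le> Ep t\<close> x by (intro mult_right_mono) auto
      also have "\<dots> \<le> Ep t * (al - be - lam' t * P t)" using lam'_P_antimono[OF x(1) t(1)] Ep_pos[of t] by (intro mult_left_mono) auto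
      finally show ?thesis by (simp add: algebra_simps)
    qed
    moreover have "((\<lambda>y. Ep y * q y + c * y) has_real_derivative Ep t * (lam' t * P t - (al - be)) + c) (at t)"
    proof -
      have "((\<lambda>y. c * y) has_real_derivative c) (at t)" by (auto intro!: derivative_eq_intros)
      then show ?thesis using t x by (intro DERIV_add Ep_q_deriv) auto
    qed
    ultimately show "\<exists>D. ((\<lambda>y. Ep y * q y + c * y) has_real_derivative D) (at t) \<and> D \<le> 0" by force
  qed
  define y where "y = x + \<bar>Ep x * q x\<bar> / c + 1"
  have "0 \<le> \<bar>Ep x * q x\<bar> / c" using c by simp
  then have y: "x \<le> y" "0 < y" using x by (simp_all add: y_def)
  have "Ep y * q y \<le> Ep x * q x - c * (y - x)" using dec[OF y(1)] by (simp add: algebra_simps)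
  also have "c * (y - x) = \<bar>Ep x * q x\<bar> + c" using c by (simp add: y_def field_simps)
  finally have "Ep y * q y < 0" using c by linarith
  then have "q y < 0" using Ep_pos[of y] by (simp add: mult_less_0_iff)
  then show ?thesis using y by blast
qed

lemma u0_tendsto: "(u0 \<longlongrightarrow> 0) at_top"
proof (rule Lim_null_comparison[OF _ inv_A_tendsto[of "1 / de"]])
  show "\<forall>\<^sub>F x in at_top. norm (u0 x) \<le> 1 / de / A x"
  proof (rule eventually_at_top_linorderI)
    fix y :: real assume "0 \<le> y"
    then have "\<bar>P y - R y\<bar> \<le> 1 / de"
      using C_le[of y 0] C_nonneg[of y 0] R_le[of y] R_nonneg[of y] by (auto simp: P_def abs_le_iff)
    moreover have "norm (u0 y) = \<bar>P y - R y\<bar> / A y" using A_pos[of y] by (simp add: u0_def)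
    ultimately show "norm (u0 y) \<le> 1 / de / A y"
      using divide_right_mono[of "\<bar>P y - R y\<bar>" "1 / de" "A y"] A_pos[of y] by simp
  qed
qed

text \<open>Once \<open>q\<close> is negative it stays so, and \<open>u0\<close> increases strictly
  from there on towards its limit 0.\<close>

lemma u0_neg: assumes x: "0 < x" "q x < 0" shows "u0 x < 0"
proof -
  have inc: "u0 y < u0 z" if "x \<le> y" "y < z" for y z
  proof (rule DERIV_pos_imp_increasing[OF that(2)])
    fix t assume t: "y \<le> t" "t \<le> z"
    then have "q t < 0" using q_single_crossing[of x t] x that by auto
    then have "0 < - q t / (g * (1 - g) * A t)" using g_pos g_less A_pos[of t]
      by (intro divide_pos_pos mult_pos_pos) auto
    then show "\<exists>D. (u0 has_real_derivative D) (at t) \<and> 0 < D" using u0_deriv[of t] t that x by auto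
  qed
  have "u0 (x + 1) \<le> 0"
    by (rule tendsto_lowerbound[OF u0_tendsto])
      (auto intro!: eventually_at_top_linorderI[of "x + 2"] less_imp_le inc)
  then show ?thesis using inc[of x "x + 1"] by simp
qed

lemma u0_decreasing: 
  assumes "0 \<le> u0 y" "0 \<le> x" "x \<le> z" "z \<le> y" shows "u0 z \<le> u0 x"
proof (cases "x = z")
  case False
  then have z: "x < z" using assms by simp
  have q0: "0 \<le> q t" if "0 < t" "t \<le> y" for t
    using q_single_crossing[of t y] u0_neg[of y] that assms by force
  show ?thesis
  proof (rule DERIV_nonpos_imp_decreasing_open[of x z u0])
    fix t assume t: "x < t" "t < z"
    have "- q t / (g * (1 - g) * A t) \<le> 0"
      using q0[of t] t assms g_pos g_less A_pos[of t] by (intro divide_nonpos_pos) auto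
    then show "\<exists>D. (u0 has_real_derivative D) (at t) \<and> D \<le> 0" using u0_deriv[of t] t assms by auto
  next
    show "continuous_on {x..z} u0" using assms by (intro continuous_on_subset[OF u0_cont]) auto
  qed (use assms in auto)
qed simp

lemma q_nonneg: "0 < t \<Longrightarrow> t \<le> y \<Longrightarrow> 0 \<le> u0 y \<Longrightarrow> 0 \<le> q t"
  using q_single_crossing[of t y] u0_neg[of y] by force

text \<open>\<open>u0\<close> is nonincreasing before its last zero, so it would vanish between the
  two zeros, hence so would \<open>q\<close> and \<open>lam' * P - (al - be)\<close>. But
  \<open>q = 0\<close> makes \<open>P\<close> strictly decreasing there, and \<open>lam'\<close> is
  positive and nonincreasing, so \<open>lam' * P\<close> is not constant.\<close>

lemma u0_zero_unique:
  assumes "0 < a" "a < b" "u0 a = 0" "u0 b = 0" shows False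
proof -
  have u00: "u0 t = 0" if "a \<le> t" "t \<le> b" for t
    using u0_decreasing[of b a t] u0_decreasing[of b t b] assms that by auto
  have q0: "q t = 0" if t: "a < t" "t < b" for t
  proof -
    have "((\<lambda>_. 0) has_real_derivative 0) (at t)" by simp
    then have "(u0 has_real_derivative 0) (at t)"
      by (rule has_field_derivative_transform_within_open[of _ _ _ "{a<..<b}"]) (use u00 t in auto)
    then have "- q t / (g * (1 - g) * A t) = 0" using DERIV_unique[OF u0_deriv] t assms by auto
    then show ?thesis using A_pos[of t] g_pos g_less by simp
  qed
  have k0: "lam' t * P t = al - be" if t: "a < t" "t < b" for t
  proof -
    have "((\<lambda>_. 0) has_real_derivative 0) (at t)" by simp
    then have "((\<lambda>y. Ep y * q y) has_real_derivative 0) (at t)"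
      by (rule has_field_derivative_transform_within_open[of _ _ _ "{a<..<b}"]) (use q0 t in auto)
    then have "Ep t * (lam' t * P t - (al - be)) = 0" using DERIV_unique[OF Ep_q_deriv] t assms by auto
    then show ?thesis using Ep_pos[of t] by simp
  qed
  define s where "s = a + (b - a) / 3"
  define t where "t = a + 2 * (b - a) / 3"
  have st: "a < s" "s < t" "t < b" using assms by (auto simp: s_def t_def field_simps)
  have "P t < P s"
  proof (rule DERIV_neg_imp_decreasing[OF st(2)])
    fix x assume x: "s \<le> x" "x \<le> t"
    then have "(r + lam x) * P x = 1 + (r - rho) * P x"
      using q0[of x] st by (simp add: q_def algebra_simps)
    then have "(1 - (r + lam x) * P x) / g = - (al - be) * P x" using g_pos by (simp add: rho_def field_simps)
    moreover have "- (al - be) * P x < 0" using be_less P_pos[of x] x st assms by (simp add: mult_neg_pos)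
    ultimately show "\<exists>D. (P has_real_derivative D) (at x) \<and> D < 0" using P_deriv[of x] x st assms by auto
  qed
  moreover have "lam' t \<le> lam' s" "0 < lam' t"
  proof -
    show "lam' t \<le> lam' s" using lam'_anti[of s t] st assms by simp
    have "lam' t \<noteq> 0" using k0[of t] st be_less by auto
    then show "0 < lam' t" using lam'_nonneg[of t] st assms by simp
  qed
  ultimately have "lam' t * P t < lam' s * P s" using P_pos[of t] st assms by (intro mult_le_less_imp_less) auto
  then show False using k0[of s] k0[of t] st by simp
qed

definition "Db = (if P 0 = R 0 then 0 else (THE d. d > 0 \<and> P d = R d))"

lemma u0_iff: "u0 y = 0 \<longleftrightarrow> P y = R y" "0 \<le> u0 y \<longleftrightarrow> R y \<le> P y" "u0 y \<le> 0 \<longleftrightarrow> P y \<le> R y"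
  using A_pos[of y] by (auto simp: u0_def field_simps)

lemma threshold_facts:
  assumes RP: "R 0 \<le> P 0"
  shows "0 \<le> Db" "P Db = R Db" "P 0 \<noteq> R 0 \<Longrightarrow> 0 < Db"
    and "\<And>d. P 0 \<noteq> R 0 \<Longrightarrow> 0 < d \<Longrightarrow> P d = R d \<Longrightarrow> d = Db"
proof -
  have *: "0 < Db \<and> P Db = R Db" "\<And>d. 0 < d \<Longrightarrow> P d = R d \<Longrightarrow> d = Db" if ne: "P 0 \<noteq> R 0"
  proof -
    have "0 < u0 0" using ne RP A_pos[of 0] by (simp add: u0_def)
    moreover obtain x where x: "0 < x" "q x < 0" using q_eventually_neg by blast
    moreover have "u0 x < 0" using u0_neg[OF x] .
    moreover have "continuous_on {0..x} u0" by (rule continuous_on_subset[OF u0_cont]) auto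
    ultimately have "\<exists>d\<ge>0. d \<le> x \<and> u0 d = 0" by (intro IVT2') auto
    then obtain d where d: "0 \<le> d" "u0 d = 0" by blast
    then have "0 < d" using \<open>0 < u0 0\<close> by (cases "d = 0") auto
    have uniq: "d' = d" if "0 < d'" "P d' = R d'" for d'
      using u0_zero_unique[of d d'] u0_zero_unique[of d' d] d \<open>0 < d\<close> that u0_iff(1)[of d'] by (metis linorder_neqE_linordered_idom)
    have "P d = R d" using d(2) u0_iff(1)[of d] by simp
    then have "(THE d. d > 0 \<and> P d = R d) = d" using uniq \<open>0 < d\<close> by (intro the_equality) blast+
    then have "Db = d" using ne by (simp add: Db_def)
    then show "0 < Db \<and> P Db = R Db" "\<And>d'. 0 < d' \<Longrightarrow> P d' = R d' \<Longrightarrow> d' = Db"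
      using uniq \<open>0 < d\<close> \<open>P d = R d\<close> by blast+
  qed
  show "0 \<le> Db" "P Db = R Db" "P 0 \<noteq> R 0 \<Longrightarrow> 0 < Db"
    "\<And>d. P 0 \<noteq> R 0 \<Longrightarrow> 0 < d \<Longrightarrow> P d = R d \<Longrightarrow> d = Db"
    using * Db_def by (cases "P 0 = R 0"; simp)+
qed

lemma P_ge_R: assumes RP: "R 0 \<le> P 0" and "0 \<le> y" "y \<le> Db" shows "R y \<le> P y"
proof -
  have "u0 Db = 0" using threshold_facts(2)[OF RP] u0_iff(1) by simp
  then have "0 \<le> u0 y" using u0_decreasing[of Db y Db] assms by simp
  then show ?thesis using u0_iff(2) by simp
qed

lemma P_le_R: assumes RP: "R 0 \<le> P 0" and "Db \<le> y" shows "P y \<le> R y"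
proof (rule ccontr)
  assume "\<not> ?thesis"
  then have "0 < u0 y" using A_pos[of y] by (simp add: u0_def)
  then have "u0 y \<le> u0 Db" using u0_decreasing[of y Db y] threshold_facts(1)[OF RP] assms by auto
  then show False using threshold_facts(2)[OF RP] u0_iff(1)[of Db] \<open>0 < u0 y\<close> by simp
qed

text \<open>Relative to racing forever, a race up to lead \<open>d\<close> followed by tied coasting
  gains \<open>A y * u0 d\<close>, and coasting at once gains \<open>A y * u0 y\<close>;
  \<open>u0\<close> does not increase as long as it is nonnegative.\<close>

lemma V_tie_le:
  assumes RP: "R 0 \<le> P 0" and y: "0 \<le> y" "y \<le> Db" and th: "0 \<le> th"
  shows "V th y 0 \<le> P y"
proof -
  let ?d = "y + (1 - g) * th"
  have d: "y \<le> ?d" using th g_less by simp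
  have uy: "0 \<le> u0 y" using P_ge_R[OF RP y] u0_iff by auto
  have "u0 ?d \<le> u0 y"
  proof (cases "0 \<le> u0 ?d")
    case True then show ?thesis using u0_decreasing[of ?d y ?d] y d by auto
  qed (use uy in auto)
  then have "A y * u0 ?d \<le> A y * u0 y" using A_pos[of y] by simp
  then show ?thesis using V_R[OF y(1) order.refl th] A_pos[of y] A_pos[of ?d]
    by (simp add: u0_def e_A P_def[symmetric])
qed

lemma v_tie: "R 0 \<le> P 0 \<Longrightarrow> 0 \<le> y \<Longrightarrow> y \<le> Db \<Longrightarrow> v y 0 = P y"
  by (intro antisym v_le V_tie_le) (auto simp: P_def C_le_v)

text \<open>Beyond \<open>Db\<close> even tied coasting is worth no more than racing, and a gap only
  lowers the value of coasting.\<close>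

lemma v_above: "R 0 \<le> P 0 \<Longrightarrow> Db \<le> y \<Longrightarrow> 0 \<le> G \<Longrightarrow> v y G \<le> R y"
proof (rule v_le)
  fix th :: real assume a: "R 0 \<le> P 0" "Db \<le> y" "0 \<le> G" "0 \<le> th"
  let ?d = "y + (1 - g) * th"
  have y: "0 \<le> y" "Db \<le> ?d" "0 \<le> ?d"
  proof -
    have "0 \<le> (1 - g) * th" using a(4) g_less by simp
    then show "0 \<le> y" "Db \<le> ?d" "0 \<le> ?d" using threshold_facts(1)[OF a(1)] a(2) by linarith+
  qed
  have "C ?d G \<le> P ?d" unfolding P_def using y a by (intro C_antimono) auto
  also have "\<dots> \<le> R ?d" using P_le_R[OF a(1) y(2)] .
  finally show "V th y G \<le> R y"
    using V_R[OF y(1) a(3,4)] e_pos[of y th] by (simp add: mult_nonneg_nonpos)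
qed

text \<open>The exponential is the effect of raising both capabilities by \<open>y - x\<close>. The
  derivative of \<open>exp ((al - be) * y) * P y\<close> is a negative multiple of \<open>q\<close>,
  and \<open>q\<close> is nonnegative up to \<open>Db\<close>.\<close>

lemma tied_value_antimono:
  assumes RP: "R 0 \<le> P 0" and x: "0 \<le> x" "x \<le> y" "y \<le> Db"
  shows "exp ((al - be) * (y - x)) * P y \<le> P x"
proof (cases "x = y")
  case False
  have "exp ((al - be) * y) * P y \<le> exp ((al - be) * x) * P x"
  proof (rule DERIV_nonpos_imp_decreasing_open[of x y "\<lambda>t. exp ((al - be) * t) * P t"])
    fix t assume t: "x < t" "t < y"
    have "((\<lambda>t. exp ((al - be) * t) * P t) has_real_derivative
        (al - be) * exp ((al - be) * t) * P t + (1 - (r + lam t) * P t) / g * exp ((al - be) * t)) (at t)"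
      using t x by (auto intro!: derivative_eq_intros P_deriv)
    moreover have "(al - be) * exp ((al - be) * t) * P t + (1 - (r + lam t) * P t) / g * exp ((al - be) * t)
        = - (exp ((al - be) * t) * q t / g)"
      using g_pos by (simp add: q_def rho_def field_simps)
    moreover have "0 \<le> exp ((al - be) * t) * q t / g"
      using q_nonneg[of t Db] t x threshold_facts(2)[OF RP] u0_iff(1)[of Db] g_pos by simp
    ultimately show "\<exists>D. ((\<lambda>t. exp ((al - be) * t) * P t) has_real_derivative D) (at t) \<and> D \<le> 0" by force
  next
    show "continuous_on {x..y} (\<lambda>t. exp ((al - be) * t) * P t)"
      using x by (intro continuous_intros continuous_on_subset[OF P_cont]) auto
  qed (use x in auto)
  then have "exp (- ((al - be) * x)) * (exp ((al - be) * y) * P y) \<le> exp (- ((al - be) * x)) * (exp ((al - be) * x) * P x)"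
    by (intro mult_left_mono) auto
  moreover have "exp (- ((al - be) * x)) * exp ((al - be) * y) = exp ((al - be) * (y - x))"
    "exp (- ((al - be) * x)) * exp ((al - be) * x) = 1"
    by (simp_all add: exp_add[symmetric] right_diff_distrib)
  ultimately show ?thesis unfolding mult.assoc[symmetric] by simp
qed simp


section \<open>Racing against a racing opponent\<close>

lemma race_margin_deriv:
  assumes y: "0 < y"
  shows "((\<lambda>y. ((B + lam y) * R y - 1) / A y) has_real_derivative (lam' y * R y - al) / A y) (at y)"
proof -
  have "((\<lambda>y. (B + lam y) * (R y / A y) - 1 / A y) has_real_derivative
     (lam' y * (R y / A y) + - 1 / ((1 - g) * A y) * (B + lam y))
     - (0 * A y - 1 * ((de + lam y) / (1 - g) * A y)) / (A y * A y)) (at y)"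
  proof (intro DERIV_diff DERIV_mult R_over_A_deriv DERIV_divide DERIV_const A_deriv)
    show "((\<lambda>y. B + lam y) has_real_derivative lam' y) (at y)"
      using y by (auto intro!: derivative_eq_intros lam_deriv)
  qed (use y A_pos[of y] in auto)
  moreover have "(\<lambda>y. (B + lam y) * (R y / A y) - 1 / A y) = (\<lambda>y. ((B + lam y) * R y - 1) / A y)"
    by (auto simp: diff_divide_distrib)
  moreover have "(lam' y * (R y / A y) + - 1 / ((1 - g) * A y) * (B + lam y))
     - (0 * A y - 1 * ((de + lam y) / (1 - g) * A y)) / (A y * A y) = (lam' y * R y - al) / A y"
  proof -
    have "(l * (R y / a) + - 1 / (k * a) * (de + al * k + m)) - (0 * a - 1 * ((de + m) / k * a)) / (a * a) = (l * R y - al) / a"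
      if "k \<noteq> 0" "a \<noteq> 0" for k a l m
      using that by (simp add: field_simps)
    from this[of "1 - g" "A y" "lam' y" "lam y"] show ?thesis using B_de g_less A_pos[of y] by (simp add: algebra_simps)
  qed
  ultimately show ?thesis by simp
qed

text \<open>The margin measures the loss from coasting for an instant before racing. Divided by
  \<open>A\<close>, its derivative has the sign of \<open>lam' y * R y - al\<close>, which is
  antitone, so it first rises and then falls. It starts nonnegative and stays above
  \<open>- 1 / A y\<close>, which tends to 0; hence it never becomes negative.\<close>

lemma race_margin_nonneg:
  assumes BR: "1 \<le> B * R 0" and x: "0 < x" shows "1 \<le> (B + lam x) * R x"
proof (rule ccontr)
  define N where "N y = ((B + lam y) * R y - 1) / A y" for y
  assume "\<not> ?thesis"
  then have Nx: "N x < 0" using A_pos[of x] by (simp add: N_def divide_neg_pos)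
  have anti: "lam' y * R y \<le> lam' z * R z" if "0 < z" "z \<le> y" for y z
    using lam'_anti[OF that] R_antimono[OF that(2)] lam'_nonneg[OF that(1)] R_nonneg by (intro mult_mono) auto
  have "lam' x * R x < al"
  proof (rule ccontr)
    assume k: "\<not> ?thesis"
    have "(B * R z - 1) / A z \<le> N x" if z: "0 < z" "z \<le> x" for z
    proof -
      have "N z \<le> N x"
      proof (rule DERIV_nonneg_imp_nondecreasing[OF z(2)])
        fix t assume t: "z \<le> t" "t \<le> x"
        have "0 \<le> (lam' t * R t - al) / A t"
          using k anti[of t x] t z A_pos[of t] by simp
        then show "\<exists>D. (N has_real_derivative D) (at t) \<and> 0 \<le> D"
          unfolding N_def using race_margin_deriv[of t] t z by auto
      qed
      moreover have "(B * R z - 1) / A z \<le> N z"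
        unfolding N_def using A_pos[of z] lam_nonneg[of z] R_nonneg[of z] by (intro divide_right_mono) (auto simp: algebra_simps)
      ultimately show ?thesis by linarith
    qed
    moreover have "((\<lambda>z. (B * R z - 1) / A z) \<longlongrightarrow> (B * R 0 - 1) / A 0) (at_right 0)"
    proof -
      have "continuous_on UNIV (\<lambda>z. (B * R z - 1) / A z)"
        using A_pos by (intro continuous_intros R_cont A_cont) (auto simp: less_imp_neq[symmetric])
      then have "((\<lambda>z. (B * R z - 1) / A z) \<longlongrightarrow> (B * R 0 - 1) / A 0) (at 0)" by (auto simp: continuous_on_def)
      then show ?thesis by (rule tendsto_within_subset) auto
    qed
    moreover have "\<forall>\<^sub>F z in at_right 0. 0 < z \<and> z \<le> x"
      using x by (auto intro!: eventually_at_rightI[of 0 x])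
    ultimately have "(B * R 0 - 1) / A 0 \<le> N x"
      by (intro tendsto_upperbound[where F = "at_right 0"]) (auto elim!: eventually_mono)
    moreover have "0 \<le> (B * R 0 - 1) / A 0" using BR A_pos[of 0] by simp
    ultimately show False using Nx by simp
  qed
  then have "N y \<le> N x" if "x \<le> y" for y
  proof (intro DERIV_nonpos_imp_nonincreasing[OF that])
    fix t assume t: "x \<le> t" "t \<le> y"
    have "(lam' t * R t - al) / A t \<le> 0"
      using \<open>lam' x * R x < al\<close> anti[of x t] t x A_pos[of t] by (intro divide_nonpos_pos) auto
    then show "\<exists>D. (N has_real_derivative D) (at t) \<and> D \<le> 0"
      unfolding N_def using race_margin_deriv[of t] t x by auto
  qed
  moreover have "- 1 / A y \<le> N y" if "x \<le> y" for y
    unfolding N_def using A_pos[of y] B_pos lam_nonneg[of y] R_nonneg[of y] by (intro divide_right_mono) auto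
  ultimately have "- 1 / A y \<le> N x" if "x \<le> y" for y using that by force
  then have "0 \<le> N x"
    by (intro tendsto_upperbound[OF inv_A_tendsto[of "- 1"]]) (auto intro!: eventually_at_top_linorderI[of x])
  then show False using Nx by simp
qed

lemma fl_coast: 
  assumes "0 \<le> t" "t \<le> G" "g * t \<le> y"
  shows "fl y G (nb y) t = exp (- (r + be) * t - (Lam y - Lam (y - g * t)) / g)"
  unfolding fl_nb[OF assms(1)] using assms by (simp add: nb_def algebra_simps)

text \<open>Vary the date at which coasting is replaced by racing: the derivative of the value is
  minus a positive multiple of the margin in \<open>race_margin_nonneg\<close>.\<close>

lemma race_base_coast:
  assumes BR: "1 \<le> B * R 0" and y: "0 \<le> y" and s: "0 \<le> s" "s \<le> G" "g * s \<le> y"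
  shows "integral {0..s} (fl y G (nb y)) + fl y G (nb y) s * R (y - g * s) \<le> R y"
proof (cases "s = 0")
  case True
  then show ?thesis using s fl_0[OF admpath_nb[OF y], of G] by simp
next
  case False
  define E where "E t = exp (- (r + be) * t - (Lam y - Lam (y - g * t)) / g)" for t
  have flE: "fl y G (nb y) t = E t" if "0 \<le> t" "t \<le> s" for t
  proof -
    have "g * t \<le> g * s" using that g_pos by simp
    then show ?thesis unfolding E_def using that s by (intro fl_coast) auto
  qed
  have Ec: "continuous_on S E" for S unfolding E_def using g_pos by (intro continuous_intros) auto
  define \<psi> where "\<psi> t = integral {0..t} E + E t * R (y - g * t)" for t
  have "\<psi> s \<le> \<psi> 0"
  proof (rule DERIV_nonpos_imp_decreasing_open[OF s(1)])
    fix t assume t: "0 < t" "t < s"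
    let ?z = "y - g * t"
    have "g * t < g * s" using t g_pos by simp
    then have z: "0 < ?z" using s by simp
    have "((\<lambda>u. integral {0..u} E) has_real_derivative E t) (at t within {0..s})"
      using t by (intro integral_has_real_derivative Ec) auto
    then have "((\<lambda>u. integral {0..u} E) has_real_derivative E t) (at t within {0<..<s})"
      by (rule DERIV_subset) auto
    then have 1: "((\<lambda>u. integral {0..u} E) has_real_derivative E t) (at t)"
      using at_within_open[of t "{0<..<s}"] t by simp
    have dz: "((\<lambda>t. y - g * t) has_real_derivative - g) (at t)" by (auto intro!: derivative_eq_intros)
    have L: "((\<lambda>t. Lam (y - g * t)) has_real_derivative lam ?z * (- g)) (at t)"
      using z by (intro DERIV_chain2[OF Lam_deriv dz]) auto
    have 2: "(E has_real_derivative E t * (- (r + be) - lam ?z)) (at t)"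
    proof -
      have "((\<lambda>t. - (r + be) * t - (Lam y - Lam (y - g * t)) / g) has_real_derivative
        - (r + be) - (0 - lam ?z * (- g)) / g) (at t)"
        by (intro DERIV_diff DERIV_cdivide L DERIV_const DERIV_cmult_Id)
      then have "(E has_real_derivative exp (- (r + be) * t - (Lam y - Lam (y - g * t)) / g) *
        (- (r + be) - (0 - lam ?z * (- g)) / g)) (at t)"
        unfolding E_def by (rule DERIV_fun_exp)
      then show ?thesis using g_pos by (simp add: E_def)
    qed
    have 3: "((\<lambda>t. R (y - g * t)) has_real_derivative ((de + lam ?z) * R ?z - 1) / (1 - g) * (- g)) (at t)"
      using z by (intro DERIV_chain2[OF R_deriv dz]) auto
    have "(\<psi> has_real_derivative E t + (E t * (- (r + be) - lam ?z) * R ?z + ((de + lam ?z) * R ?z - 1) / (1 - g) * (- g) * E t)) (at t)"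
      unfolding \<psi>_def by (intro DERIV_add DERIV_mult 1 2 3)
    moreover have "E t + (E t * (- (r + be) - lam ?z) * R ?z + ((de + lam ?z) * R ?z - 1) / (1 - g) * (- g) * E t)
      = - (E t * ((B + lam ?z) * R ?z - 1) / (1 - g))"
    proof -
      have b: "B = k * (r + be) + (1 - k) * de" if "k = 1 - g" for k unfolding that by (simp add: B_def de_def algebra_simps)
      have "a + (a * (- (r + be) - l) * c + ((de + l) * c - 1) / k * (- (1 - k)) * a)
        = - (a * ((k * (r + be) + (1 - k) * de + l) * c - 1) / k)" if "k \<noteq> 0" for a l c k
        using that by (simp add: field_simps)
      from this[of "1 - g"] show ?thesis using b[OF refl] g_less by simp
    qed
    moreover have "0 \<le> E t * ((B + lam ?z) * R ?z - 1) / (1 - g)"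
      using race_margin_nonneg[OF BR z] g_less by (simp add: E_def)
    ultimately show "\<exists>D. (\<psi> has_real_derivative D) (at t) \<and> D \<le> 0" by auto
  next
    show "continuous_on {0..s} \<psi>" unfolding \<psi>_def
      by (intro continuous_intros Ec indefinite_integral_continuous_1 integrable_continuous_interval
          continuous_on_compose2[OF R_cont[of UNIV]]) auto
  qed
  moreover have "E 0 = 1" by (simp add: E_def)
  moreover have "integral {0..s} (fl y G (nb y)) = integral {0..s} E" by (intro integral_cong flE) auto
  ultimately show ?thesis using flE[OF s(1) order.refl] by (simp add: \<psi>_def)
qed

text \<open>At lead 0, with the laggard still behind, the flow of pacing decays at rate
  \<open>B\<close>. Kept up forever it would be worth \<open>1 / B\<close>, which is at most
  \<open>R 0\<close>.\<close>

lemma race_base_pace: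
  assumes BR: "1 \<le> B * R 0" and s: "0 \<le> s" "s \<le> G"
  shows "integral {0..s} (fl 0 G (nb 0)) + fl 0 G (nb 0) s * R 0 \<le> R 0"
proof -
  have fl: "fl 0 G (nb 0) t = exp (- B * t)" if "0 \<le> t" "t \<le> s" for t
    using that s g_pos by (intro fl_pace) (auto simp: add_increasing2)
  have "integral {0..s} (fl 0 G (nb 0)) = integral {0..s} (\<lambda>t. exp (- B * t))" by (intro integral_cong fl) auto
  also have "\<dots> = (1 - exp (- B * s)) / B" using B_pos s by (intro integral_exp) auto
  also have "\<dots> \<le> (1 - exp (- B * s)) * R 0"
  proof -
    have "1 / B \<le> R 0" using BR B_pos by (simp add: field_simps)
    moreover have "0 \<le> 1 - exp (- B * s)" using B_pos s by simp
    ultimately have "(1 - exp (- B * s)) * (1 / B) \<le> (1 - exp (- B * s)) * R 0" by (rule mult_left_mono)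
    then show ?thesis by simp
  qed
  finally show ?thesis using fl[OF s(1) order.refl] by (simp add: algebra_simps)
qed

lemma race_base:
  assumes BR: "1 \<le> B * R 0" and y: "0 \<le> y" and s: "0 \<le> s" "s \<le> G"
  shows "integral {0..s} (fl y G (nb y)) + fl y G (nb y) s * R (max 0 (y - g * s)) \<le> R y"
proof (cases "g * s \<le> y")
  case True
  then show ?thesis using race_base_coast[OF BR y s True] by simp
next
  case False
  define T where "T = y / g"
  have T: "0 \<le> T" "g * T = y" "T \<le> s" using y s g_pos False by (auto simp: T_def field_simps)
  let ?F = "G - T"
  have nbT: "nb y T = 0" "max 0 (G + nb y T - T) = ?F" using T s by (auto simp: nb_def)
  have sh: "nb y (T + t) - nb y T = nb 0 t" if "0 \<le> t" for t
    using nb_shift[OF that, of y T] T by simp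
  have fs: "fl 0 ?F (\<lambda>t. nb y (T + t) - nb y T) t = fl 0 ?F (nb 0) t" if "0 \<le> t" for t
    using sh that by (intro fl_cong_path) auto
  have isx: "integral {0..s - T} (fl 0 ?F (\<lambda>t. nb y (T + t) - nb y T)) = integral {0..s - T} (fl 0 ?F (nb 0))"
    by (intro integral_cong fs) auto
  have G: "0 \<le> G" using s by simp
  have "integral {0..s} (fl y G (nb y)) + fl y G (nb y) s * R (max 0 (y - g * s))
    = integral {0..T} (fl y G (nb y)) + fl y G (nb y) T * (integral {0..s - T} (fl 0 ?F (nb 0)) + fl 0 ?F (nb 0) (s - T) * R 0)"
    using fl_integral_add[OF admpath_nb[OF y] G T(1), of "s - T" y] fl_add[OF admpath_nb[OF y] G T(1), of "s - T" y]
      T nbT fs[of "s - T"] isx False by (simp add: algebra_simps)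
  also have "\<dots> \<le> integral {0..T} (fl y G (nb y)) + fl y G (nb y) T * R 0"
    using race_base_pace[OF BR, of "s - T" ?F] T s fl_pos[of y G "nb y" T] by (intro add_left_mono mult_left_mono) auto
  also have "\<dots> \<le> R y" using race_base_coast[OF BR y T(1), of G] T s by simp
  finally show ?thesis .
qed

text \<open>A negative lead carries no hazard, so racing until date \<open>t0\<close>, at which the
  lead vanishes, costs nothing and adds capability worth at least \<open>al - be\<close> per
  unit.\<close>

lemma negative_lead_path:
  assumes y: "y \<le> 0" and m: "admpath m"
  defines "t0 \<equiv> - y / (1 - g)"
  obtains n where "admpath n" "\<And>u. 0 \<le> u \<Longrightarrow> u \<le> t0 \<Longrightarrow> n u = u"
    "\<And>t G. 0 \<le> t \<Longrightarrow> fl y G m t \<le> fl y G n t"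
proof -
  have t0: "0 \<le> t0" "y + (1 - g) * t0 = 0" using y g_less by (auto simp: t0_def divide_nonpos_pos)
  define n where "n t = max (m t) (m0 t0 t)" for t
  have n: "admpath n" unfolding n_def by (intro admpath_max m admpath_m0 t0)
  have n_race: "n u = u" if "0 \<le> u" "u \<le> t0" for u
    using admpathD(5)[OF m that(1)] that by (simp add: n_def m0_def)
  have lo: "y + m0 t0 u - g * u \<le> 0" if "0 \<le> u" for u
  proof (cases "u \<le> t0")
    case True
    then have "(1 - g) * u \<le> (1 - g) * t0" using g_less by simp
    then show ?thesis using True t0 by (simp add: m0_def algebra_simps)
  next
    case False
    then have "g * t0 \<le> g * u" using g_pos by simp
    then show ?thesis using False t0 by (simp add: m0_def algebra_simps)
  qed
  have "fl y G m t \<le> fl y G n t" if t: "0 \<le> t" for t G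
  proof -
    have mn: "m t \<le> n t" by (simp add: n_def)
    have "H y n t \<le> H y m t"
    proof (intro H_mono_path n m)
      fix u :: real assume "0 \<le> u"
      then show "lam (y + n u - g * u) \<le> lam (y + m u - g * u)"
        using lo[of u] lam_nonpos[of "y + m0 t0 u - g * u"] lam_nonneg[of "y + m u - g * u"]
        by (cases "m u \<le> m0 t0 u") (auto simp: n_def max_def)
    qed
    moreover have "al * m t - be * min t (G + m t) \<le> al * n t - be * min t (G + n t)"
    proof -
      have "min t (G + n t) \<le> min t (G + m t) + (n t - m t)" using mn by linarith
      then have "be * min t (G + n t) \<le> be * (min t (G + m t) + (n t - m t))" using be_pos by (intro mult_left_mono) auto
      moreover have "be * (n t - m t) \<le> al * (n t - m t)" using mn be_less by (intro mult_right_mono) auto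
      ultimately show ?thesis by (simp add: algebra_simps)
    qed
    ultimately show ?thesis by (simp add: fl_def)
  qed
  then show thesis using n n_race that by blast
qed

lemma race_optimal_ahead:
  assumes BR: "1 \<le> B * R 0" and "0 \<le> y" and "admpath m" and T: "0 \<le> T" "T \<le> G"
  shows "integral {0..T} (fl y G m) \<le> R y"
proof (rule partial_payoff_le[where c = False and w = "\<lambda>y G. R y"])
  show "integral {0..s} (e y) + e y s * R (y + (1 - g) * s) \<le> R y" if "0 \<le> s" for y s
    using R_rec[OF that, of y] by linarith
qed (use R_nonneg race_base[OF BR] assms in auto)

lemma race_optimal:
  assumes BR: "1 \<le> B * R 0" and m: "admpath m" and T: "0 \<le> T" "T \<le> G"
  shows "integral {0..T} (fl y G m) \<le> R y"
proof (cases "0 \<le> y")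
  case True
  show ?thesis by (rule race_optimal_ahead[OF BR True m T])
next
  case False
  define t0 where "t0 = - y / (1 - g)"
  have t0: "0 \<le> t0" "y + (1 - g) * t0 = 0" using False g_less by (auto simp: t0_def divide_nonpos_pos)
  obtain n where n: "admpath n" "\<And>u. 0 \<le> u \<Longrightarrow> u \<le> t0 \<Longrightarrow> n u = u"
    "\<And>t G. 0 \<le> t \<Longrightarrow> fl y G m t \<le> fl y G n t"
    using negative_lead_path[of y m] False m unfolding t0_def by auto
  have G: "0 \<le> G" using T by simp
  have "integral {0..T} (fl y G m) \<le> integral {0..T} (fl y G n)"
    using n(3) by (intro integral_le fl_integrable m n(1)) auto
  also have "\<dots> \<le> R y"
  proof (cases "T \<le> t0")
    case True
    then have "integral {0..T} (fl y G n) = integral {0..T} (e y)" using n(2) G by (intro race_integral) auto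
    then show ?thesis using R_rec[OF T(1), of y] e_pos[of y T] R_nonneg[of "y + (1 - g) * T"] by (simp add: mult_nonneg_nonneg)
  next
    case False
    then have T': "0 \<le> T - t0" "T = t0 + (T - t0)" by auto
    have i1: "integral {0..t0} (fl y G n) = integral {0..t0} (e y)" "fl y G n t0 = e y t0"
      using n(2) G t0 by (auto intro!: race_integral fl_race)
    have st: "y + n t0 - g * t0 = 0" "max 0 (G + n t0 - t0) = G" using n(2)[of t0] t0 G by (auto simp: algebra_simps)
    have "integral {0..T - t0} (fl 0 G (\<lambda>t. n (t0 + t) - n t0)) \<le> R 0"
      using T T' t0 by (intro race_optimal_ahead[OF BR] admpath_shift n(1)) auto
    then have "e y t0 * integral {0..T - t0} (fl 0 G (\<lambda>t. n (t0 + t) - n t0)) \<le> e y t0 * R 0"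
      using e_pos[of y t0] by simp
    then show ?thesis
      using fl_integral_add[OF n(1) G t0(1) T'(1), of y] T'(2) i1 st R_rec[OF t0(1), of y] t0(2) by simp
  qed
  finally show ?thesis .
qed

section \<open>The effective hazard\<close>

definition "leff = 1 / R 0 - de"

lemma R_pos: "0 < R 0"
proof -
  have "0 \<noteq> integral {0..1} (e 0)"
  proof
    assume "0 = integral {0..1} (e 0)"
    then have "e 0 0 = 0"
      using integral_eq_0_iff[of 0 1 "e 0"] e_cont less_imp_le[OF e_pos] by simp
    then show False by (simp add: e_0)
  qed
  moreover have "0 \<le> integral {0..1} (e 0)" by (intro integral_nonneg e_integrable) (simp add: less_imp_le e_pos)
  moreover have "0 \<le> e 0 1 * R (0 + (1 - g) * 1)" using R_nonneg e_pos[of 0 1] by (simp add: mult_nonneg_nonneg)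
  ultimately show ?thesis using R_rec[of 1 0] by linarith
qed

lemma e_tendsto: "(e y \<longlongrightarrow> 0) at_top"
proof (rule Lim_null_comparison)
  show "\<forall>\<^sub>F t in at_top. norm (e y t) \<le> exp (- de * t)"
    using e_le e_pos by (intro eventually_at_top_linorderI[of 0]) (simp add: less_imp_le abs_of_pos)
  show "((\<lambda>t. exp (- de * t)) \<longlongrightarrow> 0) at_top" using de_pos by real_asymp
qed

lemma R_tendsto: "((\<lambda>T. integral {0..T} (e y)) \<longlongrightarrow> R y) at_top"
proof -
  have "((\<lambda>T. R y - integral {0..T} (e y)) \<longlongrightarrow> 0) at_top"
  proof (rule Lim_null_comparison)
    show "\<forall>\<^sub>F T in at_top. norm (R y - integral {0..T} (e y)) \<le> e y T * (1 / de)"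
    proof (rule eventually_at_top_linorderI[of 0])
      fix T :: real assume "0 \<le> T"
      then have "R y - integral {0..T} (e y) = e y T * R (y + (1 - g) * T)" using R_rec[of T y] by linarith
      then show "norm (R y - integral {0..T} (e y)) \<le> e y T * (1 / de)"
        using e_pos[of y T] R_nonneg[of "y + (1 - g) * T"] mult_left_mono[OF R_le[of "y + (1 - g) * T"], of "e y T"]
        by (simp add: abs_mult)
    qed
    show "((\<lambda>T. e y T * (1 / de)) \<longlongrightarrow> 0) at_top" using tendsto_mult_left_zero[OF e_tendsto] .
  qed
  from tendsto_diff[OF tendsto_const[of "R y"] this] show ?thesis by simp
qed

text \<open>The derivative of \<open>e 0\<close> is \<open>- (de + lam) * e 0\<close>. In the limit
  the right-hand side becomes \<open>1 - (de + \<eta>) * R 0\<close>, whose sign compares \<eta>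
  with \<open>leff\<close>.\<close>

lemma hazard_excess:
  assumes T: "0 \<le> T"
  shows "((\<lambda>t. e 0 t * (lam ((1 - g) * t) - \<eta>)) has_integral 1 - e 0 T - (de + \<eta>) * integral {0..T} (e 0)) {0..T}"
proof -
  have "((\<lambda>t. e 0 t * (de + lam ((1 - g) * t))) has_integral (- e 0 T - (- e 0 0))) {0..T}"
  proof (rule fundamental_theorem_of_calculus_interior_strong[of "{}"])
    fix t assume t: "t \<in> {0<..<T} - {}"
    have "((\<lambda>t. Lam (0 + (1 - g) * t)) has_real_derivative lam (0 + (1 - g) * t) * (1 - g)) (at t)"
      using t g_less by (intro DERIV_chain2[OF Lam_deriv]) (auto intro!: derivative_eq_intros)
    then have "((\<lambda>t. - de * t - (Lam (0 + (1 - g) * t) - Lam 0) / (1 - g)) has_real_derivative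
        - de - (lam (0 + (1 - g) * t) * (1 - g) - 0) / (1 - g)) (at t)"
      by (intro DERIV_diff DERIV_cdivide DERIV_const DERIV_cmult_Id)
    then have "((\<lambda>t. exp (- de * t - (Lam (0 + (1 - g) * t) - Lam 0) / (1 - g))) has_real_derivative
        exp (- de * t - (Lam (0 + (1 - g) * t) - Lam 0) / (1 - g)) * (- de - (lam (0 + (1 - g) * t) * (1 - g) - 0) / (1 - g))) (at t)"
      by (rule DERIV_fun_exp)
    from DERIV_minus[OF this] have "((\<lambda>t. - e 0 t) has_real_derivative e 0 t * (de + lam ((1 - g) * t))) (at t)"
    proof -
      have "a * (- de - (l * (1 - g) - 0) / (1 - g)) = - (a * (de + l))" for a l
      proof -
        have "l * (1 - g) / (1 - g) = l" using g_less by simp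
        then show ?thesis by (simp add: distrib_left right_diff_distrib)
      qed
      then show ?thesis using \<open>((\<lambda>t. - _) has_real_derivative _) (at t)\<close> by (simp add: e_def[abs_def])
    qed
    then show "((\<lambda>t. - e 0 t) has_vector_derivative e 0 t * (de + lam ((1 - g) * t))) (at t)"
      by (simp add: has_real_derivative_iff_has_vector_derivative)
  qed (use T in \<open>auto intro!: continuous_intros e_cont\<close>)
  moreover have "((\<lambda>t. (de + \<eta>) * e 0 t) has_integral (de + \<eta>) * integral {0..T} (e 0)) {0..T}"
    by (intro has_integral_mult_right integrable_integral e_integrable)
  ultimately have "((\<lambda>t. e 0 t * (de + lam ((1 - g) * t)) - (de + \<eta>) * e 0 t) has_integral
      (- e 0 T - (- e 0 0)) - (de + \<eta>) * integral {0..T} (e 0)) {0..T}"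
    by (rule has_integral_diff)
  then show ?thesis by (simp add: e_0 algebra_simps)
qed

lemma hazard_excess_tendsto:
  "((\<lambda>T. integral {0..T} (\<lambda>t. e 0 t * (lam ((1 - g) * t) - \<eta>))) \<longlongrightarrow> 1 - (de + \<eta>) * R 0) at_top"
proof -
  have "((\<lambda>T. 1 - e 0 T - (de + \<eta>) * integral {0..T} (e 0)) \<longlongrightarrow> 1 - 0 - (de + \<eta>) * R 0) at_top"
    by (intro tendsto_intros e_tendsto R_tendsto)
  then have "((\<lambda>T. 1 - e 0 T - (de + \<eta>) * integral {0..T} (e 0)) \<longlongrightarrow> 1 - (de + \<eta>) * R 0) at_top" by simp
  then show ?thesis
    by (rule Lim_transform_eventually) (auto intro!: eventually_at_top_linorderI[of 0] integral_unique[symmetric] hazard_excess)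
qed

lemma leff_nonneg: "0 \<le> leff"
  using R_le[of 0] R_pos de_pos by (simp add: leff_def field_simps)

lemma e_eq: "0 \<le> t \<Longrightarrow> e 0 t = exp (- de * t - integral {0..t} (\<lambda>u. lam ((1 - g) * u)))"
  using integral_unique[OF lam_affine_integral[of 0 t "1 - g" 0]] g_less by (simp add: e_def)

lemma leff_zero: "1 - (de + leff) * R 0 = 0"
  using R_pos by (simp add: leff_def)

lemma leff_ge: "0 \<le> 1 - (de + \<eta>) * R 0 \<Longrightarrow> \<eta> \<le> leff" 
  and leff_le: "1 - (de + \<eta>) * R 0 \<le> 0 \<Longrightarrow> leff \<le> \<eta>"
  and leff_less: "1 - (de + \<eta>) * R 0 < 0 \<Longrightarrow> leff < \<eta>"
  using R_pos by (simp_all add: leff_def field_simps)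

text \<open>The weighted integral of the excess over \<open>leff\<close> tends to 0. The excess is
  monotone in time, so its sign changes at most once; were it always negative, the integral would
  stay below a negative constant.\<close>

lemma leff_crossing:
  obtains tc where "0 \<le> tc" "\<And>t. 0 < t \<Longrightarrow> t < tc \<Longrightarrow> lam ((1 - g) * t) < leff"
    "\<And>t. tc < t \<Longrightarrow> leff \<le> lam ((1 - g) * t)"
proof -
  define S where "S = {t. 0 < t \<and> lam ((1 - g) * t) < leff}"
  have low: "lam ((1 - g) * s) < leff" if "t \<in> S" "s \<le> t" for s t
    using that lam_mono[of "(1 - g) * s" "(1 - g) * t"] g_less by (auto simp: S_def)
  have "\<exists>t>0. t \<notin> S"
  proof (rule ccontr)
    assume "\<not> ?thesis"
    then have all: "t \<in> S" if "0 < t" for t using that by blast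
    define k where "k = lam ((1 - g) * 1) - leff"
    have k: "k < 0" using all[of 1] by (simp add: k_def S_def)
    have i: "(\<lambda>t. e 0 t * (lam ((1 - g) * t) - leff)) integrable_on {a..b}" if "0 \<le> a" for a b
    proof (cases "a \<le> b")
      case True
      then have "(\<lambda>t. e 0 t * (lam ((1 - g) * t) - leff)) integrable_on {0..b}"
        using hazard_excess[of b leff] that by auto
      then show ?thesis by (rule integrable_on_subinterval) (use that in auto)
    qed auto
    have "integral {0..T} (\<lambda>t. e 0 t * (lam ((1 - g) * t) - leff)) \<le> k * integral {0..1} (e 0)" if T: "1 \<le> T" for T
    proof -
      have "integral {0..1} (\<lambda>t. e 0 t * (lam ((1 - g) * t) - leff)) \<le> integral {0..1} (\<lambda>t. k * e 0 t)"
      proof (intro integral_le i integrable_on_mult_right e_integrable)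
        fix t :: real assume "t \<in> {0..1}"
        then have "lam ((1 - g) * t) - leff \<le> k" unfolding k_def using g_less by (auto intro!: lam_mono)
        from mult_left_mono[OF this, of "e 0 t"] show "e 0 t * (lam ((1 - g) * t) - leff) \<le> k * e 0 t"
          using e_pos[of 0 t] by (simp add: mult.commute)
      qed auto
      moreover have "integral {1..T} (\<lambda>t. e 0 t * (lam ((1 - g) * t) - leff)) \<le> integral {1..T} (\<lambda>_. 0)"
      proof (intro integral_le i)
        fix t assume "t \<in> {1..T}"
        then show "e 0 t * (lam ((1 - g) * t) - leff) \<le> 0"
          using all[of t] e_pos[of 0 t] by (auto simp: S_def intro!: mult_nonneg_nonpos)
      qed auto
      ultimately show ?thesis
        using Henstock_Kurzweil_Integration.integral_combine[of 0 1 T "\<lambda>t. e 0 t * (lam ((1 - g) * t) - leff)"] i T by simp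
    qed
    then have "1 - (de + leff) * R 0 \<le> k * integral {0..1} (e 0)"
      by (intro tendsto_upperbound[OF hazard_excess_tendsto]) (auto intro!: eventually_at_top_linorderI[of 1])
    moreover have "0 < integral {0..1} (e 0)"
    proof -
      have "integral {0..1} (e 0) \<noteq> 0"
        using integral_eq_0_iff[of 0 1 "e 0"] e_cont less_imp_le[OF e_pos] e_0[of 0] by force
      moreover have "0 \<le> integral {0..1} (e 0)" by (intro integral_nonneg e_integrable) (simp add: less_imp_le e_pos)
      ultimately show ?thesis by simp
    qed
    ultimately show False using k leff_zero by (simp add: mult_neg_pos zero_le_mult_iff)
  qed
  then obtain t1 where t1: "0 < t1" "t1 \<notin> S" by blast
  have S1: "t \<le> t1" if "t \<in> S" for t
  proof (rule ccontr)
    assume "\<not> t \<le> t1"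
    then show False using low[OF that, of t1] t1 by (auto simp: S_def)
  qed
  then have bdd: "bdd_above S" by (auto simp: bdd_above_def)
  define tc where "tc = (if S = {} then 0 else Sup S)"
  show thesis
  proof
    show "0 \<le> tc" using bdd by (auto simp: tc_def S_def intro: cSup_upper2)
    show "lam ((1 - g) * t) < leff" if "0 < t" "t < tc" for t
    proof -
      have "S \<noteq> {}" "t < Sup S" using that by (auto simp: tc_def split: if_splits)
      then obtain s where "s \<in> S" "t < s" using less_cSup_iff[OF _ bdd] by blast
      then show ?thesis using low[of s t] by simp
    qed
    show "leff \<le> lam ((1 - g) * t)" if "tc < t" for t
    proof -
      have "t \<notin> S" using that cSup_upper[OF _ bdd, of t] by (auto simp: tc_def split: if_splits)
      moreover have "0 < t" using that \<open>0 \<le> tc\<close> by simp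
      ultimately show ?thesis by (auto simp: S_def)
    qed
  qed
qed

end

section \<open>Monotonicity of the hazard ratio\<close>

text \<open>With the larger safety speed a race raises the lead more slowly and meets less hazard,
  so the ratio \<omega> of the weights increases and favours late dates, where the excess is
  nonnegative. By star-shapedness the hazard itself shrinks by no more than the factor
  \<open>c\<close>.\<close>

lemma leff_scaled_mono:
  assumes "race_env al be r g1 lam lam'" and "race_env al be r g2 lam lam'" and g: "g1 \<le> g2"
  shows "race_env.leff al be r g1 lam / (1 - g1) \<le> race_env.leff al be r g2 lam / (1 - g2)"
proof -
  interpret a: race_env al be r g1 lam lam' by fact
  interpret b: race_env al be r g2 lam lam' by fact
  define c where "c = (1 - g2) / (1 - g1)"
  have c: "0 < c" "c \<le> 1" "1 - g2 = c * (1 - g1)" using g a.g_less b.g_less by (auto simp: c_def field_simps)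
  define \<eta> where "\<eta> = a.leff"
  have eta: "0 \<le> \<eta>" by (simp add: \<eta>_def a.leff_nonneg)
  obtain tc where tc: "0 \<le> tc" "\<And>t. 0 < t \<Longrightarrow> t < tc \<Longrightarrow> lam ((1 - g1) * t) < \<eta>"
    "\<And>t. tc < t \<Longrightarrow> \<eta> \<le> lam ((1 - g1) * t)"
    using a.leff_crossing unfolding \<eta>_def by metis
  define \<omega> where "\<omega> t = b.e 0 t / a.e 0 t" for t
  have i: "(\<lambda>u. lam (k * u)) integrable_on {s..t}" for k s t by (intro a.lam_integrable continuous_intros)
  have \<omega>: "\<omega> t = exp (integral {0..t} (\<lambda>u. lam ((1 - g1) * u) - lam ((1 - g2) * u)))" if "0 \<le> t" for t
    using integral_diff[OF i i, of 0 t "1 - g1" "1 - g2"] that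
    by (simp add: \<omega>_def a.e_eq b.e_eq exp_diff[symmetric] a.de_def b.de_def)
  have omono: "\<omega> s \<le> \<omega> t" if "0 \<le> s" "s \<le> t" for s t
  proof -
    have "integral {0..s} (\<lambda>u. lam ((1 - g1) * u) - lam ((1 - g2) * u)) \<le> integral {0..t} (\<lambda>u. lam ((1 - g1) * u) - lam ((1 - g2) * u))"
      using that g by (intro integral_subset_le integrable_diff i) (auto intro!: a.lam_mono mult_right_mono)
    then show ?thesis using that by (simp add: \<omega>)
  qed
  have opos: "0 < \<omega> t" for t by (simp add: \<omega>_def a.e_pos b.e_pos)
  \<comment> \<open>At the crossing date the excess changes sign, so \<omega> may be replaced by its
    value there in the favourable direction on both sides.\<close>
  have pt: "c * \<omega> tc * (a.e 0 t * (lam ((1 - g1) * t) - \<eta>)) \<le> b.e 0 t * (lam ((1 - g2) * t) - c * \<eta>)" if t: "0 \<le> t" for t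
  proof -
    let ?k = "lam ((1 - g1) * t) - \<eta>"
    have "\<omega> tc * ?k \<le> \<omega> t * ?k"
    proof -
      consider "t = 0" | "0 < t" "t < tc" | "t = tc" | "tc < t" using t by linarith
      then show ?thesis
      proof cases
        case 1 then show ?thesis using omono[of 0 tc] tc(1) eta a.lam_nonpos[of 0] by (intro mult_right_mono_neg) auto
      next
        case 2 then show ?thesis using omono[of t tc] tc(2)[of t] by (intro mult_right_mono_neg) auto
      next
        case 4 then show ?thesis using omono[of tc t] tc(1,3) by (intro mult_right_mono) auto
      qed simp
    qed
    then have "c * a.e 0 t * (\<omega> tc * ?k) \<le> c * a.e 0 t * (\<omega> t * ?k)"
      using c a.e_pos[of 0 t] by (intro mult_left_mono) auto
    also have "\<dots> = b.e 0 t * (c * ?k)" using a.e_pos[of 0 t] by (simp add: \<omega>_def)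
    also have "\<dots> \<le> b.e 0 t * (lam ((1 - g2) * t) - c * \<eta>)"
    proof -
      have "c * lam ((1 - g1) * t) \<le> lam (c * ((1 - g1) * t))" using c t a.g_less by (intro a.lam_star) auto
      then have "c * (lam ((1 - g1) * t) - \<eta>) \<le> lam ((1 - g2) * t) - c * \<eta>"
        unfolding c(3) by (simp add: right_diff_distrib[of c "lam _" \<eta>] mult.assoc)
      then show ?thesis using b.e_pos[of 0 t] by (intro mult_left_mono) auto
    qed
    finally show ?thesis by (simp add: mult_ac)
  qed
  have "c * \<omega> tc * (1 - (a.de + \<eta>) * a.R 0) \<le> 1 - (b.de + c * \<eta>) * b.R 0"
  proof (rule tendsto_le[OF _ b.hazard_excess_tendsto tendsto_mult_left[OF a.hazard_excess_tendsto]])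
    show "\<forall>\<^sub>F T in at_top. c * \<omega> tc * integral {0..T} (\<lambda>t. a.e 0 t * (lam ((1 - g1) * t) - \<eta>))
       \<le> integral {0..T} (\<lambda>t. b.e 0 t * (lam ((1 - g2) * t) - c * \<eta>))"
    proof (rule eventually_at_top_linorderI[of 0])
      fix T :: real assume T: "0 \<le> T"
      show "c * \<omega> tc * integral {0..T} (\<lambda>t. a.e 0 t * (lam ((1 - g1) * t) - \<eta>))
       \<le> integral {0..T} (\<lambda>t. b.e 0 t * (lam ((1 - g2) * t) - c * \<eta>))"
        unfolding integral_mult_right[symmetric]
      proof (intro integral_le integrable_on_mult_right)
        show "(\<lambda>t. a.e 0 t * (lam ((1 - g1) * t) - \<eta>)) integrable_on {0..T}"
          by (rule has_integral_integrable[OF a.hazard_excess[OF T]])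
        show "(\<lambda>t. b.e 0 t * (lam ((1 - g2) * t) - c * \<eta>)) integrable_on {0..T}"
          by (rule has_integral_integrable[OF b.hazard_excess[OF T]])
      qed (use pt in auto)
    qed
  qed simp
  then have "c * \<eta> \<le> b.leff" using a.leff_zero by (intro b.leff_ge) (simp add: \<eta>_def)
  then have "c * \<eta> / (1 - g2) \<le> b.leff / (1 - g2)" using b.g_less by (intro divide_right_mono) auto
  moreover have "c * \<eta> / (1 - g2) = \<eta> / (1 - g1)" using b.g_less by (simp add: c_def)
  ultimately show ?thesis by (simp add: \<eta>_def)
qed

text \<open>A higher discount rate multiplies the weight by \<open>exp (- d * t)\<close> and favours
  early dates, where the excess is nonpositive. For strictness, the difference \<open>h\<close> of
  the rescaled integrands is nonnegative, and it is continuous and nonzero on some interval.\<close>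

lemma leff_disc_antimono:
  assumes "race_env al be r1 g lam lam'" and "race_env al be r2 g lam lam'" and r: "r1 < r2"
  shows "race_env.leff al be r2 g lam \<le> race_env.leff al be r1 g lam"
    and "0 < x1 \<Longrightarrow> lam x1 < lam x2 \<Longrightarrow> race_env.leff al be r2 g lam < race_env.leff al be r1 g lam"
proof -
  interpret a: race_env al be r1 g lam lam' by fact
  interpret b: race_env al be r2 g lam lam' by fact
  define d where "d = r2 - r1"
  have d: "0 < d" using r by (simp add: d_def)
  define \<eta> where "\<eta> = a.leff"
  have eta: "0 \<le> \<eta>" by (simp add: \<eta>_def a.leff_nonneg)
  obtain tc where tc: "0 \<le> tc" "\<And>t. 0 < t \<Longrightarrow> t < tc \<Longrightarrow> lam ((1 - g) * t) < \<eta>"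
    "\<And>t. tc < t \<Longrightarrow> \<eta> \<le> lam ((1 - g) * t)"
    using a.leff_crossing unfolding \<eta>_def by metis
  define k where "k t = lam ((1 - g) * t) - \<eta>" for t
  define h where "h t = exp (- d * tc) * (a.e 0 t * k t) - b.e 0 t * k t" for t
  have be: "b.e 0 t = a.e 0 t * exp (- d * t)" for t
    by (simp add: a.e_def b.e_def a.de_def b.de_def d_def exp_add[symmetric] algebra_simps)
  have h_eq: "h t = a.e 0 t * (k t * (exp (- d * tc) - exp (- d * t)))" for t
    by (simp add: h_def be algebra_simps)
  have sgn: "t < tc \<Longrightarrow> k t \<le> 0" "tc < t \<Longrightarrow> 0 \<le> k t" if "0 \<le> t" for t
    using that tc(2)[of t] tc(3)[of t] eta a.lam_nonpos[of 0] by (cases "t = 0"; auto simp: k_def)+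
  have h0: "0 \<le> h t" if "0 \<le> t" for t
  proof -
    have "0 \<le> k t * (exp (- d * tc) - exp (- d * t))"
      using sgn[OF that] d by (cases t tc rule: linorder_cases) (auto intro!: mult_nonneg_nonneg mult_nonpos_nonpos)
    then show ?thesis unfolding h_eq using a.e_pos[of 0 t] by simp
  qed
  have hi: "h integrable_on {0..T}" if "0 \<le> T" for T
    unfolding h_def k_def
    by (intro integrable_diff integrable_on_mult_right has_integral_integrable[OF a.hazard_excess[OF that]]
        has_integral_integrable[OF b.hazard_excess[OF that]])
  have hT: "integral {0..T} h = exp (- d * tc) * integral {0..T} (\<lambda>t. a.e 0 t * (lam ((1 - g) * t) - \<eta>))
      - integral {0..T} (\<lambda>t. b.e 0 t * (lam ((1 - g) * t) - \<eta>))" if "0 \<le> T" for T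
    unfolding h_def k_def
    by (simp add: integral_diff integrable_on_mult_right has_integral_integrable[OF a.hazard_excess[OF that]]
        has_integral_integrable[OF b.hazard_excess[OF that]])
  have "((\<lambda>T. exp (- d * tc) * integral {0..T} (\<lambda>t. a.e 0 t * (lam ((1 - g) * t) - \<eta>))
      - integral {0..T} (\<lambda>t. b.e 0 t * (lam ((1 - g) * t) - \<eta>))) \<longlongrightarrow>
      exp (- d * tc) * (1 - (a.de + \<eta>) * a.R 0) - (1 - (b.de + \<eta>) * b.R 0)) at_top"
    by (intro tendsto_intros a.hazard_excess_tendsto b.hazard_excess_tendsto)
  then have lim: "((\<lambda>T. integral {0..T} h) \<longlongrightarrow> - (1 - (b.de + \<eta>) * b.R 0)) at_top"
    using a.leff_zero unfolding \<eta>_def[symmetric]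
    by (simp only: mult_zero_right diff_0) (rule Lim_transform_eventually, auto intro!: eventually_at_top_linorderI[of 0] simp: hT)
  have "0 \<le> - (1 - (b.de + \<eta>) * b.R 0)"
    by (rule tendsto_lowerbound[OF lim])
      (auto intro!: eventually_at_top_linorderI[of 0] integral_nonneg hi h0)
  then show "race_env.leff al be r2 g lam \<le> race_env.leff al be r1 g lam"
    using b.leff_le[of \<eta>] by (simp add: \<eta>_def)
  assume x: "0 < x1" "lam x1 < lam x2"
  have g1: "0 < 1 - g" using a.g_less by simp
  define t1 where "t1 = x1 / (1 - g)"
  define t2 where "t2 = x2 / (1 - g)"
  have xx: "x1 < x2" using x a.lam_mono[of x2 x1] by force
  have t12: "0 < t1" "t1 < t2" "(1 - g) * t1 = x1" "(1 - g) * t2 = x2"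
    using x xx g1 by (auto simp: t1_def t2_def divide_strict_right_mono)
  have kmono: "k s \<le> k t" if "s \<le> t" for s t using that g1 by (auto simp: k_def intro!: a.lam_mono)
  have kk: "k t1 < k t2" using x t12 by (simp add: k_def)
  \<comment> \<open>Either the excess is negative at \<open>t1\<close>, which lies before the
    crossing, or it is positive from \<open>t2\<close> on and dates after both \<open>t2\<close> and
    \<open>tc\<close> serve.\<close>
  have "\<exists>u v. 0 < u \<and> u < v \<and> (\<forall>t\<in>{u..v}. h t \<noteq> 0)"
  proof (cases "k t1 < 0")
    case True
    have "t1 \<le> tc"
    proof (rule ccontr)
      assume "\<not> t1 \<le> tc"
      then show False using sgn(2)[of t1] t12 True by simp
    qed
    have "h t \<noteq> 0" if "t \<in> {t1 / 4..t1 / 2}" for t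
      using that True kmono[of t t1] t12 \<open>t1 \<le> tc\<close> d a.e_pos[of 0 t] by (auto simp: h_eq)
    then show ?thesis using t12 by (intro exI[of _ "t1 / 4"] exI[of _ "t1 / 2"]) auto
  next
    case False
    define u where "u = max t2 tc + 1"
    have "h t \<noteq> 0" if t: "t \<in> {u..u + 1}" for t
    proof -
      have "t2 \<le> t" "tc < t" using t by (auto simp: u_def)
      then show ?thesis using False kk kmono[of t2 t] d a.e_pos[of 0 t] by (auto simp: h_eq)
    qed
    then show ?thesis using t12 by (intro exI[of _ u] exI[of _ "u + 1"]) (auto simp: u_def)
  qed
  then obtain u v where uv: "0 < u" "u < v" "\<And>t. t \<in> {u..v} \<Longrightarrow> h t \<noteq> 0" by blast
  have "isCont k t" if "0 < t" for t
    unfolding k_def using that g1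
    by (intro continuous_intros isCont_o2[of t "\<lambda>t. (1 - g) * t" lam] a.lam_cont) (auto intro!: continuous_intros)
  then have kc: "continuous_on {u..v} k" using uv by (intro continuous_at_imp_continuous_on) auto
  have hc: "continuous_on {u..v} h" unfolding h_def by (intro continuous_intros kc a.e_cont b.e_cont)
  have "integral {u..v} h \<noteq> 0"
    using integral_eq_0_iff[OF hc] h0 uv by (auto simp: not_less dest!: bspec[of _ _ u])
  moreover have "0 \<le> integral {u..v} h" using h0 uv by (intro integral_nonneg integrable_continuous_interval hc) auto
  ultimately have pos: "0 < integral {u..v} h" by simp
  have "integral {u..v} h \<le> integral {0..T} h" if "v \<le> T" for T
    using that uv h0 by (intro integral_subset_le hi integrable_continuous_interval hc) auto
  then have "integral {u..v} h \<le> - (1 - (b.de + \<eta>) * b.R 0)"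
    by (intro tendsto_lowerbound[OF lim]) (auto intro!: eventually_at_top_linorderI[of v])
  then show "race_env.leff al be r2 g lam < race_env.leff al be r1 g lam"
    using pos b.leff_less[of \<eta>] by (simp add: \<eta>_def)
qed

lemma leff_hazard_mono:
  assumes "race_env al be r g lam lam'" and "race_env al be r g lam2 lam2'" and le: "\<And>x. lam x \<le> lam2 x"
  shows "race_env.leff al be r g lam \<le> race_env.leff al be r g lam2"
proof -
  interpret a: race_env al be r g lam lam' by fact
  interpret b: race_env al be r g lam2 lam2' by fact
  have "b.e 0 t \<le> a.e 0 t" if "0 \<le> t" for t
  proof -
    have "integral {0..t} (\<lambda>u. lam ((1 - g) * u)) \<le> integral {0..t} (\<lambda>u. lam2 ((1 - g) * u))"
      using le by (intro integral_le a.lam_integrable b.lam_integrable continuous_intros)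
    then show ?thesis using that by (simp add: a.e_eq b.e_eq a.de_def b.de_def)
  qed
  then have "b.R 0 \<le> a.R 0"
    by (intro tendsto_le[OF _ a.R_tendsto b.R_tendsto])
      (auto intro!: eventually_at_top_linorderI[of 0] integral_le a.e_integrable b.e_integrable)
  then show ?thesis using b.R_pos by (simp add: a.leff_def b.leff_def a.de_def b.de_def frac_le)
qed

section \<open>Admissible primitives\<close>

text \<open>Both \<open>y\<close> and \<open>x + h\<close> are convex combinations of
  \<open>x\<close> and \<open>y + h\<close>, with the weights exchanged, so the two concavity bounds
  add up to \<open>f x + f (y + h)\<close>.\<close>

lemma concave_on_increments:
  fixes f :: "real \<Rightarrow> real"
  assumes f: "concave_on {0..} f" and x: "0 \<le> x" "x \<le> y" "0 \<le> h"
  shows "f (y + h) - f y \<le> f (x + h) - f x"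
proof (cases "y + h = x")
  case False
  define L where "L = y + h - x"
  have L: "0 < L" using False x by (simp add: L_def)
  have c: "(1 - t) * f x + t * f (y + h) \<le> f ((1 - t) * x + t * (y + h))" if "0 \<le> t" "t \<le> 1" for t
  proof -
    have "x \<in> {0..}" "y + h \<in> {0..}" "0 \<le> 1 - t" "(1 - t) + t = 1" using x that by auto
    then have "(1 - t) * f x + t * f (y + h) \<le> f ((1 - t) *\<^sub>R x + t *\<^sub>R (y + h))"
      using f that(1) unfolding concave_on_iff by blast
    then show ?thesis by simp
  qed
  define s where "s = (y - x) / L"
  define t where "t = h / L"
  have st: "0 \<le> s" "s \<le> 1" "0 \<le> t" "t \<le> 1" "s + t = 1" "s * L = y - x" "t * L = h"
    using x L by (auto simp: s_def t_def L_def add_divide_distrib[symmetric])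
  have "(1 - s) * x + s * (y + h) = x + s * L" "(1 - t) * x + t * (y + h) = x + t * L"
    by (simp_all add: L_def algebra_simps)
  then have "(1 - s) * f x + s * f (y + h) \<le> f y" "(1 - t) * f x + t * f (y + h) \<le> f (x + h)"
    using c[OF st(1,2)] c[OF st(3,4)] st by simp_all
  moreover have "(1 - s) * f x + s * f (y + h) + ((1 - t) * f x + t * f (y + h)) = f x + f (y + h)"
  proof -
    have t: "t = 1 - s" using st by simp
    show ?thesis unfolding t by algebra
  qed
  ultimately show ?thesis by linarith
qed (use x in auto)

lemma admissible_race_env:
  assumes "admissible p"
  obtains lam' where "race_env (alpha p) (beta p) (disc p) (safety p) (hazard p) lam'"
proof -
  have p: "alpha p > beta p" "beta p > 0" "disc p > alpha p - beta p" "0 < safety p" "safety p < 1"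
    and l0: "0 \<le> lambda0 p" and mono: "mono_on {0..} (phi p)" and conc: "concave_on {0..} (phi p)" and f0: "phi p 0 = 0"
    using assms by (auto simp: admissible_def admissible_hazard_def)
  obtain f' where f': "\<And>x. 0 < x \<Longrightarrow> (phi p has_real_derivative f' x) (at x)"
    using assms by (auto simp: admissible_def admissible_hazard_def)
  have fm: "phi p x \<le> phi p y" if "0 \<le> x" "x \<le> y" for x y using mono that by (auto simp: mono_on_def)
  note inc = concave_on_increments[OF conc]
  have "race_env (alpha p) (beta p) (disc p) (safety p) (hazard p) f'"
  proof
    show "hazard p x \<le> hazard p y" if "x \<le> y" for x y
      using that l0 fm[of x y] fm[of 0 y] f0 by (auto simp: hazard_def)
    show "hazard p (y + h) - hazard p y \<le> hazard p (x + h) - hazard p x" if "0 \<le> x" "x \<le> y" "0 \<le> h" for x y h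
    proof (cases "x = 0 \<and> 0 < y \<and> 0 < h")
      \<comment> \<open>The increment from 0 contains the jump \<open>lambda0\<close>, the increment
        from \<open>y\<close> does not.\<close>
      case True
      then show ?thesis using inc[of 0 y h] l0 f0 by (simp add: hazard_def)
    next
      case False
      have "h = 0 \<or> x = 0 \<and> y = 0 \<or> 0 < x" using False that by linarith
      then consider "h = 0" | "x = 0" "y = 0" | "0 < x" by blast
      then show ?thesis
      proof cases
        case 3
        then show ?thesis using inc[OF that] that by (simp add: hazard_def)
      qed (auto simp: hazard_def)
    qed
    show "c * hazard p x \<le> hazard p (c * x)" if "0 \<le> c" "c \<le> 1" "0 \<le> x" for c x
    proof (cases "0 < c \<and> 0 < x")
      case True
      have "c * phi p x + (1 - c) * phi p 0 \<le> phi p (c * x + (1 - c) * 0)"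
      proof -
        have "x \<in> {0..}" "(0::real) \<in> {0..}" "0 \<le> 1 - c" "c + (1 - c) = 1" using that by auto
        then have "c * phi p x + (1 - c) * phi p 0 \<le> phi p (c *\<^sub>R x + (1 - c) *\<^sub>R 0)"
          using conc that(1) unfolding concave_on_iff by blast
        then show ?thesis by simp
      qed
      moreover have "c * lambda0 p \<le> lambda0 p" using l0 that by (simp add: mult_left_le_one_le)
      moreover have "hazard p (c * x) = lambda0 p + phi p (c * x)" "hazard p x = lambda0 p + phi p x"
        using True mult_pos_pos[of c x] unfolding hazard_def by (simp_all only: not_le[symmetric] if_False conj_absorb) auto
      ultimately show ?thesis using f0 by (simp add: distrib_left)
    next
      case False
      then show ?thesis using that by (auto simp: hazard_def)
    qed
    show "(hazard p has_real_derivative f' x) (at x)" if "0 < x" for x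
    proof -
      have "((\<lambda>x. lambda0 p + phi p x) has_real_derivative f' x) (at x)"
        using f'[OF that] by (auto intro!: derivative_eq_intros)
      then show ?thesis
        by (rule has_field_derivative_transform_within_open[of _ _ _ "{0<..}"]) (use that in \<open>auto simp: hazard_def\<close>)
    qed
    show "f' y \<le> f' x" if "0 < x" "x \<le> y" for x y
    proof -
      have 1: "((\<lambda>h. (phi p (z + h) - phi p z) / h) \<longlongrightarrow> f' z) (at_right 0)" if "0 < z" for z
        using f'[OF that] unfolding DERIV_def by (rule tendsto_within_subset) auto
      show ?thesis
      proof (rule tendsto_le[OF _ 1[OF that(1)] 1[of y]])
        show "\<forall>\<^sub>F h in at_right 0. (phi p (y + h) - phi p y) / h \<le> (phi p (x + h) - phi p x) / h"
          using eventually_at_right_less[of 0] by eventually_elim (use inc[of x y] that in \<open>auto intro!: divide_right_mono\<close>)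
      qed (use that in auto)
    qed
  qed (use p in \<open>auto simp: hazard_def\<close>)
  then show thesis using that by blast
qed

text \<open>\<open>R\<close> comes from a nonnegative Lebesgue integral and
  \<open>race_value\<close> is a gauge integral over a half-line; for a nonnegative measurable
  integrand with finite integral they agree.\<close>

lemma race_value_eq:
  assumes "race_env (alpha p) (beta p) (disc p) (safety p) (hazard p) lam'"
  shows "race_value p D = race_env.R (alpha p) (beta p) (disc p) (safety p) (hazard p) D"
    and "hazard_ratio p = race_env.leff (alpha p) (beta p) (disc p) (safety p) (hazard p) / (1 - safety p)"
proof -
  interpret race_env "alpha p" "beta p" "disc p" "safety p" "hazard p" lam' by fact
  have R: "race_value p D = R D" for D
  proof -
    have eff: "eff_disc p = de" by (simp add: eff_disc_def de_def)
    have e: "exp (- eff_disc p * t - integral {0..t} (\<lambda>s. hazard p (D + (1 - safety p) * s))) = e D t" if "0 \<le> t" for t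
      using integral_unique[OF lam_affine_integral[OF that, of "1 - safety p" D]] g_less by (simp add: e_def eff)
    have nn: "(\<integral>\<^sup>+ t. ennreal (fl D 0 (\<lambda>t. t) t * indicator {0..} t) \<partial>lborel) = ennreal (R D)"
    proof -
      have "ennreal (fl D 0 (\<lambda>t. t) t * indicator {0..} t) = ennreal (fl D 0 (\<lambda>t. t) t) * indicator {0..} t" for t
        by (simp add: indicator_def)
      then show ?thesis using nn_J(1)[OF admpath_id order.refl, of D] by (simp add: R_def)
    qed
    have "(\<lambda>t. fl D 0 (\<lambda>t. t) t * indicat_real {0..} t) \<in> borel_measurable borel"
      using borel_measurable_continuous_on_indicator[OF _ fl_cont[OF admpath_id, of D 0]] by (simp add: mult.commute)
    from nn_integral_has_integral[OF this _ nn]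
    have "((\<lambda>t. fl D 0 (\<lambda>t. t) t * indicat_real {0..} t) has_integral R D) UNIV"
      using R_nonneg fl_pos by (simp add: less_imp_le)
    moreover have "(\<lambda>t. fl D 0 (\<lambda>t. t) t * indicat_real {0..} t) = (\<lambda>t. if t \<in> {0..} then e D t else 0)"
      by (auto simp: indicator_def fl_race)
    ultimately have "(e D has_integral R D) {0..}" using has_integral_restrict_UNIV[of "{0..}" "e D" "R D"] by simp
    then show ?thesis unfolding race_value_def using e by (subst integral_cong[of _ _ "e D"]) (auto simp: integral_unique)
  qed
  show "race_value p D = R D" by (rule R)
  show "hazard_ratio p = leff / (1 - safety p)"
    by (simp add: hazard_ratio_def eff_hazard_def leff_def R eff_disc_def de_def)
qed

section \<open>Absolutely continuous paths with bounded speed\<close>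

text \<open>Intervals between \<open>u\<close> and \<open>v\<close> in increasing order with
  disjoint interiors, the families on which absolute continuity is tested. Lists make it easy to
  join two such families.\<close>

fun chain :: "real \<Rightarrow> real \<Rightarrow> (real \<times> real) list \<Rightarrow> bool" where
  "chain u v [] \<longleftrightarrow> u \<le> v"
| "chain u v (I # L) \<longleftrightarrow> u \<le> fst I \<and> fst I \<le> snd I \<and> chain (snd I) v L"

lemma chain_weaken: "u \<le> w \<Longrightarrow> chain w v L \<Longrightarrow> chain u v L"
  by (cases L) auto

lemma chain_append: "chain u w L \<Longrightarrow> chain w v L' \<Longrightarrow> chain u v (L @ L')"
  by (induction u w L rule: chain.induct) (auto intro: chain_weaken)

lemma chain_le: "chain u v L \<Longrightarrow> u \<le> v"
  by (induction u v L rule: chain.induct) auto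

lemma chain_bounds: "chain u v L \<Longrightarrow> I \<in> set L \<Longrightarrow> u \<le> fst I \<and> fst I \<le> snd I \<and> snd I \<le> v"
  by (induction u v L rule: chain.induct) (auto dest: chain_le)

lemma chain_nth_Suc: "chain u v L \<Longrightarrow> Suc k < length L \<Longrightarrow> snd (L ! k) \<le> fst (L ! Suc k)"
proof (induction u v L arbitrary: k rule: chain.induct)
  case (2 u v I L)
  show ?case
  proof (cases k)
    case 0
    then show ?thesis using 2(2,3) chain_bounds[of "snd I" v L "L ! 0"] by auto
  next
    case (Suc k')
    then show ?thesis using 2 by auto
  qed
qed simp

lemma chain_length_le:
  assumes U: "U \<in> sets borel"
  shows "chain u v L \<Longrightarrow> (\<And>I. I \<in> set L \<Longrightarrow> {fst I..snd I} \<subseteq> U) \<Longrightarrow>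
    ennreal (\<Sum>I\<leftarrow>L. snd I - fst I) \<le> emeasure lborel (U \<inter> {u..<v})"
proof (induction u v L rule: chain.induct)
  case (2 u v I L)
  have c: "chain (snd I) v L" and le: "u \<le> fst I" "fst I \<le> snd I" using 2(2) by auto
  have v: "snd I \<le> v" using chain_le[OF c] .
  have "0 \<le> (\<Sum>I\<leftarrow>L. snd I - fst I)" using chain_bounds[OF c] by (intro sum_list_nonneg) auto
  then have "ennreal (\<Sum>I\<leftarrow>I # L. snd I - fst I) = ennreal (snd I - fst I) + ennreal (\<Sum>I\<leftarrow>L. snd I - fst I)"
    using le by (simp add: ennreal_plus)
  also have "\<dots> \<le> emeasure lborel {fst I..<snd I} + emeasure lborel (U \<inter> {snd I..<v})"
    using 2(1)[OF c] 2(3) le by (intro add_mono) auto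
  also have "\<dots> = emeasure lborel ({fst I..<snd I} \<union> (U \<inter> {snd I..<v}))"
    using U by (intro plus_emeasure) auto
  also have "\<dots> \<le> emeasure lborel (U \<inter> {u..<v})"
  proof (intro emeasure_mono)
    have "{fst I..<snd I} \<subseteq> U" using 2(3)[of I] by force
    then show "{fst I..<snd I} \<union> (U \<inter> {snd I..<v}) \<subseteq> U \<inter> {u..<v}" using le v by auto
  qed (use U in auto)
  finally show ?case .
qed simp

text \<open>
  A point of the exceptional null set is covered by an interval inside an open set of small measure,
  where absolute continuity applies; near any other point the derivative bounds the increment.
\<close>

lemma abs_continuous_increment_le:
  fixes f :: "real \<Rightarrow> real"
  assumes ac: "abs_continuous a b f" and ab: "a \<le> b"
    and der: "AE s in lborel. a < s \<and> s < b \<longrightarrow> (\<exists>d\<le>hi. (f has_vector_derivative d) (at s))"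
  shows "f b - f a \<le> hi * (b - a)"
proof -
  have main: "f b - f a \<le> hi * (b - a) + \<epsilon> * (b - a + 2)" if ep: "0 < \<epsilon>" for \<epsilon>
  proof -
    \<comment> \<open>\<open>c\<close> bounds what the removed intervals can contribute per unit of
      length; their total length stays below \<delta> with
      \<open>\<delta> * c \<le> \<epsilon>\<close>.\<close>
    define c where "c = \<bar>hi\<bar> + \<epsilon>"
    have c: "0 < c" using ep by (simp add: c_def)
    obtain \<delta>0 where d0: "0 < \<delta>0" and ac': "\<And>n (x::nat \<Rightarrow> real) y. (\<forall>k<n. a \<le> x k \<and> x k \<le> y k \<and> y k \<le> b) \<Longrightarrow>
        (\<forall>k. Suc k < n \<longrightarrow> y k \<le> x (Suc k)) \<Longrightarrow> (\<Sum>k<n. y k - x k) < \<delta>0 \<Longrightarrow> (\<Sum>k<n. dist (f (x k)) (f (y k))) < \<epsilon>"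
      using ac[unfolded abs_continuous_def, rule_format, OF ep] by (elim exE conjE) (rule that, assumption, blast)
    define \<delta> where "\<delta> = min \<delta>0 (\<epsilon> / c)"
    have d: "0 < \<delta>" "\<delta> \<le> \<delta>0" "\<delta> * c \<le> \<epsilon>" using d0 ep c by (auto simp: \<delta>_def min_def field_simps)
    obtain N0 where N0: "N0 \<in> null_sets lborel"
      "{s \<in> space lborel. \<not> (a < s \<and> s < b \<longrightarrow> (\<exists>d\<le>hi. (f has_vector_derivative d) (at s)))} \<subseteq> N0"
      using der by (auto simp: eventually_ae_filter)
    \<comment> \<open>The end points join the exceptional set because the derivative is controlled
      in the open interval only.\<close>
    define N where "N = N0 \<union> {a, b}"
    have N: "N \<in> null_sets lborel" unfolding N_def using N0(1) finite_imp_null_set_lborel[of "{a, b}"] by (intro null_sets.Un) auto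
    then obtain U where U: "open U" "N \<subseteq> U" "emeasure lborel (U - N) < ennreal \<delta>"
      using outer_regular_lborel[of N \<delta>] d by (auto simp: null_sets_def)
    have Ub: "U \<in> sets borel" using U by simp
    have "emeasure lborel U \<le> emeasure lborel (U - N) + emeasure lborel N"
      using N Ub by (intro order_trans[OF emeasure_mono emeasure_subadditive]) (auto simp: null_sets_def)
    then have mU: "emeasure lborel U < ennreal \<delta>" using N U(3) by (simp add: null_sets_def)
    \<comment> \<open>\<open>Q\<close> combines the derivative bound on most of
      \<open>[u, v]\<close> with a chain of intervals inside \<open>U\<close>. It is additive and
      holds on short intervals around every point, so Bolzano's bisection extends it to
      \<open>[a, b]\<close>.\<close>
    define Q where "Q u v \<longleftrightarrow> u \<le> v \<and> a \<le> u \<and> v \<le> b \<longrightarrow> (\<exists>L. chain u v L \<and> (\<forall>I\<in>set L. {fst I..snd I} \<subseteq> U) \<and>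
      f v - f u \<le> (hi + \<epsilon>) * (v - u - (\<Sum>I\<leftarrow>L. snd I - fst I)) + (\<Sum>I\<leftarrow>L. dist (f (fst I)) (f (snd I))))" for u v
    have "Q a b"
    proof (rule Bolzano[OF ab])
      fix u w v assume "Q u w" "Q w v" and uwv: "u \<le> w" "w \<le> v"
      show "Q u v" unfolding Q_def
      proof (intro impI)
        assume "u \<le> v \<and> a \<le> u \<and> v \<le> b"
        then have r: "u \<le> w \<and> a \<le> u \<and> w \<le> b" "w \<le> v \<and> a \<le> w \<and> v \<le> b" using uwv by auto
        obtain L where L: "chain u w L" "\<forall>I\<in>set L. {fst I..snd I} \<subseteq> U"
          "f w - f u \<le> (hi + \<epsilon>) * (w - u - (\<Sum>I\<leftarrow>L. snd I - fst I)) + (\<Sum>I\<leftarrow>L. dist (f (fst I)) (f (snd I)))"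
          using \<open>Q u w\<close> r(1) unfolding Q_def by blast
        obtain M where M: "chain w v M" "\<forall>I\<in>set M. {fst I..snd I} \<subseteq> U"
          "f v - f w \<le> (hi + \<epsilon>) * (v - w - (\<Sum>I\<leftarrow>M. snd I - fst I)) + (\<Sum>I\<leftarrow>M. dist (f (fst I)) (f (snd I)))"
          using \<open>Q w v\<close> r(2) unfolding Q_def by blast
        show "\<exists>L. chain u v L \<and> (\<forall>I\<in>set L. {fst I..snd I} \<subseteq> U) \<and>
          f v - f u \<le> (hi + \<epsilon>) * (v - u - (\<Sum>I\<leftarrow>L. snd I - fst I)) + (\<Sum>I\<leftarrow>L. dist (f (fst I)) (f (snd I)))"
          using L M by (intro exI[of _ "L @ M"]) (auto simp: chain_append algebra_simps)
      qed
    next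
      fix x assume x: "a \<le> x" "x \<le> b"
      show "\<exists>d>0. \<forall>u v. u \<le> x \<and> x \<le> v \<and> v - u < d \<longrightarrow> Q u v"
      proof (cases "x \<in> N")
        case True
        then obtain e where e: "e > 0" "ball x e \<subseteq> U" using U open_contains_ball by blast
        have "Q u v" if "u \<le> x" "x \<le> v" "v - u < e" for u v
        proof -
          have "{u..v} \<subseteq> U" using that e(2) by (auto simp: dist_real_def subset_iff)
          then show ?thesis using that unfolding Q_def
            by (intro impI exI[of _ "[(u, v)]"]) (auto simp: dist_real_def)
        qed
        then show ?thesis using e by blast
      next
        case False
        then have ab': "a < x" "x < b" using x by (auto simp: N_def)
        then obtain D where D: "D \<le> hi" "(f has_vector_derivative D) (at x)" using False N0(2) by (auto simp: N_def)
        obtain e where e: "e > 0" "\<And>y. \<bar>y - x\<bar> < e \<Longrightarrow> \<bar>f y - f x - (y - x) * D\<bar> \<le> \<epsilon> * \<bar>y - x\<bar>"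
          using D(2) ep unfolding has_vector_derivative_def has_derivative_at_alt by (auto simp: real_norm_def)
        have "Q u v" if uv: "u \<le> x" "x \<le> v" "v - u < e" for u v
        proof -
          have "f v - f x - (v - x) * D \<le> \<epsilon> * (v - x)" using e(2)[of v] uv by auto
          moreover have "- (f u - f x - (u - x) * D) \<le> \<epsilon> * (x - u)" using e(2)[of u] uv by auto
          ultimately have "f v - f u \<le> (v - u) * D + \<epsilon> * (v - u)" by (simp add: algebra_simps)
          moreover have "(v - u) * D \<le> (v - u) * hi" using D(1) uv by (intro mult_left_mono) auto
          ultimately have "f v - f u \<le> (hi + \<epsilon>) * (v - u)" by (simp add: algebra_simps)
          then show ?thesis unfolding Q_def by (intro impI exI[of _ "[]"]) auto
        qed
        then show ?thesis using e by blast
      qed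
    qed
    then obtain L where L: "chain a b L" "\<forall>I\<in>set L. {fst I..snd I} \<subseteq> U"
      "f b - f a \<le> (hi + \<epsilon>) * (b - a - (\<Sum>I\<leftarrow>L. snd I - fst I)) + (\<Sum>I\<leftarrow>L. dist (f (fst I)) (f (snd I)))"
      unfolding Q_def using ab by blast
    let ?len = "\<Sum>I\<leftarrow>L. snd I - fst I"
    have len0: "0 \<le> ?len" using chain_bounds[OF L(1)] by (intro sum_list_nonneg) auto
    have "ennreal ?len \<le> emeasure lborel (U \<inter> {a..<b})" using L(2) by (intro chain_length_le[OF Ub L(1)]) auto
    also have "\<dots> \<le> emeasure lborel U" using Ub by (intro emeasure_mono) auto
    finally have "ennreal ?len < ennreal \<delta>" using mU by (rule le_less_trans)
    then have len: "?len < \<delta>" using len0 by (simp add: ennreal_less_iff)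
    have s1: "(\<Sum>k<length L. snd (L ! k) - fst (L ! k)) = ?len"
      "(\<Sum>k<length L. dist (f (fst (L ! k))) (f (snd (L ! k)))) = (\<Sum>I\<leftarrow>L. dist (f (fst I)) (f (snd I)))"
      by (simp_all add: sum_list_sum_nth atLeast0LessThan)
    have "(\<Sum>I\<leftarrow>L. dist (f (fst I)) (f (snd I))) < \<epsilon>"
      unfolding s1(2)[symmetric] using chain_bounds[OF L(1)] chain_nth_Suc[OF L(1)] len d(2) s1(1)
      by (intro ac') (auto simp: nth_mem)
    moreover have "- ((hi + \<epsilon>) * ?len) \<le> \<epsilon>"
    proof -
      have "- ((hi + \<epsilon>) * ?len) = (- (hi + \<epsilon>)) * ?len" by (simp only: minus_mult_left)
      also have "\<dots> \<le> \<bar>hi + \<epsilon>\<bar> * ?len" using len0 by (intro mult_right_mono) auto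
      also have "\<dots> \<le> c * \<delta>" using len len0 ep c by (intro mult_mono) (auto simp: c_def)
      finally show ?thesis using d(3) by (simp add: mult.commute)
    qed
    ultimately show ?thesis using L(3) by (simp add: algebra_simps)
  qed
  have "((\<lambda>\<epsilon>. hi * (b - a) + \<epsilon> * (b - a + 2)) \<longlongrightarrow> hi * (b - a) + 0 * (b - a + 2)) (at_right 0)"
    by (intro tendsto_intros)
  then have "f b - f a \<le> hi * (b - a) + 0 * (b - a + 2)"
    by (rule tendsto_lowerbound) (use main in \<open>auto intro!: eventually_at_rightI[of 0 1]\<close>)
  then show ?thesis by simp
qed

lemma abs_continuous_compose_dist:
  assumes "abs_continuous a b f" "\<And>x y. dist (h x) (h y) \<le> dist x y"
  shows "abs_continuous a b (\<lambda>t. h (f t))"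
  unfolding abs_continuous_def
proof (intro allI impI)
  fix \<epsilon> :: real assume "0 < \<epsilon>"
  then obtain \<delta> where \<delta>: "\<delta> > 0" "\<And>n (x::nat \<Rightarrow> real) y. (\<forall>k<n. a \<le> x k \<and> x k \<le> y k \<and> y k \<le> b) \<and>
        (\<forall>k. Suc k < n \<longrightarrow> y k \<le> x (Suc k)) \<and> (\<Sum>k<n. y k - x k) < \<delta> \<Longrightarrow> (\<Sum>k<n. dist (f (x k)) (f (y k))) < \<epsilon>"
    using assms(1) unfolding abs_continuous_def by blast
  show "\<exists>\<delta>>0. \<forall>n (x::nat \<Rightarrow> real) y. (\<forall>k<n. a \<le> x k \<and> x k \<le> y k \<and> y k \<le> b) \<and>
        (\<forall>k. Suc k < n \<longrightarrow> y k \<le> x (Suc k)) \<and> (\<Sum>k<n. y k - x k) < \<delta>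
        \<longrightarrow> (\<Sum>k<n. dist (h (f (x k))) (h (f (y k)))) < \<epsilon>"
    using \<delta>(1) by (intro exI[of _ \<delta>]) (auto intro!: le_less_trans[OF sum_mono \<delta>(2)] assms(2))
qed

lemma abs_continuous_subinterval:
  "abs_continuous a b f \<Longrightarrow> a \<le> c \<Longrightarrow> d \<le> b \<Longrightarrow> abs_continuous c d f"
  unfolding abs_continuous_def
  by (elim all_forward imp_forward ex_forward conj_forward) (auto intro: order_trans)

lemma abs_continuous_speed_bounds:
  fixes f :: "real \<Rightarrow> real"
  assumes ac: "abs_continuous a b f" and ab: "a \<le> b"
    and der: "AE s in lborel. a < s \<and> s < b \<longrightarrow> (\<exists>d\<in>{lo..hi}. (f has_vector_derivative d) (at s))"
  shows "lo * (b - a) \<le> f b - f a" "f b - f a \<le> hi * (b - a)"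
proof -
  show "f b - f a \<le> hi * (b - a)"
    by (rule abs_continuous_increment_le[OF ac ab]) (use der in eventually_elim, metis atLeastAtMost_iff)
  have "abs_continuous a b (\<lambda>t. - f t)"
    by (rule abs_continuous_compose_dist[OF ac]) (simp add: dist_real_def)
  then have "- f b - (- f a) \<le> (- lo) * (b - a)"
    by (rule abs_continuous_increment_le[OF _ ab])
      (use der in eventually_elim, metis atLeastAtMost_iff has_vector_derivative_minus neg_le_iff_le)
  then show "lo * (b - a) \<le> f b - f a" by simp
qed

lemma Lipschitz_abs_continuous:
  assumes "\<And>s t. a \<le> s \<Longrightarrow> s \<le> t \<Longrightarrow> t \<le> b \<Longrightarrow> dist (f s) (f t) \<le> K * (t - s)" "0 \<le> K"
  shows "abs_continuous a b f"
  unfolding abs_continuous_def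
proof (intro allI impI)
  fix \<epsilon> :: real assume ep: "0 < \<epsilon>"
  show "\<exists>\<delta>>0. \<forall>n (x::nat \<Rightarrow> real) y. (\<forall>k<n. a \<le> x k \<and> x k \<le> y k \<and> y k \<le> b) \<and>
        (\<forall>k. Suc k < n \<longrightarrow> y k \<le> x (Suc k)) \<and> (\<Sum>k<n. y k - x k) < \<delta>
        \<longrightarrow> (\<Sum>k<n. dist (f (x k)) (f (y k))) < \<epsilon>"
  proof (intro exI[of _ "\<epsilon> / (K + 1)"] conjI allI impI)
    fix n and x y :: "nat \<Rightarrow> real"
    assume *: "(\<forall>k<n. a \<le> x k \<and> x k \<le> y k \<and> y k \<le> b) \<and> (\<forall>k. Suc k < n \<longrightarrow> y k \<le> x (Suc k)) \<and> (\<Sum>k<n. y k - x k) < \<epsilon> / (K + 1)"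
    have "(\<Sum>k<n. dist (f (x k)) (f (y k))) \<le> (\<Sum>k<n. K * (y k - x k))" using * assms(1) by (intro sum_mono) auto
    also have "\<dots> = K * (\<Sum>k<n. y k - x k)" by (simp add: sum_distrib_left)
    also have "\<dots> \<le> (K + 1) * (\<Sum>k<n. y k - x k)" using * by (intro mult_right_mono sum_nonneg) auto
    also have "\<dots> < \<epsilon>" using * assms(2) by (simp add: field_simps)
    finally show "(\<Sum>k<n. dist (f (x k)) (f (y k))) < \<epsilon>" .
  qed (use ep assms in auto)
qed

section \<open>Capabilities along feasible paths\<close>

lemma cap_dist: "dist (cap i S) (cap i S') \<le> dist S S'"
proof (cases S; cases S')
  fix a1 a2 x b1 b2 y assume *: "S = (a1, a2, x)" "S' = (b1, b2, y)"
  show ?thesis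
  proof (cases i)
    case Firm1 then show ?thesis using dist_fst_le[of S S'] by (simp add: *)
  next
    case Firm2
    have "dist a2 b2 \<le> dist (a2, x) (b2, y)" using dist_fst_le[of "(a2, x)" "(b2, y)"] by simp
    also have "\<dots> \<le> dist S S'" using dist_snd_le[of S S'] by (simp add: *)
    finally show ?thesis using Firm2 by (simp add: *)
  qed
qed

definition speed :: "firm \<Rightarrow> real \<times> real \<Rightarrow> real" where
  "speed i a = (case i of Firm1 \<Rightarrow> fst a | Firm2 \<Rightarrow> snd a)"

lemma cap_derivative:
  assumes "(S has_vector_derivative (a1, a2, x)) (at s)"
  shows "((\<lambda>t. cap i (S t)) has_vector_derivative speed i (a1, a2)) (at s)"
    and "((\<lambda>t. snd (snd (S t))) has_vector_derivative x) (at s)"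
proof -
  note 1 = bounded_linear.has_vector_derivative[OF bounded_linear_fst assms]
  note 2 = bounded_linear.has_vector_derivative[OF bounded_linear_snd assms]
  note 3 = bounded_linear.has_vector_derivative[OF bounded_linear_fst 2]
  have c: "cap Firm1 = fst" "cap Firm2 = (\<lambda>S. fst (snd S))" by (auto simp: fun_eq_iff)
  show "((\<lambda>t. cap i (S t)) has_vector_derivative speed i (a1, a2)) (at s)"
    using 1 3 by (cases i) (simp_all add: c speed_def)
  show "((\<lambda>t. snd (snd (S t))) has_vector_derivative x) (at s)"
    using bounded_linear.has_vector_derivative[OF bounded_linear_snd 2] by simp
qed

lemma cap_speed_bounds:
  assumes ac: "abs_continuous_path S" and ab: "0 \<le> a" "a \<le> b"
    and der: "AE s in lborel. a < s \<and> s < b \<longrightarrow> (\<exists>u x. speed i u \<in> {lo..hi} \<and> (S has_vector_derivative (fst u, snd u, x)) (at s))"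
  shows "lo * (b - a) \<le> cap i (S b) - cap i (S a)" "cap i (S b) - cap i (S a) \<le> hi * (b - a)"
proof -
  have ac': "abs_continuous a b (\<lambda>t. cap i (S t))"
    using ac ab unfolding abs_continuous_path_def
    by (intro abs_continuous_compose_dist[where h = "cap i", OF abs_continuous_subinterval[of 0 b S] cap_dist]) auto
  have d: "AE s in lborel. a < s \<and> s < b \<longrightarrow> (\<exists>d\<in>{lo..hi}. ((\<lambda>t. cap i (S t)) has_vector_derivative d) (at s))"
    using der by eventually_elim (use cap_derivative(1) in fastforce)
  show "lo * (b - a) \<le> cap i (S b) - cap i (S a)" "cap i (S b) - cap i (S a) \<le> hi * (b - a)"
    using abs_continuous_speed_bounds[OF ac' ab(2) d] by auto
qed

lemma feasible_path_bounds:
  assumes S: "feasible_path p S" and st: "0 \<le> s" "s \<le> t"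
  shows "cap i (S s) \<le> cap i (S t)" "cap i (S t) \<le> cap i (S s) + (t - s)"
    and "snd (snd (S t)) = snd (snd (S s)) + safety p * (t - s)"
proof -
  have ac: "abs_continuous_path S"
    and der: "AE s in lborel. s > 0 \<longrightarrow> (\<exists>a1\<in>{0..1}. \<exists>a2\<in>{0..1}. (S has_vector_derivative (a1, a2, safety p)) (at s))"
    using S by (auto simp: feasible_path_def)
  have "AE u in lborel. s < u \<and> u < t \<longrightarrow> (\<exists>w x. speed i w \<in> {0..1} \<and> (S has_vector_derivative (fst w, snd w, x)) (at u))"
    using der
  proof eventually_elim
    case (elim u)
    show ?case
    proof (intro impI)
      assume "s < u \<and> u < t"
      then obtain a1 a2 where "a1 \<in> {0..1}" "a2 \<in> {0..1}" "(S has_vector_derivative (a1, a2, safety p)) (at u)"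
        using elim st by auto
      then show "\<exists>w x. speed i w \<in> {0..1} \<and> (S has_vector_derivative (fst w, snd w, x)) (at u)"
        by (intro exI[of _ "(a1, a2)"] exI[of _ "safety p"]) (auto simp: speed_def split: firm.split)
    qed
  qed
  from cap_speed_bounds[OF ac st this] show "cap i (S s) \<le> cap i (S t)" "cap i (S t) \<le> cap i (S s) + (t - s)" by auto
  have "abs_continuous s t (\<lambda>t. snd (snd (S t)))"
    using ac st unfolding abs_continuous_path_def
    by (intro abs_continuous_compose_dist[where h = "\<lambda>S. snd (snd S)", OF abs_continuous_subinterval[of 0 t S]])
      (auto intro: order_trans[OF dist_snd_le dist_snd_le])
  moreover have "AE u in lborel. s < u \<and> u < t \<longrightarrow> (\<exists>d\<in>{safety p..safety p}. ((\<lambda>t. snd (snd (S t))) has_vector_derivative d) (at u))"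
    using der by eventually_elim (use cap_derivative(2) st in fastforce)
  ultimately show "snd (snd (S t)) = snd (snd (S s)) + safety p * (t - s)"
    using abs_continuous_speed_bounds[OF _ st(2), of "\<lambda>t. snd (snd (S t))" "safety p" "safety p"] by fastforce
qed

lemma state_dist_le: "dist S S' \<le> dist (cap Firm1 S) (cap Firm1 S') + dist (cap Firm2 S) (cap Firm2 S') + dist (snd (snd S)) (snd (snd S'))"
proof (cases S; cases S')
  fix a1 a2 x b1 b2 y assume *: "S = (a1, a2, x)" "S' = (b1, b2, y)"
  have "dist (a2, x) (b2, y) \<le> dist a2 b2 + dist x y"
    unfolding dist_prod_def by (simp add: sqrt_sum_squares_le_sum)
  moreover have "dist (a1, a2, x) (b1, b2, y) \<le> dist a1 b1 + dist (a2, x) (b2, y)"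
    unfolding dist_prod_def[of "(a1, _)"] by (simp add: sqrt_sum_squares_le_sum)
  ultimately show ?thesis by (simp add: *)
qed

lemma feasible_path_Lipschitz:
  assumes "feasible_path p S" "0 \<le> s" "s \<le> t"
  shows "dist (S s) (S t) \<le> (2 + \<bar>safety p\<bar>) * (t - s)"
proof -
  have "dist (cap i (S s)) (cap i (S t)) \<le> t - s" for i
    using feasible_path_bounds(1,2)[OF assms, of i] by (simp add: dist_real_def)
  moreover have "dist (snd (snd (S s))) (snd (snd (S t))) = \<bar>safety p\<bar> * (t - s)"
    using feasible_path_bounds(3)[OF assms] assms(3) by (simp add: dist_real_def abs_mult)
  ultimately show ?thesis
    using state_dist_le[of "S s" "S t"] by (simp add: algebra_simps) (smt (verit))
qed

section \<open>Continuations and payoffs\<close>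

lemma feasible_path_cont:
  assumes "feasible_path p S" shows "continuous_on {0..} S"
proof -
  have "dist (S s) (S t) \<le> (2 + \<bar>safety p\<bar>) * dist s t" if "s \<in> {0..}" "t \<in> {0..}" for s t
    using feasible_path_Lipschitz[OF assms, of s t] feasible_path_Lipschitz[OF assms, of t s] that
    by (cases "s \<le> t") (auto simp: dist_real_def dist_commute)
  then have "(2 + \<bar>safety p\<bar>)-lipschitz_on {0..} S" by (intro lipschitz_onI) auto
  then show ?thesis by (rule lipschitz_on_continuous_on)
qed

lemma continuous_on_cap [continuous_intros]: "continuous_on A f \<Longrightarrow> continuous_on A (\<lambda>x. cap i (f x))"
proof -
  assume f: "continuous_on A f"
  have c: "cap Firm1 = fst" "cap Firm2 = (\<lambda>S. fst (snd S))" by (auto simp: fun_eq_iff)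
  show ?thesis using f by (cases i) (auto simp: c intro!: continuous_intros)
qed

text \<open>Through this bound, neighbourhoods of the current state control neighbourhoods of
  histories, which is how Krasovskii sets of Markov strategies are computed.\<close>

lemma hist_dist_ge:
  assumes h: "feasible_history p h" "feasible_history p h'"
  shows "dist (snd h (fst h)) (snd h' (fst h')) \<le> hist_dist h h'"
proof -
  have bd: "norm (snd k (min s (fst k))) \<le> norm (snd k 0) + (2 + \<bar>safety p\<bar>) * fst k"
    if k: "feasible_history p k" and s: "0 \<le> s" for k s
  proof -
    have "dist (snd k 0) (snd k (min s (fst k))) \<le> (2 + \<bar>safety p\<bar>) * (min s (fst k) - 0)"
      using k s by (intro feasible_path_Lipschitz[of p]) (auto simp: feasible_history_def)
    also have "\<dots> \<le> (2 + \<bar>safety p\<bar>) * fst k" by (intro mult_left_mono) auto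
    finally show ?thesis using norm_triangle_sub[of "snd k (min s (fst k))" "snd k 0"] by (simp add: dist_norm norm_minus_commute)
  qed
  let ?f = "\<lambda>s. norm (snd h (min s (fst h)) - snd h' (min s (fst h')))"
  \<comment> \<open>At the later of the two dates both stopped paths show their current states. The
    supremum is over a bounded set because feasible paths are Lipschitz.\<close>
  have "?f (max (fst h) (fst h')) \<le> (SUP s\<in>{0..}. ?f s)"
  proof (rule cSUP_upper)
    show "max (fst h) (fst h') \<in> {0..}" using h by (auto simp: feasible_history_def)
    have "?f s \<le> (norm (snd h 0) + (2 + \<bar>safety p\<bar>) * fst h) + (norm (snd h' 0) + (2 + \<bar>safety p\<bar>) * fst h')" if "0 \<le> s" for s
      using bd[OF h(1) that] bd[OF h(2) that] norm_triangle_ineq4[of "snd h (min s (fst h))" "snd h' (min s (fst h'))"] by linarith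
    then show "bdd_above (?f ` {0..})" by (intro bdd_aboveI2) auto
  qed
  then show ?thesis by (simp add: hist_dist_def dist_norm min_def max_def split: if_splits)
qed

text \<open>A slab of speed pairs is closed and convex, so it contains the Krasovskii set as soon as
  it contains the prescribed speeds on one neighbourhood.\<close>

lemma krasovskii_speed:
  assumes a: "a \<in> krasovskii p \<sigma> h" and ep: "0 < \<epsilon>"
    and b: "\<And>h'. feasible_history p h' \<Longrightarrow> hist_dist h h' < \<epsilon> \<Longrightarrow> speed_after (\<sigma> i) h' \<in> {lo..hi}"
  shows "speed i a \<in> {lo..hi}"
proof -
  define K where "K = {a. speed i a \<in> {lo..hi}}"
  have K: "K = (case i of Firm1 \<Rightarrow> {lo..hi} \<times> UNIV | Firm2 \<Rightarrow> UNIV \<times> {lo..hi})"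
    by (cases i) (auto simp: K_def speed_def)
  have "closed K" "convex K" unfolding K by (cases i; auto intro!: closed_Times convex_Times)+
  moreover have "{(speed_after (\<sigma> Firm1) h', speed_after (\<sigma> Firm2) h') | h'. feasible_history p h' \<and> hist_dist h h' < \<epsilon>} \<subseteq> K"
    using b by (cases i) (auto simp: K_def speed_def)
  ultimately have "closure (convex hull {(speed_after (\<sigma> Firm1) h', speed_after (\<sigma> Firm2) h') | h'.
      feasible_history p h' \<and> hist_dist h h' < \<epsilon>}) \<subseteq> K" (is "?X \<subseteq> K")
    by (intro closure_minimal hull_minimal)
  moreover have "a \<in> ?X" using a ep unfolding krasovskii_def by blast
  ultimately show ?thesis by (auto simp: K_def)
qed

lemma krasovskii_value:
  assumes "feasible_history p h"
  shows "(speed_after (\<sigma> Firm1) h, speed_after (\<sigma> Firm2) h) \<in> krasovskii p \<sigma> h"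
  unfolding krasovskii_def
proof (intro INT_I)
  fix \<epsilon> :: real assume "\<epsilon> \<in> {0<..}"
  then have "hist_dist h h < \<epsilon>" by (simp add: hist_dist_def)
  then have "(speed_after (\<sigma> Firm1) h, speed_after (\<sigma> Firm2) h)
      \<in> {(speed_after (\<sigma> Firm1) h', speed_after (\<sigma> Firm2) h') | h'. feasible_history p h' \<and> hist_dist h h' < \<epsilon>}"
    using assms by blast
  then show "(speed_after (\<sigma> Firm1) h, speed_after (\<sigma> Firm2) h) \<in> closure (convex hull
      {(speed_after (\<sigma> Firm1) h', speed_after (\<sigma> Firm2) h') | h'. feasible_history p h' \<and> hist_dist h h' < \<epsilon>})"
    by (meson closure_subset hull_inc subsetD)
qed

definition unit_profile :: "primitives \<Rightarrow> profile \<Rightarrow> bool" where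
  "unit_profile p \<sigma> \<longleftrightarrow> (\<forall>i h. feasible_history p h \<longrightarrow> speed_after (\<sigma> i) h \<in> {0..1})"

lemma unit_profile_deviation:
  assumes "\<And>i. is_markov_strategy (m i)" "is_strategy p \<sigma>'"
  shows "unit_profile p ((of_markov m)(i := \<sigma>'))"
  unfolding unit_profile_def
proof (intro allI impI)
  fix j h assume h: "feasible_history p h"
  show "speed_after (((of_markov m)(i := \<sigma>')) j) h \<in> {0..1}"
  proof (cases "j = i")
    case True
    then show ?thesis using assms(2) h by (auto simp: feasible_history_def is_strategy_def outcomes_def speed_after_def)
  next
    case False
    then have "speed_after (((of_markov m)(i := \<sigma>')) j) h = m j (snd h (fst h))"
      by (simp add: of_markov_def speed_after_def)
    then show ?thesis using assms(1)[of j] unfolding is_markov_strategy_def by metis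
  qed
qed

lemma unit_profile_markov: "(\<And>i. is_markov_strategy (m i)) \<Longrightarrow> unit_profile p (of_markov m)"
  unfolding unit_profile_def is_markov_strategy_def of_markov_def speed_after_def by blast

lemma continuation_feasible:
  assumes h: "feasible_history p h" and u: "unit_profile p \<sigma>" and S: "S \<in> continuations p \<sigma> h"
  shows "feasible_path p S"
  unfolding feasible_path_def
proof
  show "abs_continuous_path S" using S by (simp add: continuations_def)
  have 1: "AE s in lborel. s > 0 \<longrightarrow> (\<exists>a1\<in>{0..1}. \<exists>a2\<in>{0..1}. (snd h has_vector_derivative (a1, a2, safety p)) (at s))"
    using h by (simp add: feasible_history_def feasible_path_def)
  have 2: "AE s in lborel. s > fst h \<longrightarrow> (\<exists>a1 a2. (S has_vector_derivative (a1, a2, safety p)) (at s) \<and> (a1, a2) \<in> krasovskii p \<sigma> (s, S))"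
    using S by (simp add: continuations_def)
  have 3: "AE s in lborel. s \<noteq> fst h"
    using AE_lborel_singleton[of "fst h"] by (simp add: eq_commute)
  show "AE s in lborel. s > 0 \<longrightarrow> (\<exists>a1\<in>{0..1}. \<exists>a2\<in>{0..1}. (S has_vector_derivative (a1, a2, safety p)) (at s))"
    using 1 2 3
  proof eventually_elim
    case (elim s)
    show ?case
    proof
      assume s: "0 < s"
      show "\<exists>a1\<in>{0..1}. \<exists>a2\<in>{0..1}. (S has_vector_derivative (a1, a2, safety p)) (at s)"
      proof (cases "s < fst h")
        case True
        obtain a1 a2 where a: "a1\<in>{0..1}" "a2\<in>{0..1}" "(snd h has_vector_derivative (a1, a2, safety p)) (at s)"
          using elim(1) s by (elim impE bexE)
        have "(S has_vector_derivative (a1, a2, safety p)) (at s)"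
          by (rule has_vector_derivative_transform_within_open[OF a(3), of "{0<..<fst h}"])
            (use S s True in \<open>auto simp: continuations_def\<close>)
        then show ?thesis using a by blast
      next
        case False
        then obtain a1 a2 where a: "(S has_vector_derivative (a1, a2, safety p)) (at s)" "(a1, a2) \<in> krasovskii p \<sigma> (s, S)"
          using elim by auto
        have "speed i (a1, a2) \<in> {0..1}" for i
          by (rule krasovskii_speed[OF a(2), of 1]) (use u in \<open>auto simp: unit_profile_def\<close>)
        from this[of Firm1] this[of Firm2] have "a1 \<in> {0..1}" "a2 \<in> {0..1}" by (simp_all add: speed_def)
        then show ?thesis using a(1) by blast
      qed
    qed
  qed
qed

text \<open>If a Markov speed is bounded on an open set of states, the same bounds hold at all
  histories near one ending there, hence for every Krasovskii selection. Absolute continuity turns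
  the bound on speeds into one on increments.\<close>

lemma continuation_speed:
  assumes h: "feasible_history p h" and u: "unit_profile p \<sigma>" and S: "S \<in> continuations p \<sigma> h"
    and m: "\<sigma> i = of_markov m i" and U: "open U" "\<And>s. s \<in> U \<Longrightarrow> m i s \<in> {lo..hi}"
    and ab: "fst h \<le> a" "a \<le> b" "\<And>s. a < s \<Longrightarrow> s < b \<Longrightarrow> S s \<in> U"
  shows "lo * (b - a) \<le> cap i (S b) - cap i (S a)" "cap i (S b) - cap i (S a) \<le> hi * (b - a)"
proof -
  note fS = continuation_feasible[OF h u S]
  have a0: "0 \<le> a" using h ab by (simp add: feasible_history_def)
  have "AE s in lborel. s > fst h \<longrightarrow> (\<exists>a1 a2. (S has_vector_derivative (a1, a2, safety p)) (at s) \<and> (a1, a2) \<in> krasovskii p \<sigma> (s, S))"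
    using S by (simp add: continuations_def)
  then have "AE s in lborel. a < s \<and> s < b \<longrightarrow> (\<exists>u x. speed i u \<in> {lo..hi} \<and> (S has_vector_derivative (fst u, snd u, x)) (at s))"
  proof eventually_elim
    case (elim s)
    show ?case
    proof
      assume s: "a < s \<and> s < b"
      then obtain a1 a2 where a: "(S has_vector_derivative (a1, a2, safety p)) (at s)" "(a1, a2) \<in> krasovskii p \<sigma> (s, S)"
        using elim ab by auto
      obtain \<epsilon> where e: "\<epsilon> > 0" "ball (S s) \<epsilon> \<subseteq> U" using U(1) ab(3)[of s] s open_contains_ball by blast
      have fh: "feasible_history p (s, S)" using fS a0 s by (simp add: feasible_history_def)
      have "speed i (a1, a2) \<in> {lo..hi}"
      proof (rule krasovskii_speed[OF a(2) e(1)])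
        fix h' assume h': "feasible_history p h'" "hist_dist (s, S) h' < \<epsilon>"
        then have "snd h' (fst h') \<in> U" using hist_dist_ge[OF fh h'(1)] e(2) by auto
        then show "speed_after (\<sigma> i) h' \<in> {lo..hi}" using U(2) by (simp add: m of_markov_def speed_after_def)
      qed
      then show "\<exists>u x. speed i u \<in> {lo..hi} \<and> (S has_vector_derivative (fst u, snd u, x)) (at s)"
        using a(1) by (intro exI[of _ "(a1, a2)"] exI[of _ "safety p"]) auto
    qed
  qed
  from cap_speed_bounds[OF _ a0 ab(2) this] fS
  show "lo * (b - a) \<le> cap i (S b) - cap i (S a)" "cap i (S b) - cap i (S a) \<le> hi * (b - a)"
    by (auto simp: feasible_path_def)
qed

text \<open>The integrand may be arbitrary because the integral is a supremum over simple functions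
  below it, and these are measurable.\<close>

lemma nn_integral_lborel_shift:
  fixes f :: "real \<Rightarrow> ennreal"
  shows "(\<integral>\<^sup>+x. f x \<partial>lborel) = (\<integral>\<^sup>+x. f (t + x) \<partial>lborel)"
proof -
  have *: "(\<integral>\<^sup>+x. f x \<partial>lborel) \<le> (\<integral>\<^sup>+x. f (t + x) \<partial>lborel)" for f :: "real \<Rightarrow> ennreal" and t
    unfolding nn_integral_def[of _ f]
  proof (rule SUP_least)
    fix k assume k: "k \<in> {k. simple_function lborel k \<and> k \<le> f}"
    then have km: "k \<in> borel_measurable lborel" using borel_measurable_simple_function[of lborel k] by blast
    have "integral\<^sup>S lborel k = (\<integral>\<^sup>+x. k x \<partial>lborel)" using k by (simp add: nn_integral_eq_simple_integral)
    also have "\<dots> = (\<integral>\<^sup>+x. k (t + x) \<partial>lborel)" using nn_integral_real_affine[of k 1 t] km by simp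
    also have "\<dots> \<le> (\<integral>\<^sup>+x. f (t + x) \<partial>lborel)" using k by (intro nn_integral_mono) (auto simp: le_fun_def)
    finally show "integral\<^sup>S lborel k \<le> (\<integral>\<^sup>+x. f (t + x) \<partial>lborel)" .
  qed
  show ?thesis using *[of f t] *[of "\<lambda>x. f (t + x)" "- t"] by (intro antisym) (auto simp: add.commute)
qed

definition flow :: "primitives \<Rightarrow> firm \<Rightarrow> path \<Rightarrow> real \<Rightarrow> real \<Rightarrow> real" where
  "flow p i S t s = exp (- disc p * s - integral {0..s} (\<lambda>u. hazard p (lead (S (t + u))))
     + (alpha p * cap i (S (t + s)) - beta p * cap (other i) (S (t + s))))"

definition total :: "(real \<Rightarrow> real) \<Rightarrow> ennreal" where
  "total f = (\<integral>\<^sup>+s. ennreal (f s) * indicator {0..} s \<partial>lborel)"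

lemma total_mono: "(\<And>s. 0 \<le> s \<Longrightarrow> f s \<le> f' s) \<Longrightarrow> total f \<le> total f'"
  unfolding total_def by (intro nn_integral_mono) (auto simp: indicator_def intro: ennreal_leI)

lemma integral_shift_Icc:
  fixes f :: "real \<Rightarrow> real"
  shows "integral {t..t + s} f = integral {0..s} (\<lambda>u. f (t + u))"

  using integral_shift_Icc_real[of 0 s f t] by (simp add: o_def add.commute)

lemma payoff_eq: "payoff p i \<sigma> h = (SUP S\<in>continuations p \<sigma> h. total (flow p i S (fst h)))"
proof -
  have "(\<integral>\<^sup>+ s. ennreal (exp (- disc p * (s - fst h) - integral {fst h..s} (\<lambda>u. hazard p (lead (S u))))
          * exp (alpha p * cap i (S s) - beta p * cap (other i) (S s))) * indicator {fst h..} s \<partial>lborel)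
      = total (flow p i S (fst h))" for S
    unfolding total_def flow_def exp_add[symmetric]
    by (subst nn_integral_lborel_shift[of _ "fst h"])
      (auto intro!: nn_integral_cong simp: indicator_def integral_shift_Icc)
  then show ?thesis by (simp add: payoff_def)
qed

text \<open>For arguments by excursion: after the last zero the sign of \<open>f\<close> is fixed,
  and with it the prescribed speed.\<close>

lemma last_nonneg_time:
  fixes f :: "real \<Rightarrow> real"
  assumes f: "continuous_on {a..b} f" and ab: "a \<le> b" "0 \<le> f a" "f b < 0"
  obtains s where "a \<le> s" "s < b" "f s = 0" "\<And>u. s < u \<Longrightarrow> u \<le> b \<Longrightarrow> f u < 0"
proof -
  define Z where "Z = {u \<in> {a..b}. 0 \<le> f u}"
  have Z: "a \<in> Z" "closed Z" "bdd_above Z"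
    using ab f continuous_closed_preimage[of "{a..b}" f "{0..}"] by (auto simp: Z_def vimage_def Int_def intro!: bdd_aboveI[of _ b])
  define s where "s = Sup Z"
  have s: "s \<in> Z" unfolding s_def using Z by (intro closed_contains_Sup) auto
  have u: "f u < 0" if "s < u" "u \<le> b" for u
  proof (rule ccontr)
    assume "\<not> f u < 0"
    then have "u \<in> Z" using that s by (auto simp: Z_def)
    then show False using cSup_upper[of u Z] Z(3) that by (simp add: s_def[symmetric])
  qed
  have sb: "s < b" using s ab by (cases "s = b") (auto simp: Z_def)
  have "f s \<le> 0"
  proof (rule ccontr)
    assume "\<not> f s \<le> 0"
    then obtain w where "s \<le> w" "w \<le> b" "f w = 0"
      using IVT2'[of f b 0 s] ab sb continuous_on_subset[OF f, of "{s..b}"] s by (auto simp: Z_def)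
    then show False using u[of w] \<open>\<not> f s \<le> 0\<close> by (cases "w = s") auto
  qed
  then show thesis using that[of s] s sb u by (auto simp: Z_def)
qed

section \<open>Continuations built from capability paths\<close>

definition extend :: "primitives \<Rightarrow> history \<Rightarrow> (firm \<Rightarrow> real \<Rightarrow> real) \<Rightarrow> path" where
  "extend p h f s = (if s \<le> fst h then snd h s
     else (f Firm1 (s - fst h), f Firm2 (s - fst h), snd (snd (snd h (fst h))) + safety p * (s - fst h)))"

lemma extend_after:
  assumes "\<And>i. f i 0 = cap i (snd h (fst h))" "0 \<le> s"
  shows "extend p h f (fst h + s) = (f Firm1 s, f Firm2 s, snd (snd (snd h (fst h))) + safety p * s)"
proof (cases "s = 0")
  case True
  show ?thesis using assms(1)[of Firm1] assms(1)[of Firm2] True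
    by (cases "snd h (fst h)") (simp add: extend_def)
qed (use assms in \<open>simp add: extend_def\<close>)

lemma cap_extend:
  assumes "\<And>i. f i 0 = cap i (snd h (fst h))" "0 \<le> s"
  shows "cap i (extend p h f (fst h + s)) = f i s"
    and "snd (snd (extend p h f (fst h + s))) = snd (snd (snd h (fst h))) + safety p * s"
  using extend_after[of f h s p] assms by (cases i; simp)+

text \<open>Prescribed speeds belong to the Krasovskii set, so it suffices that they are the
  derivatives of the capability paths off finitely many dates.\<close>

lemma extend_continuation:
  assumes h: "feasible_history p h" and f0: "\<And>i. f i 0 = cap i (snd h (fst h))"
    and mono: "\<And>i s t. 0 \<le> s \<Longrightarrow> s \<le> t \<Longrightarrow> f i s \<le> f i t \<and> f i t - f i s \<le> t - s"
    and K: "finite K"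
    and sp: "\<And>i s. 0 < s \<Longrightarrow> s \<notin> K \<Longrightarrow> speed_after (\<sigma> i) (fst h + s, extend p h f) \<in> {0..1} \<and>
      (f i has_real_derivative speed_after (\<sigma> i) (fst h + s, extend p h f)) (at s)"
  shows "extend p h f \<in> continuations p \<sigma> h" and "feasible_path p (extend p h f)"
proof -
  let ?S = "extend p h f" and ?t = "fst h" and ?L = "2 + \<bar>safety p\<bar>"
  have t0: "0 \<le> ?t" and fS: "feasible_path p (snd h)" using h by (auto simp: feasible_history_def)
  have after: "dist (?S a) (?S b) \<le> ?L * (b - a)" if "?t \<le> a" "a \<le> b" for a b
  proof -
    have eq: "?S c = (f Firm1 (c - ?t), f Firm2 (c - ?t), snd (snd (snd h ?t)) + safety p * (c - ?t))" if "?t \<le> c" for c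
      using extend_after[of f h "c - ?t" p] f0 that by simp
    have "dist (f i (a - ?t)) (f i (b - ?t)) \<le> b - a" for i
      using mono[of "a - ?t" "b - ?t" i] that by (auto simp: dist_real_def)
    moreover have "dist (safety p * (a - ?t)) (safety p * (b - ?t)) \<le> \<bar>safety p\<bar> * (b - a)"
    proof -
      have "safety p * (a - ?t) - safety p * (b - ?t) = - (safety p * (b - a))" by (simp add: algebra_simps)
      then show ?thesis using that by (simp add: dist_real_def abs_mult)
    qed
    ultimately show ?thesis using state_dist_le[of "?S a" "?S b"] that
      by (simp add: eq distrib_right) (smt (verit))
  qed
  have Lip: "dist (?S a) (?S b) \<le> ?L * (b - a)" if "0 \<le> a" "a \<le> b" for a b
  proof -
    have before: "dist (?S c) (?S d) \<le> ?L * (d - c)" if "0 \<le> c" "c \<le> d" "d \<le> ?t" for c d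
      using feasible_path_Lipschitz[OF fS that(1,2)] that by (simp add: extend_def)
    consider "b \<le> ?t" | "?t \<le> a" | "a \<le> ?t" "?t \<le> b" by linarith
    then show ?thesis
    proof cases
      case 3
      have "dist (?S a) (?S b) \<le> ?L * (?t - a) + ?L * (b - ?t)"
        using dist_triangle[of "?S a" "?S b" "?S ?t"] before[of a ?t] after[of ?t b] that 3 by auto
      then show ?thesis by (simp add: algebra_simps)
    qed (use before after that in auto)
  qed
  have ac: "abs_continuous_path ?S"
    unfolding abs_continuous_path_def by (intro allI impI Lipschitz_abs_continuous[where K = ?L] Lip) auto
  have AE: "AE s in lborel. s - ?t \<notin> K \<and> s \<noteq> ?t"
  proof -
    have "finite (insert ?t ((\<lambda>k. k + ?t) ` K))" using K by simp
    then have "AE s in lborel. s \<notin> insert ?t ((\<lambda>k. k + ?t) ` K)"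
      by (intro AE_not_in finite_imp_null_set_lborel)
    then show ?thesis
    proof eventually_elim
      case (elim s)
      have "s = (s - ?t) + ?t" by simp
      then show ?case using elim by (auto simp: image_iff)
    qed
  qed
  have der: "(?S has_vector_derivative (speed_after (\<sigma> Firm1) (s, ?S), speed_after (\<sigma> Firm2) (s, ?S), safety p)) (at s)"
    if s: "?t < s" "s - ?t \<notin> K" for s
  proof -
    have d: "((\<lambda>s. f i (s - ?t)) has_vector_derivative speed_after (\<sigma> i) (s, ?S)) (at s)" for i
    proof -
      have "((\<lambda>s. f i (s - ?t)) has_real_derivative speed_after (\<sigma> i) (s, ?S) * 1) (at s)"
        using sp[of "s - ?t" i] s by (intro DERIV_chain2[of "f i"]) (auto intro!: derivative_eq_intros)
      then show ?thesis by (simp add: has_real_derivative_iff_has_vector_derivative)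
    qed
    have x: "((\<lambda>s. snd (snd (snd h ?t)) + safety p * (s - ?t)) has_vector_derivative safety p) (at s)"
      unfolding has_real_derivative_iff_has_vector_derivative[symmetric] by (auto intro!: derivative_eq_intros)
    have "((\<lambda>s. (f Firm1 (s - ?t), f Firm2 (s - ?t), snd (snd (snd h ?t)) + safety p * (s - ?t))) has_vector_derivative
      (speed_after (\<sigma> Firm1) (s, ?S), speed_after (\<sigma> Firm2) (s, ?S), safety p)) (at s)"
      by (intro has_vector_derivative_Pair d x)
    then show ?thesis
      by (rule has_vector_derivative_transform_within_open[of _ _ _ "{?t<..}"]) (use s in \<open>auto simp: extend_def\<close>)
  qed
  show feas: "feasible_path p ?S"
    unfolding feasible_path_def
  proof
    have "AE s in lborel. s > 0 \<longrightarrow> (\<exists>a1\<in>{0..1}. \<exists>a2\<in>{0..1}. (snd h has_vector_derivative (a1, a2, safety p)) (at s))"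
      using fS by (simp add: feasible_path_def)
    then show "AE s in lborel. s > 0 \<longrightarrow> (\<exists>a1\<in>{0..1}. \<exists>a2\<in>{0..1}. (?S has_vector_derivative (a1, a2, safety p)) (at s))"
      using AE
    proof eventually_elim
      case (elim s)
      show ?case
      proof
        assume s: "0 < s"
        show "\<exists>a1\<in>{0..1}. \<exists>a2\<in>{0..1}. (?S has_vector_derivative (a1, a2, safety p)) (at s)"
        proof (cases "s < ?t")
          case True
          obtain a1 a2 where a: "a1\<in>{0..1}" "a2\<in>{0..1}" "(snd h has_vector_derivative (a1, a2, safety p)) (at s)"
            using elim(1) s by (elim impE bexE)
          have "(?S has_vector_derivative (a1, a2, safety p)) (at s)"
            by (rule has_vector_derivative_transform_within_open[OF a(3), of "{0<..<?t}"]) (use s True in \<open>auto simp: extend_def\<close>)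
          then show ?thesis using a by blast
        next
          case False
          then have s': "?t < s" "s - ?t \<notin> K" using elim by auto
          then have "speed_after (\<sigma> i) (s, ?S) \<in> {0..1}" for i using sp[of "s - ?t" i] by simp
          then show ?thesis using der[OF s'] by blast
        qed
      qed
    qed
  qed (rule ac)
  have "AE s in lborel. s > ?t \<longrightarrow> (\<exists>a1 a2. (?S has_vector_derivative (a1, a2, safety p)) (at s) \<and> (a1, a2) \<in> krasovskii p \<sigma> (s, ?S))"
    using AE
  proof eventually_elim
    case (elim s)
    show ?case
    proof
      assume s: "?t < s"
      then have "feasible_history p (s, ?S)" using feas t0 by (simp add: feasible_history_def)
      from der[OF s] krasovskii_value[OF this, of \<sigma>] elim
      show "\<exists>a1 a2. (?S has_vector_derivative (a1, a2, safety p)) (at s) \<and> (a1, a2) \<in> krasovskii p \<sigma> (s, ?S)" by blast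
    qed
  qed
  then show "?S \<in> continuations p \<sigma> h" using ac by (simp add: continuations_def extend_def)
qed

definition top :: "state \<Rightarrow> real" where "top S = max (cap Firm1 S) (cap Firm2 S)"

lemma top_eq: "top S = max (cap i S) (cap (other i) S)"
  by (cases i) (auto simp: top_def)

lemma lead_eq: "lead S = top S - snd (snd S)"
  by (simp add: lead_def top_def)

lemma other_other [simp]: "other (other i) = i"
  by (cases i) auto

text \<open>The clamp makes the gain constant before date 0, so that it meets
  \<open>admpath\<close>, which speaks of all real dates.\<close>

definition top_gain :: "path \<Rightarrow> real \<Rightarrow> real \<Rightarrow> real" where
  "top_gain S t s = top (S (t + max 0 s)) - top (S t)"

text \<open>After the last date at which \<open>j\<close> is not behind, it races while the other
  firm moves at speed at most 1, so it does not fall behind again. Without such a date it has raced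
  throughout.\<close>

lemma laggard_catches_up:
  assumes h: "feasible_history p h" and u: "unit_profile p \<sigma>" and S: "S \<in> continuations p \<sigma> h"
    and m: "\<sigma> j = of_markov m j" "\<And>s. cap j s < cap (other j) s \<Longrightarrow> m j s = 1"
    and t: "fst h \<le> t" and s: "0 \<le> s"
  shows "min (cap j (S t) + s) (top (S (t + s))) \<le> cap j (S (t + s))"
proof -
  note fS = continuation_feasible[OF h u S]
  have t0: "0 \<le> t" using h t by (simp add: feasible_history_def)
  define U where "U = {s. cap j s < cap (other j) s}"
  have U: "open U" unfolding U_def by (intro open_Collect_less continuous_intros)
  have race: "cap j (S b) = cap j (S a) + (b - a)" if "t \<le> a" "a \<le> b" "\<And>u. a < u \<Longrightarrow> u < b \<Longrightarrow> S u \<in> U" for a b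
    using continuation_speed[OF h u S m(1) U, of 1 1 a b] m(2) that t by (auto simp: U_def)
  show ?thesis
  proof (cases "cap (other j) (S (t + s)) \<le> cap j (S (t + s))")
    case True
    then show ?thesis by (simp add: top_eq[of _ j])
  next
    case False
    let ?f = "\<lambda>u. cap j (S u) - cap (other j) (S u)"
    show ?thesis
    proof (cases "\<exists>u\<in>{t..t + s}. 0 \<le> ?f u")
      case True
      then obtain u where u: "u \<in> {t..t + s}" "0 \<le> ?f u" by blast
      have "continuous_on {u..t + s} ?f"
        using continuous_on_subset[OF feasible_path_cont[OF fS], of "{u..t + s}"] t0 u by (intro continuous_intros) auto
      then obtain w where w: "u \<le> w" "w < t + s" "?f w = 0" "\<And>z. w < z \<Longrightarrow> z \<le> t + s \<Longrightarrow> ?f z < 0"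
        using last_nonneg_time[of u "t + s" ?f] u False by auto
      have "cap j (S (t + s)) = cap j (S w) + (t + s - w)"
        using w u by (intro race) (auto simp: U_def dest!: w(4))
      moreover have "cap (other j) (S (t + s)) \<le> cap (other j) (S w) + (t + s - w)"
        using feasible_path_bounds(2)[OF fS, of w "t + s" "other j"] w u t0 by auto
      ultimately show ?thesis using w(3) False by simp
    next
      case no: False
      have "cap j (S (t + s)) = cap j (S t) + (t + s - t)"
        using no s by (intro race) (auto simp: U_def not_le)
      then show ?thesis by simp
    qed
  qed
qed

locale race_game =
  race_env "alpha p" "beta p" "disc p" "safety p" "hazard p" lam' for p :: primitives and lam'
begin

lemma top_gain_admpath:
  assumes S: "feasible_path p S" and t: "0 \<le> t"
  shows "admpath (top_gain S t)"
proof (rule admpathI)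
  fix a b :: real assume ab: "a \<le> b"
  have "top (S (t + max 0 a)) \<le> top (S (t + max 0 b)) \<and> top (S (t + max 0 b)) \<le> top (S (t + max 0 a)) + (max 0 b - max 0 a)"
  proof -
    have uw: "0 \<le> t + max 0 a" "t + max 0 a \<le> t + max 0 b" using t ab by auto
    show ?thesis using feasible_path_bounds(1,2)[OF S uw, of Firm1] feasible_path_bounds(1,2)[OF S uw, of Firm2]
      unfolding top_def by (simp add: max_def del: max_less_iff_conj)
  qed
  then show "top_gain S t a \<le> top_gain S t b" "top_gain S t b \<le> top_gain S t a + (b - a)"
    using ab by (auto simp: top_gain_def)
qed (simp add: top_gain_def)

lemma flow_top_gain:
  assumes S: "feasible_path p S" and t: "0 \<le> t" and s: "0 \<le> s"
  shows "flow p i S t s = exp (- disc p * s - H (lead (S t)) (top_gain S t) s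
    + (alpha p * cap i (S (t + s)) - beta p * cap (other i) (S (t + s))))"
proof -
  have "lead (S (t + u)) = lead (S t) + top_gain S t u - safety p * u" if "0 \<le> u" for u
    using feasible_path_bounds(3)[OF S, of t "t + u"] t that by (simp add: lead_eq top_gain_def)
  then have "integral {0..s} (\<lambda>u. hazard p (lead (S (t + u)))) = H (lead (S t)) (top_gain S t) s"
    unfolding H_def by (intro Henstock_Kurzweil_Integration.integral_cong) auto
  then show ?thesis by (simp add: flow_def)
qed

lemma total_fl:
  assumes "admpath m" "0 \<le> G" "0 \<le> c"
  shows "total (\<lambda>s. c * fl y G m s) = ennreal (c * J y G m)"
proof -
  have "total (\<lambda>s. c * fl y G m s) = (\<integral>\<^sup>+s. ennreal c * (ennreal (fl y G m s) * indicator {0..} s) \<partial>lborel)"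
    unfolding total_def using assms(3) less_imp_le[OF fl_pos]
    by (intro nn_integral_cong) (simp add: ennreal_mult mult.assoc)
  also have "\<dots> = ennreal c * ennreal (J y G m)"
    using assms(1) by (subst nn_integral_cmult) (auto simp: nn_J[OF assms(1,2)] intro: fl_borel)
  also have "\<dots> = ennreal (c * J y G m)" using assms nn_J(3) by (simp add: ennreal_mult)
  finally show ?thesis .
qed

text \<open>Against a rival that races forever no single gap describes the flow, but up to each
  horizon \<open>T\<close> it equals the flow for gap \<open>T\<close>. A bound uniform in
  \<open>T\<close> passes to the limit by monotone convergence.\<close>

lemma total_fl_le_of_partial:
  assumes m: "admpath m" and c: "0 \<le> c" and f0: "\<And>s. 0 \<le> s \<Longrightarrow> f s \<le> c * exp (- disc p * s - H y m s + alpha p * m s - beta p * s)"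
    and K: "\<And>T. 0 \<le> T \<Longrightarrow> integral {0..T} (fl y T m) \<le> K"
  shows "total f \<le> ennreal (c * K)"
proof -
  define k where "k s = exp (- disc p * s - H y m s + alpha p * m s - beta p * s)" for s
  have kf: "k s = fl y T m s" if "0 \<le> s" "s \<le> T" for s T
    using admpathD(4)[OF m that(1)] that by (simp add: k_def fl_def)
  have kc: "continuous_on {0..} k"
    unfolding k_def[abs_def] by (intro continuous_intros H_cont admpath_cont m)
  have kb: "(\<lambda>s. ennreal (k s) * indicator {0..} s) \<in> borel_measurable borel"
  proof -
    have "(\<lambda>s. indicator {0..} s *\<^sub>R k s) \<in> borel_measurable borel"
      using kc by (intro borel_measurable_continuous_on_indicator) auto
    then have "(\<lambda>s. ennreal (indicator {0..} s *\<^sub>R k s)) \<in> borel_measurable borel" by measurable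
    then show ?thesis by (rule subst[of _ _ "\<lambda>f. f \<in> borel_measurable borel", rotated]) (auto simp: indicator_def fun_eq_iff)
  qed
  have part: "(\<integral>\<^sup>+s. ennreal (k s) * indicator {0..real n} s \<partial>lborel) \<le> ennreal K" for n
  proof -
    have "(\<integral>\<^sup>+s. ennreal (k s) * indicator {0..real n} s \<partial>lborel) = (\<integral>\<^sup>+s. ennreal (fl y (real n) m s) * indicator {0..real n} s \<partial>lborel)"
      by (intro nn_integral_cong) (auto simp: indicator_def kf)
    also have "\<dots> = ennreal (integral {0..real n} (fl y (real n) m))" by (intro nn_fl_Icc m) auto
    finally show ?thesis using K[of "real n"] by (simp add: ennreal_leI)
  qed
  have mono: "incseq (\<lambda>n s. ennreal (k s) * indicator {0..real n} s)"
    by (auto simp: incseq_def le_fun_def indicator_def)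
  have "(\<integral>\<^sup>+s. ennreal (k s) * indicator {0..} s \<partial>lborel) = (\<integral>\<^sup>+s. (SUP n. ennreal (k s) * indicator {0..real n} s) \<partial>lborel)"
  proof (intro nn_integral_cong)
    fix s
    have "(SUP n. indicator {0..real n} s :: ennreal) = indicator {0..} s"
    proof (cases "0 \<le> s")
      case True
      obtain n where "s \<le> real n" using real_arch_simple by blast
      then have 1: "(1::ennreal) \<le> (SUP n. indicator {0..real n} s)" using True by (intro SUP_upper2[of n]) auto
      have "(SUP n. indicator {0..real n} s :: ennreal) \<le> 1" by (intro SUP_least) (simp add: indicator_def)
      from antisym[OF this 1] True show ?thesis by simp
    qed simp
    then show "ennreal (k s) * indicator {0..} s = (SUP n. ennreal (k s) * indicator {0..real n} s)"
      by (metis SUP_mult_left_ennreal)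
  qed
  also have "\<dots> = (SUP n. \<integral>\<^sup>+s. ennreal (k s) * indicator {0..real n} s \<partial>lborel)"
  proof (rule nn_integral_monotone_convergence_SUP[OF mono])
    fix n
    have "(\<lambda>s. (ennreal (k s) * indicator {0..} s) * indicator {0..real n} s) \<in> borel_measurable borel" using kb by measurable
    moreover have "(\<lambda>s. (ennreal (k s) * indicator {0..} s) * indicator {0..real n} s) = (\<lambda>s. ennreal (k s) * indicator {0..real n} s)"
      by (auto simp: indicator_def fun_eq_iff)
    ultimately show "(\<lambda>s. ennreal (k s) * indicator {0..real n} s) \<in> borel_measurable lborel" by simp
  qed
  also have "\<dots> \<le> ennreal K" using part by (intro SUP_least)
  finally have 1: "(\<integral>\<^sup>+s. ennreal (k s) * indicator {0..} s \<partial>lborel) \<le> ennreal K" .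
  have "total f \<le> (\<integral>\<^sup>+s. ennreal c * (ennreal (k s) * indicator {0..} s) \<partial>lborel)"
    unfolding total_def using f0 c by (intro nn_integral_mono) (auto simp: indicator_def k_def ennreal_mult[symmetric] intro!: ennreal_leI)
  also have "\<dots> = ennreal c * (\<integral>\<^sup>+s. ennreal (k s) * indicator {0..} s \<partial>lborel)"
    using kb by (intro nn_integral_cmult) auto
  also have "\<dots> \<le> ennreal c * ennreal K" using 1 by (intro mult_left_mono) auto
  also have "\<dots> = ennreal (c * K)" using c by (simp add: ennreal_mult')
  finally show ?thesis .
qed

section \<open>When racing is an equilibrium\<close>

lemma racing_markov: "is_markov_strategy (racing i)"
  by (simp add: racing_def is_markov_strategy_def)

lemma racing_flow:
  assumes S: "feasible_path p S" and t: "0 \<le> t"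
    and c: "\<And>i s. 0 \<le> s \<Longrightarrow> cap i (S (t + s)) = cap i (S t) + s" and s: "0 \<le> s"
  shows "flow p i S t s = exp (alpha p * cap i (S t) - beta p * cap (other i) (S t)) * fl (lead (S t)) 0 (\<lambda>t. t) s"
proof -
  have "H (lead (S t)) (top_gain S t) s = H (lead (S t)) (\<lambda>t. t) s"
    by (intro H_cong) (simp add: top_gain_def top_def c)
  then show ?thesis using s
    by (simp add: flow_top_gain[OF S t s] c[OF s] fl_def exp_add[symmetric] distrib_left)
qed

lemma racing_payoff:
  assumes h: "feasible_history p h"
  defines "s0 \<equiv> snd h (fst h)"
  shows "payoff p i (of_markov racing) h = ennreal (exp (alpha p * cap i s0 - beta p * cap (other i) s0) * R (lead s0))"
proof -
  let ?\<sigma> = "of_markov racing" and ?c = "exp (alpha p * cap i s0 - beta p * cap (other i) s0)"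
  have u: "unit_profile p ?\<sigma>" by (rule unit_profile_markov) (rule racing_markov)
  have t: "0 \<le> fst h" using h by (simp add: feasible_history_def)
  have eq: "total (flow p i S (fst h)) = ennreal (?c * R (lead s0))" if S: "S \<in> continuations p ?\<sigma> h" for S
  proof -
    note fS = continuation_feasible[OF h u S]
    have St: "S (fst h) = s0" using S t by (simp add: continuations_def s0_def)
    have c: "cap i (S (fst h + s)) = cap i (S (fst h)) + s" if "0 \<le> s" for i s
      using continuation_speed[OF h u S, of i racing UNIV 1 1 "fst h" "fst h + s"] that by (auto simp: racing_def of_markov_def)
    have "total (flow p i S (fst h)) = total (\<lambda>s. ?c * fl (lead s0) 0 (\<lambda>t. t) s)"
      using racing_flow[OF fS t c, of _ i] unfolding St by (intro antisym total_mono) auto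
    then show ?thesis by (simp add: total_fl[OF admpath_id] R_def)
  qed
  define f where "f i s = cap i s0 + s" for i and s :: real
  have "extend p h f \<in> continuations p ?\<sigma> h"
    by (rule extend_continuation[OF h, where K = "{}"])
      (auto simp: f_def[abs_def] s0_def speed_after_def of_markov_def racing_def intro!: derivative_eq_intros)
  then have "continuations p ?\<sigma> h \<noteq> {}" by blast
  then show ?thesis by (simp add: payoff_eq eq)
qed

text \<open>A deviator that is behind cannot change the lead, which the racing rival determines, and
  can only lose capability of its own. A tied or leading one faces the problem of
  \<open>race_optimal\<close> at every horizon.\<close>

lemma racing_deviation_le:
  assumes BR: "1 \<le> B * R 0" and h: "feasible_history p h" and \<sigma>': "is_strategy p \<sigma>'"
  defines "s0 \<equiv> snd h (fst h)"
  shows "payoff p i ((of_markov racing)(i := \<sigma>')) h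
    \<le> ennreal (exp (alpha p * cap i s0 - beta p * cap (other i) s0) * R (lead s0))"
  unfolding payoff_eq
proof (rule SUP_least)
  let ?\<sigma> = "(of_markov racing)(i := \<sigma>')" and ?j = "other i" and ?c = "exp (alpha p * cap i s0 - beta p * cap (other i) s0)"
  fix S assume S: "S \<in> continuations p ?\<sigma> h"
  have ji: "?j \<noteq> i" by (cases i) auto
  have u: "unit_profile p ?\<sigma>" by (rule unit_profile_deviation[OF racing_markov \<sigma>'])
  have t: "0 \<le> fst h" using h by (simp add: feasible_history_def)
  note fS = continuation_feasible[OF h u S]
  have St: "S (fst h) = s0" using S t by (simp add: continuations_def s0_def)
  have cj: "cap ?j (S (fst h + s)) = cap ?j s0 + s" if "0 \<le> s" for s
    using continuation_speed[OF h u S, of ?j racing UNIV 1 1 "fst h" "fst h + s"] that ji St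
    by (auto simp: racing_def of_markov_def)
  have ci: "cap i (S (fst h + s)) \<le> cap i s0 + s" if "0 \<le> s" for s
    using feasible_path_bounds(2)[OF fS, of "fst h" "fst h + s" i] that t St by simp
  define m where "m = top_gain S (fst h)"
  have m: "admpath m" unfolding m_def by (rule top_gain_admpath[OF fS t])
  show "total (flow p i S (fst h)) \<le> ennreal (?c * R (lead s0))"
  proof (cases "cap ?j s0 \<le> cap i s0")
    case True
    show ?thesis
    proof (rule total_fl_le_of_partial[OF m])
      fix s :: real assume s: "0 \<le> s"
      have "cap i (S (fst h + s)) \<le> cap i s0 + m s"
        using True s St by (simp add: m_def top_gain_def top_eq[of _ i])
      then have "alpha p * cap i (S (fst h + s)) \<le> alpha p * (cap i s0 + m s)" using al_pos by simp
      then show "flow p i S (fst h) s \<le> ?c * exp (- disc p * s - H (lead s0) m s + alpha p * m s - beta p * s)"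
        unfolding flow_top_gain[OF fS t s] St exp_add[symmetric] exp_le_cancel_iff cj[OF s]
        by (simp add: m_def distrib_left)
    qed (use race_optimal[OF BR m] in auto)
  next
    case False
    have ms: "m s = s" if "0 \<le> s" for s
      using ci[OF that] cj[OF that] False that St by (simp add: m_def top_gain_def top_eq[of _ i])
    have "total (flow p i S (fst h)) \<le> total (\<lambda>s. ?c * fl (lead s0) 0 (\<lambda>t. t) s)"
    proof (rule total_mono)
      fix s :: real assume s: "0 \<le> s"
      have "H (lead s0) m s = H (lead s0) (\<lambda>t. t) s" by (intro H_cong ms)
      moreover have "alpha p * cap i (S (fst h + s)) \<le> alpha p * (cap i s0 + s)" using al_pos ci[OF s] by simp
      ultimately show "flow p i S (fst h) s \<le> ?c * fl (lead s0) 0 (\<lambda>t. t) s"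
        unfolding flow_top_gain[OF fS t s] St fl_def exp_add[symmetric] exp_le_cancel_iff cj[OF s] using s
        by (simp add: m_def[symmetric] distrib_left)
    qed
    then show ?thesis by (simp add: total_fl[OF admpath_id] R_def)
  qed
qed

lemma racing_MPE_of: 
  assumes BR: "1 \<le> B * R 0" shows "is_MPE p racing"
  unfolding is_MPE_def using racing_deviation_le[OF BR] racing_payoff racing_markov by auto

lemma racing_MPE_imp: 
  assumes MPE: "is_MPE p racing" shows "1 \<le> B * R 0"
proof -
  have *: "1 - exp (- B * T) \<le> B * R 0" if T: "0 \<le> T" for T
  proof -
    \<comment> \<open>The gap that a racing rival closes exactly at date \<open>T\<close> against a
      leader moving at the safety speed. Until then the deviator holds its lead at 0 and its flow
      decays at rate \<open>B\<close>.\<close>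
    define G where "G = (1 - safety p) * T"
    have G: "0 \<le> G" using T g_less by (simp add: G_def)
    define h :: history where "h = (0, \<lambda>s. (0, - G, safety p * s))"
    define \<sigma>' :: strategy where "\<sigma>' = (\<lambda>_ _. safety p)"
    let ?\<sigma> = "(of_markov racing)(Firm1 := \<sigma>')"
    have h: "feasible_history p h"
    proof -
      have "((\<lambda>s. (0::real, - G, safety p * s)) has_vector_derivative (0, 0, safety p)) (at s)" for s
        by (intro has_vector_derivative_Pair) (auto intro!: derivative_eq_intros simp: has_real_derivative_iff_has_vector_derivative[symmetric])
      moreover have "abs_continuous_path (\<lambda>s. (0, - G, safety p * s))"
        unfolding abs_continuous_path_def
      proof (intro allI impI Lipschitz_abs_continuous[where K = "safety p"])
        fix s t T :: real assume "s \<le> t"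
        have "dist (safety p * s) (safety p * t) = safety p * (t - s)"
        proof -
          have "safety p * s - safety p * t = - (safety p * (t - s))" by (simp add: algebra_simps)
          then show ?thesis using g_pos \<open>s \<le> t\<close> by (simp add: dist_real_def abs_mult)
        qed
        then show "dist (0::real, - G, safety p * s) (0, - G, safety p * t) \<le> safety p * (t - s)"
          using g_pos \<open>s \<le> t\<close> by (simp add: dist_Pair_Pair)
      qed (use g_pos in auto)
      moreover have "(\<exists>a1\<in>{0..1}. \<exists>a2\<in>{0..1}. ((\<lambda>s. (0::real, - G, safety p * s)) has_vector_derivative (a1, a2, safety p)) (at s))" for s
        using calculation(1) by (intro bexI[of _ 0]) auto
      ultimately show ?thesis by (simp add: feasible_history_def feasible_path_def h_def)
    qed
    have \<sigma>': "is_strategy p \<sigma>'"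
      using g_pos g_less by (simp add: is_strategy_def \<sigma>'_def case_prod_beta')
    define f where "f i s = (case i of Firm1 \<Rightarrow> safety p * s | Firm2 \<Rightarrow> s - G)" for i and s :: real
    have S: "extend p h f \<in> continuations p ?\<sigma> h" "feasible_path p (extend p h f)"
    proof -
      have "(f i has_real_derivative speed_after (?\<sigma> i) k) (at s)" for i s k
        by (cases i) (auto simp: f_def[abs_def] \<sigma>'_def speed_after_def of_markov_def racing_def intro!: derivative_eq_intros)
      moreover have "speed_after (?\<sigma> i) k \<in> {0..1}" for i k
        using g_pos g_less by (cases i) (auto simp: \<sigma>'_def speed_after_def of_markov_def racing_def)
      moreover have "f i s \<le> f i t \<and> f i t - f i s \<le> t - s" if "s \<le> t" for i s t
        using g_speed[OF that, of 0] that by (cases i) (auto simp: f_def)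
      moreover have "f i 0 = cap i (snd h (fst h))" for i by (cases i) (auto simp: f_def h_def)
      ultimately show "extend p h f \<in> continuations p ?\<sigma> h" "feasible_path p (extend p h f)"
        using extend_continuation[OF h, of f "{}" ?\<sigma>] by auto
    qed
    have fl: "exp (beta p * G) * exp (- B * s) \<le> flow p Firm1 (extend p h f) 0 s" if s: "0 \<le> s" "s \<le> T" for s
    proof -
      have e: "extend p h f u = (safety p * u, u - G, safety p * u)" if "0 \<le> u" for u
        using extend_after[of f h u p] that by (auto simp: f_def h_def split: firm.splits)
      have "lead (extend p h f u) = 0" if "0 \<le> u" "u \<le> s" for u
      proof -
        have "u - G \<le> safety p * u"
        proof -
          have "(1 - safety p) * u \<le> G" unfolding G_def using that s g_less by (intro mult_left_mono) auto
          then show ?thesis by (simp add: algebra_simps)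
        qed
        then show ?thesis using e[OF that(1)] by (simp add: lead_def)
      qed
      then have "integral {0..s} (\<lambda>u. hazard p (lead (extend p h f (0 + u)))) = integral {0..s} (\<lambda>u. 0)"
        by (intro Henstock_Kurzweil_Integration.integral_cong) (simp add: hazard_def)
      then show ?thesis by (simp add: flow_def e[OF s(1)] exp_add[symmetric] B_def algebra_simps)
    qed
    have "ennreal (exp (beta p * G) * ((1 - exp (- B * T)) / B)) \<le> total (flow p Firm1 (extend p h f) 0)"
    proof -
      have "exp (beta p * G) * ((1 - exp (- B * T)) / B) = integral {0..T} (\<lambda>s. exp (beta p * G) * exp (- B * s))"
        using integral_exp[of B T] T B_pos by simp
      also have "ennreal \<dots> = (\<integral>\<^sup>+s. ennreal (exp (beta p * G) * exp (- B * s)) * indicator {0..T} s \<partial>lborel)"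
      proof -
        have "((\<lambda>s. exp (beta p * G) * exp (- B * s)) has_integral integral {0..T} (\<lambda>s. exp (beta p * G) * exp (- B * s))) {0..T}"
          by (intro integrable_integral integrable_continuous_interval continuous_intros)
        from nn_integral_has_integral_lebesgue[OF _ this]
        have "(\<integral>\<^sup>+s. ennreal (indicat_real {0..T} s * (exp (beta p * G) * exp (- B * s))) \<partial>lborel)
            = ennreal (integral {0..T} (\<lambda>s. exp (beta p * G) * exp (- B * s)))" by simp
        moreover have "(\<integral>\<^sup>+s. ennreal (indicat_real {0..T} s * (exp (beta p * G) * exp (- B * s))) \<partial>lborel)
            = (\<integral>\<^sup>+s. ennreal (exp (beta p * G) * exp (- B * s)) * indicator {0..T} s \<partial>lborel)"
          by (intro nn_integral_cong) (auto simp: indicator_def)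
        ultimately show ?thesis by simp
      qed
      also have "\<dots> \<le> total (flow p Firm1 (extend p h f) 0)"
        unfolding total_def using fl by (intro nn_integral_mono) (auto simp: indicator_def intro!: ennreal_leI)
      finally show ?thesis .
    qed
    also have "\<dots> \<le> payoff p Firm1 ?\<sigma> h"
      using S(1) unfolding payoff_eq by (intro SUP_upper2[of "extend p h f"]) (auto simp: h_def)
    also have "\<dots> \<le> payoff p Firm1 (of_markov racing) h"
      using MPE h \<sigma>' unfolding is_MPE_def by blast
    also have "\<dots> = ennreal (exp (beta p * G) * R 0)"
      unfolding racing_payoff[OF h] using G by (simp add: h_def lead_def)
    finally have "exp (beta p * G) * ((1 - exp (- B * T)) / B) \<le> exp (beta p * G) * R 0"
      using R_pos by (subst (asm) ennreal_le_iff) auto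
    then have "(1 - exp (- B * T)) / B \<le> R 0" by (rule mult_left_le_imp_le) simp
    then show ?thesis using B_pos by (simp add: field_simps)
  qed
  have "((\<lambda>T. 1 - exp (- B * T)) \<longlongrightarrow> 1) at_top" using B_pos by real_asymp
  then show ?thesis
    by (rule tendsto_upperbound) (auto intro!: eventually_at_top_linorderI[of 0] *[simplified])
qed

end

section \<open>The benchmark values\<close>

context race_env
begin

lemma continuous_on_C [continuous_intros]:
  fixes f h :: "'a::topological_space \<Rightarrow> real"
  assumes f: "continuous_on X f" "continuous_on X h" and nn: "\<And>x. x \<in> X \<Longrightarrow> 0 \<le> f x" "\<And>x. x \<in> X \<Longrightarrow> 0 \<le> h x"
  shows "continuous_on X (\<lambda>x. C (f x) (h x))"
  unfolding continuous_on_def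
proof
  fix x assume x: "x \<in> X"
  define L where "L z = \<bar>Lam (f z) - Lam (f x)\<bar> / g + al * \<bar>f z - f x\<bar> + be * \<bar>h z - h x\<bar>" for z
  have "continuous_on X L" unfolding L_def by (intro continuous_intros f) (use g_pos in auto)
  then have "(L \<longlongrightarrow> L x) (at x within X)" using x by (simp add: continuous_on_def)
  then have L: "(L \<longlongrightarrow> 0) (at x within X)" by (simp add: L_def)
  have nh: "\<forall>\<^sub>F z in at x within X. z \<in> X" by (simp add: eventually_at_filter)
  show "((\<lambda>z. C (f z) (h z)) \<longlongrightarrow> C (f x) (h x)) (at x within X)"
  proof (rule tendsto_sandwich)
    show "\<forall>\<^sub>F z in at x within X. exp (- L z) * C (f x) (h x) \<le> C (f z) (h z)"
      using nh by eventually_elim (use C_log_Lipschitz[of "f x" "f _" "h x" "h _"] nn x in \<open>auto simp: L_def\<close>)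
    show "\<forall>\<^sub>F z in at x within X. C (f z) (h z) \<le> exp (L z) * C (f x) (h x)"
      using nh
    proof eventually_elim
      case (elim z)
      have "exp (- L z) * C (f z) (h z) \<le> C (f x) (h x)"
        using C_log_Lipschitz[of "f z" "f x" "h z" "h x"] nn x elim by (auto simp: L_def abs_minus_commute)
      then have "exp (L z) * (exp (- L z) * C (f z) (h z)) \<le> exp (L z) * C (f x) (h x)" by (intro mult_left_mono) auto
      then show ?case by (simp add: mult.assoc[symmetric] exp_add[symmetric])
    qed
    show "((\<lambda>z. exp (- L z) * C (f x) (h x)) \<longlongrightarrow> C (f x) (h x)) (at x within X)"
      by (rule tendsto_eq_intros L refl | simp)+
    show "((\<lambda>z. exp (L z) * C (f x) (h x)) \<longlongrightarrow> C (f x) (h x)) (at x within X)"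
      by (rule tendsto_eq_intros L refl | simp)+
  qed
qed

lemma continuous_on_R [continuous_intros]: "continuous_on X f \<Longrightarrow> continuous_on X (\<lambda>x. R (f x))"
  by (rule continuous_on_compose2[OF R_cont[of UNIV]]) auto

lemma continuous_on_A [continuous_intros]: "continuous_on X f \<Longrightarrow> continuous_on X (\<lambda>x. A (f x))"
  by (rule continuous_on_compose2[OF A_cont[of UNIV]]) auto

text \<open>The states at which the pacing profile lets a leading or tied firm stop racing: no later
  switching lead up to \<open>Db\<close> is better, nor is racing forever. The clause on
  \<open>P 0\<close> and \<open>R 0\<close> records that in the degenerate case only tied firms
  stop.\<close>

definition "stop y G \<longleftrightarrow> 0 \<le> y \<and> y \<le> Db \<and> (P 0 \<noteq> R 0 \<or> G = 0) \<and> R y \<le> C y G \<and>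
  (\<forall>d\<in>{y..Db}. A y / A d * (C d G - R d) \<le> C y G - R y)"

lemma V_A: "0 \<le> y \<Longrightarrow> y \<le> d \<Longrightarrow> 0 \<le> G \<Longrightarrow> V ((d - y) / (1 - g)) y G = R y + A y / A d * (C d G - R d)"
  using V_R[of y G "(d - y) / (1 - g)"] g_less e_A[of y "(d - y) / (1 - g)"] by simp

lemma stop_tie: "R 0 \<le> P 0 \<Longrightarrow> 0 \<le> y \<Longrightarrow> y \<le> Db \<Longrightarrow> stop y 0"
proof -
  assume a: "R 0 \<le> P 0" "0 \<le> y" "y \<le> Db"
  have "A y / A d * (C d 0 - R d) \<le> C y 0 - R y" if "y \<le> d" for d
  proof -
    have "V ((d - y) / (1 - g)) y 0 \<le> P y" using that g_less by (intro V_tie_le a) simp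
    then show ?thesis using V_A[OF a(2) that, of 0] by (simp add: P_def)
  qed
  then show ?thesis using P_ge_R[OF a] a by (auto simp: stop_def P_def)
qed

text \<open>Racing forever is the limit of races of growing length.\<close>

lemma R_le_v:
  assumes "0 \<le> y" "0 \<le> G" shows "R y \<le> v y G"
proof -
  have "((\<lambda>th. e y th * (1 / de)) \<longlongrightarrow> 0 * (1 / de)) at_top" by (intro tendsto_intros e_tendsto)
  then have "((\<lambda>th. R y - e y th * (1 / de)) \<longlongrightarrow> R y - 0) at_top" by (intro tendsto_intros) simp
  then have "R y - 0 \<le> v y G"
  proof (rule tendsto_upperbound)
    show "\<forall>\<^sub>F th in at_top. R y - e y th * (1 / de) \<le> v y G"
      using eventually_ge_at_top[of 0]
    proof eventually_elim
      case (elim th)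
      have d: "0 \<le> y + (1 - g) * th" using elim assms g_less by simp
      have "e y th * (- (1 / de)) \<le> e y th * (C (y + (1 - g) * th) G - R (y + (1 - g) * th))"
        using C_nonneg[OF d assms(2)] R_le[of "y + (1 - g) * th"] e_pos[of y th] by (intro mult_left_mono) auto
      then show ?case using V_le_v[OF elim assms] V_R[OF assms elim] by simp
    qed
  qed simp
  then show ?thesis by simp
qed

text \<open>Switching leads beyond \<open>Db\<close>, which \<open>stop\<close> does not test, are
  no better than racing forever by \<open>v_above\<close>, and racing forever is tested by
  \<open>R y \<le> C y G\<close>.\<close>

lemma stop_iff:
  assumes RP: "R 0 \<le> P 0" and y: "0 \<le> y" "y \<le> Db" and G: "0 \<le> G" and ne: "P 0 \<noteq> R 0 \<or> G = 0"
  shows "stop y G \<longleftrightarrow> v y G \<le> C y G"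
proof
  assume s: "stop y G"
  show "v y G \<le> C y G"
  proof (rule v_le)
    fix th :: real assume th: "0 \<le> th"
    let ?d = "y + (1 - g) * th"
    have dy: "y \<le> ?d" "(?d - y) / (1 - g) = th" using th g_less by auto
    show "V th y G \<le> C y G"
    proof (cases "?d \<le> Db")
      case True
      have "A y / A ?d * (C ?d G - R ?d) \<le> C y G - R y" using s True dy(1) unfolding stop_def by simp
      then show ?thesis using V_A[OF y(1) dy(1) G] unfolding dy(2) by linarith
    next
      case False
      have "C ?d G - R ?d \<le> 0" using v_above[OF RP _ G, of ?d] C_le_v[of ?d G] False G y dy by auto
      then have "e y th * (C ?d G - R ?d) \<le> 0" using e_pos[of y th] by (intro mult_nonneg_nonpos) auto
      then show ?thesis using V_R[OF y(1) G th] s by (simp add: stop_def)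
    qed
  qed
next
  assume v: "v y G \<le> C y G"
  have "A y / A d * (C d G - R d) \<le> C y G - R y" if "y \<le> d" for d
    using V_le_v[OF _ y(1) G, of "(d - y) / (1 - g)"] V_A[OF y(1) that G] that v g_less by simp
  then show "stop y G" using y ne R_le_v[OF y(1) G] v by (auto simp: stop_def)
qed

lemma tie_le: "R 0 \<le> P 0 \<Longrightarrow> v 0 0 \<le> C 0 0"
  using v_tie[of 0] threshold_facts(1) by (simp add: P_def)

lemma stop_less_gap:
  assumes RP: "R 0 \<le> P 0" and s: "stop y G" and G: "0 \<le> G'" "G' \<le> G" shows "stop y G'"
proof -
  have y: "0 \<le> y" "y \<le> Db" and ne: "P 0 \<noteq> R 0 \<or> G = 0" using s by (auto simp: stop_def)
  have "v y G \<le> C y G" using stop_iff[OF RP y _ ne] s G by simp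
  have "v y G' \<le> C y G'"
  proof (rule v_le)
    fix th :: real assume th: "0 \<le> th"
    show "V th y G' \<le> C y G'"
      using race_gain_mono[OF y(1) th G] V_le_v[OF th y(1), of G] \<open>v y G \<le> C y G\<close> G by simp
  qed
  then show ?thesis using stop_iff[OF RP y G(1)] ne G by auto
qed

text \<open>Coasting first and continuing with the best plan is worth at most \<open>v y G\<close>,
  which equals the coasting value at a stopping state. Cancelling the common prefix shows that
  coasting stays optimal along the way.\<close>

lemma stop_coast:
  assumes RP: "R 0 \<le> P 0" and st: "stop y G" and G: "0 \<le> G" and s: "0 \<le> s"
  shows "stop (max 0 (y - g * s)) (max 0 (G + nb y s - s))"
proof -
  let ?y = "max 0 (y - g * s)" and ?G = "max 0 (G + nb y s - s)"
  have y: "0 \<le> y" "y \<le> Db" and ne: "P 0 \<noteq> R 0 \<or> G = 0" using st by (auto simp: stop_def)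
  have "0 \<le> g * s" using s g_pos by simp
  then have y': "0 \<le> ?y" "?y \<le> Db" using y by auto
  have ne': "P 0 \<noteq> R 0 \<or> ?G = 0" using ne admpathD(5)[OF admpath_nb[OF y(1)] s] by auto
  have "v y G \<le> C y G" using stop_iff[OF RP y G ne] st by simp
  then have "fl y G (nb y) s * v ?y ?G \<le> fl y G (nb y) s * C ?y ?G"
    using base_step[OF y(1) G s tie_le[OF RP]] C_rec[OF y(1) G s] by linarith
  then have "v ?y ?G \<le> C ?y ?G" using fl_pos[of y G "nb y" s] by simp
  then show ?thesis using stop_iff[OF RP y' _ ne'] by simp
qed

text \<open>Divided by \<open>A\<close>, the gain of stopping over racing becomes a function
  \<open>k\<close> of the lead on a scale common to all starting leads. A lead stops iff
  \<open>k\<close> is nonnegative there and not exceeded later up to \<open>Db\<close>, so the first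
  stopping lead is the smallest maximiser of \<open>k\<close>.\<close>

lemma first_stop:
  assumes RP: "R 0 \<le> P 0" and y: "0 \<le> y" and G: "0 \<le> G"
  obtains (never) "\<And>d. y \<le> d \<Longrightarrow> \<not> stop d G" "v y G \<le> R y"
    | (first) d where "y \<le> d" "stop d G" "\<And>x. y \<le> x \<Longrightarrow> x < d \<Longrightarrow> \<not> stop x G"
        "v y G = V ((d - y) / (1 - g)) y G"
proof (cases "y \<le> Db \<and> (P 0 \<noteq> R 0 \<or> G = 0)")
  case False
  have "v y G \<le> R y"
  proof (rule v_above[OF RP _ G])
    show "Db \<le> y" using False y by (cases "P 0 = R 0") (auto simp: Db_def)
  qed
  moreover have "\<not> stop d G" if "y \<le> d" for d using False that by (auto simp: stop_def)
  ultimately show thesis by (rule never[rotated])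
next
  case True
  define k where "k d = (C d G - R d) / A d" for d
  have kc: "continuous_on {y..Db} k"
    unfolding k_def[abs_def] by (intro continuous_intros) (use y G A_pos in \<open>auto simp: less_imp_neq[OF A_pos, symmetric]\<close>)
  obtain d1 where d1: "d1 \<in> {y..Db}" "\<And>d. d \<in> {y..Db} \<Longrightarrow> k d \<le> k d1"
    using continuous_attains_sup[of "{y..Db}" k] kc True by auto
  have V: "V ((d - y) / (1 - g)) y G = R y + A y * k d" if "y \<le> d" for d
    using V_A[OF y that G] by (simp add: k_def)
  have sk: "stop d G \<longleftrightarrow> 0 \<le> k d \<and> (\<forall>x\<in>{d..Db}. k x \<le> k d)" if d: "d \<in> {y..Db}" for d
  proof -
    have "A d / A x * (C x G - R x) \<le> C d G - R d \<longleftrightarrow> k x \<le> k d" for x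
      using A_pos[of d] by (simp add: k_def field_simps)
    moreover have "R d \<le> C d G \<longleftrightarrow> 0 \<le> k d" using A_pos[of d] by (simp add: k_def field_simps)
    ultimately show ?thesis using d y True by (auto simp: stop_def)
  qed
  have beyond: "k d \<le> 0" if "Db \<le> d" for d
  proof -
    have "C d G \<le> R d" using v_above[OF RP that G] C_le_v[of d G] G that threshold_facts(1)[OF RP] by auto
    then show ?thesis using A_pos[of d] by (simp add: k_def divide_nonpos_pos)
  qed
  have v_k: "v y G \<le> R y + A y * max 0 (k d1)"
  proof (rule v_le)
    fix th :: real assume th: "0 \<le> th"
    let ?d = "y + (1 - g) * th"
    have dy: "y \<le> ?d" "(?d - y) / (1 - g) = th" using th g_less by auto
    have "k ?d \<le> max 0 (k d1)" using d1(2)[of ?d] beyond[of ?d] dy(1) by (cases "?d \<le> Db") auto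
    then have "A y * k ?d \<le> A y * max 0 (k d1)" using A_pos[of y] by simp
    then show "V th y G \<le> R y + A y * max 0 (k d1)" using V[OF dy(1)] dy(2) by simp
  qed
  show thesis
  proof (cases "0 \<le> k d1")
    case False
    have "\<not> stop d G" if "y \<le> d" for d
    proof (cases "d \<le> Db")
      case True
      then show ?thesis using sk[of d] d1(2)[of d] False that by auto
    qed (simp add: stop_def)
    moreover have "v y G \<le> R y" using v_k False by simp
    ultimately show thesis by (rule never)
  next
    case pos: True
    \<comment> \<open>The maximisers of \<open>k\<close>; up to the smallest of them, stopping leads
      and maximisers coincide.\<close>
    define Z where "Z = {d \<in> {y..Db}. k d1 \<le> k d}"
    have Z: "d1 \<in> Z" "closed Z" "bdd_below Z"
      using d1 kc continuous_closed_preimage[of "{y..Db}" k "{k d1..}"]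
      by (auto simp: Z_def vimage_def Int_def intro!: bdd_belowI[of _ y])
    define d where "d = Inf Z"
    have d: "d \<in> Z" unfolding d_def using Z by (intro closed_contains_Inf) auto
    have "stop x G \<longleftrightarrow> x \<in> Z" if x: "x \<in> {y..Db}" "x \<le> d" for x
    proof
      assume "stop x G"
      then have "k d \<le> k x" using sk[OF x(1)] d x by (auto simp: Z_def)
      then show "x \<in> Z" using d x by (auto simp: Z_def)
    next
      assume "x \<in> Z"
      then have "k d1 \<le> k x" by (simp add: Z_def)
      moreover have "k w \<le> k d1" if "w \<in> {x..Db}" for w using d1(2)[of w] that x(1) by auto
      ultimately show "stop x G" using sk[OF x(1)] pos by (meson order_trans)
    qed
    note st = this
    have dZ: "d \<in> {y..Db}" using d by (simp add: Z_def)
    have "stop d G" using st[OF dZ] d by simp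
    moreover have "\<not> stop x G" if "y \<le> x" "x < d" for x
      using st[of x] cInf_lower[of x Z] Z(3) dZ that by (auto simp: d_def[symmetric])
    moreover have "y \<le> d" using d by (simp add: Z_def)
    moreover have "v y G = V ((d - y) / (1 - g)) y G"
    proof (rule antisym)
      have "k d = k d1" using d d1(2)[of d] by (auto simp: Z_def)
      then show "v y G \<le> V ((d - y) / (1 - g)) y G" using v_k V[OF \<open>y \<le> d\<close>] pos by simp
      show "V ((d - y) / (1 - g)) y G \<le> v y G" using \<open>y \<le> d\<close> g_less by (intro V_le_v y G) simp
    qed
    ultimately show thesis by (intro first)
  qed
qed

end

context race_game
begin

section \<open>The benchmark functions of the game in terms of \<open>C\<close>, \<open>P\<close>
  and \<open>R\<close>\<close>

lemma pace0_eq: "pace0 p = P 0"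
  by (simp add: pace0_def P_def C_00 rho_def)

lemma coast0_eq: "0 \<le> G \<Longrightarrow> coast0 p G = C 0 G"
  by (simp add: coast0_def C_0 pace_value_def pace0_def coast_rate_def B_def rho_def)

lemma hazard_along_coast: "0 \<le> t \<Longrightarrow> integral {0..t} (\<lambda>s. hazard p (D - safety p * s)) = (Lam D - Lam (D - safety p * t)) / safety p"
  using integral_unique[OF lam_affine_integral[of 0 t "- safety p" D]] g_pos by (simp add: field_simps)

lemma coast_disc_eq: "0 \<le> t \<Longrightarrow> t \<le> G \<Longrightarrow> safety p * t \<le> D \<Longrightarrow> coast_disc p D t = fl D G (nb D) t"
  using hazard_along_coast[of t D] by (simp add: coast_disc_def fl_coast)

lemma pace_value_eq:
  assumes D: "0 \<le> D" shows "pace_value p D = P D"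
proof (cases "D = 0")
  case False
  let ?s = "D / safety p"
  have s: "0 \<le> ?s" "safety p * ?s = D" using D g_pos by auto
  have gt: "safety p * t \<le> D" if "t \<le> ?s" for t
    using mult_left_mono[OF that, of "safety p"] g_pos s(2) by simp
  have nb: "nb D t = 0" if "t \<le> ?s" for t
    using gt[OF that] by (simp add: nb_def)
  have fl: "fl D 0 (nb D) t = exp (- disc p * t - integral {0..t} (\<lambda>s. hazard p (D - safety p * s)))" if "t \<in> {0..?s}" for t
    using that fl_nb[of t D 0] nb[of t] hazard_along_coast[of t D] by simp
  have i: "integral {0..?s} (fl D 0 (nb D)) = integral {0..?s} (\<lambda>t. exp (- disc p * t - integral {0..t} (\<lambda>s. hazard p (D - safety p * s))))"
    using fl by (rule Henstock_Kurzweil_Integration.integral_cong)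
  have f: "fl D 0 (nb D) ?s = exp (- disc p * D / safety p - 1 / safety p * integral {0..D} (hazard p))"
    using fl_nb[OF s(1), of D 0] nb[of ?s] s by (simp add: Lam_nonpos) (simp add: Lam_def)
  show ?thesis
    using C_rec[OF D order.refl s(1)] D False i f s(2) nb[of ?s] s(1) by (simp add: pace_value_def pace0_eq P_def)
qed (simp add: pace_value_def pace0_eq)

lemma coast_value_eq:
  assumes D: "0 \<le> D" and G: "0 \<le> G" shows "coast_value p D G = C D G"
proof -
  have i: "integral {0..s} (coast_disc p D) = integral {0..s} (fl D G (nb D))" if "s \<le> G" "safety p * s \<le> D" for s
  proof (rule Henstock_Kurzweil_Integration.integral_cong)
    fix t assume t: "t \<in> {0..s}"
    then have "safety p * t \<le> safety p * s" using g_pos by simp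
    then show "coast_disc p D t = fl D G (nb D) t" using t that by (intro coast_disc_eq) auto
  qed
  have s0: "safety p * (D / safety p) = D" "0 \<le> D / safety p" using g_pos D by auto
  consider "D = 0" | "0 < D" "G \<le> D / safety p" | "0 < D" "D / safety p < G" using D by linarith
  then show ?thesis
  proof cases
    case 1
    then show ?thesis by (simp add: coast_value_def coast0_eq G)
  next
    case 2
    have gG: "safety p * G \<le> D" using 2 g_pos by (simp add: field_simps)
    have nbG: "nb D G = 0" using gG by (simp add: nb_def)
    show ?thesis using C_rec[OF D G G] i[OF order.refl gG] coast_disc_eq[OF G order.refl gG] gG 2 nbG
      by (simp add: coast_value_def pace_value_eq P_def)
  next
    case 3
    have nbG: "nb D (D / safety p) = 0" using s0 by (simp add: nb_def)
    show ?thesis using C_rec[OF D G s0(2)] i[of "D / safety p"] coast_disc_eq[OF s0(2), of G D] 3 s0 nbG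
      by (simp add: coast_value_def coast0_eq)
  qed
qed

lemma race_value_R: "race_value p D = R D"
  by (rule race_value_eq(1)) unfold_locales

lemma pacing_defined_iff: "pacing_defined p \<longleftrightarrow> R 0 \<le> P 0"
  by (simp add: pacing_defined_def race_value_R pace_value_eq)

lemma threshold_eq: "threshold p = Db"
proof -
  have "(\<lambda>d. d > 0 \<and> pace_value p d = race_value p d) = (\<lambda>d. d > 0 \<and> P d = R d)"
    by (auto simp: fun_eq_iff race_value_R pace_value_eq)
  then show ?thesis by (simp add: threshold_def Db_def race_value_R pace_value_eq)
qed

text \<open>The exponential weight is \<open>A D / A d\<close>, and its supremum is attained at
  \<open>d = D\<close> exactly when no later switching lead gains.\<close>

lemma leader_value_eq_iff:
  assumes D: "0 \<le> D" "D \<le> Db" and G: "0 \<le> G" and ne: "P 0 \<noteq> R 0"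
  shows "leader_value p D G = exp (beta p * G) * coast_value p D G \<longleftrightarrow> stop D G"
proof -
  define k where "k d = A D / A d * (C d G - R d)" for d
  have w: "exp (- 1 / (1 - safety p) * integral {D..d} (\<lambda>s. eff_disc p + hazard p s)) = A D / A d" if "D \<le> d" for d
  proof -
    have "integral {D..d} (\<lambda>s. eff_disc p + hazard p s) = eff_disc p * (d - D) + (Lam d - Lam D)"
      using Lam_diff[OF that] lam_integrable[of "\<lambda>x. x" D d] that
      by (subst Henstock_Kurzweil_Integration.integral_add) auto
    moreover have "- 1 / (1 - safety p) * (de * (d - D) + (Lam d - Lam D))
        = (de * D + Lam D) / (1 - safety p) - (de * d + Lam d) / (1 - safety p)"
    proof -
      have "- 1 / c * (b - a) = a / c - b / c" for a b c :: real by (simp add: diff_divide_distrib)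
      from this[of "1 - safety p" "de * d + Lam d" "de * D + Lam D"]
      show ?thesis by (simp only: right_diff_distrib) argo
    qed
    moreover have "eff_disc p = de" by (simp add: eff_disc_def de_def)
    ultimately show ?thesis unfolding A_def exp_diff[symmetric] by metis
  qed
  have SUP: "(SUP d\<in>{D..Db}. exp (- 1 / (1 - safety p) * integral {D..d} (\<lambda>s. eff_disc p + hazard p s))
      * (coast_value p d G - race_value p d)) = (SUP d\<in>{D..Db}. k d)"
  proof (rule SUP_cong[OF refl])
    fix d assume "d \<in> {D..Db}"
    then have "D \<le> d" "0 \<le> d" using D by auto
    then show "exp (- 1 / (1 - safety p) * integral {D..d} (\<lambda>s. eff_disc p + hazard p s))
      * (coast_value p d G - race_value p d) = k d"
      unfolding w[OF \<open>D \<le> d\<close>] k_def race_value_R using coast_value_eq[of d G] G by simp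
  qed
  have "continuous_on {D..Db} k"
    unfolding k_def[abs_def] by (intro continuous_intros) (use D G A_pos in \<open>auto simp: less_imp_neq[OF A_pos, symmetric]\<close>)
  then have bdd: "bdd_above (k ` {D..Db})"
    by (intro bounded_imp_bdd_above compact_imp_bounded compact_continuous_image) auto
  have k0: "k D = C D G - R D" using A_pos[of D] by (simp add: k_def)
  have "leader_value p D G = exp (beta p * G) * coast_value p D G \<longleftrightarrow> max 0 (SUP d\<in>{D..Db}. k d) = k D"
    unfolding leader_value_def threshold_eq SUP k0 using D G by (auto simp: coast_value_eq race_value_R)
  also have "\<dots> \<longleftrightarrow> 0 \<le> k D \<and> (SUP d\<in>{D..Db}. k d) \<le> k D"
    using cSUP_upper[OF _ bdd, of D] D by auto
  also have "\<dots> \<longleftrightarrow> 0 \<le> k D \<and> (\<forall>d\<in>{D..Db}. k d \<le> k D)"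
    using D by (subst cSUP_le_iff[OF _ bdd]) auto
  also have "\<dots> \<longleftrightarrow> stop D G" using D ne by (simp add: stop_def k0) (simp add: k_def)
  finally show ?thesis .
qed

definition "spd D G = (if stop D G then if D = 0 then safety p else 0 else 1)"

lemma pacing_top:
  assumes RP: "R 0 \<le> P 0" and c: "cap (other i) S \<le> cap i S"
  shows "pacing p i S = spd (lead S) (cap i S - cap (other i) S)"
proof (cases "cap (other i) S = cap i S")
  case True
  have "stop (lead S) 0 \<longleftrightarrow> 0 \<le> lead S \<and> lead S \<le> Db" using stop_tie[OF RP, of "lead S"] by (auto simp: stop_def)
  then show ?thesis using True threshold_facts(1)[OF RP] by (auto simp: pacing_def pace_speed_def spd_def threshold_eq)
next
  case False
  let ?G = "cap i S - cap (other i) S" and ?D = "lead S"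
  have G: "0 < ?G" "\<bar>cap Firm1 S - cap Firm2 S\<bar> = ?G" using False c by (cases i; simp)+
  have 1: "pacing p i S = leader_speed p ?D ?G" using False c G(2) by (simp add: pacing_def)
  show ?thesis
  proof (cases "P 0 = R 0")
    case True
    then show ?thesis using G(1) by (simp add: 1 leader_speed_def spd_def stop_def race_value_R pace_value_eq)
  next
    case ne: False
    have "?D = 0 \<and> leader_value p 0 ?G = exp (beta p * ?G) * coast_value p 0 ?G \<longleftrightarrow> ?D = 0 \<and> stop ?D ?G"
      using leader_value_eq_iff[of 0 ?G] ne G(1) threshold_facts(1)[OF RP] by auto
    moreover have "0 < ?D \<and> ?D \<le> threshold p \<and> leader_value p ?D ?G = exp (beta p * ?G) * coast_value p ?D ?G
        \<longleftrightarrow> 0 < ?D \<and> stop ?D ?G"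
      using leader_value_eq_iff[of ?D ?G] ne G(1) by (auto simp: threshold_eq stop_def)
    ultimately show ?thesis using ne
      by (auto simp: 1 leader_speed_def spd_def race_value_R pace_value_eq) (auto simp: stop_def)
  qed
qed

lemma pacing_laggard: "cap i S < cap (other i) S \<Longrightarrow> pacing p i S = 1"
  by (simp add: pacing_def)

definition "stopped i = {S. cap (other i) S \<le> cap i S \<and> stop (lead S) (cap i S - cap (other i) S)}"

text \<open>Closedness makes the pacing speed Borel, and it makes the region where a leader races
  open, as \<open>continuation_speed\<close> requires.\<close>

lemma closed_stopped: "R 0 \<le> P 0 \<Longrightarrow> closed (stopped i)"
proof -
  assume RP: "R 0 \<le> P 0"
  have lc: "continuous_on UNIV lead" unfolding lead_def[abs_def] by (intro continuous_intros)
  show ?thesis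
  proof (cases "P 0 = R 0")
    case True
    then have "stop y G \<longleftrightarrow> y = 0 \<and> G = 0" for y G using stop_tie[OF RP, of 0] by (auto simp: stop_def Db_def)
    then have "stopped i = {S. lead S = 0} \<inter> {S. cap i S = cap (other i) S}" by (auto simp: stopped_def)
    then show ?thesis using lc by (auto intro!: closed_Int closed_Collect_eq continuous_intros)
  next
    case False
    \<comment> \<open>The clamps keep the arguments of \<open>C\<close> nonnegative, where it is
      continuous, without changing the relevant states; likewise \<open>max (?y S) d\<close> turns
      the moving range of \<open>d\<close> into a fixed one.\<close>
    let ?y = "\<lambda>S. max 0 (lead S)" and ?G = "\<lambda>S. max 0 (cap i S - cap (other i) S)"
    have eq: "stopped i = {S. cap (other i) S \<le> cap i S} \<inter> ({S. 0 \<le> lead S} \<inter> ({S. lead S \<le> Db} \<inter> ({S. R (?y S) \<le> C (?y S) (?G S)} \<inter>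
        (\<Inter>d\<in>{0..Db}. {S. A (?y S) / A (max (?y S) d) * (C (max (?y S) d) (?G S) - R (max (?y S) d)) \<le> C (?y S) (?G S) - R (?y S)}))))"
      (is "_ = ?X")
    proof (intro equalityI subsetI)
      fix S assume S: "S \<in> stopped i"
      then have y: "0 \<le> lead S" and st: "stop (lead S) (cap i S - cap (other i) S)" by (auto simp: stopped_def stop_def)
      have "A (lead S) / A (max (lead S) d) * (C (max (lead S) d) (cap i S - cap (other i) S) - R (max (lead S) d))
          \<le> C (lead S) (cap i S - cap (other i) S) - R (lead S)" if "d \<le> Db" for d
        using st that unfolding stop_def by (meson atLeastAtMost_iff max.boundedI max.cobounded1)
      then show "S \<in> ?X" using S y by (auto simp: stopped_def stop_def)
    next
      fix S assume S: "S \<in> ?X"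
      have "A (lead S) / A d * (C d (cap i S - cap (other i) S) - R d)
          \<le> C (lead S) (cap i S - cap (other i) S) - R (lead S)" if "lead S \<le> d" "d \<le> Db" for d
      proof -
        have "S \<in> {S. A (?y S) / A (max (?y S) d) * (C (max (?y S) d) (?G S) - R (max (?y S) d)) \<le> C (?y S) (?G S) - R (?y S)}"
        proof -
          have "d \<in> {0..Db}" using S that by auto
          with S show ?thesis by (elim IntE) (erule INT_D)
        qed
        moreover have "max (lead S) d = d" "0 \<le> lead S" "cap (other i) S \<le> cap i S" using S that by auto
        ultimately show ?thesis by simp
      qed
      then show "S \<in> stopped i" using S False by (auto simp: stopped_def stop_def)
    qed
    show ?thesis unfolding eq
      by (intro closed_Int closed_INT ballI closed_Collect_le continuous_intros lc)
        (use A_pos in \<open>auto simp: less_imp_neq[OF A_pos, symmetric]\<close>)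
  qed
qed

lemma pacing_markov:
  assumes RP: "R 0 \<le> P 0" shows "is_markov_strategy (pacing p i)"
proof -
  have eq: "pacing p i = (\<lambda>S. if S \<in> stopped i then if S \<in> {S. lead S = 0} then safety p else 0 else 1)"
  proof
    fix S show "pacing p i S = (if S \<in> stopped i then if S \<in> {S. lead S = 0} then safety p else 0 else 1)"
      using pacing_top[OF RP, of i S] pacing_laggard[of i S] by (cases "cap (other i) S \<le> cap i S") (auto simp: stopped_def spd_def)
  qed
  have lc: "continuous_on UNIV lead" unfolding lead_def[abs_def] by (intro continuous_intros)
  have [measurable]: "stopped i \<in> sets borel" using closed_stopped[OF RP] by (rule borel_closed)
  have [measurable]: "{S. lead S = 0} \<in> sets borel" using lc by (intro borel_closed closed_Collect_eq) auto
  have "pacing p i \<in> borel_measurable borel" unfolding eq by measurable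
  moreover have "pacing p i S \<in> {0..1}" for S unfolding eq using g_pos g_less by auto
  ultimately show ?thesis by (simp add: is_markov_strategy_def)
qed

end

section \<open>The path of play of the pacing profile\<close>

context race_game
begin

text \<open>The gap \<open>G + m u - u\<close> never increases, so away from the first tie its sign
  is locally constant. There the laggard locally either races or copies the leader, which settles
  its derivative.\<close>

lemma tie_time:
  assumes m: "admpath m"
  obtains T where "finite T" "\<And>s. 0 < s \<Longrightarrow> s \<notin> T \<Longrightarrow>
    (\<forall>\<^sub>F u in nhds s. 0 < G + m u - u) \<or> (\<forall>\<^sub>F u in nhds s. G + m u - u \<le> 0)"
proof -
  define Z where "Z = {s \<in> {0..}. G + m s - s \<le> 0}"
  have anti: "G + m t - t \<le> G + m s - s" if "s \<le> t" for s t using admpathD(3)[OF m that] by simp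
  have ev: "\<forall>\<^sub>F u in nhds s. 0 < G + m u - u" if "0 < G + m s - s" for s
  proof -
    have "open {u. 0 < G + m u - u}" by (intro open_Collect_less continuous_on_diff continuous_on_add continuous_on_const continuous_on_id admpath_cont m)
    then show ?thesis using eventually_nhds_in_open[of "{u. 0 < G + m u - u}" s] that by simp
  qed
  show thesis
  proof (cases "Z = {}")
    case True
    have "0 < G + m s - s" if "0 < s" for s     proof (rule ccontr)
      assume "\<not> 0 < G + m s - s"
      then have "s \<in> Z" using that by (simp add: Z_def)
      then show False using True by simp
    qed
    then show thesis by (intro that[of "{}"]) (use ev in blast)+
  next
    case False
    have "Z = {0..} \<inter> {s. G + m s - s \<le> 0}" by (auto simp: Z_def)
    moreover have "continuous_on UNIV (\<lambda>s. G + m s - s)" by (intro continuous_on_diff continuous_on_add continuous_on_const continuous_on_id admpath_cont m)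
    ultimately have "closed Z" by (auto intro!: closed_Int closed_Collect_le simp del: diff_le_0_iff_le)
    moreover have "bdd_below Z" by (auto simp: Z_def intro!: bdd_belowI[of _ 0])
    ultimately have Z: "closed Z" "bdd_below Z" .
    then have I: "Inf Z \<in> Z" using False by (intro closed_contains_Inf) auto
    have "(\<forall>\<^sub>F u in nhds s. 0 < G + m u - u) \<or> (\<forall>\<^sub>F u in nhds s. G + m u - u \<le> 0)" if s: "0 < s" "s \<noteq> Inf Z" for s
    proof (cases "s < Inf Z")
      case True
      then have "s \<notin> Z" using cInf_lower[of s Z] Z by auto
      then have "0 < G + m s - s" using s by (auto simp: Z_def)
      then show ?thesis using ev by blast
    next
      case False
      then have "Inf Z < s" using s by simp
      then have "\<forall>\<^sub>F u in nhds s. u \<in> {Inf Z<..}" by (intro eventually_nhds_in_open) auto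
      then have "\<forall>\<^sub>F u in nhds s. G + m u - u \<le> 0"
      proof eventually_elim
        case (elim u)
        then show ?case using anti[of "Inf Z" u] I by (auto simp: Z_def)
      qed
      then show ?thesis ..
    qed
    then show thesis by (intro that[of "{Inf Z}"]) auto
  qed
qed

lemma pacing_path:
  assumes RP: "R 0 \<le> P 0" and h: "feasible_history p h"
  defines "s0 \<equiv> snd h (fst h)"
  assumes k: "cap (other k) s0 \<le> cap k s0" and m: "admpath m" and K: "finite K"
  defines "G \<equiv> cap k s0 - cap (other k) s0"
  assumes der: "\<And>s. 0 < s \<Longrightarrow> s \<notin> K \<Longrightarrow>
    (m has_real_derivative spd (lead s0 + m s - safety p * s) (max 0 (G + m s - s))) (at s)"
  obtains S where "S \<in> continuations p (of_markov (pacing p)) h" "feasible_path p S"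
    "\<And>s. 0 \<le> s \<Longrightarrow> cap k (S (fst h + s)) = cap k s0 + m s"
    "\<And>s. 0 \<le> s \<Longrightarrow> cap (other k) (S (fst h + s)) = min (cap (other k) s0 + s) (cap k s0 + m s)"
proof -
  let ?o = "other k"
  have ok: "?o \<noteq> k" by (cases k) auto
  have io: "i = k \<or> i = ?o" for i by (cases i; cases k) auto
  define f where "f i s = (if i = k then cap k s0 + m s else min (cap ?o s0 + s) (cap k s0 + m s))" for i s
  have fk: "f k = (\<lambda>s. cap k s0 + m s)" and fo: "f ?o = (\<lambda>s. min (cap ?o s0 + s) (cap k s0 + m s))"
    using ok by (auto simp: f_def fun_eq_iff)
  let ?S = "extend p h f"
  have f0: "f i 0 = cap i (snd h (fst h))" for i
    using io[of i] k admpathD(1)[OF m] by (auto simp: fk fo s0_def)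
  obtain T where T: "finite T" "\<And>s. 0 < s \<Longrightarrow> s \<notin> T \<Longrightarrow>
    (\<forall>\<^sub>F u in nhds s. 0 < G + m u - u) \<or> (\<forall>\<^sub>F u in nhds s. G + m u - u \<le> 0)" using tie_time[OF m, of G] by blast
  have mono: "f i s \<le> f i t \<and> f i t - f i s \<le> t - s" if "s \<le> t" for i s t
    using io[of i] admpathD(2,3)[OF m that] that by (auto simp: fk fo)
  have sp: "pacing p i (?S (fst h + s)) \<in> {0..1} \<and> (f i has_real_derivative pacing p i (?S (fst h + s))) (at s)"
    if s: "0 < s" "s \<notin> K \<union> T" for i s
  proof -
    let ?Z = "?S (fst h + s)" and ?D = "lead s0 + m s - safety p * s"
    have cap: "cap i ?Z = f i s" "snd (snd ?Z) = snd (snd s0) + safety p * s" for i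
      using cap_extend[where f = f and h = h and s = s and p = p] f0 s by (auto simp: s0_def)
    have le: "cap ?o ?Z \<le> cap k ?Z" by (simp add: cap fk fo)
    have lead: "lead ?Z = ?D"
      using le k by (simp add: lead_eq top_eq[of _ k] cap(2)) (simp add: cap fk)
    have gap: "cap k ?Z - cap ?o ?Z = max 0 (G + m s - s)" by (simp add: cap fk fo G_def)
    have dk: "(f k has_real_derivative spd ?D (max 0 (G + m s - s))) (at s)"
      unfolding fk using der[of s] s by (auto intro!: derivative_eq_intros)
    have "(f i has_real_derivative pacing p i ?Z) (at s)"
    proof (cases "i = k")
      case True
      then show ?thesis using dk pacing_top[OF RP le] by (simp add: lead gap)
    next
      case False
      then have i: "i = ?o" using io by blast
      from T(2)[of s] s have "(\<forall>\<^sub>F u in nhds s. 0 < G + m u - u) \<or> (\<forall>\<^sub>F u in nhds s. G + m u - u \<le> 0)" by simp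
      then show ?thesis
      proof
        assume e: "\<forall>\<^sub>F u in nhds s. 0 < G + m u - u"
        then have "cap ?o ?Z < cap k ?Z" using gap eventually_nhds_x_imp_x[OF e] by simp
        then have 1: "pacing p i ?Z = 1" unfolding i using pacing_laggard[of ?o ?Z] by simp
        have "\<forall>\<^sub>F u in nhds s. f ?o u = cap ?o s0 + u"
          using e by eventually_elim (simp add: fo G_def)
        then have "(f ?o has_real_derivative 1) (at s) = ((\<lambda>u. cap ?o s0 + u) has_real_derivative 1) (at s)"
          by (rule DERIV_cong_ev[OF refl _ refl])
        moreover have "((\<lambda>u. cap ?o s0 + u) has_real_derivative 1) (at s)" by (auto intro!: derivative_eq_intros)
        ultimately show ?thesis using 1 by (simp only: i)
      next
        assume e: "\<forall>\<^sub>F u in nhds s. G + m u - u \<le> 0"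
        then have z: "max 0 (G + m s - s) = 0" using eventually_nhds_x_imp_x[OF e] by simp
        have "pacing p i ?Z = spd ?D 0"
          using pacing_top[OF RP, of i ?Z] gap z by (simp add: i lead)
        moreover have "\<forall>\<^sub>F u in nhds s. f ?o u = f k u"
          using e by eventually_elim (simp add: fo fk G_def)
        then have "(f ?o has_real_derivative spd ?D 0) (at s) = (f k has_real_derivative spd ?D 0) (at s)"
          by (rule DERIV_cong_ev[OF refl _ refl])
        ultimately show ?thesis using dk by (simp add: i z)
      qed
    qed
    moreover have "pacing p i ?Z \<in> {0..1}" using pacing_markov[OF RP, of i] unfolding is_markov_strategy_def by blast
    ultimately show ?thesis by blast
  qed
  have "?S \<in> continuations p (of_markov (pacing p)) h" "feasible_path p ?S"
    using extend_continuation[OF h, of f "K \<union> T" "of_markov (pacing p)"] f0 mono sp K T(1)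
    by (auto simp: of_markov_def speed_after_def)
  then show thesis
  proof (rule that)
    fix s :: real assume "0 \<le> s"
    then show "cap k (?S (fst h + s)) = cap k s0 + m s" "cap ?o (?S (fst h + s)) = min (cap ?o s0 + s) (cap k s0 + m s)"
      using cap_extend(1)[where f = f and h = h and s = s and p = p] f0 by (simp_all add: fk fo)
  qed
qed

text \<open>Race for \<open>th\<close>, then coast and pace from the lead \<open>d\<close> reached
  by then. Unlike \<open>mt\<close>, this also describes a start at a negative lead.\<close>

definition "rc th d s = (if s \<le> th then s else th + nb d (s - th))"

lemma admpath_rc:
  assumes "0 \<le> th" "0 \<le> d" shows "admpath (rc th d)"
proof (rule admpathI)
  fix s t :: real assume st: "s \<le> t"
  consider "t \<le> th" | "s \<le> th" "th < t" | "th < s" by linarith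
  then show "rc th d s \<le> rc th d t" and "rc th d t \<le> rc th d s + (t - s)"
  proof (atomize(full), cases)
    case 2
    then show "rc th d s \<le> rc th d t \<and> rc th d t \<le> rc th d s + (t - s)"
      using admpathD(4,5)[OF admpath_nb[OF assms(2)], of "t - th"] st by (simp add: rc_def)
  next
    case 3
    then show "rc th d s \<le> rc th d t \<and> rc th d t \<le> rc th d s + (t - s)"
      using admpathD(2,3)[OF admpath_nb[OF assms(2)], of "s - th" "t - th"] st by (simp add: rc_def)
  qed (use st in \<open>simp add: rc_def\<close>)
qed (use assms in \<open>simp add: rc_def\<close>)

text \<open>The excluded dates are the kinks at the end of the race and at the end of coasting.
  Before the first no state stops, by the choice of \<open>d\<close>; afterwards
  \<open>stop_coast\<close> keeps the path in the stopping region.\<close>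

lemma rc_derivative:
  assumes RP: "R 0 \<le> P 0" and y: "y \<le> d" and st: "stop d G" and G: "0 \<le> G"
    and ns: "\<And>x. y \<le> x \<Longrightarrow> x < d \<Longrightarrow> \<not> stop x G"
  defines "th \<equiv> (d - y) / (1 - safety p)"
  assumes s: "0 < s" "s \<notin> {th, th + d / safety p}"
  shows "(rc th d has_real_derivative spd (y + rc th d s - safety p * s) (max 0 (G + rc th d s - s))) (at s)"
proof -
  have d: "0 \<le> d" using st by (simp add: stop_def)
  have thd: "d = y + (1 - safety p) * th" using g_less by (simp add: th_def)
  have "s < th \<or> th < s \<and> s < th + d / safety p \<or> th + d / safety p < s" and dg: "0 \<le> d / safety p"
    using s d g_pos by auto
  then consider "s < th" | "th < s" "s < th + d / safety p" | "th + d / safety p < s" by blast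
  then show ?thesis
  proof cases
    case 1
    have "\<forall>\<^sub>F u in nhds s. u \<in> {..<th}" using 1 by (intro eventually_nhds_in_open) auto
    then have "\<forall>\<^sub>F u in nhds s. rc th d u = u" by eventually_elim (simp add: rc_def)
    then have "(rc th d has_real_derivative 1) (at s) = ((\<lambda>u. u) has_real_derivative 1) (at s)"
      by (rule DERIV_cong_ev[OF refl _ refl])
    moreover have "\<not> stop (y + s - safety p * s) G"
    proof (rule ns)
      have "(1 - safety p) * s < (1 - safety p) * th" "0 \<le> (1 - safety p) * s" using 1 g_less s by auto
      then show "y \<le> y + s - safety p * s" "y + s - safety p * s < d" using thd by (auto simp: algebra_simps)
    qed
    ultimately show ?thesis using 1 G by (simp add: rc_def spd_def)
  next
    case 2
    have z: "safety p * (s - th) < d" using 2(2) g_pos by (simp add: field_simps)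
    have "\<forall>\<^sub>F u in nhds s. u \<in> {th<..<th + d / safety p}" using 2 by (intro eventually_nhds_in_open) auto
    then have "\<forall>\<^sub>F u in nhds s. rc th d u = th"
    proof eventually_elim
      case (elim u)
      then have "safety p * (u - th) < d" using g_pos by (simp add: field_simps)
      then show ?case using elim by (simp add: rc_def nb_def)
    qed
    then have "(rc th d has_real_derivative 0) (at s) = ((\<lambda>u. th) has_real_derivative 0) (at s)"
      by (rule DERIV_cong_ev[OF refl _ refl])
    moreover have rc: "rc th d s = th + nb d (s - th)" "nb d (s - th) = 0" using 2 z by (auto simp: rc_def nb_def)
    moreover have "y + rc th d s - safety p * s = d - safety p * (s - th)"
      unfolding rc using thd by (simp add: algebra_simps)
    moreover have "stop (d - safety p * (s - th)) (max 0 (G + rc th d s - s))"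
      using stop_coast[OF RP st G, of "s - th"] 2 z rc by (simp add: algebra_simps)
    ultimately show ?thesis using z by (simp add: spd_def)
  next
    case 3
    have ths: "th < s" using 3 dg by linarith
    have z: "d < safety p * (s - th)" using 3 g_pos by (simp add: field_simps)
    have "\<forall>\<^sub>F u in nhds s. u \<in> {th + d / safety p<..}" using 3 by (intro eventually_nhds_in_open) auto
    then have "\<forall>\<^sub>F u in nhds s. rc th d u = th + (safety p * (u - th) - d)"
    proof eventually_elim
      case (elim u)
      then have "th < u" using dg by simp
      moreover have "d < safety p * (u - th)" using elim g_pos by (simp add: field_simps)
      ultimately show ?case by (simp add: rc_def nb_def)
    qed
    then have "(rc th d has_real_derivative safety p) (at s) = ((\<lambda>u. th + (safety p * (u - th) - d)) has_real_derivative safety p) (at s)"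
      by (rule DERIV_cong_ev[OF refl _ refl])
    moreover have "((\<lambda>u. th + (safety p * (u - th) - d)) has_real_derivative safety p) (at s)"
      by (auto intro!: derivative_eq_intros)
    moreover have rc: "rc th d s = th + nb d (s - th)" "nb d (s - th) = safety p * (s - th) - d" using ths z by (auto simp: rc_def nb_def)
    moreover have "y + rc th d s - safety p * s = 0" unfolding rc using thd by (simp add: algebra_simps)
    moreover have "stop 0 (max 0 (G + rc th d s - s))"
    proof -
      have "G + rc th d s - s = G + nb d (s - th) - (s - th)" using rc(1) by simp
      then show ?thesis using stop_coast[OF RP st G, of "s - th"] ths z by (simp only:) simp
    qed
    ultimately show ?thesis by (simp add: spd_def)
  qed
qed

lemma race_not_stopped_derivative:
  assumes G: "0 \<le> G" and ns: "\<And>x. y \<le> x \<Longrightarrow> \<not> stop x G" and s: "0 < s"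
  shows "((\<lambda>s. s) has_real_derivative spd (y + s - safety p * s) (max 0 (G + s - s))) (at s)"
proof -
  have "0 \<le> (1 - safety p) * s" using g_less s by simp
  then have "\<not> stop (y + s - safety p * s) G" by (intro ns) (simp add: algebra_simps)
  then show ?thesis using G by (simp add: spd_def)
qed

text \<open>From a negative lead the leading firm first races until its lead vanishes.\<close>

definition "Val y G = (if 0 \<le> y then v y G
  else integral {0..- y / (1 - safety p)} (e y) + e y (- y / (1 - safety p)) * v 0 G)"

lemma lead_vanishes: "y + (- y / (1 - safety p)) - safety p * (- y / (1 - safety p)) = 0"
proof -
  have "y + t - safety p * t = y + (1 - safety p) * t" for t by (simp add: algebra_simps)
  from this[of "- y / (1 - safety p)"] show ?thesis using g_less by (simp only:) simp
qed

lemma J_negative_lead: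
  assumes y: "y \<le> 0" and m: "admpath m" and G: "0 \<le> G"
  defines "t0 \<equiv> - y / (1 - safety p)"
  assumes race: "\<And>u. 0 \<le> u \<Longrightarrow> u \<le> t0 \<Longrightarrow> m u = u"
  shows "J y G m = integral {0..t0} (e y) + e y t0 * J 0 G (\<lambda>t. m (t0 + t) - t0)"
proof -
  have t0: "0 \<le> t0" using y g_less divide_nonneg_pos[of "- y" "1 - safety p"] by (simp add: t0_def)
  have z: "y + t0 - safety p * t0 = 0" unfolding t0_def by (rule lead_vanishes)
  have "J y G m = integral {0..t0} (fl y G m) + fl y G m t0 * J 0 G (\<lambda>t. m (t0 + t) - t0)"
    using J_split[OF m G t0, of y] race[OF t0 order.refl] G z by simp
  then show ?thesis using race_integral[of t0 m G y] fl_race[OF race t0 G] race t0 G by simp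
qed

lemma J_le_Val:
  assumes RP: "R 0 \<le> P 0" and m: "admpath m" and G: "0 \<le> G"
  shows "J y G m \<le> Val y G"
proof (cases "0 \<le> y")
  case True
  then show ?thesis using race_then_coast_optimal[OF tie_le[OF RP] True G m] by (simp add: Val_def)
next
  case False
  let ?t0 = "- y / (1 - safety p)"
  obtain n where n: "admpath n" "\<And>u. 0 \<le> u \<Longrightarrow> u \<le> ?t0 \<Longrightarrow> n u = u"
    "\<And>t G. 0 \<le> t \<Longrightarrow> fl y G m t \<le> fl y G n t" using negative_lead_path[OF _ m, of y] False by auto
  have t0: "0 \<le> ?t0" using False g_less divide_nonneg_pos[of "- y" "1 - safety p"] by simp
  have "J y G m \<le> 1 * J y G n" using n by (intro J_mono m G) auto
  also have "\<dots> = integral {0..?t0} (e y) + e y ?t0 * J 0 G (\<lambda>t. n (?t0 + t) - ?t0)"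
    using J_negative_lead[OF _ n(1) G n(2)] False by simp
  also have "\<dots> \<le> integral {0..?t0} (e y) + e y ?t0 * v 0 G"
  proof -
    have "admpath (\<lambda>t. n (?t0 + t) - ?t0)" using admpath_shift[OF n(1), of ?t0] n(2)[OF t0] by simp
    then have "J 0 G (\<lambda>t. n (?t0 + t) - ?t0) \<le> v 0 G" by (intro race_then_coast_optimal tie_le RP G) auto
    then show ?thesis using e_pos[of y ?t0] by simp
  qed
  finally show ?thesis using False by (simp add: Val_def)
qed

lemma V_rc: "0 \<le> y \<Longrightarrow> y \<le> d \<Longrightarrow> J y G (rc ((d - y) / (1 - safety p)) d) = V ((d - y) / (1 - safety p)) y G"
proof -
  assume a: "0 \<le> y" "y \<le> d"
  let ?th = "(d - y) / (1 - safety p)"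
  have thd: "d = y + (1 - safety p) * ?th" using g_less by simp
  have "rc ?th d t = mt ?th y t" if "0 \<le> t" for t
  proof (cases "t \<le> ?th")
    case True
    then show ?thesis using mt_race[OF a(1) that True] by (simp add: rc_def)
  next
    case False
    have "safety p * (t - th) - d = safety p * t - y - th" if "d = y + (1 - safety p) * th" for th
      using that by (simp add: algebra_simps)
    note this[OF thd]
    then show ?thesis using False by (simp add: rc_def nb_def mt_def max_def)
  qed
  then show ?thesis unfolding V_def by (rule J_cong)
qed

lemma equilibrium_plan:
  assumes RP: "R 0 \<le> P 0" and G: "0 \<le> G"
  obtains (never) "\<And>d. y \<le> d \<Longrightarrow> \<not> stop d G" "Val y G \<le> R y"
    | (first) d where "y \<le> d" "stop d G" "\<And>x. y \<le> x \<Longrightarrow> x < d \<Longrightarrow> \<not> stop x G"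
        "Val y G = J y G (rc ((d - y) / (1 - safety p)) d)"
proof (cases "0 \<le> y")
  case True
  from first_stop[OF RP True G] show thesis
  proof cases
    case 1
    then show thesis using True by (intro never) (auto simp: Val_def)
  next
    case (2 d)
    then show thesis using True V_rc[of y d G] by (intro first[of d]) (auto simp: Val_def)
  qed
next
  case False
  let ?t0 = "- y / (1 - safety p)"
  have t0: "0 \<le> ?t0" using False g_less divide_nonneg_pos[of "- y" "1 - safety p"] by simp
  have neg: "\<not> stop x G" if "x < 0" for x using that by (simp add: stop_def)
  from first_stop[OF RP order.refl G] show thesis
  proof cases
    case 1
    have "Val y G \<le> R y"
    proof -
      have "(1 - safety p) * ?t0 = - y" using g_less by simp
      then have "R y = integral {0..?t0} (e y) + e y ?t0 * R 0" using R_rec[OF t0, of y] by simp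
      moreover have "e y ?t0 * v 0 G \<le> e y ?t0 * R 0" using 1(2) e_pos[of y ?t0] by simp
      ultimately show ?thesis using False by (simp add: Val_def)
    qed
    moreover have "\<not> stop d G" for d using 1(1)[of d] neg[of d] by (cases "0 \<le> d") auto
    ultimately show thesis by (intro never) auto
  next
    case (2 d)
    let ?th = "(d - y) / (1 - safety p)"
    have th: "?t0 \<le> ?th" "?th - ?t0 = (d - 0) / (1 - safety p)" using 2(1) g_less divide_right_mono[of "- y" "d - y" "1 - safety p"]
      by (simp_all add: diff_divide_distrib)
    have "J y G (rc ?th d) = integral {0..?t0} (e y) + e y ?t0 * J 0 G (\<lambda>t. rc ?th d (?t0 + t) - ?t0)"
      by (rule J_negative_lead[OF _ admpath_rc G]) (use False t0 th(1) 2(1) in \<open>auto simp: rc_def\<close>)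
    moreover have "J 0 G (\<lambda>t. rc ?th d (?t0 + t) - ?t0) = J 0 G (rc ((d - 0) / (1 - safety p)) d)"
      using th(2) by (intro J_cong) (auto simp: rc_def algebra_simps)
    ultimately have "J y G (rc ?th d) = Val y G" using 2(4) V_rc[OF order.refl 2(1), of G] False by (simp add: Val_def)
    moreover have "\<not> stop x G" if "x < d" for x using 2(3)[of x] that neg[of x] by (cases "0 \<le> x") auto
    ultimately show thesis using 2(1,2) False by (intro first[of d]) auto
  qed
qed

lemma top_flow:
  assumes S: "feasible_path p S" and t: "0 \<le> t" and s: "0 \<le> s" and m: "admpath m"
    and k: "cap (other k) (S t) \<le> cap k (S t)"
  defines "G \<equiv> cap k (S t) - cap (other k) (S t)"
  assumes ck: "\<And>s. 0 \<le> s \<Longrightarrow> cap k (S (t + s)) = cap k (S t) + m s"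
    and co: "\<And>s. 0 \<le> s \<Longrightarrow> cap (other k) (S (t + s)) = min (cap (other k) (S t) + s) (cap k (S t) + m s)"
  shows "flow p k S t s = exp (alpha p * cap k (S t) - beta p * cap (other k) (S t)) * fl (lead (S t)) G m s"
    and "flow p (other k) S t s = exp (- disc p * s - H (lead (S t)) m s
      + (alpha p * (cap (other k) (S t) + min s (G + m s)) - beta p * (cap k (S t) + m s)))"
proof -
  have "top_gain S t u = m u" if "0 \<le> u" for u
    using ck[OF that] co[OF that] k that by (simp add: top_gain_def top_eq[of _ k])
  then have H: "H (lead (S t)) (top_gain S t) s = H (lead (S t)) m s" by (intro H_cong) auto
  have o: "cap (other k) (S (t + s)) = cap (other k) (S t) + min s (G + m s)"
    unfolding co[OF s] G_def by simp
  show "flow p k S t s = exp (alpha p * cap k (S t) - beta p * cap (other k) (S t)) * fl (lead (S t)) G m s"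
    unfolding flow_top_gain[OF S t s] H ck[OF s] o fl_def exp_add[symmetric] by (simp add: distrib_left)
  show "flow p (other k) S t s = exp (- disc p * s - H (lead (S t)) m s
      + (alpha p * (cap (other k) (S t) + min s (G + m s)) - beta p * (cap k (S t) + m s)))"
    unfolding flow_top_gain[OF S t s] H other_other ck[OF s] o ..
qed

text \<open>This continuation bounds the equilibrium payoff from below. Its explicit shape is kept
  because a lagging deviator is compared with it date by date.\<close>

lemma pacing_plan:
  assumes RP: "R 0 \<le> P 0" and h: "feasible_history p h"
  defines "s0 \<equiv> snd h (fst h)"
  assumes k: "cap (other k) s0 \<le> cap k s0"
  defines "G \<equiv> cap k s0 - cap (other k) s0"
  obtains m S where "admpath m" "Val (lead s0) G \<le> J (lead s0) G m"
    "S \<in> continuations p (of_markov (pacing p)) h" "feasible_path p S"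
    "\<forall>s\<ge>0. cap k (S (fst h + s)) = cap k s0 + m s"
    "\<forall>s\<ge>0. cap (other k) (S (fst h + s)) = min (cap (other k) s0 + s) (cap k s0 + m s)"
    "((\<forall>d\<ge>lead s0. \<not> stop d G) \<and> m = (\<lambda>s. s)) \<or>
     (\<exists>d\<ge>lead s0. stop d G \<and> (\<forall>x\<ge>lead s0. x < d \<longrightarrow> \<not> stop x G) \<and> m = rc ((d - lead s0) / (1 - safety p)) d)"
proof -
  have G: "0 \<le> G" using k by (simp add: G_def)
  from equilibrium_plan[OF RP G, of "lead s0"] show thesis
  proof cases
    case 1
    have der: "((\<lambda>s. s) has_real_derivative spd (lead s0 + s - safety p * s) (max 0 (G + s - s))) (at s)" if "0 < s" for s
      using race_not_stopped_derivative[OF G 1(1) that] .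
    from pacing_path[OF RP h, folded s0_def, OF k admpath_id finite.emptyI, folded G_def, OF der]
    obtain S where S: "S \<in> continuations p (of_markov (pacing p)) h" "feasible_path p S"
      "\<And>s. 0 \<le> s \<Longrightarrow> cap k (S (fst h + s)) = cap k s0 + s"
      "\<And>s. 0 \<le> s \<Longrightarrow> cap (other k) (S (fst h + s)) = min (cap (other k) s0 + s) (cap k s0 + s)" by blast
    show thesis
      by (rule that[OF admpath_id _ S(1,2)]) (use 1 R_G[OF G] S(3,4) in auto)
  next
    case (2 d)
    let ?th = "(d - lead s0) / (1 - safety p)"
    have rc: "admpath (rc ?th d)" using 2(1,2) g_less by (intro admpath_rc) (auto simp: stop_def)
    have der: "(rc ?th d has_real_derivative spd (lead s0 + rc ?th d s - safety p * s) (max 0 (G + rc ?th d s - s))) (at s)"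
      if "0 < s" "s \<notin> {?th, ?th + d / safety p}" for s
      using rc_derivative[OF RP 2(1,2) G 2(3) that] .
    have fin: "finite {?th, ?th + d / safety p}" by simp
    from pacing_path[OF RP h, folded s0_def, OF k rc fin, folded G_def, OF der]
    obtain S where S: "S \<in> continuations p (of_markov (pacing p)) h" "feasible_path p S"
      "\<And>s. 0 \<le> s \<Longrightarrow> cap k (S (fst h + s)) = cap k s0 + rc ?th d s"
      "\<And>s. 0 \<le> s \<Longrightarrow> cap (other k) (S (fst h + s)) = min (cap (other k) s0 + s) (cap k s0 + rc ?th d s)" by blast
    show thesis
      by (rule that[OF rc _ S(1,2)]) (use 2 S(3,4) in auto)
  qed
qed

end

section \<open>Deviations from the pacing profile\<close>

context race_game
begin

lemma continuous_on_flow: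
  assumes S: "feasible_path p S" and t: "0 \<le> t" shows "continuous_on {0..} (flow p i S t)"
proof -
  have c: "continuous_on {0..} (\<lambda>s. cap i (S (t + s)))" for i
    by (intro continuous_on_cap continuous_on_compose2[OF feasible_path_cont[OF S]] continuous_intros) (use t in auto)
  have "continuous_on {0..} (\<lambda>s. exp (- disc p * s - H (lead (S t)) (top_gain S t) s
    + (alpha p * cap i (S (t + s)) - beta p * cap (other i) (S (t + s)))))"
    by (intro continuous_intros c H_cont top_gain_admpath S t)
  then show ?thesis by (rule continuous_on_eq) (use flow_top_gain[OF S t] in auto)
qed

lemma total_split:
  assumes f: "continuous_on {0..} f" and T: "0 \<le> T"
  shows "total f = (\<integral>\<^sup>+s. ennreal (f s) * indicator {0..<T} s \<partial>lborel) + total (\<lambda>s. f (T + s))"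
proof -
  have m: "(\<lambda>s. ennreal (f s) * indicator X s) \<in> borel_measurable lborel" if "X \<in> sets borel" "X \<subseteq> {0..}" for X
  proof -
    have "(\<lambda>s. indicator X s *\<^sub>R f s) \<in> borel_measurable borel"
      using f that by (intro borel_measurable_continuous_on_indicator) (auto intro: continuous_on_subset)
    then have "(\<lambda>s. ennreal (indicator X s *\<^sub>R f s)) \<in> borel_measurable borel" by measurable
    moreover have "(\<lambda>s. ennreal (indicator X s *\<^sub>R f s)) = (\<lambda>s. ennreal (f s) * indicator X s)"
      by (auto simp: indicator_def fun_eq_iff)
    ultimately show ?thesis by simp
  qed
  have "total f = (\<integral>\<^sup>+s. ennreal (f s) * indicator {0..<T} s + ennreal (f s) * indicator {T..} s \<partial>lborel)"
    unfolding total_def using T by (intro nn_integral_cong) (auto simp: indicator_def)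
  also have "\<dots> = (\<integral>\<^sup>+s. ennreal (f s) * indicator {0..<T} s \<partial>lborel) + (\<integral>\<^sup>+s. ennreal (f s) * indicator {T..} s \<partial>lborel)"
    using T by (intro nn_integral_add m) auto
  also have "(\<integral>\<^sup>+s. ennreal (f s) * indicator {T..} s \<partial>lborel) = total (\<lambda>s. f (T + s))"
    unfolding total_def by (subst nn_integral_lborel_shift[of _ T]) (auto intro!: nn_integral_cong simp: indicator_def)
  finally show ?thesis .
qed

lemma flow_continue:
  assumes S: "feasible_path p S" and t: "0 \<le> t" and s: "0 \<le> s" "0 \<le> s'"
  shows "flow p i S t (s + s') = exp (- disc p * s - H (lead (S t)) (top_gain S t) s) * flow p i S (t + s) s'"
proof -
  note tg = top_gain_admpath[OF S t]
  have l: "lead (S (t + s)) = lead (S t) + top_gain S t s - safety p * s"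
    using feasible_path_bounds(3)[OF S, of t "t + s"] t s by (simp add: lead_eq top_gain_def)
  have "H (lead (S (t + s))) (top_gain S (t + s)) s' = H (lead (S (t + s))) (\<lambda>u. top_gain S t (s + u) - top_gain S t s) s'"
    by (intro H_cong) (use s in \<open>auto simp: top_gain_def add.assoc\<close>)
  then have "H (lead (S t)) (top_gain S t) (s + s')
      = H (lead (S t)) (top_gain S t) s + H (lead (S (t + s))) (top_gain S (t + s)) s'"
    using H_add[OF tg s, of "lead (S t)"] l by simp
  then show ?thesis
    using flow_top_gain[OF S t, of "s + s'" i] flow_top_gain[OF S, of "t + s" s' i] t s
    by (simp add: exp_add[symmetric] distrib_left add.assoc)
qed

lemma tied_or_leading_flow_le:
  assumes S: "feasible_path p S" and t: "0 \<le> t" and s: "0 \<le> s"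
    and i: "cap (other i) (S t) \<le> cap i (S t)"
  defines "G \<equiv> cap i (S t) - cap (other i) (S t)"
  assumes cu: "min (cap (other i) (S t) + s) (top (S (t + s))) \<le> cap (other i) (S (t + s))"
  shows "flow p i S t s \<le> exp (alpha p * cap i (S t) - beta p * cap (other i) (S t)) * fl (lead (S t)) G (top_gain S t) s"
proof -
  have top: "top (S (t + s)) = cap i (S t) + top_gain S t s"
    using i s by (simp add: top_gain_def top_eq[of "S t" i])
  have "cap i (S (t + s)) \<le> cap i (S t) + top_gain S t s"
    using top by (simp add: top_eq[of _ i])
  then have "alpha p * cap i (S (t + s)) \<le> alpha p * (cap i (S t) + top_gain S t s)" using al_pos by simp
  moreover have "beta p * (cap (other i) (S t) + min s (G + top_gain S t s)) \<le> beta p * cap (other i) (S (t + s))"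
    using cu be_pos unfolding top G_def by (intro mult_left_mono) auto
  ultimately show ?thesis
    unfolding flow_top_gain[OF S t s] fl_def exp_add[symmetric] exp_le_cancel_iff distrib_left by linarith
qed

text \<open>Below the safety frontier the firm either lags or has a negative lead, and in both cases
  the pacing profile prescribes speed 1. On a last excursion below, it would outrun the
  frontier.\<close>

lemma never_behind:
  assumes h: "feasible_history p h" and u: "unit_profile p \<sigma>" and S: "S \<in> continuations p \<sigma> h"
    and RP: "R 0 \<le> P 0" and m: "\<sigma> j = of_markov (pacing p) j"
    and ab: "fst h \<le> a" "a \<le> b" "snd (snd (S a)) \<le> cap j (S a)"
  shows "snd (snd (S b)) \<le> cap j (S b)"
proof (rule ccontr)
  assume neg: "\<not> snd (snd (S b)) \<le> cap j (S b)"
  note fS = continuation_feasible[OF h u S]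
  have a0: "0 \<le> a" using h ab by (simp add: feasible_history_def)
  define U where "U = {s. cap j s < snd (snd s)}"
  have U: "open U" unfolding U_def by (intro open_Collect_less continuous_intros)
  have p1: "pacing p j s = 1" if "s \<in> U" for s
  proof (cases "cap j s < cap (other j) s")
    case False
    then have "lead s < 0" using that by (simp add: U_def lead_eq top_eq[of _ j])
    then show ?thesis using pacing_top[OF RP, of j s] False by (simp add: spd_def stop_def)
  qed (simp add: pacing_laggard)
  let ?f = "\<lambda>u. cap j (S u) - snd (snd (S u))"
  have "continuous_on {a..b} ?f"
    using continuous_on_subset[OF feasible_path_cont[OF fS], of "{a..b}"] a0 by (intro continuous_intros) auto
  then obtain w where w: "a \<le> w" "w < b" "?f w = 0" "\<And>z. w < z \<Longrightarrow> z \<le> b \<Longrightarrow> ?f z < 0"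
    using last_nonneg_time[of a b ?f] ab neg by auto
  have "1 * (b - w) \<le> cap j (S b) - cap j (S w)"
    by (rule continuation_speed(1)[OF h u S m U, where hi = 1]) (use p1 w ab in \<open>auto simp: U_def dest!: w(4)\<close>)
  moreover have "snd (snd (S b)) = snd (snd (S w)) + safety p * (b - w)"
    using w a0 by (intro feasible_path_bounds(3)[OF fS]) auto
  moreover have "safety p * (b - w) \<le> 1 * (b - w)" using w g_less by (intro mult_right_mono) auto
  ultimately show False using w(3) neg by simp
qed

text \<open>Off the closed set \<open>stopped j\<close> every selection has speed 1. The hypothesis
  concerns only states reached by racing so far; the longest racing interval ends at a state still
  off the set and could therefore be prolonged.\<close>

lemma leader_races:
  assumes h: "feasible_history p h" and u: "unit_profile p \<sigma>" and S: "S \<in> continuations p \<sigma> h"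
    and RP: "R 0 \<le> P 0" and m: "\<sigma> j = of_markov (pacing p) j" and t: "fst h \<le> t"
    and T: "0 \<le> T" and out: "\<And>u. 0 \<le> u \<Longrightarrow> u < T \<Longrightarrow> cap j (S (t + u)) = cap j (S t) + u \<Longrightarrow> S (t + u) \<notin> stopped j"
    and s: "0 \<le> s" "s \<le> T"
  shows "cap j (S (t + s)) = cap j (S t) + s"
proof -
  note fS = continuation_feasible[OF h u S]
  have t0: "0 \<le> t" using h t by (simp add: feasible_history_def)
  define U where "U = - stopped j"
  have U: "open U" unfolding U_def using closed_stopped[OF RP] by auto
  have p1: "pacing p j z = 1" if "z \<in> U" for z
    using that pacing_top[OF RP, of j z] pacing_laggard[of j z]
    by (cases "cap (other j) z \<le> cap j z") (auto simp: U_def stopped_def spd_def)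
  define k where "k s = cap j (S t) + s - cap j (S (t + s))" for s
  have Sc: "continuous_on {0..} (\<lambda>s. S (t + s))"
    by (rule continuous_on_compose2[OF feasible_path_cont[OF fS]]) (use t0 in \<open>auto intro!: continuous_intros\<close>)
  have kc: "continuous_on {0..T} k"
    unfolding k_def[abs_def] using continuous_on_subset[OF Sc, of "{0..T}"] by (intro continuous_intros) auto
  have k_mono: "k a \<le> k b" if "0 \<le> a" "a \<le> b" for a b
    using feasible_path_bounds(2)[OF fS, of "t + a" "t + b" j] that t0 by (simp add: k_def)
  have k0: "k 0 = 0" by (simp add: k_def)
  define Z where "Z = {s \<in> {0..T}. k s \<le> 0}"
  have Z: "0 \<in> Z" "closed Z" "bdd_above Z"
    using T k0 kc continuous_closed_preimage[of "{0..T}" k "{..0}"]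
    by (auto simp: Z_def vimage_def Int_def intro!: bdd_aboveI[of _ T])
  define b where "b = Sup Z"
  have b: "b \<in> Z" unfolding b_def using Z by (intro closed_contains_Sup) auto
  have eq: "cap j (S (t + a)) = cap j (S t) + a" if "0 \<le> a" "a \<le> b" for a
    using k_mono[OF that] k_mono[of 0 a] k0 that b by (simp add: Z_def k_def)
  have "b = T"
  proof (rule ccontr)
    assume "b \<noteq> T"
    then have bT: "0 \<le> b" "b < T" using b by (auto simp: Z_def)
    then have "S (t + b) \<in> U" using out[of b] eq[of b] by (simp add: U_def)
    then obtain \<epsilon> where e: "0 < \<epsilon>" "ball (S (t + b)) \<epsilon> \<subseteq> U" using U open_contains_ball by blast
    obtain \<delta> where d: "0 < \<delta>" "\<And>a. 0 \<le> a \<Longrightarrow> dist a b < \<delta> \<Longrightarrow> dist (S (t + a)) (S (t + b)) < \<epsilon>"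
      using Sc bT(1) e(1) unfolding continuous_on_iff by (metis atLeast_iff)
    define w where "w = min T (b + \<delta> / 2)"
    have w: "b < w" "w \<le> T" "w < b + \<delta>" using bT d(1) by (auto simp: w_def)
    have "1 * (t + w - (t + b)) \<le> cap j (S (t + w)) - cap j (S (t + b))"
    proof (rule continuation_speed(1)[OF h u S m U, where hi = 1])
      fix z assume z: "t + b < z" "z < t + w"
      then have "dist (z - t) b < \<delta>" "0 \<le> z - t" using w bT by (auto simp: dist_real_def)
      then have "dist (S z) (S (t + b)) < \<epsilon>" using d(2)[of "z - t"] by simp
      then show "S z \<in> U" using e(2) by (auto simp: dist_commute)
    qed (use p1 w t bT in auto)
    then have "k w \<le> 0" using eq[of b] bT by (simp add: k_def)
    then have "w \<in> Z" using w bT by (auto simp: Z_def)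
    then show False using cSup_upper[of w Z] Z(3) w by (simp add: b_def[symmetric])
  qed
  then show ?thesis using eq s by simp
qed

context
  fixes h :: history and \<sigma>' :: strategy and i :: firm and S :: path
  assumes RP: "R 0 \<le> P 0" and h: "feasible_history p h" and \<sigma>': "is_strategy p \<sigma>'"
    and S: "S \<in> continuations p ((of_markov (pacing p))(i := \<sigma>')) h"
begin

lemma t0: "0 \<le> fst h" and St: "S (fst h) = snd h (fst h)"
  using h S by (auto simp: feasible_history_def continuations_def)

lemma unit: "unit_profile p ((of_markov (pacing p))(i := \<sigma>'))"
  by (rule unit_profile_deviation[OF pacing_markov[OF RP] \<sigma>'])

lemma fS: "feasible_path p S"
  by (rule continuation_feasible[OF h unit S])

lemma opponent: "((of_markov (pacing p))(i := \<sigma>')) (other i) = of_markov (pacing p) (other i)"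
  by (cases i) auto

lemma opponent_catches_up:
  assumes "fst h \<le> t" "0 \<le> s"
  shows "min (cap (other i) (S t) + s) (top (S (t + s))) \<le> cap (other i) (S (t + s))"
  by (rule laggard_catches_up[OF h unit S opponent _ assms]) (simp add: pacing_laggard)

lemma tied_or_leading_deviation:
  assumes i: "cap (other i) (S t) \<le> cap i (S t)" and t: "fst h \<le> t"
  shows "total (flow p i S t) \<le> ennreal (exp (alpha p * cap i (S t) - beta p * cap (other i) (S t))
    * Val (lead (S t)) (cap i (S t) - cap (other i) (S t)))"
proof -
  let ?c = "exp (alpha p * cap i (S t) - beta p * cap (other i) (S t))" and ?G = "cap i (S t) - cap (other i) (S t)"
  have t': "0 \<le> t" using t t0 by simp
  note m = top_gain_admpath[OF fS t']
  have "total (flow p i S t) \<le> total (\<lambda>s. ?c * fl (lead (S t)) ?G (top_gain S t) s)"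
    using tied_or_leading_flow_le[OF fS t' _ i] opponent_catches_up[OF t] by (intro total_mono) auto
  also have "\<dots> = ennreal (?c * J (lead (S t)) ?G (top_gain S t))" using i by (intro total_fl m) auto
  also have "\<dots> \<le> ennreal (?c * Val (lead (S t)) ?G)"
    using i by (intro ennreal_leI mult_left_mono J_le_Val RP m) auto
  finally show ?thesis .
qed

text \<open>\<open>a\<close> is a fictitious common capability between the two actual ones. Up to
  lead \<open>Db\<close> the deviator is granted the rival's capability, and
  \<open>tied_value_antimono\<close> compares that tie with the one at \<open>a\<close>. Beyond
  \<open>Db\<close> the rival races forever, and racing from the larger lead is worth at most
  \<open>P x\<close>.\<close>

lemma near_tie_deviation:
  assumes t: "fst h \<le> t" and a: "cap i (S t) \<le> a" "a \<le> cap (other i) (S t)"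
  defines "x \<equiv> a - snd (snd (S t))"
  assumes x: "0 \<le> x" "x \<le> Db"
  shows "total (flow p i S t) \<le> ennreal (exp ((alpha p - beta p) * a) * P x)"
proof -
  let ?j = "other i" and ?y = "lead (S t)"
  have t': "0 \<le> t" using t t0 by simp
  note m = top_gain_admpath[OF fS t']
  have y: "?y = cap ?j (S t) - snd (snd (S t))" using a by (simp add: lead_eq top_eq[of _ i])
  then have xy: "x \<le> ?y" using a by (simp add: x_def)
  have tg: "top (S (t + s)) = cap ?j (S t) + top_gain S t s" if "0 \<le> s" for s
    using that a by (simp add: top_gain_def top_eq[of "S t" i])
  have lag: "cap i (S (t + s)) \<le> cap ?j (S t) + top_gain S t s \<and> cap ?j (S (t + s)) = cap ?j (S t) + top_gain S t s"
    if s: "0 \<le> s" for s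
    using opponent_catches_up[OF t s] tg[OF s] admpathD(5)[OF m s] unfolding top_eq[of "S (t + s)" i] by (auto simp: max_def split: if_splits)
  show ?thesis
  proof (cases "?y \<le> Db")
    case True
    have "total (flow p i S t) \<le> total (\<lambda>s. exp ((alpha p - beta p) * cap ?j (S t)) * fl ?y 0 (top_gain S t) s)"
    proof (rule total_mono)
      fix s :: real assume s: "0 \<le> s"
      have "alpha p * cap i (S (t + s)) \<le> alpha p * (cap ?j (S t) + top_gain S t s)" using al_pos lag[OF s] by simp
      then show "flow p i S t s \<le> exp ((alpha p - beta p) * cap ?j (S t)) * fl ?y 0 (top_gain S t) s"
        unfolding flow_top_gain[OF fS t' s] fl_def exp_add[symmetric] exp_le_cancel_iff
        using lag[OF s] admpathD(5)[OF m s] by (simp add: algebra_simps)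
    qed
    also have "\<dots> = ennreal (exp ((alpha p - beta p) * cap ?j (S t)) * J ?y 0 (top_gain S t))" by (intro total_fl m) auto
    also have "\<dots> \<le> ennreal (exp ((alpha p - beta p) * a) * P x)"
    proof (rule ennreal_leI)
      have "J ?y 0 (top_gain S t) \<le> P ?y"
        using race_then_coast_optimal[OF tie_le[OF RP] _ order.refl m, of ?y] v_tie[OF RP _ True] x xy by simp
      then have "exp ((alpha p - beta p) * cap ?j (S t)) * J ?y 0 (top_gain S t)
          \<le> exp ((alpha p - beta p) * cap ?j (S t)) * P ?y" by simp
      also have "\<dots> = exp ((alpha p - beta p) * a) * (exp ((alpha p - beta p) * (?y - x)) * P ?y)"
        unfolding mult.assoc[symmetric] exp_add[symmetric] using y by (simp add: x_def algebra_simps)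
      also have "\<dots> \<le> exp ((alpha p - beta p) * a) * P x"
        using tied_value_antimono[OF RP x(1) xy True] by simp
      finally show "exp ((alpha p - beta p) * cap ?j (S t)) * J ?y 0 (top_gain S t) \<le> exp ((alpha p - beta p) * a) * P x" .
    qed
    finally show ?thesis .
  next
    case False
    have race: "cap ?j (S (t + s)) = cap ?j (S t) + s" if s: "0 \<le> s" for s
    proof (rule leader_races[OF h unit S RP opponent t s _ s order.refl])
      fix u assume u: "0 \<le> u" "u < s" "cap ?j (S (t + u)) = cap ?j (S t) + u"
      have "lead (S (t + u)) \<ge> cap ?j (S (t + u)) - snd (snd (S (t + u)))" by (simp add: lead_eq top_eq[of _ i])
      also have "cap ?j (S (t + u)) - snd (snd (S (t + u))) = ?y + (1 - safety p) * u"
        using u feasible_path_bounds(3)[OF fS, of t "t + u"] t' y by (simp add: algebra_simps)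
      finally have "Db < lead (S (t + u))" using False mult_nonneg_nonneg[of "1 - safety p" u] g_less u by linarith
      then show "S (t + u) \<notin> stopped ?j" by (simp add: stopped_def stop_def)
    qed
    have "total (flow p i S t) \<le> total (\<lambda>s. exp (alpha p * a - beta p * cap ?j (S t)) * fl ?y 0 (\<lambda>t. t) s)"
    proof (rule total_mono)
      fix s :: real assume s: "0 \<le> s"
      have "cap i (S (t + s)) \<le> a + s" using feasible_path_bounds(2)[OF fS t', of "t + s" i] s a by simp
      then have 1: "alpha p * cap i (S (t + s)) \<le> alpha p * (a + s)" using al_pos by simp
      have "top_gain S t u = u" if "0 \<le> u" for u using race[OF that] lag[OF that] by simp
      then have "H ?y (top_gain S t) s = H ?y (\<lambda>t. t) s" by (intro H_cong) auto
      then show "flow p i S t s \<le> exp (alpha p * a - beta p * cap ?j (S t)) * fl ?y 0 (\<lambda>t. t) s"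
        unfolding flow_top_gain[OF fS t' s] fl_def exp_add[symmetric] exp_le_cancel_iff race[OF s]
        using 1 s by (simp add: algebra_simps)
    qed
    also have "\<dots> = ennreal (exp (alpha p * a - beta p * cap ?j (S t)) * R ?y)"
      unfolding R_def by (intro total_fl admpath_id) auto
    also have "\<dots> \<le> ennreal (exp ((alpha p - beta p) * a) * P x)"
    proof (intro ennreal_leI mult_mono)
      show "exp (alpha p * a - beta p * cap ?j (S t)) \<le> exp ((alpha p - beta p) * a)"
        using mult_left_mono[OF a(2), of "beta p"] be_pos by (simp add: algebra_simps)
      show "R ?y \<le> P x" using R_antimono[OF xy] P_ge_R[OF RP x] by simp
    qed (auto simp: R_nonneg)
    finally show ?thesis .
  qed
qed

lemma lagging_deviation:
  assumes i: "cap i (S (fst h)) < cap (other i) (S (fst h))"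
  shows "total (flow p i S (fst h)) \<le> payoff p i (of_markov (pacing p)) h"
proof -
  let ?j = "other i" and ?t = "fst h"
  define s0 where "s0 = S ?t"
  have s0': "snd h ?t = s0" by (simp add: s0_def St)
  define G where "G = cap ?j s0 - cap i s0"
  define y where "y = lead s0"
  have G: "0 < G" using i by (simp add: G_def s0_def)
  have y: "y = cap ?j s0 - snd (snd s0)" using i by (simp add: y_def lead_eq top_eq[of _ i] s0_def)
  have kj: "cap (other ?j) (snd h ?t) \<le> cap ?j (snd h ?t)" using i by (simp add: St)
  obtain m E where m: "admpath m" and "Val y G \<le> J y G m"
    and E: "E \<in> continuations p (of_markov (pacing p)) h" "feasible_path p E"
    and Ej: "\<forall>s\<ge>0. cap ?j (E (?t + s)) = cap ?j s0 + m s"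
    and Ei: "\<forall>s\<ge>0. cap i (E (?t + s)) = min (cap i s0 + s) (cap ?j s0 + m s)"
    and plan: "((\<forall>d\<ge>y. \<not> stop d G) \<and> m = (\<lambda>s. s)) \<or>
     (\<exists>d\<ge>y. stop d G \<and> (\<forall>x\<ge>y. x < d \<longrightarrow> \<not> stop x G) \<and> m = rc ((d - y) / (1 - safety p)) d)"
    using pacing_plan[OF RP h kj, unfolded other_other s0', folded y_def G_def] .
  have Et: "E ?t = s0" using E(1) t0 by (simp add: continuations_def s0')
  have eflow: "flow p i E ?t s = exp (- disc p * s - H y m s + (alpha p * (cap i s0 + min s (G + m s)) - beta p * (cap ?j s0 + m s)))"
    if "0 \<le> s" for s
    using top_flow(2)[OF E(2) t0 that m, where k = ?j] Ej Ei i by (simp add: Et y_def G_def s0_def)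
  have cap_i: "cap i (S (?t + s)) \<le> cap i s0 + s" if "0 \<le> s" for s
    using feasible_path_bounds(2)[OF fS t0, of "?t + s" i] that by (simp add: s0_def)
  \<comment> \<open>Against a rival at full speed the actual gap is at least \<open>G\<close>. If
    the rival stopped there, \<open>stop_less_gap\<close> would let it stop at gap \<open>G\<close>
    as well.\<close>
  have outside: "S (?t + u) \<notin> stopped ?j"
    if u: "0 \<le> u" "cap ?j (S (?t + u)) = cap ?j s0 + u" and ns: "\<not> stop (y + (1 - safety p) * u) G" for u
  proof
    assume "S (?t + u) \<in> stopped ?j"
    moreover have "cap i (S (?t + u)) < cap ?j (S (?t + u))" using cap_i[OF u(1)] u(2) G by (simp add: G_def)
    moreover have "snd (snd (S (?t + u))) = snd (snd s0) + safety p * u"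
      using feasible_path_bounds(3)[OF fS t0, of "?t + u"] u(1) by (simp add: s0_def)
    then have "lead (S (?t + u)) = y + (1 - safety p) * u"
      using u(2) y \<open>cap i (S (?t + u)) < cap ?j (S (?t + u))\<close> by (simp add: lead_eq top_eq[of _ i]) (simp add: algebra_simps)
    ultimately have "stop (y + (1 - safety p) * u) (cap ?j (S (?t + u)) - cap i (S (?t + u)))"
      by (simp add: stopped_def)
    from stop_less_gap[OF RP this, of G] ns show False using cap_i[OF u(1)] u(2) G by (simp add: G_def)
  qed
  have before_tie: "flow p i S ?t s \<le> flow p i E ?t s"
    if s: "0 \<le> s" "s \<le> G + m s" and ahead: "\<And>u. 0 \<le> u \<Longrightarrow> u \<le> s \<Longrightarrow> cap ?j s0 + m u \<le> cap ?j (S (?t + u))" for s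
  proof -
    have "H y m s \<le> H y (top_gain S ?t) s"
    proof (intro H_mono_path lam_mono m top_gain_admpath fS t0)
      fix u assume "0 \<le> u" "u \<le> s"
      then show "y + m u - safety p * u \<le> y + top_gain S ?t u - safety p * u"
        using ahead[of u] i by (simp add: top_gain_def top_eq[of _ i] s0_def)
    qed
    moreover have "alpha p * cap i (S (?t + s)) \<le> alpha p * (cap i s0 + s)" using cap_i[OF s(1)] al_pos by simp
    moreover have "beta p * (cap ?j s0 + m s) \<le> beta p * cap ?j (S (?t + s))" using ahead[of s] s be_pos by simp
    moreover have "min s (G + m s) = s" using s by simp
    ultimately show ?thesis
      unfolding flow_top_gain[OF fS t0 s(1)] eflow[OF s(1)] s0_def[symmetric] y_def[symmetric] by simp
  qed
  have "total (flow p i S ?t) \<le> total (flow p i E ?t)"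
    using plan
  proof (elim disjE exE conjE)
    assume ns: "\<forall>d\<ge>y. \<not> stop d G" and mid: "m = (\<lambda>s. s)"
    have race: "cap ?j (S (?t + s)) = cap ?j s0 + s" if s: "0 \<le> s" for s
      unfolding s0_def
    proof (rule leader_races[OF h unit S RP opponent order.refl s _ s order.refl])
      fix u assume u: "0 \<le> u" "cap ?j (S (?t + u)) = cap ?j (S ?t) + u"
      have "0 \<le> (1 - safety p) * u" using u g_less by simp
      then show "S (?t + u) \<notin> stopped ?j" using ns u by (intro outside) (auto simp: s0_def)
    qed
    show ?thesis by (intro total_mono before_tie) (use G race mid in auto)
  next
    fix d assume d: "y \<le> d" "stop d G" and ns: "\<forall>x\<ge>y. x < d \<longrightarrow> \<not> stop x G" and mrc: "m = rc ((d - y) / (1 - safety p)) d"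
    define th where "th = (d - y) / (1 - safety p)"
    have th: "0 \<le> th" and thd: "d = y + (1 - safety p) * th" using d(1) g_less by (auto simp: th_def)
    have d0: "0 \<le> d" "d \<le> Db" using d(2) by (auto simp: stop_def)
    have m_rc: "m s = (if s \<le> th then s else th + nb d (s - th))" for s by (simp add: mrc th_def rc_def)
    have race: "cap ?j (S (?t + s)) = cap ?j s0 + s" if s: "0 \<le> s" "s \<le> th" for s
      unfolding s0_def
    proof (rule leader_races[OF h unit S RP opponent order.refl th _ s])
      fix u assume u: "0 \<le> u" "u < th" "cap ?j (S (?t + u)) = cap ?j (S ?t) + u"
      have "0 \<le> (1 - safety p) * u" "(1 - safety p) * u < (1 - safety p) * th" using u g_less by auto
      then show "S (?t + u) \<notin> stopped ?j" using ns u thd by (intro outside) (auto simp: s0_def)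
    qed
    have X: "snd (snd (S (?t + s))) = snd (snd s0) + safety p * s" if "0 \<le> s" for s
      using feasible_path_bounds(3)[OF fS t0, of "?t + s"] that by (simp add: s0_def)
    \<comment> \<open>The rival is at least where equilibrium play puts it: it races as long as the
      plan does, and afterwards neither loses capability nor drops below the safety
      frontier.\<close>
    have ahead: "cap ?j s0 + m s \<le> cap ?j (S (?t + s))" if s: "0 \<le> s" for s
    proof (cases "s \<le> th")
      case True
      then show ?thesis using race[OF s True] by (simp add: m_rc)
    next
      case False
      have "cap ?j s0 + th \<le> cap ?j (S (?t + s))"
        using feasible_path_bounds(1)[OF fS, of "?t + th" "?t + s" ?j] race[OF th order.refl] False th t0 by simp
      moreover have "cap ?j s0 + (th + (safety p * (s - th) - d)) = snd (snd (S (?t + s)))"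
        using thd y X[OF s] by (simp add: algebra_simps)
      moreover have "snd (snd (S (?t + s))) \<le> cap ?j (S (?t + s))"
      proof (rule never_behind[OF h unit S RP opponent])
        show "snd (snd (S (?t + th))) \<le> cap ?j (S (?t + th))"
          using race[OF th order.refl] X[OF th] thd y d0 by (simp add: algebra_simps)
      qed (use th False in auto)
      ultimately show ?thesis using False by (auto simp: m_rc nb_def max_def)
    qed
    \<comment> \<open>\<open>T\<close> is the tie date on the equilibrium path. After the race the
      gap closes at rate at least \<open>1 - safety p\<close>, whence the bound.\<close>
    have "\<exists>T\<ge>0. T \<le> th + G / (1 - safety p) \<and> T - m T = G"
    proof (rule IVT')
      let ?b = "th + G / (1 - safety p)"
      show "0 - m 0 \<le> G" using G admpathD(1)[OF m] by simp
      have b: "0 < G / (1 - safety p)" "(1 - safety p) * (G / (1 - safety p)) = G" using G g_less by auto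
      have "nb d (G / (1 - safety p)) \<le> safety p * (G / (1 - safety p))"
      proof -
        have "0 \<le> safety p * (G / (1 - safety p))" using b(1) g_pos by (intro mult_nonneg_nonneg) auto
        then show ?thesis using d0 unfolding nb_def by linarith
      qed
      then have "G \<le> G / (1 - safety p) - nb d (G / (1 - safety p))"
        using b(2) unfolding left_diff_distrib by linarith
      then show "G \<le> ?b - m ?b" using b(1) by (simp add: m_rc)
      show "0 \<le> ?b" using th b(1) by simp
      show "continuous_on {0..?b} (\<lambda>T. T - m T)" by (intro continuous_on_diff continuous_on_id admpath_cont m)
    qed
    then obtain T where T: "0 \<le> T" "T - m T = G" by blast
    have Tth: "th < T" using T G by (cases "T \<le> th") (auto simp: m_rc)
    \<comment> \<open>The common capability at the equilibrium tie. At that date the deviator is at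
      most there and the rival at least, the situation of \<open>near_tie_deviation\<close>.\<close>
    define a where "a = cap ?j s0 + m T"
    define x where "x = max 0 (d - safety p * (T - th))"
    have "0 \<le> safety p * (T - th)" using Tth g_pos by (intro mult_nonneg_nonneg) auto
    then have x: "0 \<le> x" "x \<le> Db" using d0 unfolding x_def by linarith+
    have xm: "y + m T - safety p * T = x"
    proof -
      have "m T = th + nb d (T - th)" using Tth by (simp add: m_rc)
      moreover have "y + (th + n) - safety p * T = d + n - safety p * (T - th)" for n using thd by (simp add: algebra_simps)
      ultimately have "y + m T - safety p * T = d + nb d (T - th) - safety p * (T - th)" by metis
      then show ?thesis using nb_state[OF d0(1)] by (simp add: x_def)
    qed
    have xa: "a - snd (snd (S (?t + T))) = x" using xm y X[OF T(1)] by (simp add: a_def)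
    have sm: "s \<le> G + m s" if "s \<le> T" for s using admpathD(3)[OF m that] T(2) by simp
    have smT: "G + m (T + s) \<le> T + s" if "0 \<le> s" for s using admpathD(3)[OF m, of T "T + s"] T(2) that by simp
    have fT: "flow p i S ?t (T + s) \<le> exp (- disc p * T - H y m T) * flow p i S (?t + T) s" if s: "0 \<le> s" for s
    proof -
      have "H y m T \<le> H y (top_gain S ?t) T"
      proof (intro H_mono_path lam_mono m top_gain_admpath fS t0)
        fix u assume "0 \<le> u" "u \<le> T"
        then show "y + m u - safety p * u \<le> y + top_gain S ?t u - safety p * u"
          using ahead[of u] i by (simp add: top_gain_def top_eq[of _ i] s0_def)
      qed
      moreover have "0 \<le> flow p i S (?t + T) s" by (simp add: flow_def)
      ultimately show ?thesis
        unfolding flow_continue[OF fS t0 T(1) s] s0_def[symmetric] y_def[symmetric] by (intro mult_right_mono) auto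
    qed
    have eT: "flow p i E ?t (T + s) = exp (- disc p * T - H y m T) * exp ((alpha p - beta p) * a) * fl x 0 (nb x) s"
      if s: "0 \<le> s" for s
    proof -
      have sh: "m (T + u) - m T = nb x u" if "0 \<le> u" for u
        using nb_shift[OF that, of d "T - th"] Tth that by (simp add: m_rc x_def algebra_simps)
      have "H x (\<lambda>u. m (T + u) - m T) s = H x (nb x) s" by (intro H_cong sh)
      then have H: "H y m (T + s) = H y m T + H x (nb x) s" using H_add[OF m T(1) s, of y] xm by simp
      have ms: "m (T + s) = m T + nb x s" using sh[OF s] by simp
      have "min (T + s) (G + m (T + s)) = G + m (T + s)" using smT[OF s] by simp
      moreover have "min s (0 + nb x s) = nb x s" using admpathD(5)[OF admpath_nb[OF x(1)] s] by simp
      moreover have "cap i s0 + (G + m (T + s)) = a + nb x s" "cap ?j s0 + m (T + s) = a + nb x s"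
        by (simp_all add: a_def G_def ms)
      ultimately show ?thesis
        using eflow[of "T + s"] T(1) s unfolding fl_def exp_add[symmetric] H by (simp add: algebra_simps)
    qed
    let ?c = "exp (- disc p * T - H y m T)"
    have "total (\<lambda>s. flow p i S ?t (T + s)) \<le> total (\<lambda>s. ?c * flow p i S (?t + T) s)" using fT by (rule total_mono)
    also have "\<dots> = ennreal ?c * total (flow p i S (?t + T))"
    proof -
      have "(\<lambda>s. ennreal (flow p i S (?t + T) s) * indicator {0..} s) \<in> borel_measurable borel"
      proof -
        have "(\<lambda>s. indicator {0..} s *\<^sub>R flow p i S (?t + T) s) \<in> borel_measurable borel"
          using continuous_on_flow[OF fS, of "?t + T"] t0 T(1) by (intro borel_measurable_continuous_on_indicator) auto
        then have "(\<lambda>s. ennreal (indicator {0..} s *\<^sub>R flow p i S (?t + T) s)) \<in> borel_measurable borel" by measurable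
        moreover have "(\<lambda>s. ennreal (indicator {0..} s *\<^sub>R flow p i S (?t + T) s)) = (\<lambda>s. ennreal (flow p i S (?t + T) s) * indicator {0..} s)"
          by (auto simp: indicator_def fun_eq_iff)
        ultimately show ?thesis by simp
      qed
      then show ?thesis unfolding total_def
        by (subst nn_integral_cmult[symmetric]) (auto intro!: nn_integral_cong simp: ennreal_mult' mult.assoc)
    qed
    also have "\<dots> \<le> ennreal ?c * ennreal (exp ((alpha p - beta p) * a) * P x)"
    proof (intro mult_left_mono)
      have "cap i (S (?t + T)) \<le> a" using cap_i[OF T(1)] T(2) by (simp add: a_def G_def)
      moreover have "a \<le> cap ?j (S (?t + T))" using ahead[OF T(1)] by (simp add: a_def)
      ultimately show "total (flow p i S (?t + T)) \<le> ennreal (exp ((alpha p - beta p) * a) * P x)"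
        using near_tie_deviation[of "?t + T" a] x T(1) unfolding xa by simp
    qed simp
    also have "\<dots> = ennreal (?c * exp ((alpha p - beta p) * a) * J x 0 (nb x))"
      using x by (simp add: P_def C_def ennreal_mult' mult.assoc)
    also have "\<dots> = total (\<lambda>s. ?c * exp ((alpha p - beta p) * a) * fl x 0 (nb x) s)"
      by (subst total_fl) (auto simp: admpath_nb x)
    also have "\<dots> = total (\<lambda>s. flow p i E ?t (T + s))"
      using eT by (intro antisym total_mono) auto
    finally have after: "total (\<lambda>s. flow p i S ?t (T + s)) \<le> total (\<lambda>s. flow p i E ?t (T + s))" .
    have "(\<integral>\<^sup>+s. ennreal (flow p i S ?t s) * indicator {0..<T} s \<partial>lborel) \<le> (\<integral>\<^sup>+s. ennreal (flow p i E ?t s) * indicator {0..<T} s \<partial>lborel)"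
      using before_tie ahead sm by (intro nn_integral_mono) (auto simp: indicator_def intro!: ennreal_leI)
    then show ?thesis
      unfolding total_split[OF continuous_on_flow[OF fS t0] T(1)] total_split[OF continuous_on_flow[OF E(2) t0] T(1)]
      using after by (rule add_mono)
  qed
  also have "\<dots> \<le> payoff p i (of_markov (pacing p)) h" unfolding payoff_eq using E(1) by (rule SUP_upper)
  finally show ?thesis .
qed

end

lemma pacing_payoff_ge:
  assumes RP: "R 0 \<le> P 0" and h: "feasible_history p h"
  defines "s0 \<equiv> snd h (fst h)"
  assumes i: "cap (other i) s0 \<le> cap i s0"
  shows "ennreal (exp (alpha p * cap i s0 - beta p * cap (other i) s0) * Val (lead s0) (cap i s0 - cap (other i) s0))
    \<le> payoff p i (of_markov (pacing p)) h"
proof -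
  let ?G = "cap i s0 - cap (other i) s0" and ?c = "exp (alpha p * cap i s0 - beta p * cap (other i) s0)" and ?t = "fst h"
  have t0: "0 \<le> ?t" using h by (simp add: feasible_history_def)
  obtain m E where m: "admpath m" and V: "Val (lead s0) ?G \<le> J (lead s0) ?G m"
    and E: "E \<in> continuations p (of_markov (pacing p)) h" "feasible_path p E"
    and Ej: "\<forall>s\<ge>0. cap i (E (?t + s)) = cap i s0 + m s"
    and Ei: "\<forall>s\<ge>0. cap (other i) (E (?t + s)) = min (cap (other i) s0 + s) (cap i s0 + m s)"
    and "((\<forall>d\<ge>lead s0. \<not> stop d ?G) \<and> m = (\<lambda>s. s)) \<or>
      (\<exists>d\<ge>lead s0. stop d ?G \<and> (\<forall>x\<ge>lead s0. x < d \<longrightarrow> \<not> stop x ?G) \<and> m = rc ((d - lead s0) / (1 - safety p)) d)"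
    using pacing_plan[OF RP h, folded s0_def, OF i] .
  have Et: "E ?t = s0" using E(1) t0 by (simp add: continuations_def s0_def)
  have "ennreal (?c * Val (lead s0) ?G) \<le> ennreal (?c * J (lead s0) ?G m)" using V by (intro ennreal_leI) simp
  also have "\<dots> = total (\<lambda>s. ?c * fl (lead s0) ?G m s)" using i by (intro total_fl[symmetric] m) auto
  also have "\<dots> \<le> total (flow p i E ?t)"
    using top_flow(1)[OF E(2) t0 _ m, where k = i] Ej Ei i by (intro total_mono) (auto simp: Et)
  also have "\<dots> \<le> payoff p i (of_markov (pacing p)) h" unfolding payoff_eq using E(1) by (rule SUP_upper)
  finally show ?thesis .
qed

lemma pacing_MPE:
  assumes RP: "R 0 \<le> P 0" shows "is_MPE p (pacing p)"
  unfolding is_MPE_def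
proof (intro conjI allI impI)
  fix h i \<sigma>' assume "feasible_history p h \<and> is_strategy p \<sigma>'"
  then have h: "feasible_history p h" and \<sigma>': "is_strategy p \<sigma>'" by auto
  show "payoff p i ((of_markov (pacing p))(i := \<sigma>')) h \<le> payoff p i (of_markov (pacing p)) h"
    unfolding payoff_eq[of p i "(of_markov (pacing p))(i := \<sigma>')"]
  proof (rule SUP_least)
    fix S assume S: "S \<in> continuations p ((of_markov (pacing p))(i := \<sigma>')) h"
    have St: "S (fst h) = snd h (fst h)" by (rule St[OF RP h \<sigma>' S])
    show "total (flow p i S (fst h)) \<le> payoff p i (of_markov (pacing p)) h"
    proof (cases "cap (other i) (S (fst h)) \<le> cap i (S (fst h))")
      case True
      from order_trans[OF tied_or_leading_deviation[OF RP h \<sigma>' S True order.refl, unfolded St]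
          pacing_payoff_ge[OF RP h True[unfolded St]]]
      show ?thesis .
    next
      case False
      then show ?thesis by (intro lagging_deviation[OF RP h \<sigma>' S]) simp
    qed
  qed
qed (rule pacing_markov[OF RP])

end

section \<open>Comparative statics\<close>

context race_game
begin

lemma hazard_ratio_eq: "hazard_ratio p = leff / (1 - safety p)"
  by (rule race_value_eq(2)) unfold_locales

lemma racing_MPE_iff: "is_MPE p racing \<longleftrightarrow> hazard_ratio p \<le> alpha p"
proof -
  have "hazard_ratio p \<le> alpha p \<longleftrightarrow> 1 / R 0 - de \<le> B - de"
    using g_less unfolding hazard_ratio_eq leff_def B_de by (simp add: pos_divide_le_eq)
  also have "\<dots> \<longleftrightarrow> 1 \<le> B * R 0" using R_pos by (simp add: pos_divide_le_eq)
  finally show ?thesis using racing_MPE_of racing_MPE_imp by blast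
qed

lemma pacing_MPE_iff: "pacing_defined p \<and> is_MPE p (pacing p) \<longleftrightarrow> alpha p - beta p \<le> hazard_ratio p"
proof -
  have "alpha p - beta p \<le> hazard_ratio p \<longleftrightarrow> rho - de \<le> 1 / R 0 - de"
    using g_less unfolding hazard_ratio_eq leff_def rho_de by (simp add: pos_le_divide_eq mult.commute)
  also have "\<dots> \<longleftrightarrow> R 0 \<le> P 0" using R_pos rho_pos by (simp add: P_def C_00 field_simps)
  finally show ?thesis using pacing_defined_iff pacing_MPE by blast
qed

end

lemma race_env_change:
  "race_env al be r g lam lam' \<Longrightarrow> al - be < r' \<Longrightarrow> 0 < g' \<Longrightarrow> g' < 1 \<Longrightarrow> race_env al be r' g' lam lam'"
  unfolding race_env_def by (elim conjE) (intro conjI; assumption)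

lemma admissible_race_game:
  assumes "admissible p" obtains lam' where "race_game p lam'"
  using admissible_race_env[OF assms] race_game.intro by metis

lemma hazard_ratio_safety_mono:
  assumes p: "admissible p" and g: "0 < g1" "g1 \<le> g2" "g2 < 1"
  shows "hazard_ratio (p\<lparr>safety := g1\<rparr>) \<le> hazard_ratio (p\<lparr>safety := g2\<rparr>)"
proof -
  obtain lam' where E: "race_env (alpha p) (beta p) (disc p) (safety p) (hazard p) lam'"
    using admissible_race_env[OF p] .
  have E': "race_env (alpha p) (beta p) (disc p) g (hazard p) lam'" if "0 < g" "g < 1" for g
    using race_env_change[OF E _ that] race_env.r_gt[OF E] by simp
  have hz: "hazard (p\<lparr>safety := g\<rparr>) = hazard p" for g by (simp add: hazard_def fun_eq_iff)
  have "hazard_ratio (p\<lparr>safety := g\<rparr>) = race_env.leff (alpha p) (beta p) (disc p) g (hazard p) / (1 - g)" if "0 < g" "g < 1" for g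
    using race_value_eq(2)[of "p\<lparr>safety := g\<rparr>" lam'] E'[OF that] by (simp add: hz)
  then show ?thesis using leff_scaled_mono[OF E' E' g(2)] g by simp
qed

lemma hazard_ratio_hazard_mono:
  assumes p: "admissible p" and q: "admissible_hazard l f" "\<And>D. hazard p D \<le> hazard (p\<lparr>lambda0 := l, phi := f\<rparr>) D"
  shows "hazard_ratio p \<le> hazard_ratio (p\<lparr>lambda0 := l, phi := f\<rparr>)"
proof -
  let ?q = "p\<lparr>lambda0 := l, phi := f\<rparr>"
  have "admissible ?q" using p q by (simp add: admissible_def)
  then obtain lam2' where E2: "race_env (alpha p) (beta p) (disc p) (safety p) (hazard ?q) lam2'"
    using admissible_race_env[of ?q] by auto
  obtain lam' where E: "race_env (alpha p) (beta p) (disc p) (safety p) (hazard p) lam'"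
    using admissible_race_env[OF p] .
  have "hazard_ratio ?q = race_env.leff (alpha p) (beta p) (disc p) (safety p) (hazard ?q) / (1 - safety p)"
    using race_value_eq(2)[of ?q lam2'] E2 by simp
  then show ?thesis
    using race_value_eq(2)[OF E] leff_hazard_mono[OF E E2 q(2)] race_env.g_less[OF E] by (simp add: divide_right_mono)
qed

lemma hazard_ratio_disc_antimono:
  assumes p: "admissible p" and r: "alpha p - beta p < r1" "r1 < r2"
  shows "hazard_ratio (p\<lparr>disc := r2\<rparr>) \<le> hazard_ratio (p\<lparr>disc := r1\<rparr>)"
    and "\<not> phi p constant_on {0..} \<Longrightarrow> hazard_ratio (p\<lparr>disc := r2\<rparr>) < hazard_ratio (p\<lparr>disc := r1\<rparr>)"
proof -
  obtain lam' where E: "race_env (alpha p) (beta p) (disc p) (safety p) (hazard p) lam'"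
    using admissible_race_env[OF p] .
  note g = race_env.g_pos[OF E] race_env.g_less[OF E]
  have E': "race_env (alpha p) (beta p) r (safety p) (hazard p) lam'" if "alpha p - beta p < r" for r
    using race_env_change[OF E that g] .
  have hz: "hazard (p\<lparr>disc := r\<rparr>) = hazard p" for r by (simp add: hazard_def fun_eq_iff)
  have eq: "hazard_ratio (p\<lparr>disc := r\<rparr>) = race_env.leff (alpha p) (beta p) r (safety p) (hazard p) / (1 - safety p)"
    if "alpha p - beta p < r" for r
    using race_value_eq(2)[of "p\<lparr>disc := r\<rparr>" lam'] E'[OF that] by (simp add: hz)
  have r2: "alpha p - beta p < r2" using r by simp
  show "hazard_ratio (p\<lparr>disc := r2\<rparr>) \<le> hazard_ratio (p\<lparr>disc := r1\<rparr>)"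
    using leff_disc_antimono(1)[OF E'[OF r(1)] E'[OF r2] r(2)] g by (simp add: eq[OF r(1)] eq[OF r2] divide_right_mono)
  show "hazard_ratio (p\<lparr>disc := r2\<rparr>) < hazard_ratio (p\<lparr>disc := r1\<rparr>)" if nc: "\<not> phi p constant_on {0..}"
  proof -
    have mono: "mono_on {0..} (phi p)" and cont: "continuous_on {0..} (phi p)" and f0: "phi p 0 = 0"
      using p by (auto simp: admissible_def admissible_hazard_def)
    obtain x2 where x2: "0 \<le> x2" "phi p x2 \<noteq> 0" using nc unfolding constant_on_def by auto
    have pos: "0 < phi p x2" using mono_onD[OF mono, of 0 x2] x2 f0 by simp
    \<comment> \<open>Strictness requires two different hazards at positive leads, since the jump at
      0 does not count. Continuity of \<open>phi\<close> at 0 supplies the smaller one at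
      \<open>d / 2\<close>.\<close>
    then obtain d where d: "0 < d" "\<And>x. 0 \<le> x \<Longrightarrow> dist x 0 < d \<Longrightarrow> dist (phi p x) (phi p 0) < phi p x2"
      using cont unfolding continuous_on_iff by (metis atLeast_iff order_refl)
    have "phi p (d / 2) < phi p x2" using d(2)[of "d / 2"] d(1) f0 by (simp add: dist_real_def)
    moreover have "0 < x2" using x2 f0 by (cases "x2 = 0") auto
    ultimately have "hazard p (d / 2) < hazard p x2" using d(1) by (simp add: hazard_def)
    then show ?thesis
      using leff_disc_antimono(2)[OF E'[OF r(1)] E'[OF r2] r(2), of "d / 2" x2] d(1) g
      by (simp add: eq[OF r(1)] eq[OF r2] divide_strict_right_mono)
  qed
qed

lemma MPE_regions_mono:
  assumes "admissible p" "admissible q" "alpha q = alpha p" "beta q = beta p" "hazard_ratio p \<le> hazard_ratio q"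
  shows "(pacing_defined p \<and> is_MPE p (pacing p) \<longrightarrow> pacing_defined q \<and> is_MPE q (pacing q))
    \<and> (is_MPE q racing \<longrightarrow> is_MPE p racing)"
proof -
  obtain l1 l2 where "race_game p l1" "race_game q l2"
    using admissible_race_game[OF assms(1)] admissible_race_game[OF assms(2)] by metis
  then show ?thesis using assms race_game.racing_MPE_iff race_game.pacing_MPE_iff by (metis order_trans)
qed

theorem proposition1:
  fixes p :: primitives
  assumes "admissible p"
  shows
    "mono_on {0<..<1} (\<lambda>g. hazard_ratio (p\<lparr>safety := g\<rparr>))
     \<and> (\<forall>l f. admissible_hazard l f \<and> (\<forall>D. hazard p D \<le> hazard (p\<lparr>lambda0 := l, phi := f\<rparr>) D)
          \<longrightarrow> hazard_ratio p \<le> hazard_ratio (p\<lparr>lambda0 := l, phi := f\<rparr>))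
     \<and> antimono_on {alpha p - beta p<..} (\<lambda>r. hazard_ratio (p\<lparr>disc := r\<rparr>))
     \<and> (\<not> phi p constant_on {0..}
          \<longrightarrow> strict_antimono_on {alpha p - beta p<..} (\<lambda>r. hazard_ratio (p\<lparr>disc := r\<rparr>)))
     \<and> (\<forall>q. (\<exists>g. safety p \<le> g \<and> g < 1 \<and> q = p\<lparr>safety := g\<rparr>)
          \<or> (\<exists>l f. admissible_hazard l f \<and> q = p\<lparr>lambda0 := l, phi := f\<rparr>
                 \<and> (\<forall>D. hazard p D \<le> hazard q D))
          \<or> (\<exists>r. alpha p - beta p < r \<and> r \<le> disc p \<and> q = p\<lparr>disc := r\<rparr>)
          \<longrightarrow> (pacing_defined p \<and> is_MPE p (pacing p) \<longrightarrow> pacing_defined q \<and> is_MPE q (pacing q))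
            \<and> (is_MPE q racing \<longrightarrow> is_MPE p racing))"
proof (intro conjI allI impI)
  have p: "0 < safety p" "alpha p - beta p < disc p" using assms by (auto simp: admissible_def)
  show "mono_on {0<..<1} (\<lambda>g. hazard_ratio (p\<lparr>safety := g\<rparr>))"
    by (intro mono_onI hazard_ratio_safety_mono assms) auto
  show "hazard_ratio p \<le> hazard_ratio (p\<lparr>lambda0 := l, phi := f\<rparr>)"
    if "admissible_hazard l f \<and> (\<forall>D. hazard p D \<le> hazard (p\<lparr>lambda0 := l, phi := f\<rparr>) D)" for l f
    using that by (intro hazard_ratio_hazard_mono assms) auto
  show "antimono_on {alpha p - beta p<..} (\<lambda>r. hazard_ratio (p\<lparr>disc := r\<rparr>))"
  proof (rule monotone_onI)
    fix r1 r2 assume "r1 \<in> {alpha p - beta p<..}" "r1 \<le> r2"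
    then show "hazard_ratio (p\<lparr>disc := r2\<rparr>) \<le> hazard_ratio (p\<lparr>disc := r1\<rparr>)"
      using hazard_ratio_disc_antimono(1)[OF assms, of r1 r2] by (cases "r1 = r2") auto
  qed
  show "strict_antimono_on {alpha p - beta p<..} (\<lambda>r. hazard_ratio (p\<lparr>disc := r\<rparr>))" if "\<not> phi p constant_on {0..}"
    by (rule monotone_onI) (use hazard_ratio_disc_antimono(2)[OF assms _ _ that] in auto)
  fix q
  assume "(\<exists>g. safety p \<le> g \<and> g < 1 \<and> q = p\<lparr>safety := g\<rparr>)
    \<or> (\<exists>l f. admissible_hazard l f \<and> q = p\<lparr>lambda0 := l, phi := f\<rparr> \<and> (\<forall>D. hazard p D \<le> hazard q D))
    \<or> (\<exists>r. alpha p - beta p < r \<and> r \<le> disc p \<and> q = p\<lparr>disc := r\<rparr>)"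
  then have "admissible q \<and> alpha q = alpha p \<and> beta q = beta p \<and> hazard_ratio p \<le> hazard_ratio q"
  proof (elim disjE exE conjE)
    fix g assume g: "safety p \<le> g" "g < 1" "q = p\<lparr>safety := g\<rparr>"
    then have "hazard_ratio (p\<lparr>safety := safety p\<rparr>) \<le> hazard_ratio q"
      using hazard_ratio_safety_mono[OF assms p(1)] by blast
    then show ?thesis using g assms by (simp add: admissible_def)
  next
    fix l f assume l: "admissible_hazard l f" "q = p\<lparr>lambda0 := l, phi := f\<rparr>" "\<forall>D. hazard p D \<le> hazard q D"
    then have "hazard_ratio p \<le> hazard_ratio q" using hazard_ratio_hazard_mono[OF assms l(1)] by simp
    then show ?thesis using l(1,2) assms by (simp add: admissible_def)
  next
    fix r assume r: "alpha p - beta p < r" "r \<le> disc p" "q = p\<lparr>disc := r\<rparr>"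
    have "hazard_ratio (p\<lparr>disc := disc p\<rparr>) \<le> hazard_ratio q"
      using hazard_ratio_disc_antimono(1)[OF assms r(1), of "disc p"] r by (cases "r = disc p") auto
    then show ?thesis using r assms by (simp add: admissible_def)
  qed
  then show "pacing_defined p \<and> is_MPE p (pacing p) \<Longrightarrow> pacing_defined q"
    "pacing_defined p \<and> is_MPE p (pacing p) \<Longrightarrow> is_MPE q (pacing q)"
    "is_MPE q racing \<Longrightarrow> is_MPE p racing"
    using MPE_regions_mono[OF assms, of q] by auto
qed

end
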